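(* Let $K$ be a compact subset of $H$ and let $\phi\in L^2([0,1];U)$. Let $\delta>0$ and $\gamma>0$. There exists $\epsilon_0\in(0,1]$ such that for all $x\in K$ and for all $\epsilon\in(0,\epsilon_0]$ $$P\left\{\sup_{t\in[0,1]}|X^\epsilon_x(t)-z^\phi_x(t)|<\delta\right\}\ge\exp\left(\frac{-\frac12\int_0^1|\phi(s)|_U^2\,ds-\gamma}{\epsilon}\right).$$
   Context: Setting. $(H,\langle\cdot,\cdot\rangle,|\cdot|)$ and $(U,\langle\cdot,\cdot\rangle_U,|\cdot|_U)$ are separable Hilbert spaces; $L(H,H)$ denotes the bounded operators on $H$ and $L_2(U,H)$ the Hilbert–Schmidt operators from $U$ to $H$. $(S(t))_{t\ge0}$ is a strongly continuous semigroup of bounded linear operators on $H$ with generator $A$. $F:[0,1]\times H\to H$ is Borel measurable and $G:H\to L_2(U,H)$; there are $\nu\in L^2([0,1];\mathbb{R})$ and a constant $\Lambda\in(0,\infty)$ such that for all $t\in[0,1]$, $x,y\in H$: $|F(t,x)-F(t,y)|\le\nu(t)|x-y|$, $|F(t,x)|\le\nu(t)(1+|x|)$, $\|G(x)-G(y)\|_{L_2(U,H)}\le\Lambda|x-y|$, $\|G(x)\|_{L_2(U,H)}\le\Lambda(1+|x|)$. $(\Omega,\mathcal{F},P)$ is a probability space with a right continuous filtration $(\mathcal{F}_t)_{t\ge0}$ such that $\mathcal{F}_0$ contains all $P$-null sets of $\mathcal{F}$. $(g_k)$ is an orthonormal basis of $U$, $(\beta_k)$ is an independent sequence of real $(\mathcal{F}_t)$-Brownian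 motions, and $W(t)=\sum_k\beta_k(t)g_k$ is the associated cylindrical Wiener process on $U$. For $\epsilon\in(0,1]$ and $x\in H$, $(X^\epsilon_x(t))_{t\in[0,1]}$ is the (unique) continuous $(\mathcal{F}_t)$-predictable $H$-valued process satisfying, $P$-a.e. for each $t\in[0,1]$, $$X^\epsilon_x(t)=S(\epsilon t)x+\epsilon\int_0^tS(\epsilon(t-u))F(\epsilon u,X^\epsilon_x(u))\,du+\epsilon^{1/2}\int_0^tS(\epsilon(t-u))G(X^\epsilon_x(u))\,dW(u).$$ For $\phi\in L^2([0,1];U)$ and $x\in H$, $z^\phi_x$ is the unique function in $C([0,1];H)$ with $z^\phi_x(t)=x+\int_0^tG(z^\phi_x(s))\phi(s)\,ds$ for all $t\in[0,1]$. *)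

theory Defs
  imports "HOL-Probability.Probability"
begin

text \<open>
  Separable real Hilbert spaces are rendered as types of sort
  \<open>{real_inner, banach, second_countable_topology}\<close>. The type of \<open>H\<close> is written \<open>'h\<close>, that of
  \<open>U\<close> is written \<open>'u\<close>, and the sample space lives on \<open>'w\<close>.
\<close>

subsection \<open>Bases, Hilbert--Schmidt operators, semigroups\<close>

text \<open>The index set is an arbitrary set of naturals, so that finite-dimensional spaces are covered.\<close>

definition orthonormal_basis :: "nat set \<Rightarrow> (nat \<Rightarrow> 'u::real_inner) \<Rightarrow> bool" where
  "orthonormal_basis I g \<longleftrightarrow>
     (\<forall>j\<in>I. \<forall>k\<in>I. g j \<bullet> g k = (if j = k then 1 else 0)) \<and> closure (span (g ` I)) = UNIV"

text \<open>
  Both notions are computed in a given orthonormal basis \<open>(g k)\<close>, \<open>k \<in> I\<close>; as usual, they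
  do not depend on which orthonormal basis is used.
\<close>

definition hilbert_schmidt ::
  "nat set \<Rightarrow> (nat \<Rightarrow> 'u::real_inner) \<Rightarrow> ('u \<Rightarrow>\<^sub>L 'h::real_inner) \<Rightarrow> bool" where
  "hilbert_schmidt I g T \<longleftrightarrow> (\<lambda>k. (norm (T (g k)))\<^sup>2) summable_on I"

definition hs_norm ::
  "nat set \<Rightarrow> (nat \<Rightarrow> 'u::real_inner) \<Rightarrow> ('u \<Rightarrow>\<^sub>L 'h::real_inner) \<Rightarrow> real" where
  "hs_norm I g T = sqrt (\<Sum>\<^sub>\<infinity>k\<in>I. (norm (T (g k)))\<^sup>2)"

text \<open>Only the values at nonnegative times are constrained.\<close>

definition c0_semigroup :: "(real \<Rightarrow> 'h::real_normed_vector \<Rightarrow>\<^sub>L 'h) \<Rightarrow> bool" where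
  "c0_semigroup S \<longleftrightarrow>
     S 0 = id_blinfun \<and>
     (\<forall>s\<ge>0. \<forall>t\<ge>0. S (s + t) = S s o\<^sub>L S t) \<and>
     (\<forall>x. ((\<lambda>t. S t x) \<longlongrightarrow> x) (at_right 0))"

definition square_integrable ::
  "'a measure \<Rightarrow> ('a \<Rightarrow> 'b::{banach, second_countable_topology}) \<Rightarrow> bool" where
  "square_integrable M f \<longleftrightarrow> f \<in> borel_measurable M \<and> integrable M (\<lambda>s. (norm (f s))\<^sup>2)"

subsection \<open>Filtrations, Brownian motions, predictability\<close>

text \<open>The time set is \<open>[0,\<infinity>)\<close>; the values of a filtration at negative times play no role.\<close>

definition usual_filtration :: "'w measure \<Rightarrow> (real \<Rightarrow> 'w measure) \<Rightarrow> bool" where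
  "usual_filtration M \<F> \<longleftrightarrow>
     (\<forall>t\<ge>0. subalgebra M (\<F> t)) \<and>
     (\<forall>s t. 0 \<le> s \<and> s \<le> t \<longrightarrow> sets (\<F> s) \<subseteq> sets (\<F> t)) \<and>
     (\<forall>t\<ge>0. (\<Inter>s\<in>{t<..}. sets (\<F> s)) = sets (\<F> t)) \<and>
     null_sets M \<subseteq> sets (\<F> 0)"

definition brownian_motion ::
  "'w measure \<Rightarrow> (real \<Rightarrow> 'w measure) \<Rightarrow> (real \<Rightarrow> 'w \<Rightarrow> real) \<Rightarrow> bool" where
  "brownian_motion M \<F> b \<longleftrightarrow>
     (\<forall>t\<ge>0. b t \<in> borel_measurable (\<F> t)) \<and>
     (AE \<omega> in M. b 0 \<omega> = 0) \<and>
     (AE \<omega> in M. continuous_on {0..} (\<lambda>t. b t \<omega>)) \<and>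
     (\<forall>s t. 0 \<le> s \<and> s < t \<longrightarrow>
        distributed M lborel (\<lambda>\<omega>. b t \<omega> - b s \<omega>) (normal_density 0 (sqrt (t - s))) \<and>
        prob_space.indep_set M (sets (\<F> s))
          (sets (vimage_algebra (space M) (\<lambda>\<omega>. b t \<omega> - b s \<omega>) borel)))"

text \<open>
  Independence of a family of processes is independence of the induced random elements of the
  path space with its product sigma-algebra.
\<close>

definition independent_brownian_motions ::
  "'w measure \<Rightarrow> (real \<Rightarrow> 'w measure) \<Rightarrow> nat set \<Rightarrow> (nat \<Rightarrow> real \<Rightarrow> 'w \<Rightarrow> real) \<Rightarrow> bool" where
  "independent_brownian_motions M \<F> I \<beta> \<longleftrightarrow>
     (\<forall>k\<in>I. brownian_motion M \<F> (\<beta> k)) \<and>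
     prob_space.indep_vars M (\<lambda>_. \<Pi>\<^sub>M t\<in>{0..}. borel) (\<lambda>k \<omega>. \<lambda>t\<in>{0..}. \<beta> k t \<omega>) I"

definition predictable_sigma ::
  "'w measure \<Rightarrow> (real \<Rightarrow> 'w measure) \<Rightarrow> real \<Rightarrow> (real \<times> 'w) measure" where
  "predictable_sigma M \<F> T =
     sigma ({0..T} \<times> space M)
       ({{0} \<times> B | B. B \<in> sets (\<F> 0)} \<union>
        {{s<..t} \<times> B | s t B. 0 \<le> s \<and> s < t \<and> t \<le> T \<and> B \<in> sets (\<F> s)})"

definition converges_in_probability ::
  "'w measure \<Rightarrow> (nat \<Rightarrow> 'w \<Rightarrow> 'h::metric_space) \<Rightarrow> ('w \<Rightarrow> 'h) \<Rightarrow> bool" where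
  "converges_in_probability M Y Z \<longleftrightarrow>
     (\<forall>\<eta>>0. (\<lambda>n. measure M {\<omega>\<in>space M. \<eta> < dist (Y n \<omega>) (Z \<omega>)}) \<longlonglongrightarrow> 0)"

subsection \<open>The stochastic integral with respect to a cylindrical Wiener process\<close>

text \<open>
  The cylindrical Wiener process \<open>W(t) = \<Sum>k\<in>I. \<beta> k t *\<^sub>R g k\<close> does not converge in \<open>U\<close> and is
  represented by the pair \<open>(g, \<beta>)\<close>. An elementary integrand is a finite sum, encoded as a list,
  of terms \<open>(k, a, b, \<xi>)\<close>, each standing for the rank-one operator process
  \<open>(u, \<omega>) \<mapsto> (h \<mapsto> indicator {a<..b} u * (h \<bullet> g k) *\<^sub>R \<xi> \<omega>)\<close>. As \<open>W\<close> paired with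
  \<open>g k\<close> is \<open>\<beta> k\<close>, the integral of such a term over \<open>[0,t]\<close> is
  \<open>(\<beta> k (min b t) - \<beta> k (min a t)) *\<^sub>R \<xi>\<close>.
\<close>

type_synonym ('w, 'h) elementary = "(nat \<times> real \<times> real \<times> ('w \<Rightarrow> 'h)) list"

definition elementary_process ::
  "'w measure \<Rightarrow> (real \<Rightarrow> 'w measure) \<Rightarrow> nat set \<Rightarrow> ('w, 'h::real_normed_vector) elementary \<Rightarrow> bool"
where
  "elementary_process M \<F> I e \<longleftrightarrow>
     (\<forall>(k, a, b, \<xi>)\<in>set e. k \<in> I \<and> 0 \<le> a \<and> a \<le> b \<and>
        \<xi> \<in> borel_measurable (\<F> a) \<and> bounded (\<xi> ` space M))"

definition elementary_value ::
  "(nat \<Rightarrow> 'u::real_inner) \<Rightarrow> ('w, 'h::real_normed_vector) elementary \<Rightarrow> real \<Rightarrow> 'w \<Rightarrow> 'u \<Rightarrow>\<^sub>L 'h"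
where
  "elementary_value g e u \<omega> =
     (\<Sum>(k, a, b, \<xi>)\<leftarrow>e. indicator {a<..b} u *\<^sub>R
        (blinfun_scaleR_left (\<xi> \<omega>) o\<^sub>L blinfun_inner_left (g k)))"

definition elementary_integral ::
  "(nat \<Rightarrow> real \<Rightarrow> 'w \<Rightarrow> real) \<Rightarrow> ('w, 'h::real_normed_vector) elementary \<Rightarrow> real \<Rightarrow> 'w \<Rightarrow> 'h"
where
  "elementary_integral \<beta> e t \<omega> =
     (\<Sum>(k, a, b, \<xi>)\<leftarrow>e. (\<beta> k (min b t) \<omega> - \<beta> k (min a t) \<omega>) *\<^sub>R \<xi> \<omega>)"

text \<open>
  Admissible integrands over \<open>[0,t]\<close>: predictable processes with Hilbert--Schmidt values whose
  squared Hilbert--Schmidt norm is almost surely integrable in time. Since \<open>H\<close> is separable,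
  predictability as a Hilbert--Schmidt-valued process is the same as predictability of the image
  of every vector.
\<close>

definition stochastically_integrable ::
  "'w measure \<Rightarrow> (real \<Rightarrow> 'w measure) \<Rightarrow> nat set \<Rightarrow> (nat \<Rightarrow> 'u::real_inner) \<Rightarrow> real \<Rightarrow>
   (real \<Rightarrow> 'w \<Rightarrow> 'u \<Rightarrow>\<^sub>L 'h::real_inner) \<Rightarrow> bool" where
  "stochastically_integrable M \<F> I g t \<Phi> \<longleftrightarrow>
     (\<forall>u\<in>{0..t}. \<forall>\<omega>\<in>space M. hilbert_schmidt I g (\<Phi> u \<omega>)) \<and>
     (\<forall>h. (\<lambda>(u, \<omega>). \<Phi> u \<omega> h) \<in> borel_measurable (predictable_sigma M \<F> t)) \<and>
     (AE \<omega> in M. (\<integral>\<^sup>+u\<in>{0..t}. ennreal ((hs_norm I g (\<Phi> u \<omega>))\<^sup>2) \<partial>lborel) < \<infinity>)"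

text \<open>
  \<open>has_stochastic_integral M \<F> I g \<beta> t \<Phi> Y\<close> says that \<open>Y\<close> is a version of the integral of
  \<open>\<Phi>\<close> against \<open>W\<close> over \<open>[0,t]\<close>: elementary integrals converge to it in probability along
  elementary integrands approximating \<open>\<Phi>\<close> in \<open>L\<^sup>2([0,t]; L\<^sub>2(U,H))\<close>, in probability. It is a
  relation because the integral is determined only up to null sets.
\<close>

definition has_stochastic_integral ::
  "'w measure \<Rightarrow> (real \<Rightarrow> 'w measure) \<Rightarrow> nat set \<Rightarrow> (nat \<Rightarrow> 'u::real_inner) \<Rightarrow>
   (nat \<Rightarrow> real \<Rightarrow> 'w \<Rightarrow> real) \<Rightarrow> real \<Rightarrow> (real \<Rightarrow> 'w \<Rightarrow> 'u \<Rightarrow>\<^sub>L 'h::real_inner) \<Rightarrow> ('w \<Rightarrow> 'h) \<Rightarrow> bool"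
where
  "has_stochastic_integral M \<F> I g \<beta> t \<Phi> Y \<longleftrightarrow>
     stochastically_integrable M \<F> I g t \<Phi> \<and>
     Y \<in> borel_measurable M \<and>
     (\<exists>e :: nat \<Rightarrow> ('w, 'h) elementary.
        (\<forall>n. elementary_process M \<F> I (e n)) \<and>
        (\<forall>\<eta>>0. (\<lambda>n. measure M {\<omega>\<in>space M. ennreal \<eta> <
            (\<integral>\<^sup>+u\<in>{0..t}. ennreal ((hs_norm I g (\<Phi> u \<omega> - elementary_value g (e n) u \<omega>))\<^sup>2) \<partial>lborel)})
          \<longlonglongrightarrow> 0) \<and>
        converges_in_probability M (\<lambda>n. elementary_integral \<beta> (e n) t) Y)"

subsection \<open>The stochastic equation and the controlled equation\<close>

definition mild_solution ::
  "'w measure \<Rightarrow> (real \<Rightarrow> 'w measure) \<Rightarrow> nat set \<Rightarrow> (nat \<Rightarrow> 'u::real_inner) \<Rightarrow>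
   (nat \<Rightarrow> real \<Rightarrow> 'w \<Rightarrow> real) \<Rightarrow>
   (real \<Rightarrow> 'h \<Rightarrow>\<^sub>L 'h) \<Rightarrow> (real \<Rightarrow> 'h \<Rightarrow> 'h) \<Rightarrow> ('h \<Rightarrow> 'u \<Rightarrow>\<^sub>L 'h) \<Rightarrow> real \<Rightarrow> 'h \<Rightarrow>
   (real \<Rightarrow> 'w \<Rightarrow> 'h::{real_inner, banach, second_countable_topology}) \<Rightarrow> bool" where
  "mild_solution M \<F> I g \<beta> S F G \<epsilon> x X \<longleftrightarrow>
     (\<forall>\<omega>\<in>space M. continuous_on {0..1} (\<lambda>t. X t \<omega>)) \<and>
     (\<lambda>(t, \<omega>). X t \<omega>) \<in> borel_measurable (predictable_sigma M \<F> 1) \<and>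
     (\<forall>t\<in>{0..1}. \<exists>Y.
        has_stochastic_integral M \<F> I g \<beta> t (\<lambda>u \<omega>. S (\<epsilon> * (t - u)) o\<^sub>L G (X u \<omega>)) Y \<and>
        (AE \<omega> in M. X t \<omega> =
           S (\<epsilon> * t) x
           + \<epsilon> *\<^sub>R (LINT u:{0..t}|lebesgue. S (\<epsilon> * (t - u)) (F (\<epsilon> * u) (X u \<omega>)))
           + sqrt \<epsilon> *\<^sub>R Y \<omega>))"

definition controlled_solution ::
  "('h \<Rightarrow> 'u::real_inner \<Rightarrow>\<^sub>L 'h) \<Rightarrow> (real \<Rightarrow> 'u) \<Rightarrow> 'h \<Rightarrow>
   (real \<Rightarrow> 'h::{real_inner, banach, second_countable_topology}) \<Rightarrow> bool" where
  "controlled_solution G \<phi> x z \<longleftrightarrow>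
     continuous_on {0..1} z \<and>
     (\<forall>t\<in>{0..1}. z t = x + (LINT s:{0..t}|lebesgue. G (z s) (\<phi> s)))"

end

theory Submission imports Defs "HOL-Real_Asymp.Real_Asymp" begin

text \<open>
  Replace \<open>\<phi>\<close> by a piecewise constant control \<open>\<psi>\<close> and tilt the measure by the exponential of the
  integral of \<open>\<psi> / sqrt \<epsilon>\<close> against \<open>W\<close>. If the solution stays close to the controlled path with tilted
  probability near one, the lower bound follows by undoing the tilt on the event where the density is
  at most \<open>exp ((\<integral> norm \<psi>^2 / 2 + small) / \<epsilon>)\<close>.

  Girsanov's theorem is never needed in full: exponentials of elementary integrals are
  supermartingales, and averaging them over random signs along an orthonormal system gives Gaussian tails,
  independent of the dimension, for the norm of a stochastic increment minus its controlled drift, directly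
  under the tilted measure. Dyadic chaining, based on the semigroup property of the convolution,
  makes these bounds uniform over dyadic times as long as the path stays in a ball. On the
  complement of the exceptional set a pathwise Gronwall argument, stopped when the path first leaves
  the \<open>\<delta>\<close>-tube around the controlled solution, shows that it never leaves.
\<close>

section \<open>Exponential martingales of the Brownian motions\<close>

text \<open>Each \<open>\<beta> k\<close> is Brownian for the filtration and the processes are
  independent of one another, but joint independence of several increments from the past is not part
  of the hypotheses. It is recovered, in the form of a martingale property of joint exponentials, by
  adding one index at a time and showing that discrete covariations vanish. The stochastic
  convolution is no martingale, because its integrand depends on the end time. What has good tails
  is the difference of \<open>Y t\<close> and the propagated value
  \<open>S (\<epsilon> * (t - s)) (Y s)\<close>, in which the integrands cancel on
  \<open>[0,s]\<close>. Moreover \<open>Y\<close> is known only time by time and up to null sets;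
  hence the work at dyadic times, with continuity of the paths of \<open>X\<close> doing the rest.
  The noise carries a factor \<open>sqrt \<epsilon>\<close>, so the tilt by
  \<open>\<psi> / sqrt \<epsilon>\<close> creates the drift \<open>G \<psi>\<close> and costs half
  the energy of \<open>\<psi>\<close> divided by \<open>\<epsilon>\<close>. The estimates are
  uniform over \<open>K\<close> because all points \<open>z x t\<close> with \<open>x\<close> in
  \<open>K\<close> form a compact set.\<close>

lemma nn_integral_exp_normal:
  assumes "0 < \<sigma>"
  shows "(\<integral>\<^sup>+x. ennreal (exp (a * x)) * ennreal (normal_density 0 \<sigma> x) \<partial>lborel) = ennreal (exp (a\<^sup>2 * \<sigma>\<^sup>2 / 2))"
proof -
  have *: "exp (a * x) * normal_density 0 \<sigma> x = exp (a\<^sup>2 * \<sigma>\<^sup>2 / 2) * normal_density (a * \<sigma>\<^sup>2) \<sigma> x" for x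
  proof -
    have "a * x + (- (x - 0)\<^sup>2 / (2 * \<sigma>\<^sup>2)) = a\<^sup>2 * \<sigma>\<^sup>2 / 2 + (- (x - a * \<sigma>\<^sup>2)\<^sup>2 / (2 * \<sigma>\<^sup>2))"
      using assms by (simp add: field_simps power2_eq_square)
    then show ?thesis
      unfolding normal_density_def by (simp add: exp_add [symmetric] mult_ac)
  qed
  have "(\<integral>\<^sup>+x. ennreal (exp (a * x)) * ennreal (normal_density 0 \<sigma> x) \<partial>lborel)
      = (\<integral>\<^sup>+x. ennreal (exp (a\<^sup>2 * \<sigma>\<^sup>2 / 2)) * ennreal (normal_density (a * \<sigma>\<^sup>2) \<sigma> x) \<partial>lborel)"
    by (simp add: ennreal_mult [symmetric] *)
  also have "\<dots> = ennreal (exp (a\<^sup>2 * \<sigma>\<^sup>2 / 2)) * (\<integral>\<^sup>+x. ennreal (normal_density (a * \<sigma>\<^sup>2) \<sigma> x) \<partial>lborel)"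
    by (simp add: nn_integral_cmult)
  also have "(\<integral>\<^sup>+x. ennreal (normal_density (a * \<sigma>\<^sup>2) \<sigma> x) \<partial>lborel) = 1"
    using assms by (subst nn_integral_eq_integral) auto
  finally show ?thesis by simp
qed

locale wiener_setting = prob_space M for M :: "'w measure" +
  fixes \<F> :: "real \<Rightarrow> 'w measure" and I :: "nat set"
    and g :: "nat \<Rightarrow> 'u::{real_inner, banach, second_countable_topology}"
    and \<beta> :: "nat \<Rightarrow> real \<Rightarrow> 'w \<Rightarrow> real"
  assumes basis: "orthonormal_basis I g"
    and filtration: "usual_filtration M \<F>"
    and wiener: "independent_brownian_motions M \<F> I \<beta>"
begin

lemma subalgebra_\<F>: "0 \<le> t \<Longrightarrow> subalgebra M (\<F> t)"
  using filtration by (simp add: usual_filtration_def)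

lemma space_\<F>: "0 \<le> t \<Longrightarrow> space (\<F> t) = space M"
  using subalgebra_\<F> by (simp add: subalgebra_def)

lemma sets_\<F>: "0 \<le> t \<Longrightarrow> A \<in> sets (\<F> t) \<Longrightarrow> A \<in> sets M"
  using subalgebra_\<F> by (auto simp: subalgebra_def)

lemma \<F>_mono: "0 \<le> s \<Longrightarrow> s \<le> t \<Longrightarrow> subalgebra (\<F> t) (\<F> s)"
  using filtration by (simp add: usual_filtration_def subalgebra_def)

lemma measurable_\<F>_mono: "f \<in> borel_measurable (\<F> s) \<Longrightarrow> 0 \<le> s \<Longrightarrow> s \<le> t \<Longrightarrow> f \<in> borel_measurable (\<F> t)"
  using \<F>_mono measurable_from_subalg by blast

lemma measurable_\<F>_M: "f \<in> borel_measurable (\<F> s) \<Longrightarrow> 0 \<le> s \<Longrightarrow> f \<in> borel_measurable M"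
  using subalgebra_\<F> measurable_from_subalg by blast

lemma brownian: "k \<in> I \<Longrightarrow> brownian_motion M \<F> (\<beta> k)"
  using wiener by (simp add: independent_brownian_motions_def)

lemma \<beta>_measurable_\<F>: "k \<in> I \<Longrightarrow> 0 \<le> t \<Longrightarrow> \<beta> k t \<in> borel_measurable (\<F> t)"
  using brownian by (simp add: brownian_motion_def)

lemma \<beta>_measurable_\<F>': "k \<in> I \<Longrightarrow> 0 \<le> t \<Longrightarrow> t \<le> u \<Longrightarrow> \<beta> k t \<in> borel_measurable (\<F> u)"
  using \<beta>_measurable_\<F> measurable_\<F>_mono by blast

lemma \<beta>_measurable [measurable]: "k \<in> I \<Longrightarrow> 0 \<le> t \<Longrightarrow> \<beta> k t \<in> borel_measurable M"
  using \<beta>_measurable_\<F> measurable_\<F>_M by blast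

section \<open>Exponentials of a single Brownian motion\<close>

definition wexp :: "real \<Rightarrow> nat \<Rightarrow> real \<Rightarrow> real \<Rightarrow> 'w \<Rightarrow> real" where
  "wexp a k s t \<omega> = exp (a * (\<beta> k t \<omega> - \<beta> k s \<omega>) - a\<^sup>2 * (t - s) / 2)"

lemma wexp_pos [simp]: "0 < wexp a k s t \<omega>" "0 \<le> wexp a k s t \<omega>"
  by (auto simp: wexp_def)

lemma wexp_same [simp]: "wexp a k s s \<omega> = 1"
  by (simp add: wexp_def)

lemma wexp_split: "wexp a k s t \<omega> = wexp a k s r \<omega> * wexp a k r t \<omega>"
  by (simp add: wexp_def exp_add [symmetric] field_simps)

lemma wexp_square: "(wexp a k s t \<omega>)\<^sup>2 = exp (a\<^sup>2 * (t - s)) * wexp (2 * a) k s t \<omega>"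
  by (simp add: wexp_def exp_add [symmetric] power2_eq_square field_simps)

lemma wexp_measurable_\<F>:
  "k \<in> I \<Longrightarrow> 0 \<le> s \<Longrightarrow> s \<le> t \<Longrightarrow> t \<le> u \<Longrightarrow> wexp a k s t \<in> borel_measurable (\<F> u)"
  unfolding wexp_def [abs_def]
  using \<beta>_measurable_\<F>' [of k t u] \<beta>_measurable_\<F>' [of k s u] by measurable

lemma wexp_measurable [measurable]:
  "k \<in> I \<Longrightarrow> 0 \<le> s \<Longrightarrow> 0 \<le> t \<Longrightarrow> wexp a k s t \<in> borel_measurable M"
  unfolding wexp_def [abs_def] by measurable

text \<open>Independence of the increment from \<open>\<F> s\<close> factors the integral, and the
  Gaussian moment generating function equals the compensator. Since \<open>X\<close> takes values in
  ennreal, no integrability condition arises, and earlier exponentials can be multiplied into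
  \<open>X\<close> when the identity is iterated.\<close>

lemma wexp_martingale_single:
  assumes k: "k \<in> I" and st: "0 \<le> s" "s \<le> t" and X: "X \<in> borel_measurable (\<F> s)"
  shows "(\<integral>\<^sup>+\<omega>. X \<omega> * ennreal (wexp a k s t \<omega>) \<partial>M) = (\<integral>\<^sup>+\<omega>. X \<omega> \<partial>M)"
proof (cases "s = t")
  case False
  with st have lt: "s < t" by simp
  define \<Delta> where "\<Delta> \<omega> = \<beta> k t \<omega> - \<beta> k s \<omega>" for \<omega>
  have D: "distributed M lborel \<Delta> (normal_density 0 (sqrt (t - s)))"
    and ind: "indep_set (sets (\<F> s)) (sets (vimage_algebra (space M) \<Delta> borel))"
    using brownian [OF k] st lt by (auto simp: brownian_motion_def \<Delta>_def [abs_def])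
  have [measurable]: "X \<in> borel_measurable M" "\<Delta> \<in> borel_measurable M"
    using X st measurable_\<F>_M D by (auto dest: distributed_measurable)
  define Y where "Y \<omega> = ennreal (exp (a * \<Delta> \<omega> - a\<^sup>2 * (t - s) / 2))" for \<omega>
  have [measurable]: "Y \<in> borel_measurable M"
    unfolding Y_def [abs_def] by measurable
  have "indep_var borel X borel Y"
    unfolding indep_var_eq
  proof (intro conjI)
    show "X \<in> borel_measurable M" "Y \<in> borel_measurable M" by simp_all
    have 1: "sigma_sets (space M) {X -` A \<inter> space M |A. A \<in> sets borel} \<subseteq> sets (\<F> s)"
    proof -
      have "{X -` A \<inter> space M |A. A \<in> sets borel} \<subseteq> sets (\<F> s)"
        using measurable_sets [OF X] space_\<F> [OF st(1)] by auto
      then show ?thesis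
        using sets.sigma_sets_subset [of _ "\<F> s"] space_\<F> [OF st(1)] by auto
    qed
    have 2: "sigma_sets (space M) {Y -` A \<inter> space M |A. A \<in> sets borel} \<subseteq> sets (vimage_algebra (space M) \<Delta> borel)"
    proof -
      have [measurable]: "\<Delta> \<in> borel_measurable (vimage_algebra (space M) \<Delta> borel)"
        by (rule measurable_vimage_algebra1) simp
      have "Y \<in> borel_measurable (vimage_algebra (space M) \<Delta> borel)"
        unfolding Y_def [abs_def] by measurable
      from measurable_sets [OF this]
      have "{Y -` A \<inter> space M |A. A \<in> sets borel} \<subseteq> sets (vimage_algebra (space M) \<Delta> borel)"
        by auto
      then show ?thesis
        using sets.sigma_sets_subset [of _ "vimage_algebra (space M) \<Delta> borel"] by auto
    qed
    show "indep_set (sigma_sets (space M) {X -` A \<inter> space M |A. A \<in> sets borel})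
        (sigma_sets (space M) {Y -` A \<inter> space M |A. A \<in> sets borel})"
      using ind 1 2 unfolding indep_sets2_eq by blast
  qed
  then have "indep_vars (\<lambda>_. borel) (case_bool X Y) UNIV"
    unfolding indep_var_def by (rule back_subst [where P = "\<lambda>N. indep_vars N _ _"]) (auto split: bool.split)
  from indep_vars_nn_integral [OF _ this]
  have "(\<integral>\<^sup>+\<omega>. X \<omega> * ennreal (exp (a * \<Delta> \<omega> - a\<^sup>2 * (t - s) / 2)) \<partial>M)
      = (\<integral>\<^sup>+\<omega>. X \<omega> \<partial>M) * (\<integral>\<^sup>+\<omega>. ennreal (exp (a * \<Delta> \<omega> - a\<^sup>2 * (t - s) / 2)) \<partial>M)"
    by (simp add: UNIV_bool mult.commute Y_def [abs_def])
  also have "(\<integral>\<^sup>+\<omega>. ennreal (exp (a * \<Delta> \<omega> - a\<^sup>2 * (t - s) / 2)) \<partial>M)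
      = (\<integral>\<^sup>+x. ennreal (normal_density 0 (sqrt (t - s)) x) * ennreal (exp (a * x - a\<^sup>2 * (t - s) / 2)) \<partial>lborel)"
    by (rule distributed_nn_integral [OF D, symmetric]) simp
  also have "\<dots> = (\<integral>\<^sup>+x. ennreal (exp (- (a\<^sup>2 * (t - s) / 2))) * (ennreal (exp (a * x)) * ennreal (normal_density 0 (sqrt (t - s)) x)) \<partial>lborel)"
    proof (intro nn_integral_cong)
    fix x
    have "exp (a * x - a\<^sup>2 * (t - s) / 2) = exp (- (a\<^sup>2 * (t - s) / 2)) * exp (a * x)"
      by (simp add: exp_add [symmetric])
    then show "ennreal (normal_density 0 (sqrt (t - s)) x) * ennreal (exp (a * x - a\<^sup>2 * (t - s) / 2))
      = ennreal (exp (- (a\<^sup>2 * (t - s) / 2))) * (ennreal (exp (a * x)) * ennreal (normal_density 0 (sqrt (t - s)) x))"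
      by (simp add: ennreal_mult [symmetric] mult_ac)
  qed
  also have "\<dots> = ennreal (exp (- (a\<^sup>2 * (t - s) / 2))) * ennreal (exp (a\<^sup>2 * (sqrt (t - s))\<^sup>2 / 2))"
    using lt by (subst nn_integral_cmult) (simp_all add: nn_integral_exp_normal)
  also have "\<dots> = 1"
    using lt by (simp add: ennreal_mult [symmetric] exp_add [symmetric])
  finally show ?thesis by (simp add: wexp_def \<Delta>_def)
qed simp

text \<open>The last assumption says that \<open>Y\<close> has conditional expectation one given
  \<open>\<F> s\<close>. Then \<open>density M Y\<close> and \<open>M\<close> agree on
  \<open>\<F> s\<close>, and equality of measures passes to all nonnegative integrands at once, in
  place of a monotone class argument.\<close>

lemma nn_integral_eq_subalgebra:
  assumes st: "0 \<le> s" and X: "X \<in> borel_measurable (\<F> s)" and Y: "Y \<in> borel_measurable M"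
    and eq: "\<And>B. B \<in> sets (\<F> s) \<Longrightarrow> (\<integral>\<^sup>+\<omega>. Y \<omega> * indicator B \<omega> \<partial>M) = emeasure M B"
  shows "(\<integral>\<^sup>+\<omega>. X \<omega> * Y \<omega> \<partial>M) = (\<integral>\<^sup>+\<omega>. X \<omega> \<partial>M)"
proof -
  have sub: "subalgebra M (\<F> s)" "subalgebra (density M Y) (\<F> s)"
    using subalgebra_\<F> [OF st] by (auto simp: subalgebra_def)
  have "restr_to_subalg (density M Y) (\<F> s) = restr_to_subalg M (\<F> s)"
  proof (rule measure_eqI)
    fix B assume "B \<in> sets (restr_to_subalg (density M Y) (\<F> s))"
    then have B: "B \<in> sets (\<F> s)" using sub by (simp add: sets_restr_to_subalg)
    then show "emeasure (restr_to_subalg (density M Y) (\<F> s)) B = emeasure (restr_to_subalg M (\<F> s)) B"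
      using sub eq [OF B] sets_\<F> [OF st B] Y by (simp add: emeasure_restr_to_subalg emeasure_density)
  qed (use sub in \<open>simp add: sets_restr_to_subalg\<close>)
  then have "nn_integral (density M Y) X = nn_integral M X"
    using nn_integral_subalgebra2 [OF sub(1) X] nn_integral_subalgebra2 [OF sub(2) X] by simp
  then show ?thesis
    using X Y measurable_\<F>_M [OF X st] by (simp add: nn_integral_density mult.commute)
qed

section \<open>Joint exponentials of finitely many Brownian motions\<close>

definition wexps :: "(nat \<Rightarrow> real) \<Rightarrow> nat set \<Rightarrow> real \<Rightarrow> real \<Rightarrow> 'w \<Rightarrow> real" where
  "wexps a J s t \<omega> = (\<Prod>k\<in>J. wexp (a k) k s t \<omega>)"

lemma wexps_pos [simp]: "0 < wexps a J s t \<omega>" "0 \<le> wexps a J s t \<omega>"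
  by (auto simp: wexps_def intro: prod_pos prod_nonneg)

lemma wexps_same [simp]: "wexps a J s s \<omega> = 1"
  by (simp add: wexps_def)

lemma wexps_split: "wexps a J s t \<omega> = wexps a J s r \<omega> * wexps a J r t \<omega>"
  by (simp add: wexps_def prod.distrib [symmetric] wexp_split [symmetric])

lemma wexps_square: "(wexps a J s t \<omega>)\<^sup>2 = exp ((\<Sum>k\<in>J. (a k)\<^sup>2) * (t - s)) * wexps (\<lambda>k. 2 * a k) J s t \<omega>"
  by (cases "finite J")
     (simp_all add: wexps_def prod_power_distrib wexp_square prod.distrib exp_sum sum_distrib_right)

lemma wexps_measurable_\<F>:
  "J \<subseteq> I \<Longrightarrow> 0 \<le> s \<Longrightarrow> s \<le> t \<Longrightarrow> t \<le> u \<Longrightarrow> wexps a J s t \<in> borel_measurable (\<F> u)"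
  unfolding wexps_def [abs_def] by (intro borel_measurable_prod wexp_measurable_\<F>) auto

lemma wexps_measurable [measurable]:
  "J \<subseteq> I \<Longrightarrow> 0 \<le> s \<Longrightarrow> 0 \<le> t \<Longrightarrow> wexps a J s t \<in> borel_measurable M"
  unfolding wexps_def [abs_def] by (intro borel_measurable_prod wexp_measurable) auto

text \<open>The induction hypothesis of \<open>mgf_finite\<close>. It ranges over all coefficient
  families \<open>a\<close>, because second moments of \<open>wexps a\<close> are computed from
  \<open>wexps\<close> with doubled coefficients.\<close>

definition mgf :: "nat set \<Rightarrow> bool" where
  "mgf J \<longleftrightarrow> J \<subseteq> I \<and> (\<forall>a s t X. 0 \<le> s \<and> s \<le> t \<and> X \<in> borel_measurable (\<F> s) \<longrightarrow>
     (\<integral>\<^sup>+\<omega>. X \<omega> * ennreal (wexps a J s t \<omega>) \<partial>M) = (\<integral>\<^sup>+\<omega>. X \<omega> \<partial>M))"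

lemma mgfD:
  "mgf J \<Longrightarrow> 0 \<le> s \<Longrightarrow> s \<le> t \<Longrightarrow> X \<in> borel_measurable (\<F> s) \<Longrightarrow>
     (\<integral>\<^sup>+\<omega>. X \<omega> * ennreal (wexps a J s t \<omega>) \<partial>M) = (\<integral>\<^sup>+\<omega>. X \<omega> \<partial>M)"
  by (simp add: mgf_def)

lemma mgf_singleton: "k \<in> I \<Longrightarrow> mgf {k}"
  unfolding mgf_def using wexp_martingale_single by (simp add: wexps_def)

text \<open>By the martingale property the later factor may be replaced by its value at
  \<open>r\<close>. The resulting square is a deterministic factor times an exponential with
  coefficients \<open>2 * a\<close>, which has mean one.\<close>

lemma mgf_covariance:
  assumes J: "mgf J" and st: "0 \<le> s" "s \<le> r" "r \<le> t"
  shows "integrable M (\<lambda>\<omega>. wexps a J s r \<omega> * wexps a J s t \<omega>)"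
    and "expectation (\<lambda>\<omega>. wexps a J s r \<omega> * wexps a J s t \<omega>) = exp ((\<Sum>k\<in>J. (a k)\<^sup>2) * (r - s))"
proof -
  have JI: "J \<subseteq> I" using J by (simp add: mgf_def)
  note [measurable] = wexps_measurable_\<F> [OF JI]
  have "(\<integral>\<^sup>+\<omega>. ennreal (wexps a J s r \<omega> * wexps a J s t \<omega>) \<partial>M)
      = (\<integral>\<^sup>+\<omega>. ennreal ((wexps a J s r \<omega>)\<^sup>2) * ennreal (wexps a J r t \<omega>) \<partial>M)"
    by (simp add: ennreal_mult [symmetric] wexps_split [of a J s t _ r] power2_eq_square mult_ac)
  also have "\<dots> = (\<integral>\<^sup>+\<omega>. ennreal ((wexps a J s r \<omega>)\<^sup>2) \<partial>M)"
    using st by (intro mgfD [OF J]) auto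
  also have "\<dots> = (\<integral>\<^sup>+\<omega>. ennreal (exp ((\<Sum>k\<in>J. (a k)\<^sup>2) * (r - s))) * ennreal (wexps (\<lambda>k. 2 * a k) J s r \<omega>) \<partial>M)"
    by (simp add: wexps_square ennreal_mult)
  also have "\<dots> = (\<integral>\<^sup>+\<omega>. ennreal (exp ((\<Sum>k\<in>J. (a k)\<^sup>2) * (r - s))) \<partial>M)"
    using st by (intro mgfD [OF J]) auto
  also have "\<dots> = ennreal (exp ((\<Sum>k\<in>J. (a k)\<^sup>2) * (r - s)))"
    by (simp add: emeasure_space_1)
  finally have *: "(\<integral>\<^sup>+\<omega>. ennreal (wexps a J s r \<omega> * wexps a J s t \<omega>) \<partial>M) = ennreal (exp ((\<Sum>k\<in>J. (a k)\<^sup>2) * (r - s)))" .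
  have [measurable]: "wexps a J s r \<in> borel_measurable M" "wexps a J s t \<in> borel_measurable M"
    using st JI by simp_all
  from * show "integrable M (\<lambda>\<omega>. wexps a J s r \<omega> * wexps a J s t \<omega>)"
    by (intro integrableI_nn_integral_finite) auto
  from * show "expectation (\<lambda>\<omega>. wexps a J s r \<omega> * wexps a J s t \<omega>) = exp ((\<Sum>k\<in>J. (a k)\<^sup>2) * (r - s))"
    by (intro integral_eq_nn_integral [THEN trans]) auto
qed


lemma wexps_integrable:
  assumes J: "mgf J" and st: "0 \<le> s" "s \<le> t"
  shows "integrable M (wexps a J s t)" "integrable M (\<lambda>\<omega>. (wexps a J s t \<omega>)\<^sup>2)"
proof -
  show 1: "integrable M (\<lambda>\<omega>. (wexps a J s t \<omega>)\<^sup>2)"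
    using mgf_covariance(1) [OF J st order_refl] by (simp add: power2_eq_square)
  have "J \<subseteq> I" using J by (simp add: mgf_def)
  then show "integrable M (wexps a J s t)"
    using st by (intro square_integrable_imp_integrable [OF _ 1]) auto
qed

text \<open>Orthogonality of martingale increments, together with their size: by
  \<open>exp_increment_le\<close> the second moment is of the order of the length of the interval.
  Both enter the variance computation in \<open>wexps_product_indicator\<close>.\<close>

lemma mgf_increments:
  assumes J: "mgf J" and st: "0 \<le> s" "s \<le> p" "p \<le> q" "q \<le> u" "u \<le> v"
  shows "integrable M (\<lambda>\<omega>. (wexps a J s q \<omega> - wexps a J s p \<omega>) * (wexps a J s v \<omega> - wexps a J s u \<omega>))"
    and "expectation (\<lambda>\<omega>. (wexps a J s q \<omega> - wexps a J s p \<omega>) * (wexps a J s v \<omega> - wexps a J s u \<omega>)) = 0"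
    and "integrable M (\<lambda>\<omega>. (wexps a J s q \<omega> - wexps a J s p \<omega>)\<^sup>2)"
    and "expectation (\<lambda>\<omega>. (wexps a J s q \<omega> - wexps a J s p \<omega>)\<^sup>2)
       = exp ((\<Sum>k\<in>J. (a k)\<^sup>2) * (q - s)) - exp ((\<Sum>k\<in>J. (a k)\<^sup>2) * (p - s))"
proof -
  note cov = mgf_covariance [OF J st(1), of _ _ a]
  have [simp]: "integrable M (\<lambda>\<omega>. wexps a J s q \<omega> * wexps a J s v \<omega>)" "integrable M (\<lambda>\<omega>. wexps a J s q \<omega> * wexps a J s u \<omega>)"
    "integrable M (\<lambda>\<omega>. wexps a J s p \<omega> * wexps a J s v \<omega>)" "integrable M (\<lambda>\<omega>. wexps a J s p \<omega> * wexps a J s u \<omega>)"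
    "integrable M (\<lambda>\<omega>. wexps a J s p \<omega> * wexps a J s p \<omega>)" "integrable M (\<lambda>\<omega>. wexps a J s p \<omega> * wexps a J s q \<omega>)"
    "integrable M (\<lambda>\<omega>. wexps a J s q \<omega> * wexps a J s q \<omega>)"
    using st by (auto intro!: cov(1))
  have 1: "(\<lambda>\<omega>. (wexps a J s q \<omega> - wexps a J s p \<omega>) * (wexps a J s v \<omega> - wexps a J s u \<omega>))
     = (\<lambda>\<omega>. (wexps a J s q \<omega> * wexps a J s v \<omega> - wexps a J s q \<omega> * wexps a J s u \<omega>)
        - (wexps a J s p \<omega> * wexps a J s v \<omega> - wexps a J s p \<omega> * wexps a J s u \<omega>))"
    by (auto simp: algebra_simps)
  show "integrable M (\<lambda>\<omega>. (wexps a J s q \<omega> - wexps a J s p \<omega>) * (wexps a J s v \<omega> - wexps a J s u \<omega>))"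
    unfolding 1 by (intro Bochner_Integration.integrable_diff) auto
  show "expectation (\<lambda>\<omega>. (wexps a J s q \<omega> - wexps a J s p \<omega>) * (wexps a J s v \<omega> - wexps a J s u \<omega>)) = 0"
    unfolding 1 using st by (subst Bochner_Integration.integral_diff | simp add: cov(2) del: right_diff_distrib left_diff_distrib)+
  have 2: "(\<lambda>\<omega>. (wexps a J s q \<omega> - wexps a J s p \<omega>)\<^sup>2)
     = (\<lambda>\<omega>. (wexps a J s q \<omega> * wexps a J s q \<omega> - wexps a J s p \<omega> * wexps a J s q \<omega>)
        - (wexps a J s p \<omega> * wexps a J s q \<omega> - wexps a J s p \<omega> * wexps a J s p \<omega>))"
    by (auto simp: algebra_simps power2_eq_square)
  show "integrable M (\<lambda>\<omega>. (wexps a J s q \<omega> - wexps a J s p \<omega>)\<^sup>2)"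
    unfolding 2 by (intro Bochner_Integration.integrable_diff) auto
  show "expectation (\<lambda>\<omega>. (wexps a J s q \<omega> - wexps a J s p \<omega>)\<^sup>2)
       = exp ((\<Sum>k\<in>J. (a k)\<^sup>2) * (q - s)) - exp ((\<Sum>k\<in>J. (a k)\<^sup>2) * (p - s))"
    unfolding 2 using st by (subst Bochner_Integration.integral_diff | simp add: cov(2) del: right_diff_distrib left_diff_distrib)+
qed

lemma exp_increment_le:
  fixes A :: real
  assumes "0 \<le> A" "s \<le> p" "p \<le> q" "q \<le> t"
  shows "exp (A * (q - s)) - exp (A * (p - s)) \<le> A * exp (A * (t - s)) * (q - p)"
proof -
  have "exp (A * (q - s)) * (1 - A * (q - p)) \<le> exp (A * (q - s)) * exp (- (A * (q - p)))"
    using exp_ge_add_one_self [of "- (A * (q - p))"] by (intro mult_left_mono) auto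
  also have "\<dots> = exp (A * (p - s))"
    by (simp add: exp_add [symmetric] algebra_simps)
  finally have "exp (A * (q - s)) - exp (A * (p - s)) \<le> A * (q - p) * exp (A * (q - s))"
    by (simp add: algebra_simps)
  also have "\<dots> \<le> A * (q - p) * exp (A * (t - s))"
    using assms by (intro mult_left_mono) (auto intro!: mult_left_mono)
  finally show ?thesis by (simp add: mult_ac)
qed

text \<open>Two increments stand on each side because the second moment of a sum of terms
  \<open>U i * V i\<close> consists of the terms \<open>(U i * U j) * (V i * V j)\<close>, and these
  have to factor.\<close>

lemma wexps_increments_indep:
  assumes J: "mgf J" and k: "k \<in> I - J" and st: "0 \<le> s"
    and t: "s \<le> p" "p \<le> q" "s \<le> u" "u \<le> v" and t': "s \<le> p'" "p' \<le> q'" "s \<le> u'" "u' \<le> v'"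
  shows "indep_var borel (\<lambda>\<omega>. (wexps a J s q \<omega> - wexps a J s p \<omega>) * (wexps a J s v \<omega> - wexps a J s u \<omega>))
     borel (\<lambda>\<omega>. (wexps b {k} s q' \<omega> - wexps b {k} s p' \<omega>) * (wexps b {k} s v' \<omega> - wexps b {k} s u' \<omega>))"
proof -
  have JI: "J \<subseteq> I" using J by (simp add: mgf_def)
  \<comment> \<open>The exponential as a functional of the whole path, so that independence on path
    space carries over by composition with measurable maps.\<close>
  define E :: "(nat \<Rightarrow> real) \<Rightarrow> nat set \<Rightarrow> real \<Rightarrow> (nat \<Rightarrow> real \<Rightarrow> real) \<Rightarrow> real"
    where "E a J t x = (\<Prod>k\<in>J. exp (a k * (x k t - x k s) - (a k)\<^sup>2 * (t - s) / 2))" for a J t x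
  have [measurable]: "E a J t \<in> borel_measurable (\<Pi>\<^sub>M k\<in>J. \<Pi>\<^sub>M t\<in>{0..}. borel)" if "0 \<le> t" for a J t
  proof -
    have [measurable]: "(\<lambda>x. x k r) \<in> borel_measurable (\<Pi>\<^sub>M k\<in>J. \<Pi>\<^sub>M t\<in>{0..}. borel)" if "k \<in> J" "0 \<le> r" for k and r :: real
      by (rule measurable_compose [OF measurable_component_singleton [OF that(1)] measurable_component_singleton]) (use that in auto)
    show ?thesis
      unfolding E_def [abs_def] using that st by measurable
  qed
  have "indep_var (\<Pi>\<^sub>M k\<in>J. \<Pi>\<^sub>M t\<in>{0..}. borel) (\<lambda>\<omega>. \<lambda>k\<in>J. \<lambda>t\<in>{0..}. \<beta> k t \<omega>)
        (\<Pi>\<^sub>M k\<in>{k}. \<Pi>\<^sub>M t\<in>{0..}. borel) (\<lambda>\<omega>. \<lambda>k\<in>{k}. \<lambda>t\<in>{0..}. \<beta> k t \<omega>)"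
    using wiener JI k by (intro indep_var_restrict) (auto simp: independent_brownian_motions_def)
  then have "indep_var borel ((\<lambda>x. (E a J q x - E a J p x) * (E a J v x - E a J u x)) \<circ> (\<lambda>\<omega>. \<lambda>k\<in>J. \<lambda>t\<in>{0..}. \<beta> k t \<omega>))
        borel ((\<lambda>x. (E b {k} q' x - E b {k} p' x) * (E b {k} v' x - E b {k} u' x)) \<circ> (\<lambda>\<omega>. \<lambda>k\<in>{k}. \<lambda>t\<in>{0..}. \<beta> k t \<omega>))"
    using st t t' by (intro indep_var_compose) measurable
  moreover have "E a J t (\<lambda>k\<in>J. \<lambda>t\<in>{0..}. \<beta> k t \<omega>) = wexps a J s t \<omega>" if "s \<le> t" for a J t \<omega>
    using that st unfolding E_def wexps_def wexp_def by (intro prod.cong) auto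
  ultimately show ?thesis
    using t t' by (simp add: comp_def del: restrict_apply)
qed

text \<open>Let \<open>f p\<close> be the mean of the product at time \<open>p\<close> on
  \<open>B\<close>. Over a small step the product changes by \<open>U * V\<close> plus two mixed
  terms, and the latter have mean zero on \<open>B\<close> because each factor is a martingale by
  itself. So \<open>f t - prob B\<close> is the mean on \<open>B\<close> of the discrete covariation
  \<open>Z\<close>. Its second moment is at most \<open>C / n\<close>: off-diagonal terms vanish
  since the two factors are independent and increments of the second are orthogonal, while each of
  the \<open>n\<close> diagonal terms is a product of two numbers of order
  \<open>1 / n\<close>.\<close>

lemma wexps_product_indicator:
  assumes J: "mgf J" and k: "k \<in> I - J" and st: "0 \<le> s" "s < t" and B: "B \<in> sets (\<F> s)"
  shows "integrable M (\<lambda>\<omega>. indicator B \<omega> * wexps a J s t \<omega> * wexps a {k} s t \<omega>)"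
    and "expectation (\<lambda>\<omega>. indicator B \<omega> * wexps a J s t \<omega> * wexps a {k} s t \<omega>) = prob B"
proof -
  have JI: "J \<subseteq> I" using J by (simp add: mgf_def)
  have mk: "mgf {k}" using k by (simp add: mgf_singleton)
  have kI: "{k} \<subseteq> I" using k by simp
  have [measurable]: "B \<in> sets M" using B st sets_\<F> by blast
  have int: "integrable M (\<lambda>\<omega>. indicator B \<omega> * wexps a J s p \<omega> * wexps a {k} s q \<omega>)" if "s \<le> p" "s \<le> q" for p q
  proof (rule Bochner_Integration.integrable_bound)
    show "integrable M (\<lambda>\<omega>. (wexps a J s p \<omega>)\<^sup>2 + (wexps a {k} s q \<omega>)\<^sup>2)"
      using st that by (intro Bochner_Integration.integrable_add wexps_integrable J mk) auto
    show "(\<lambda>\<omega>. indicator B \<omega> * wexps a J s p \<omega> * wexps a {k} s q \<omega>) \<in> borel_measurable M"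
      using st that JI kI by (intro borel_measurable_times borel_measurable_indicator wexps_measurable) auto
    have "x * y \<le> x\<^sup>2 + y\<^sup>2" if "0 \<le> x" "0 \<le> y" for x y :: real
      using sum_squares_bound [of x y] mult_nonneg_nonneg [OF that] by linarith
    then show "AE \<omega> in M. norm (indicator B \<omega> * wexps a J s p \<omega> * wexps a {k} s q \<omega>)
        \<le> norm ((wexps a J s p \<omega>)\<^sup>2 + (wexps a {k} s q \<omega>)\<^sup>2)"
      by (intro AE_I2) (auto simp: indicator_def)
  qed
  show "integrable M (\<lambda>\<omega>. indicator B \<omega> * wexps a J s t \<omega> * wexps a {k} s t \<omega>)"
    using int st by simp
  \<comment> \<open>The factor of \<open>k\<close> is frozen at time \<open>p\<close> and becomes
    part of the \<open>\<F> p\<close>-measurable weight; \<open>mart2\<close> exchanges the roles of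
    the two factors.\<close>
  have mart1: "expectation (\<lambda>\<omega>. indicator B \<omega> * wexps a J s q \<omega> * wexps a {k} s p \<omega>)
      = expectation (\<lambda>\<omega>. indicator B \<omega> * wexps a J s p \<omega> * wexps a {k} s p \<omega>)" if pq: "s \<le> p" "p \<le> q" for p q
  proof -
    have [measurable]: "B \<in> sets (\<F> p)" using \<F>_mono [of s p] st that B by (auto simp: subalgebra_def)
    have [measurable]: "wexps a J s p \<in> borel_measurable (\<F> p)" "wexps a {k} s p \<in> borel_measurable (\<F> p)"
      using JI kI st that by (auto intro: wexps_measurable_\<F>)
    have "(\<integral>\<^sup>+\<omega>. ennreal (indicator B \<omega> * wexps a J s p \<omega> * wexps a {k} s p \<omega>) * ennreal (wexps a J p q \<omega>) \<partial>M)
        = (\<integral>\<^sup>+\<omega>. ennreal (indicator B \<omega> * wexps a J s p \<omega> * wexps a {k} s p \<omega>) \<partial>M)"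
      using st that by (intro mgfD [OF J]) auto
    then have "(\<integral>\<^sup>+\<omega>. ennreal (indicator B \<omega> * wexps a J s q \<omega> * wexps a {k} s p \<omega>) \<partial>M)
        = (\<integral>\<^sup>+\<omega>. ennreal (indicator B \<omega> * wexps a J s p \<omega> * wexps a {k} s p \<omega>) \<partial>M)"
      by (simp add: ennreal_mult [symmetric] wexps_split [of a J s q _ p] mult_ac)
    then show ?thesis
      using int [of q p] int [of p p] that by (simp add: nn_integral_eq_integral)
  qed
  have mart2: "expectation (\<lambda>\<omega>. indicator B \<omega> * wexps a J s p \<omega> * wexps a {k} s q \<omega>)
      = expectation (\<lambda>\<omega>. indicator B \<omega> * wexps a J s p \<omega> * wexps a {k} s p \<omega>)" if pq: "s \<le> p" "p \<le> q" for p q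
  proof -
    have [measurable]: "B \<in> sets (\<F> p)" using \<F>_mono [of s p] st that B by (auto simp: subalgebra_def)
    have [measurable]: "wexps a J s p \<in> borel_measurable (\<F> p)" "wexps a {k} s p \<in> borel_measurable (\<F> p)"
      using JI kI st that by (auto intro: wexps_measurable_\<F>)
    have "(\<integral>\<^sup>+\<omega>. ennreal (indicator B \<omega> * wexps a J s p \<omega> * wexps a {k} s p \<omega>) * ennreal (wexps a {k} p q \<omega>) \<partial>M)
        = (\<integral>\<^sup>+\<omega>. ennreal (indicator B \<omega> * wexps a J s p \<omega> * wexps a {k} s p \<omega>) \<partial>M)"
      using st that by (intro mgfD [OF mk]) auto
    then have "(\<integral>\<^sup>+\<omega>. ennreal (indicator B \<omega> * wexps a J s p \<omega> * wexps a {k} s q \<omega>) \<partial>M)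
        = (\<integral>\<^sup>+\<omega>. ennreal (indicator B \<omega> * wexps a J s p \<omega> * wexps a {k} s p \<omega>) \<partial>M)"
      by (simp add: ennreal_mult [symmetric] wexps_split [of a "{k}" s q _ p] mult_ac)
    then show ?thesis
      using int [of p q] int [of p p] that by (simp add: nn_integral_eq_integral)
  qed
  define A where "A = (\<Sum>j\<in>J. (a j)\<^sup>2)"
  define A' where "A' = (\<Sum>j\<in>{k}. (a j)\<^sup>2)"
  have A: "0 \<le> A" "0 \<le> A'" by (auto simp: A_def A'_def intro: sum_nonneg)
  \<comment> \<open>\<open>n\<close> diagonal terms, each a product of two second moments over a
    step of length \<open>(t - s) / n\<close>, add up to \<open>C / n\<close>.\<close>
  define C where "C = A * exp (A * (t - s)) * (t - s) * (A' * exp (A' * (t - s)) * (t - s))"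
  define f where "f p = expectation (\<lambda>\<omega>. indicator B \<omega> * wexps a J s p \<omega> * wexps a {k} s p \<omega>)" for p
  \<comment> \<open>\<open>c\<close> is the free weight in Young's inequality
    \<open>\<bar>Z\<bar> \<le> c / 2 + Z\<^sup>2 / (2 * c)\<close>. Refining the partition removes
    the second summand only.\<close>
  have est: "\<bar>f t - prob B\<bar> \<le> c / 2 + C / (2 * c) * (1 / real (Suc m))" if c: "0 < c" for c m
  proof -
    define n where "n = Suc m"
    have n0: "real n > 0" by (simp add: n_def)
    define h where "h = (t - s) / n"
    have h: "0 < h" using st n0 by (simp add: h_def)
    define \<tau> where "\<tau> i = s + real i * h" for i
    have \<tau>0: "\<tau> 0 = s" and \<tau>n: "\<tau> n = t" using n0 by (auto simp: \<tau>_def h_def)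
    have \<tau>mono: "i \<le> j \<Longrightarrow> \<tau> i \<le> \<tau> j" for i j using h by (simp add: \<tau>_def)
    have \<tau>s: "s \<le> \<tau> i" for i using \<tau>mono [of 0 i] \<tau>0 by simp
    have \<tau>t: "i \<le> n \<Longrightarrow> \<tau> i \<le> t" for i using \<tau>mono [of i n] \<tau>n by simp
    have \<tau>Suc: "\<tau> (Suc i) - \<tau> i = h" for i by (simp add: \<tau>_def algebra_simps)
    define U where "U i \<omega> = wexps a J s (\<tau> (Suc i)) \<omega> - wexps a J s (\<tau> i) \<omega>" for i \<omega>
    define V where "V i \<omega> = wexps a {k} s (\<tau> (Suc i)) \<omega> - wexps a {k} s (\<tau> i) \<omega>" for i \<omega>
    define Z where "Z \<omega> = (\<Sum>i<n. U i \<omega> * V i \<omega>)" for \<omega>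
    have ind: "indep_var borel (\<lambda>\<omega>. U i \<omega> * U j \<omega>) borel (\<lambda>\<omega>. V i \<omega> * V j \<omega>)" for i j
      unfolding U_def V_def using \<tau>s \<tau>mono by (intro wexps_increments_indep J k st) auto
    have UU: "integrable M (\<lambda>\<omega>. U i \<omega> * U j \<omega>)" for i j
    proof -
      consider "i < j" | "j < i" | "i = j" by linarith
      then show ?thesis
      proof cases
        case 1
        then show ?thesis unfolding U_def using \<tau>s \<tau>mono by (intro mgf_increments(1) J st) auto
      next
        case 2
        then show ?thesis unfolding U_def using \<tau>s \<tau>mono
          by (subst mult.commute, intro mgf_increments(1) J st) auto
      next
        case 3
        then show ?thesis unfolding U_def using \<tau>s \<tau>mono mgf_increments(3) [OF J st(1), of "\<tau> i" "\<tau> (Suc i)" "\<tau> (Suc i)" "\<tau> (Suc i)" a]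
          by (auto simp: power2_eq_square)
      qed
    qed
    have VV: "integrable M (\<lambda>\<omega>. V i \<omega> * V j \<omega>)" "i \<noteq> j \<Longrightarrow> expectation (\<lambda>\<omega>. V i \<omega> * V j \<omega>) = 0" for i j
    proof -
      have *: "integrable M (\<lambda>\<omega>. V i \<omega> * V j \<omega>) \<and> (i \<noteq> j \<longrightarrow> expectation (\<lambda>\<omega>. V i \<omega> * V j \<omega>) = 0)" if "i \<le> j" for i j
      proof (cases "i = j")
        case True
        then show ?thesis unfolding V_def using \<tau>s \<tau>mono mgf_increments(3) [OF mk st(1), of "\<tau> i" "\<tau> (Suc i)" "\<tau> (Suc i)" "\<tau> (Suc i)" a]
          by (auto simp: power2_eq_square)
      next
        case False
        then show ?thesis unfolding V_def using that \<tau>s \<tau>mono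
          by (intro conjI impI mgf_increments(1,2) mk st) auto
      qed
      show "integrable M (\<lambda>\<omega>. V i \<omega> * V j \<omega>)"
        using * [of i j] * [of j i] by (cases "i \<le> j") (auto simp: mult.commute)
      show "i \<noteq> j \<Longrightarrow> expectation (\<lambda>\<omega>. V i \<omega> * V j \<omega>) = 0"
        using * [of i j] * [of j i] by (cases "i \<le> j") (auto simp: mult.commute)
    qed
    have UV: "integrable M (\<lambda>\<omega>. (U i \<omega> * U j \<omega>) * (V i \<omega> * V j \<omega>))"
      "expectation (\<lambda>\<omega>. (U i \<omega> * U j \<omega>) * (V i \<omega> * V j \<omega>)) = expectation (\<lambda>\<omega>. U i \<omega> * U j \<omega>) * expectation (\<lambda>\<omega>. V i \<omega> * V j \<omega>)" for i j
      using indep_var_integrable [OF ind UU VV(1)] indep_var_lebesgue_integral [OF ind UU VV(1)] by auto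
    have Z2: "(Z \<omega>)\<^sup>2 = (\<Sum>i<n. \<Sum>j<n. (U i \<omega> * U j \<omega>) * (V i \<omega> * V j \<omega>))" for \<omega>
      unfolding Z_def power2_eq_square sum_product by (simp add: mult_ac)
    have Zint: "integrable M (\<lambda>\<omega>. (Z \<omega>)\<^sup>2)"
      unfolding Z2 by (intro Bochner_Integration.integrable_sum UV)
    have bU: "expectation (\<lambda>\<omega>. U i \<omega> * U i \<omega>) \<le> A * exp (A * (t - s)) * h" if "i < n" for i
    proof -
      have "expectation (\<lambda>\<omega>. U i \<omega> * U i \<omega>) = exp (A * (\<tau> (Suc i) - s)) - exp (A * (\<tau> i - s))"
        unfolding U_def A_def power2_eq_square [symmetric]
        using \<tau>s \<tau>mono by (intro mgf_increments(4) [OF J st(1) _ _ order_refl order_refl]) auto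
      also have "\<dots> \<le> A * exp (A * (t - s)) * (\<tau> (Suc i) - \<tau> i)"
        using A \<tau>s \<tau>mono \<tau>t that by (intro exp_increment_le) auto
      finally show ?thesis by (simp add: \<tau>Suc)
    qed
    have bV: "expectation (\<lambda>\<omega>. V i \<omega> * V i \<omega>) \<le> A' * exp (A' * (t - s)) * h" if "i < n" for i
    proof -
      have "expectation (\<lambda>\<omega>. V i \<omega> * V i \<omega>) = exp (A' * (\<tau> (Suc i) - s)) - exp (A' * (\<tau> i - s))"
        unfolding V_def A'_def power2_eq_square [symmetric]
        using \<tau>s \<tau>mono by (intro mgf_increments(4) [OF mk st(1) _ _ order_refl order_refl]) auto
      also have "\<dots> \<le> A' * exp (A' * (t - s)) * (\<tau> (Suc i) - \<tau> i)"
        using A \<tau>s \<tau>mono \<tau>t that by (intro exp_increment_le) auto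
      finally show ?thesis by (simp add: \<tau>Suc)
    qed
    have "expectation (\<lambda>\<omega>. (Z \<omega>)\<^sup>2) = (\<Sum>i<n. \<Sum>j<n. expectation (\<lambda>\<omega>. U i \<omega> * U j \<omega>) * expectation (\<lambda>\<omega>. V i \<omega> * V j \<omega>))"
      unfolding Z2 by (simp add: Bochner_Integration.integral_sum Bochner_Integration.integrable_sum UV)
    also have "\<dots> = (\<Sum>i<n. expectation (\<lambda>\<omega>. U i \<omega> * U i \<omega>) * expectation (\<lambda>\<omega>. V i \<omega> * V i \<omega>))"
    proof (rule sum.cong)
      fix i assume "i \<in> {..<n}"
      then show "(\<Sum>j<n. expectation (\<lambda>\<omega>. U i \<omega> * U j \<omega>) * expectation (\<lambda>\<omega>. V i \<omega> * V j \<omega>))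
        = expectation (\<lambda>\<omega>. U i \<omega> * U i \<omega>) * expectation (\<lambda>\<omega>. V i \<omega> * V i \<omega>)"
        by (subst sum.remove [of _ i]) (auto intro!: sum.neutral simp: VV(2))
    qed simp
    also have "\<dots> \<le> (\<Sum>i<n. (A * exp (A * (t - s)) * h) * (A' * exp (A' * (t - s)) * h))"
      using A h bU bV by (intro sum_mono mult_mono) (auto intro!: integral_nonneg_AE)
    also have "\<dots> = C / n"
      using n0 by (simp add: C_def h_def field_simps)
    finally have EZ: "expectation (\<lambda>\<omega>. (Z \<omega>)\<^sup>2) \<le> C / n" .
    have Zm: "Z \<in> borel_measurable M"
    proof -
      have "U i \<in> borel_measurable M" "V i \<in> borel_measurable M" for i
        unfolding U_def [abs_def] V_def [abs_def]
        using st \<tau>s order_trans [OF st(1) \<tau>s] JI kI by (auto intro!: borel_measurable_diff wexps_measurable)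
      then show ?thesis unfolding Z_def [abs_def] by measurable
    qed
    have Z1: "integrable M Z"
      by (rule square_integrable_imp_integrable [OF Zm Zint])
    \<comment> \<open>\<open>U i * V i\<close> expands into four products. By \<open>mart1\<close>
      and \<open>mart2\<close> the two mixed ones have mean \<open>f (\<tau> i)\<close>, so that a
      telescoping difference remains.\<close>
    have step: "integrable M (\<lambda>\<omega>. indicator B \<omega> * (U i \<omega> * V i \<omega>))"
      "expectation (\<lambda>\<omega>. indicator B \<omega> * (U i \<omega> * V i \<omega>)) = f (\<tau> (Suc i)) - f (\<tau> i)" for i
    proof -
      let ?w = "\<lambda>p q \<omega>. indicator B \<omega> * wexps a J s p \<omega> * wexps a {k} s q \<omega>"
      have eq: "(\<lambda>\<omega>. indicator B \<omega> * (U i \<omega> * V i \<omega>)) = (\<lambda>\<omega>. (?w (\<tau> (Suc i)) (\<tau> (Suc i)) \<omega> - ?w (\<tau> (Suc i)) (\<tau> i) \<omega>)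
          - (?w (\<tau> i) (\<tau> (Suc i)) \<omega> - ?w (\<tau> i) (\<tau> i) \<omega>))"
        by (auto simp: U_def V_def algebra_simps)
      have i: "integrable M (?w (\<tau> x) (\<tau> y))" for x y using int \<tau>s by blast
      show "integrable M (\<lambda>\<omega>. indicator B \<omega> * (U i \<omega> * V i \<omega>))"
        unfolding eq by (intro Bochner_Integration.integrable_diff i)
      have "expectation (\<lambda>\<omega>. indicator B \<omega> * (U i \<omega> * V i \<omega>))
         = (expectation (?w (\<tau> (Suc i)) (\<tau> (Suc i))) - expectation (?w (\<tau> (Suc i)) (\<tau> i)))
          - (expectation (?w (\<tau> i) (\<tau> (Suc i))) - expectation (?w (\<tau> i) (\<tau> i)))"
        unfolding eq by (subst Bochner_Integration.integral_diff | intro Bochner_Integration.integrable_diff i refl)+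
      also have "\<dots> = f (\<tau> (Suc i)) - f (\<tau> i)"
        using mart1 [OF \<tau>s \<tau>mono, of i "Suc i"] mart2 [OF \<tau>s \<tau>mono, of i "Suc i"] by (simp add: f_def)
      finally show "expectation (\<lambda>\<omega>. indicator B \<omega> * (U i \<omega> * V i \<omega>)) = f (\<tau> (Suc i)) - f (\<tau> i)" .
    qed
    have "f (\<tau> 0) = prob B"
      by (simp add: f_def \<tau>0)
    moreover have "expectation (\<lambda>\<omega>. indicator B \<omega> * Z \<omega>) = f (\<tau> n) - f (\<tau> 0)"
    proof -
      have "expectation (\<lambda>\<omega>. indicator B \<omega> * Z \<omega>) = (\<Sum>i<n. expectation (\<lambda>\<omega>. indicator B \<omega> * (U i \<omega> * V i \<omega>)))"
        unfolding Z_def sum_distrib_left by (intro Bochner_Integration.integral_sum step(1))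
      then show ?thesis using sum_lessThan_telescope [of "\<lambda>i. f (\<tau> i)" n] by (simp add: step(2))
    qed
    ultimately have "\<bar>f t - prob B\<bar> = \<bar>expectation (\<lambda>\<omega>. indicator B \<omega> * Z \<omega>)\<bar>"
      by (simp add: \<tau>n)
    also have "\<dots> \<le> expectation (\<lambda>\<omega>. c / 2 + (Z \<omega>)\<^sup>2 / (2 * c))"
    proof (rule integral_abs_bound [THEN order_trans], rule integral_mono)
      show "integrable M (\<lambda>\<omega>. \<bar>indicator B \<omega> * Z \<omega>\<bar>)"
        using integrable_real_mult_indicator [OF \<open>B \<in> sets M\<close> Z1] by (simp add: mult.commute)
      show "integrable M (\<lambda>\<omega>. c / 2 + (Z \<omega>)\<^sup>2 / (2 * c))"
        using Zint by simp
      fix \<omega>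
      have "\<bar>indicator B \<omega> * Z \<omega>\<bar> \<le> \<bar>Z \<omega>\<bar>" by (simp add: indicator_def)
      also have "\<dots> \<le> c / 2 + (Z \<omega>)\<^sup>2 / (2 * c)"
        using c sum_squares_bound [of c "\<bar>Z \<omega>\<bar>"] by (simp add: field_simps power2_eq_square)
      finally show "\<bar>indicator B \<omega> * Z \<omega>\<bar> \<le> c / 2 + (Z \<omega>)\<^sup>2 / (2 * c)" .
    qed
    also have "\<dots> = c / 2 + expectation (\<lambda>\<omega>. (Z \<omega>)\<^sup>2) / (2 * c)"
      using Zint by (simp add: prob_space)
    also have "\<dots> \<le> c / 2 + (C / n) / (2 * c)"
      using EZ c by (intro add_left_mono divide_right_mono) auto
    finally show ?thesis by (simp add: n_def mult_ac)
  qed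
  have "\<bar>f t - prob B\<bar> \<le> c / 2" if "0 < c" for c
  proof (rule LIMSEQ_le_const)
    show "(\<lambda>m. c / 2 + C / (2 * c) * (1 / real (Suc m))) \<longlonglongrightarrow> c / 2"
      using tendsto_add [OF tendsto_const [of "c / 2"] tendsto_mult_right_zero [OF LIMSEQ_Suc [OF lim_1_over_n], of "C / (2 * c)"]] by simp
    show "\<exists>N. \<forall>m\<ge>N. \<bar>f t - prob B\<bar> \<le> c / 2 + C / (2 * c) * (1 / real (Suc m))"
      using est [OF that] by blast
  qed
  \<comment> \<open>With \<open>c\<close> taken to be the quantity itself, it is at most half of
    itself.\<close>
  from this [of "\<bar>f t - prob B\<bar>"] have "f t = prob B" by (cases "f t = prob B") auto
  then show "expectation (\<lambda>\<omega>. indicator B \<omega> * wexps a J s t \<omega> * wexps a {k} s t \<omega>) = prob B"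
    by (simp add: f_def)
qed

text \<open>One index is added at a time: \<open>wexps_product_indicator\<close> proves the identity
  on sets of \<open>\<F> s\<close>, and \<open>nn_integral_eq_subalgebra\<close> extends it to every
  weight \<open>X\<close>.\<close>

lemma mgf_finite:
  assumes "finite J" "J \<subseteq> I"
  shows "mgf J"
  using assms
proof (induction J rule: finite_induct)
  case empty
  then show ?case by (simp add: mgf_def wexps_def)
next
  case (insert k J)
  then have J: "mgf J" and k: "k \<in> I - J" by auto
  have JI: "J \<subseteq> I" "{k} \<subseteq> I" using insert.prems by auto
  show ?case
    unfolding mgf_def
  proof (intro conjI allI impI)
    fix a s t and X :: "'w \<Rightarrow> ennreal"
    assume *: "0 \<le> s \<and> s \<le> t \<and> X \<in> borel_measurable (\<F> s)"
    show "(\<integral>\<^sup>+\<omega>. X \<omega> * ennreal (wexps a (insert k J) s t \<omega>) \<partial>M) = (\<integral>\<^sup>+\<omega>. X \<omega> \<partial>M)"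
    proof (cases "s = t")
      case False
      have eq: "wexps a (insert k J) s t \<omega> = wexps a J s t \<omega> * wexps a {k} s t \<omega>" for \<omega>
        using insert.hyps by (simp add: wexps_def mult.commute)
      show ?thesis
      proof (rule nn_integral_eq_subalgebra)
        show "(\<lambda>\<omega>. ennreal (wexps a (insert k J) s t \<omega>)) \<in> borel_measurable M"
          using wexps_measurable [of "insert k J" s t a] insert.prems * by simp
        fix B assume B: "B \<in> sets (\<F> s)"
        have "(\<integral>\<^sup>+\<omega>. ennreal (wexps a (insert k J) s t \<omega>) * indicator B \<omega> \<partial>M)
           = (\<integral>\<^sup>+\<omega>. ennreal (indicator B \<omega> * wexps a J s t \<omega> * wexps a {k} s t \<omega>) \<partial>M)"
          by (intro nn_integral_cong) (auto simp: eq indicator_def)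
        also have "\<dots> = ennreal (prob B)"
          using wexps_product_indicator [OF J k _ _ B, of t a] * False by (subst nn_integral_eq_integral) auto
        finally show "(\<integral>\<^sup>+\<omega>. ennreal (wexps a (insert k J) s t \<omega>) * indicator B \<omega> \<partial>M) = emeasure M B"
          by (simp add: emeasure_eq_measure)
      qed (use * in auto)
    qed simp
  qed (use insert.prems in auto)
qed

end

section \<open>Elementary integrals and exponential supermartingales\<close>

text \<open>The \<open>k\<close>-th column of the integrand, that is,
  \<open>elementary_value\<close> applied to \<open>g k\<close>; see
  \<open>elementary_value_basis\<close>. Terms of the list may share an index and overlap in time,
  and then add up. The value space is generic: real coefficients describe controls, vectors describe
  operator-valued integrands.\<close>

definition coef :: "('w, 'b::real_vector) elementary \<Rightarrow> nat \<Rightarrow> real \<Rightarrow> 'w \<Rightarrow> 'b" where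
  "coef e k u \<omega> = (\<Sum>(k', a, b, \<xi>)\<leftarrow>e. if k' = k then indicator {a<..b} u *\<^sub>R \<xi> \<omega> else 0)"

lemma coef_Nil [simp]: "coef [] k u \<omega> = 0"
  by (simp add: coef_def)

lemma coef_Cons: "coef ((k', a, b, \<xi>) # e) k u \<omega> = (if k' = k then indicator {a<..b} u *\<^sub>R \<xi> \<omega> else 0) + coef e k u \<omega>"
  by (simp add: coef_def)

lemma coef_append: "coef (e @ e') k u \<omega> = coef e k u \<omega> + coef e' k u \<omega>"
  by (simp add: coef_def)

lemma coef_outside: "k \<notin> fst ` set e \<Longrightarrow> coef e k u \<omega> = 0"
  by (induction e) (auto simp: coef_Cons)

lemma coef_measurable_time [measurable]:
  "(\<lambda>u. coef e k u \<omega>) \<in> borel_measurable borel" for e :: "('w, 'b::{real_normed_vector, second_countable_topology}) elementary"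
proof (induction e)
  case (Cons x e)
  note [measurable] = Cons.IH
  show ?case by (cases x; cases "fst x = k") (simp_all add: coef_Cons)
qed simp

lemma coef_bounded:
  fixes e :: "('w, 'b::{real_normed_vector, second_countable_topology}) elementary"
  shows "\<exists>C. \<forall>u. norm (coef e k u \<omega>) \<le> C"
proof (induction e)
  case (Cons x e)
  obtain k' a b \<xi> where x: "x = (k', a, b, \<xi>)" by (cases x)
  from Cons obtain C where C: "norm (coef e k u \<omega>) \<le> C" for u by blast
  have "norm (coef (x # e) k u \<omega>) \<le> norm (\<xi> \<omega>) + C" for u
    unfolding x coef_Cons
    by (rule order_trans [OF norm_triangle_ineq add_mono [OF _ C]]) (simp add: indicator_def)
  then show ?case by blast
qed auto

lemma elementary_integral_Nil [simp]: "elementary_integral \<beta> [] t \<omega> = 0"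
  by (simp add: elementary_integral_def)

lemma elementary_integral_Cons:
  "elementary_integral \<beta> ((k, a, b, \<xi>) # e) t \<omega> = (\<beta> k (min b t) \<omega> - \<beta> k (min a t) \<omega>) *\<^sub>R \<xi> \<omega> + elementary_integral \<beta> e t \<omega>"
  by (simp add: elementary_integral_def)

lemma elementary_integral_append:
  "elementary_integral \<beta> (e @ e') t \<omega> = elementary_integral \<beta> e t \<omega> + elementary_integral \<beta> e' t \<omega>"
  by (simp add: elementary_integral_def)

lemma elementary_process_Nil [simp]: "elementary_process M \<F> I []"
  by (simp add: elementary_process_def)

lemma elementary_process_Cons:
  "elementary_process M \<F> I ((k, a, b, \<xi>) # e) \<longleftrightarrow>
    k \<in> I \<and> 0 \<le> a \<and> a \<le> b \<and> \<xi> \<in> borel_measurable (\<F> a) \<and> bounded (\<xi> ` space M) \<and> elementary_process M \<F> I e"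
  by (auto simp: elementary_process_def)

lemma elementary_process_append:
  "elementary_process M \<F> I (e @ e') \<longleftrightarrow> elementary_process M \<F> I e \<and> elementary_process M \<F> I e'"
  unfolding elementary_process_def set_append ball_Un by (rule refl)

lemma elementary_process_idx: "elementary_process M \<F> I e \<Longrightarrow> fst ` set e \<subseteq> I"
  by (auto simp: elementary_process_def)

lemma elementary_induct [consumes 1, case_names Nil Cons]:
  assumes "elementary_process M \<F> I e" "P []"
    and "\<And>k a b \<xi> e. \<lbrakk>k \<in> I; 0 \<le> a; a \<le> b; \<xi> \<in> borel_measurable (\<F> a); bounded (\<xi> ` space M);
       elementary_process M \<F> I e; P e\<rbrakk> \<Longrightarrow> P ((k, a, b, \<xi>) # e)"
  shows "P e"
  using assms(1)
proof (induction e)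
  case (Cons x e)
  then show ?case by (cases x) (auto simp: elementary_process_Cons intro: assms(3))
qed (rule assms(2))

lemma elementary_integral_zero:
  "elementary_process M \<F> I e \<Longrightarrow> elementary_integral \<beta> e 0 \<omega> = 0"
  by (induction rule: elementary_induct) (auto simp: elementary_integral_Cons)

text \<open>If \<open>J\<close> contains all indices of \<open>e\<close>, this is the time integral
  of the squared Hilbert-Schmidt norm; for real coefficients it is the quadratic variation of the
  integral. The index set is a parameter so that several lists can be treated over a common
  \<open>J\<close>.\<close>

definition energy :: "('w, 'b::{real_normed_vector, second_countable_topology}) elementary \<Rightarrow> nat set \<Rightarrow> real \<Rightarrow> 'w \<Rightarrow> real" where
  "energy e J t \<omega> = (LINT u:{0..t}|lborel. (\<Sum>k\<in>J. (norm (coef e k u \<omega>))\<^sup>2))"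

lemma set_integrable_bounded_Icc:
  fixes f :: "real \<Rightarrow> 'b::{banach, second_countable_topology}"
  assumes "f \<in> borel_measurable borel" "\<And>u. norm (f u) \<le> C"
  shows "set_integrable lborel {s..t} f" "set_integrable lborel {s<..t} f"
proof -
  show "set_integrable lborel {s..t} f" 
    unfolding set_integrable_def
    by (rule integrableI_bounded_set [where A = "{s..t}" and B = "max C 0"])
       (use assms in \<open>auto simp: emeasure_lborel_Icc_eq intro!: AE_I2 split: split_indicator\<close>,
        metis assms(2) max.coboundedI1)
  then show "set_integrable lborel {s<..t} f"
    by (rule set_integrable_subset) auto
qed

lemma energy_integrand:
  fixes e :: "('w, 'b::{real_normed_vector, second_countable_topology}) elementary"
  assumes "finite J"
  shows "(\<lambda>u. \<Sum>k\<in>J. (norm (coef e k u \<omega>))\<^sup>2) \<in> borel_measurable borel"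
    and "\<exists>C. \<forall>u. norm (\<Sum>k\<in>J. (norm (coef e k u \<omega>))\<^sup>2) \<le> C"
proof -
  show "(\<lambda>u. \<Sum>k\<in>J. (norm (coef e k u \<omega>))\<^sup>2) \<in> borel_measurable borel"
    by measurable
  obtain C where C: "\<And>k u. norm (coef e k u \<omega>) \<le> C k"
    using coef_bounded [of e _ \<omega>] by metis
  have "norm (\<Sum>k\<in>J. (norm (coef e k u \<omega>))\<^sup>2) \<le> (\<Sum>k\<in>J. (C k)\<^sup>2)" for u
    by (simp add: sum_nonneg) (intro sum_mono power_mono C norm_ge_zero)
  then show "\<exists>C. \<forall>u. norm (\<Sum>k\<in>J. (norm (coef e k u \<omega>))\<^sup>2) \<le> C"
    by blast
qed

lemma energy_nonneg: "0 \<le> energy e J t \<omega>"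
  unfolding energy_def set_lebesgue_integral_def
  by (intro integral_nonneg_AE AE_I2) (simp add: sum_nonneg)

section \<open>Exponential supermartingales with random coefficients\<close>

context wiener_setting
begin

text \<open>Coefficients are random on \<open>J1\<close> and constant on \<open>J2\<close>. A random
  coefficient is approximated by simple functions; on each of their level sets, which lie in
  \<open>\<F> s\<close>, it is constant and its index moves from \<open>J1\<close> to
  \<open>J2\<close>. The limit is taken by Fatou's lemma, which is why only an inequality
  results.\<close>

lemma wexp_random_le:
  assumes "finite J1" "finite J2" "J1 \<inter> J2 = {}" "J1 \<subseteq> I" "J2 \<subseteq> I" and st: "0 \<le> s" "s \<le> t"
    and "\<And>k. k \<in> J1 \<Longrightarrow> A k \<in> borel_measurable (\<F> s)" and "X \<in> borel_measurable (\<F> s)"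
  shows "(\<integral>\<^sup>+\<omega>. X \<omega> * ennreal ((\<Prod>k\<in>J1. wexp (A k \<omega>) k s t \<omega>) * wexps a J2 s t \<omega>) \<partial>M) \<le> (\<integral>\<^sup>+\<omega>. X \<omega> \<partial>M)"
  using assms(1-5,8,9)
proof (induction J1 arbitrary: J2 a X rule: finite_induct)
  case empty
  then show ?case using mgfD [OF mgf_finite [of J2] st] by simp
next
  case (insert k J1)
  have k: "k \<in> I" "k \<notin> J2" "k \<notin> J1" using insert by auto
  note X = insert.prems(6)
  have Ak: "A k \<in> borel_measurable (\<F> s)" using insert.prems by simp
  from borel_measurable_implies_sequence_metric [OF Ak, of 0] obtain H where
    H: "\<And>i. simple_function (\<F> s) (H i)" "\<And>\<omega>. \<omega> \<in> space M \<Longrightarrow> (\<lambda>i. H i \<omega>) \<longlonglongrightarrow> A k \<omega>"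
    using space_\<F> [OF st(1)] by auto
  have Hm: "H i \<in> borel_measurable (\<F> s)" for i using H(1) by (rule borel_measurable_simple_function)
  have [measurable]: "H i \<in> borel_measurable M" for i using Hm measurable_\<F>_M st by blast
  have [measurable]: "X \<in> borel_measurable M" using X measurable_\<F>_M st by blast
  have [measurable]: "A j \<in> borel_measurable M" if "j \<in> J1" for j using insert.prems(5) measurable_\<F>_M st that by blast
  have [measurable]: "k \<in> I" "0 \<le> s" "0 \<le> t" using k st by auto
  have wm [measurable]: "(\<lambda>\<omega>. wexp (f \<omega>) j s t \<omega>) \<in> borel_measurable M" if "f \<in> borel_measurable M" "j \<in> I" for f j
    unfolding wexp_def using that st by measurable
  have J: "J1 \<subseteq> I" "J2 \<subseteq> I" using insert.prems by auto
  have pm [measurable]: "(\<lambda>\<omega>. \<Prod>k\<in>J1. wexp (A k \<omega>) k s t \<omega>) \<in> borel_measurable M"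
    using J by (intro borel_measurable_prod wm) auto
  have [measurable]: "wexps a J2 s t \<in> borel_measurable M" using J st by simp
  define f where "f c \<omega> = X \<omega> * ennreal (wexp c k s t \<omega> * (\<Prod>k\<in>J1. wexp (A k \<omega>) k s t \<omega>) * wexps a J2 s t \<omega>)" for c \<omega>
  have fm [measurable]: "(\<lambda>\<omega>. f (h \<omega>) \<omega>) \<in> borel_measurable M" if [measurable]: "h \<in> borel_measurable M" for h
    unfolding f_def by measurable
  have le: "(\<integral>\<^sup>+\<omega>. f (H i \<omega>) \<omega> \<partial>M) \<le> (\<integral>\<^sup>+\<omega>. X \<omega> \<partial>M)" for i
  proof -
    define B where "B v = H i -` {v} \<inter> space M" for v
    have fin: "finite (H i ` space M)"
      using H(1) [of i] space_\<F> [OF st(1)] by (simp add: simple_function_def)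
    have B\<F>: "B v \<in> sets (\<F> s)" for v
      using measurable_sets [OF Hm, of "{v}" i] space_\<F> [OF st(1)] by (simp add: B_def)
    then have BM [measurable]: "B v \<in> sets M" for v using sets_\<F> st by blast
    have sum1: "c = (\<Sum>v\<in>H i ` space M. c * indicator (B v) \<omega>)" if "\<omega> \<in> space M" for c :: ennreal and \<omega>
      using fin that by (subst sum.remove [of _ "H i \<omega>"]) (auto simp: B_def indicator_def intro!: sum.neutral)
    have "(\<integral>\<^sup>+\<omega>. f (H i \<omega>) \<omega> \<partial>M) = (\<integral>\<^sup>+\<omega>. (\<Sum>v\<in>H i ` space M. f (H i \<omega>) \<omega> * indicator (B v) \<omega>) \<partial>M)"
      by (intro nn_integral_cong sum1) auto
    also have "\<dots> = (\<Sum>v\<in>H i ` space M. \<integral>\<^sup>+\<omega>. f (H i \<omega>) \<omega> * indicator (B v) \<omega> \<partial>M)"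
      by (intro nn_integral_sum) measurable
    also have "\<dots> \<le> (\<Sum>v\<in>H i ` space M. \<integral>\<^sup>+\<omega>. X \<omega> * indicator (B v) \<omega> \<partial>M)"
    proof (rule sum_mono)
      fix v
      have "(\<integral>\<^sup>+\<omega>. f (H i \<omega>) \<omega> * indicator (B v) \<omega> \<partial>M)
         = (\<integral>\<^sup>+\<omega>. (X \<omega> * indicator (B v) \<omega>) * ennreal ((\<Prod>k\<in>J1. wexp (A k \<omega>) k s t \<omega>) * wexps (a(k := v)) (insert k J2) s t \<omega>) \<partial>M)"
      proof (intro nn_integral_cong)
        fix \<omega>
        have "wexps (a(k := v)) (insert k J2) s t \<omega> = wexp v k s t \<omega> * wexps a J2 s t \<omega>"
          unfolding wexps_def using k insert.prems(1)
          by (subst prod.insert) (auto intro!: prod.cong)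
        then show "f (H i \<omega>) \<omega> * indicator (B v) \<omega>
          = (X \<omega> * indicator (B v) \<omega>) * ennreal ((\<Prod>k\<in>J1. wexp (A k \<omega>) k s t \<omega>) * wexps (a(k := v)) (insert k J2) s t \<omega>)"
          by (auto simp: f_def B_def indicator_def mult_ac)
      qed
      also have "\<dots> \<le> (\<integral>\<^sup>+\<omega>. X \<omega> * indicator (B v) \<omega> \<partial>M)"
        using insert.prems k X B\<F> by (intro insert.IH) auto
      finally show "(\<integral>\<^sup>+\<omega>. f (H i \<omega>) \<omega> * indicator (B v) \<omega> \<partial>M) \<le> (\<integral>\<^sup>+\<omega>. X \<omega> * indicator (B v) \<omega> \<partial>M)" .
    qed
    also have "\<dots> = (\<integral>\<^sup>+\<omega>. (\<Sum>v\<in>H i ` space M. X \<omega> * indicator (B v) \<omega>) \<partial>M)"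
      by (intro nn_integral_sum [symmetric]) measurable
    also have "\<dots> = (\<integral>\<^sup>+\<omega>. X \<omega> \<partial>M)"
      by (intro nn_integral_cong sum1 [symmetric]) auto
    finally show ?thesis .
  qed
  have lim: "(\<lambda>i. f (H i \<omega>) \<omega>) \<longlonglongrightarrow> f (A k \<omega>) \<omega>" if "\<omega> \<in> space M" for \<omega>
  proof -
    have "(\<lambda>i. ennreal (wexp (H i \<omega>) k s t \<omega> * (\<Prod>k\<in>J1. wexp (A k \<omega>) k s t \<omega>) * wexps a J2 s t \<omega>))
       \<longlonglongrightarrow> ennreal (wexp (A k \<omega>) k s t \<omega> * (\<Prod>k\<in>J1. wexp (A k \<omega>) k s t \<omega>) * wexps a J2 s t \<omega>)"
      unfolding wexp_def [of "H _ \<omega>" k] wexp_def [of "A k \<omega>" k]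
      by (intro tendsto_ennrealI tendsto_intros H(2) that) simp_all
    moreover have "0 < wexp (A k \<omega>) k s t \<omega> * (\<Prod>k\<in>J1. wexp (A k \<omega>) k s t \<omega>) * wexps a J2 s t \<omega>"
      by (intro mult_pos_pos prod_pos) auto
    ultimately show ?thesis
      unfolding f_def by (intro tendsto_mult_ennreal tendsto_const) auto
  qed
  have "(\<integral>\<^sup>+\<omega>. X \<omega> * ennreal ((\<Prod>k\<in>insert k J1. wexp (A k \<omega>) k s t \<omega>) * wexps a J2 s t \<omega>) \<partial>M)
     = (\<integral>\<^sup>+\<omega>. f (A k \<omega>) \<omega> \<partial>M)"
    using insert.hyps by (simp add: f_def)
  also have "\<dots> = (\<integral>\<^sup>+\<omega>. liminf (\<lambda>i. f (H i \<omega>) \<omega>) \<partial>M)"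
    by (intro nn_integral_cong lim_imp_Liminf [symmetric] lim) auto
  also have "\<dots> \<le> liminf (\<lambda>i. \<integral>\<^sup>+\<omega>. f (H i \<omega>) \<omega> \<partial>M)"
    by (intro nn_integral_liminf) measurable
  also have "\<dots> \<le> liminf (\<lambda>i. \<integral>\<^sup>+\<omega>. X \<omega> \<partial>M)"
    by (intro Liminf_mono always_eventually allI le)
  also have "\<dots> = (\<integral>\<^sup>+\<omega>. X \<omega> \<partial>M)"
    by (intro Liminf_const) simp
  finally show ?case .
qed

text \<open>Without breakpoints strictly between \<open>r\<close> and \<open>t\<close> the integrand
  is constant on \<open>{r<..t}\<close>, and its value is already known at time \<open>r\<close>: a
  term that is active at \<open>t\<close> has \<open>a < t\<close>, hence \<open>a \<le> r\<close>.
  Left-open intervals are what makes this work.\<close>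

lemma elementary_integral_increment:
  fixes e :: "('w, 'b::{real_normed_vector, second_countable_topology}) elementary"
  assumes e: "elementary_process M \<F> I e" and J: "finite J" "fst ` set e \<subseteq> J" and r: "r < t"
    and nb: "\<forall>(k, a, b, \<xi>)\<in>set e. a \<notin> {r<..<t} \<and> b \<notin> {r<..<t}"
  shows "elementary_integral \<beta> e t \<omega> - elementary_integral \<beta> e r \<omega> = (\<Sum>k\<in>J. (\<beta> k t \<omega> - \<beta> k r \<omega>) *\<^sub>R coef e k t \<omega>)"
    and "u \<in> {r<..t} \<Longrightarrow> coef e k u \<omega> = coef e k t \<omega>"
    and "0 \<le> r \<Longrightarrow> coef e k t \<in> borel_measurable (\<F> r)"
    and "0 \<le> r \<Longrightarrow> elementary_integral \<beta> e r \<in> borel_measurable (\<F> r)"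
proof -
  show "elementary_integral \<beta> e t \<omega> - elementary_integral \<beta> e r \<omega> = (\<Sum>k\<in>J. (\<beta> k t \<omega> - \<beta> k r \<omega>) *\<^sub>R coef e k t \<omega>)"
    using e J(2) nb
  proof (induction rule: elementary_induct)
    case (Cons k a b \<xi> e)
    have IH: "elementary_integral \<beta> e t \<omega> - elementary_integral \<beta> e r \<omega> = (\<Sum>k\<in>J. (\<beta> k t \<omega> - \<beta> k r \<omega>) *\<^sub>R coef e k t \<omega>)"
      using Cons by auto
    have kJ: "k \<in> J" using Cons by auto
    have "(\<beta> k (min b t) \<omega> - \<beta> k (min a t) \<omega>) *\<^sub>R \<xi> \<omega> - (\<beta> k (min b r) \<omega> - \<beta> k (min a r) \<omega>) *\<^sub>R \<xi> \<omega>
       = (\<beta> k t \<omega> - \<beta> k r \<omega>) *\<^sub>R (indicator {a<..b} t *\<^sub>R \<xi> \<omega>)"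
      using Cons.prems(2) \<open>a \<le> b\<close> r by (auto simp: min_def indicator_def scaleR_diff_left)
    moreover have "(\<Sum>j\<in>J. (\<beta> j t \<omega> - \<beta> j r \<omega>) *\<^sub>R coef ((k, a, b, \<xi>) # e) j t \<omega>)
       = (\<beta> k t \<omega> - \<beta> k r \<omega>) *\<^sub>R (indicator {a<..b} t *\<^sub>R \<xi> \<omega>) + (\<Sum>k\<in>J. (\<beta> k t \<omega> - \<beta> k r \<omega>) *\<^sub>R coef e k t \<omega>)"
      using J(1) kJ
      by (simp add: coef_Cons scaleR_add_right sum.distrib if_distrib [of "scaleR _"] cong: if_cong)
    ultimately show ?case
      by (simp add: elementary_integral_Cons IH [symmetric])
  qed simp
  show "u \<in> {r<..t} \<Longrightarrow> coef e k u \<omega> = coef e k t \<omega>"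
    using e nb
  proof (induction rule: elementary_induct)
    case (Cons k' a b \<xi> e)
    then have "coef e k u \<omega> = coef e k t \<omega>" by auto
    then show ?case using Cons.prems r by (auto simp: coef_Cons indicator_def)
  qed simp
  show "coef e k t \<in> borel_measurable (\<F> r)" if "0 \<le> r"
    using e nb
  proof (induction rule: elementary_induct)
    case Nil
    then show ?case by (simp add: coef_def [abs_def])
  next
    case (Cons k' a b \<xi> e)
    then have m [measurable]: "coef e k t \<in> borel_measurable (\<F> r)" by auto
    show ?case
    proof (cases "a < t")
      case True
      then have "a \<le> r" using Cons.prems by auto
      then have [measurable]: "\<xi> \<in> borel_measurable (\<F> r)" using Cons measurable_\<F>_mono by blast
      show ?thesis unfolding coef_Cons [abs_def] by (cases "k' = k") simp_all
    next
      case False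
      then have "coef ((k', a, b, \<xi>) # e) k t = coef e k t" by (intro ext) (auto simp: coef_Cons)
      then show ?thesis by simp
    qed
  qed
  show "elementary_integral \<beta> e r \<in> borel_measurable (\<F> r)" if "0 \<le> r"
    using e
  proof (induction rule: elementary_induct)
    case Nil
    then show ?case by (simp add: elementary_integral_def [abs_def])
  next
    case (Cons k a b \<xi> e)
    note [measurable] = Cons.IH
    show ?case
    proof (cases "a < r")
      case True
      then have [measurable]: "\<xi> \<in> borel_measurable (\<F> r)" using Cons measurable_\<F>_mono by (meson less_imp_le)
      have [measurable]: "\<beta> k (min b r) \<in> borel_measurable (\<F> r)" "\<beta> k (min a r) \<in> borel_measurable (\<F> r)"
        using Cons that by (auto intro!: \<beta>_measurable_\<F>')
      show ?thesis unfolding elementary_integral_Cons [abs_def] by measurable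
    next
      case False
      then have "elementary_integral \<beta> ((k, a, b, \<xi>) # e) r = elementary_integral \<beta> e r"
        using \<open>a \<le> b\<close> by (intro ext) (simp add: elementary_integral_Cons)
      then show ?thesis by simp
    qed
  qed
qed

text \<open>Induction on the number of breakpoints below \<open>t\<close>. From the last one,
  \<open>r\<close>, up to \<open>t\<close> the exponential gains a product of exponentials with
  \<open>\<F> r\<close>-measurable coefficients, to which \<open>wexp_random_le\<close> applies. For
  constant coefficients the exact identity \<open>mgfD\<close> takes its place; the resulting mean
  one later gives the tilted measure total mass one.\<close>

lemma exponential_supermartingale:
  fixes e :: "('w, real) elementary"
  assumes e: "elementary_process M \<F> I e" and J: "finite J" "fst ` set e \<subseteq> J" "J \<subseteq> I" and t: "0 \<le> t"
  shows "energy e J t \<in> borel_measurable (\<F> t)"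
    and "(\<integral>\<^sup>+\<omega>. ennreal (exp (elementary_integral \<beta> e t \<omega> - energy e J t \<omega> / 2)) \<partial>M) \<le> 1"
    and "\<forall>(k, a, b, \<xi>)\<in>set e. \<exists>c. \<xi> = (\<lambda>_. c) \<Longrightarrow>
      (\<integral>\<^sup>+\<omega>. ennreal (exp (elementary_integral \<beta> e t \<omega> - energy e J t \<omega> / 2)) \<partial>M) = 1"
proof -
  \<comment> \<open>The point 0 is added so that every positive \<open>t\<close> has a last
    breakpoint before it.\<close>
  define BP where "BP = insert 0 (\<Union>(k, a, b, \<xi>)\<in>set e. {a, b})"
  have finBP: "finite BP" by (auto simp: BP_def)
  let ?E = "\<lambda>t. (\<integral>\<^sup>+\<omega>. ennreal (exp (elementary_integral \<beta> e t \<omega> - energy e J t \<omega> / 2)) \<partial>M)"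
  let ?C = "\<forall>(k, a, b, \<xi>)\<in>set e. \<exists>c. \<xi> = (\<lambda>_. c)"
  have "energy e J t \<in> borel_measurable (\<F> t) \<and> ?E t \<le> 1 \<and> (?C \<longrightarrow> ?E t = 1)"
    using t
  proof (induction "card {p \<in> BP. 0 \<le> p \<and> p < t}" arbitrary: t rule: less_induct)
    case less
    show ?case
    proof (cases "t = 0")
      case True
      have "energy e J 0 = (\<lambda>_. 0)"
      proof
        fix \<omega>
        show "energy e J 0 \<omega> = 0"
          unfolding energy_def set_lebesgue_integral_def
          by (intro integral_eq_zero_AE AE_mp [OF AE_lborel_singleton [of "0::real"] AE_I2])
             (auto simp: indicator_def)
      qed
      then show ?thesis using True e by (simp add: elementary_integral_zero emeasure_space_1)
    next
      case False
      define r where "r = Max {p \<in> BP. 0 \<le> p \<and> p < t}"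
      have ne: "{p \<in> BP. 0 \<le> p \<and> p < t} \<noteq> {}" using False less.prems by (auto simp: BP_def)
      have fin: "finite {p \<in> BP. 0 \<le> p \<and> p < t}" using finBP by simp
      have r: "r \<in> BP" "0 \<le> r" "r < t" using Max_in [OF fin ne] by (auto simp: r_def)
      have rmax: "p \<in> BP \<Longrightarrow> 0 \<le> p \<Longrightarrow> p < t \<Longrightarrow> p \<le> r" for p
        unfolding r_def by (rule Max_ge [OF fin]) auto
      have nb: "\<forall>(k, a, b, \<xi>)\<in>set e. a \<notin> {r<..<t} \<and> b \<notin> {r<..<t}"
      proof -
        have "p \<notin> {r<..<t}" if "p \<in> BP" for p using rmax [OF that] r by force
        moreover have "(k, a, b, \<xi>) \<in> set e \<Longrightarrow> a \<in> BP \<and> b \<in> BP" for k a b \<xi> by (force simp: BP_def)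
        ultimately show ?thesis by blast
      qed
      have "card {p \<in> BP. 0 \<le> p \<and> p < r} < card {p \<in> BP. 0 \<le> p \<and> p < t}"
        by (rule psubset_card_mono [OF fin]) (use r in auto)
      from less.hyps [OF this r(2)]
      have IH: "energy e J r \<in> borel_measurable (\<F> r)" "?E r \<le> 1" "?C \<Longrightarrow> ?E r = 1" by auto
      note inc = elementary_integral_increment [OF e J(1,2) r(3) nb]
      note [measurable] = IH(1) inc(3) [OF r(2)] inc(4) [OF r(2)]
      have en: "energy e J t \<omega> = energy e J r \<omega> + (t - r) * (\<Sum>k\<in>J. (coef e k t \<omega>)\<^sup>2)" for \<omega>
      proof -
        note i = energy_integrand [OF J(1), of e \<omega>]
        obtain C where C: "\<And>u. norm (\<Sum>k\<in>J. (norm (coef e k u \<omega>))\<^sup>2) \<le> C" using i(2) by blast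
        have "energy e J t \<omega> = energy e J r \<omega> + (LINT u:{r<..t}|lborel. (\<Sum>k\<in>J. (norm (coef e k u \<omega>))\<^sup>2))"
        proof -
          define f where "f u = (\<Sum>k\<in>J. (norm (coef e k u \<omega>))\<^sup>2)" for u
          have "set_integrable lborel {0..r} f" "set_integrable lborel {r<..t} f"
            unfolding f_def by (intro set_integrable_bounded_Icc [OF i(1) C])+
          moreover have "{0..t} = {0..r} \<union> {r<..t}" using r by auto
          ultimately have "(LINT u:{0..t}|lborel. f u) = (LINT u:{0..r}|lborel. f u) + (LINT u:{r<..t}|lborel. f u)"
            using set_integral_Un [of "{0..r}" "{r<..t}" lborel f] by (simp add: ivl_disj_int)
          then show ?thesis by (simp add: energy_def f_def)
        qed
        also have "(LINT u:{r<..t}|lborel. (\<Sum>k\<in>J. (norm (coef e k u \<omega>))\<^sup>2)) = (LINT u:{r<..t}|lborel. (\<Sum>k\<in>J. (coef e k t \<omega>)\<^sup>2))"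
        proof (intro set_lebesgue_integral_cong allI impI sum.cong refl)
          fix u k assume "u \<in> {r<..t}"
          from inc(2) [OF this] show "(norm (coef e k u \<omega>))\<^sup>2 = (coef e k t \<omega>)\<^sup>2"
            by (simp only: real_norm_def power2_abs)
        qed simp
        also have "\<dots> = (t - r) * (\<Sum>k\<in>J. (coef e k t \<omega>)\<^sup>2)"
          using r by (simp add: set_lebesgue_integral_def)
        finally show ?thesis .
      qed
      have meas: "energy e J t \<in> borel_measurable (\<F> t)"
      proof -
        have "energy e J t \<in> borel_measurable (\<F> r)" unfolding en [abs_def] by measurable
        then show ?thesis by (rule measurable_\<F>_mono) (use r in auto)
      qed
      define X where "X \<omega> = ennreal (exp (elementary_integral \<beta> e r \<omega> - energy e J r \<omega> / 2))" for \<omega>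
      have X: "X \<in> borel_measurable (\<F> r)" unfolding X_def [abs_def] by measurable
      have eq: "ennreal (exp (elementary_integral \<beta> e t \<omega> - energy e J t \<omega> / 2)) = X \<omega> * ennreal (\<Prod>k\<in>J. wexp (coef e k t \<omega>) k r t \<omega>)" for \<omega>
      proof -
        have "(\<Prod>k\<in>J. wexp (coef e k t \<omega>) k r t \<omega>) = exp (\<Sum>k\<in>J. coef e k t \<omega> * (\<beta> k t \<omega> - \<beta> k r \<omega>) - (coef e k t \<omega>)\<^sup>2 * (t - r) / 2)"
          using J by (simp add: wexp_def exp_sum)
        also have "(\<Sum>k\<in>J. coef e k t \<omega> * (\<beta> k t \<omega> - \<beta> k r \<omega>) - (coef e k t \<omega>)\<^sup>2 * (t - r) / 2)
          = (elementary_integral \<beta> e t \<omega> - elementary_integral \<beta> e r \<omega>) - (t - r) * (\<Sum>k\<in>J. (coef e k t \<omega>)\<^sup>2) / 2"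
          unfolding inc(1) by (simp add: sum_subtractf mult.commute sum_distrib_left sum_divide_distrib)
        finally show ?thesis
          unfolding X_def by (simp add: ennreal_mult [symmetric] exp_add [symmetric] en diff_divide_distrib add_divide_distrib)
      qed
      have "?E t \<le> (\<integral>\<^sup>+\<omega>. X \<omega> \<partial>M)"
        unfolding eq using wexp_random_le [of J "{}" r t "\<lambda>k. coef e k t" X "\<lambda>_. 0"] J r X inc(3)
        by (simp add: wexps_def)
      moreover have "?E t = (\<integral>\<^sup>+\<omega>. X \<omega> \<partial>M)" if ?C
      proof -
        have "coef e k t \<omega> = coef e k t undefined" for k \<omega>
          using that by (induction e) (auto simp: coef_Cons)
        then have "(\<Prod>k\<in>J. wexp (coef e k t \<omega>) k r t \<omega>) = wexps (\<lambda>k. coef e k t undefined) J r t \<omega>" for \<omega>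
          unfolding wexps_def by metis
        then show ?thesis unfolding eq using mgfD [OF mgf_finite [OF J(1,3)] r(2) less_imp_le [OF r(3)] X] by simp
      qed
      ultimately show ?thesis using meas IH unfolding X_def by auto
    qed
  qed
  then show "energy e J t \<in> borel_measurable (\<F> t)" "?E t \<le> 1" "?C \<Longrightarrow> ?E t = 1" by auto
qed

end

section \<open>Random signs and Hilbert space valued integrals\<close>

text \<open>The mean of \<open>f\<close> at the end of a walk that starts at \<open>h\<close> and
  moves by plus or minus each \<open>e\<close> of the list, with independent signs of mean
  \<open>e \<bullet> u\<close>. It is a genuine mean when these numbers lie in
  \<open>[-1,1]\<close>, and \<open>u = 0\<close> means fair signs. The recursion avoids a
  probability space for the signs.\<close>

fun rad :: "'h::real_inner \<Rightarrow> 'h list \<Rightarrow> ('h \<Rightarrow> real) \<Rightarrow> 'h \<Rightarrow> real" where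
  "rad u [] f h = f h"
| "rad u (e # es) f h = (1 + e \<bullet> u) / 2 * rad u es f (h + e) + (1 - e \<bullet> u) / 2 * rad u es f (h - e)"

lemma rad_mono:
  "\<forall>e\<in>set es. \<bar>e \<bullet> u\<bar> \<le> 1 \<Longrightarrow> (\<And>h. f h \<le> f' h) \<Longrightarrow> rad u es f h \<le> rad u es f' h"
  by (induction es arbitrary: h) (auto intro!: add_mono mult_left_mono)

lemma rad_add: "rad u es (\<lambda>h. f h + f' h) h = rad u es f h + rad u es f' h"
  by (induction es arbitrary: h) (auto simp: algebra_simps)

lemma rad_cmult: "rad u es (\<lambda>h. c * f h) h = c * rad u es f h"
  by (induction es arbitrary: h) (auto simp: algebra_simps)

lemma rad_const: "rad u es (\<lambda>h. c) h = c"
  by (induction es arbitrary: h) (auto simp: field_simps)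

lemma rad_nonneg: "\<forall>e\<in>set es. \<bar>e \<bullet> u\<bar> \<le> 1 \<Longrightarrow> (\<And>h. 0 \<le> f h) \<Longrightarrow> 0 \<le> rad u es f h"
  using rad_mono [of es u "\<lambda>_. 0" f h] by (simp add: rad_const)

lemma rad_inner: "rad u es (\<lambda>h. h \<bullet> v) h = (h + (\<Sum>e\<leftarrow>es. (e \<bullet> u) *\<^sub>R e)) \<bullet> v"
  by (induction es arbitrary: h) (auto simp: inner_simps field_simps)

text \<open>A quadratic form has as its mean the value at the mean position plus, for each step,
  \<open>q e\<close> times the variance \<open>1 - (e \<bullet> u)\<^sup>2\<close> of the
  sign.\<close>

lemma rad_quadratic:
  assumes q: "\<And>x c e. q (x + c *\<^sub>R e) = q x + 2 * c * B x e + c\<^sup>2 * q e"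
  shows "rad u es q h = q (h + (\<Sum>e\<leftarrow>es. (e \<bullet> u) *\<^sub>R e)) + (\<Sum>e\<leftarrow>es. (1 - (e \<bullet> u)\<^sup>2) * q e)"
proof (induction es arbitrary: h)
  case (Cons e es)
  define D where "D = h + (\<Sum>e\<leftarrow>es. (e \<bullet> u) *\<^sub>R e)"
  have 1: "h + e + (\<Sum>e\<leftarrow>es. (e \<bullet> u) *\<^sub>R e) = D + 1 *\<^sub>R e" "h - e + (\<Sum>e\<leftarrow>es. (e \<bullet> u) *\<^sub>R e) = D + (-1) *\<^sub>R e"
    "h + ((e \<bullet> u) *\<^sub>R e + (\<Sum>e\<leftarrow>es. (e \<bullet> u) *\<^sub>R e)) = D + (e \<bullet> u) *\<^sub>R e"
    by (auto simp: D_def)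
  show ?case
    unfolding rad.simps Cons.IH list.map sum_list.Cons 1 q by (simp add: field_simps power2_eq_square)
qed simp

text \<open>A change of measure for signs: relative to a fair sign a biased one has density
  \<open>1 + c \<le> exp c\<close>, where \<open>c\<close> is \<open>e \<bullet> u\<close> or its
  negative, and the exponential weight cancels \<open>exp c\<close>.\<close>

lemma rad_tilt:
  assumes "\<forall>e\<in>set es. \<bar>e \<bullet> u\<bar> \<le> 1" "\<And>h. 0 \<le> f h"
  shows "rad u es (\<lambda>h'. f h' * exp (- ((h' - h) \<bullet> u))) h \<le> rad 0 es f h"
  using assms(1)
proof (induction es arbitrary: h)
  case (Cons e es)
  have es: "\<forall>e\<in>set es. \<bar>e \<bullet> u\<bar> \<le> 1" and e: "\<bar>e \<bullet> u\<bar> \<le> 1" using Cons.prems by auto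
  have shift: "rad u es (\<lambda>h'. f h' * exp (- ((h' - h) \<bullet> u))) k
     = exp (- ((k - h) \<bullet> u)) * rad u es (\<lambda>h'. f h' * exp (- ((h' - k) \<bullet> u))) k" for k
    unfolding rad_cmult [symmetric]
    by (intro arg_cong2 [where f = "rad u es"] ext) (simp_all add: exp_add [symmetric] inner_diff_left)
  have step: "(1 + c) / 2 * (exp (- c) * R) \<le> 1 / 2 * R'" if "R \<le> R'" "0 \<le> R" "\<bar>c\<bar> \<le> 1" for c R R' :: real
  proof -
    have "(1 + c) * exp (- c) \<le> exp c * exp (- c)"
      using exp_ge_add_one_self [of c] by (intro mult_right_mono) auto
    then have "(1 + c) * exp (- c) \<le> 1" by (simp add: exp_add [symmetric])
    then have "((1 + c) * exp (- c)) * R \<le> 1 * R'"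
      using that by (intro mult_mono) auto
    then show ?thesis by simp
  qed
  have nn: "0 \<le> rad u es (\<lambda>h'. f h' * exp (- ((h' - k) \<bullet> u))) k" for k
    by (intro rad_nonneg es) (simp add: assms)
  have "rad u (e # es) (\<lambda>h'. f h' * exp (- ((h' - h) \<bullet> u))) h
     = (1 + e \<bullet> u) / 2 * (exp (- (e \<bullet> u)) * rad u es (\<lambda>h'. f h' * exp (- ((h' - (h + e)) \<bullet> u))) (h + e))
     + (1 + (- (e \<bullet> u))) / 2 * (exp (- (- (e \<bullet> u))) * rad u es (\<lambda>h'. f h' * exp (- ((h' - (h - e)) \<bullet> u))) (h - e))"
    unfolding rad.simps shift [of "h + e"] shift [of "h - e"] by simp
  also have "\<dots> \<le> 1 / 2 * rad 0 es f (h + e) + 1 / 2 * rad 0 es f (h - e)"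
    using e by (intro add_mono step Cons.IH es nn) auto
  finally show ?case by simp
qed simp

text \<open>The tangent of \<open>exp\<close> at the mean \<open>m\<close> lies below
  \<open>exp\<close>, and \<open>rad\<close> is monotone and preserves affine combinations.\<close>

lemma rad_jensen:
  assumes "\<forall>e\<in>set es. \<bar>e \<bullet> u\<bar> \<le> 1"
  shows "exp (rad u es Q h) \<le> rad u es (\<lambda>h. exp (Q h)) h"
proof -
  define m where "m = rad u es Q h"
  have "exp m * (1 - m + Q k) \<le> exp (Q k)" for k
  proof -
    have "exp m * (1 + (Q k - m)) \<le> exp m * exp (Q k - m)"
      by (intro mult_left_mono exp_ge_add_one_self) auto
    then show ?thesis by (simp add: exp_add [symmetric] algebra_simps)
  qed
  then have "rad u es (\<lambda>k. exp m * (1 - m + Q k)) h \<le> rad u es (\<lambda>k. exp (Q k)) h"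
    by (intro rad_mono assms)
  then show ?thesis
    unfolding rad_cmult rad_add rad_const by (simp add: m_def)
qed

section \<open>Finite orthonormal systems and Parseval's identity in the limit\<close>

definition orthonormal_set :: "'h::real_inner set \<Rightarrow> bool" where
  "orthonormal_set E \<longleftrightarrow> finite E \<and> pairwise orthogonal E \<and> (\<forall>e\<in>E. norm e = 1)"

lemma orthonormal_set_norm_sum:
  assumes "orthonormal_set E"
  shows "(norm (\<Sum>e\<in>E. c e *\<^sub>R e))\<^sup>2 = (\<Sum>e\<in>E. (c e)\<^sup>2)"
  using assms
  by (subst norm_sum_Pythagorean)
     (auto simp: orthonormal_set_def pairwise_def orthogonal_clauses power_mult_distrib)

lemma orthonormal_set_projection:
  assumes E: "orthonormal_set E"
  shows "(norm (y - (\<Sum>e\<in>E. (e \<bullet> y) *\<^sub>R e)))\<^sup>2 = (norm y)\<^sup>2 - (\<Sum>e\<in>E. (e \<bullet> y)\<^sup>2)"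
proof -
  have "y \<bullet> (\<Sum>e\<in>E. (e \<bullet> y) *\<^sub>R e) = (\<Sum>e\<in>E. (e \<bullet> y)\<^sup>2)"
    by (simp add: inner_sum_right inner_commute power2_eq_square)
  then show ?thesis
    using orthonormal_set_norm_sum [OF E, of "\<lambda>e. e \<bullet> y"]
    by (simp add: power2_norm_eq_inner inner_diff_left inner_diff_right inner_commute)
qed

lemma bessel:
  assumes "orthonormal_set E"
  shows "(\<Sum>e\<in>E. (e \<bullet> y)\<^sup>2) \<le> (norm y)\<^sup>2"
  using orthonormal_set_projection [OF assms, of y] zero_le_power2 [of "norm (y - (\<Sum>e\<in>E. (e \<bullet> y) *\<^sub>R e))"]
  by linarith

lemma orthonormal_set_best_approximation:
  assumes E: "orthonormal_set E" and d: "d \<in> span E"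
  shows "(norm y)\<^sup>2 - (\<Sum>e\<in>E. (e \<bullet> y)\<^sup>2) \<le> (norm (y - d))\<^sup>2"
proof -
  define P where "P = (\<Sum>e\<in>E. (e \<bullet> y) *\<^sub>R e)"
  have "orthogonal (y - P) e" if "e \<in> E" for e
  proof -
    have "P \<bullet> e = (\<Sum>e'\<in>E. (e' \<bullet> y) * (e' \<bullet> e))"
      by (simp add: P_def inner_sum_left)
    also have "\<dots> = (\<Sum>e'\<in>E. if e' = e then e \<bullet> y else 0)"
      using E that by (intro sum.cong) (auto simp: orthonormal_set_def pairwise_def orthogonal_def norm_eq_1)
    also have "\<dots> = e \<bullet> y" using E that by (simp add: orthonormal_set_def)
    finally show ?thesis by (simp add: orthogonal_def inner_diff_left inner_commute [of y e])
  qed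
  moreover have "P - d \<in> span E"
    unfolding P_def by (intro span_diff span_sum span_scale span_base d)
  ultimately have "orthogonal (y - P) (P - d)"
    using orthogonal_to_span [of "P - d" E "y - P"] by blast
  then have "(norm ((y - P) + (P - d)))\<^sup>2 = (norm (y - P))\<^sup>2 + (norm (P - d))\<^sup>2"
    by (rule norm_add_Pythagorean)
  then have "(norm (y - P))\<^sup>2 \<le> (norm (y - d))\<^sup>2" by simp
  then show ?thesis
    using orthonormal_set_projection [OF E, of y] by (simp add: P_def)
qed

text \<open>Orthogonalise the first points of a dense sequence. The sets \<open>E n\<close> need not
  be nested: it suffices that their spans absorb the sequence, because projection is best
  approximation. Finite sets are what the random signs require.\<close>

lemma orthonormal_exhaustion:
  "\<exists>E :: nat \<Rightarrow> 'h::{real_inner, second_countable_topology} set.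
    (\<forall>n. orthonormal_set (E n)) \<and> (\<forall>y. (\<lambda>n. \<Sum>e\<in>E n. (e \<bullet> y)\<^sup>2) \<longlonglongrightarrow> (norm y)\<^sup>2)"
proof -
  obtain D :: "'h set" where D: "countable D" "\<And>X. open X \<Longrightarrow> X \<noteq> {} \<Longrightarrow> \<exists>d\<in>D. d \<in> X"
    by (erule countable_dense_setE)
  have ne: "D \<noteq> {}" using D(2) [of UNIV] by auto
  have "\<exists>E. orthonormal_set E \<and> from_nat_into D ` {..n} \<subseteq> span E" for n
  proof -
    obtain C where C: "finite C" "span C = span (from_nat_into D ` {..n})" "pairwise orthogonal C"
      using basis_orthogonal [of "from_nat_into D ` {..n}"] by auto
    define E where "E = (\<lambda>x. x /\<^sub>R norm x) ` (C - {0})"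
    have "orthonormal_set E"
      using C by (auto simp: orthonormal_set_def E_def pairwise_def orthogonal_def)
    moreover have "C \<subseteq> span E"
    proof
      fix x assume x: "x \<in> C"
      show "x \<in> span E"
      proof (cases "x = 0")
        case False
        then have "x /\<^sub>R norm x \<in> span E" using x by (intro span_base) (auto simp: E_def)
        then have "norm x *\<^sub>R (x /\<^sub>R norm x) \<in> span E" by (rule span_scale)
        then show ?thesis using False by simp
      qed (simp add: span_zero)
    qed
    then have "span C \<subseteq> span E" by (rule span_minimal) simp
    moreover have "from_nat_into D ` {..n} \<subseteq> span C"
      unfolding C(2) by (rule span_superset)
    ultimately show ?thesis by (intro exI [of _ E] conjI) auto
  qed
  then have "\<exists>E. \<forall>n. orthonormal_set (E n) \<and> from_nat_into D ` {..n} \<subseteq> span (E n)" by (intro choice allI)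
  then obtain E where E: "\<And>n. orthonormal_set (E n)" "\<And>n. from_nat_into D ` {..n} \<subseteq> span (E n)" by blast
  have "(\<lambda>n. \<Sum>e\<in>E n. (e \<bullet> y)\<^sup>2) \<longlonglongrightarrow> (norm y)\<^sup>2" for y
  proof (rule LIMSEQ_I)
    fix r :: real assume r: "0 < r"
    obtain d where d: "d \<in> D" "d \<in> ball y (sqrt r)"
      using D(2) [of "ball y (sqrt r)"] r by auto
    then obtain N where N: "d = from_nat_into D N"
      using D(1) ne by (metis from_nat_into_surj)
    have "norm ((\<Sum>e\<in>E n. (e \<bullet> y)\<^sup>2) - (norm y)\<^sup>2) < r" if "N \<le> n" for n
    proof -
      have "d \<in> span (E n)" using E(2) [of n] N that by auto
      then have "(norm y)\<^sup>2 - (\<Sum>e\<in>E n. (e \<bullet> y)\<^sup>2) \<le> (norm (y - d))\<^sup>2"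
        by (rule orthonormal_set_best_approximation [OF E(1)])
      also have "\<dots> < (sqrt r)\<^sup>2"
        using d(2) by (intro power_strict_mono) (auto simp: dist_norm)
      finally show ?thesis using bessel [OF E(1) [of n], of y] r by simp
    qed
    then show "\<exists>N. \<forall>n\<ge>N. norm ((\<Sum>e\<in>E n. (e \<bullet> y)\<^sup>2) - (norm y)\<^sup>2) < r" by blast
  qed
  then show ?thesis using E(1) by (intro exI [of _ E] conjI allI)
qed

text \<open>Tilting the signs towards \<open>y\<close> costs at most a factor \<open>exp (- 1)\<close>, whatever the dimension.\<close>

lemma rad_lower_bound:
  assumes E: "orthonormal_set (set es)" "distinct es" and a: "0 < a"
    and q: "\<And>x c e. q (x + c *\<^sub>R e) = q x + 2 * c * B x e + c\<^sup>2 * q e"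
    and B0: "\<And>e. B 0 e = 0" and q0: "\<And>x. 0 \<le> q x" and qV: "\<And>x. q x \<le> (norm x)\<^sup>2 * V" and tr: "(\<Sum>e\<in>set es. q e) \<le> V"
  shows "exp (a * (\<Sum>e\<in>set es. (e \<bullet> y)\<^sup>2) / norm y - a\<^sup>2 * V - 1)
      \<le> rad 0 (map (scaleR a) es) (\<lambda>h. exp (h \<bullet> y - q h / 2)) 0"
proof -
  define E where "E = set es"
  have finE: "finite E" by (simp add: E_def)
  \<comment> \<open>With this bias the sign of \<open>a *\<^sub>R e\<close> has mean
    \<open>\<theta> e\<close>, the coordinate of the unit vector along \<open>y\<close>, and the
    walk drifts to \<open>a\<close> times the projection of that unit vector. If
    \<open>y = 0\<close>, division by zero makes both \<open>u\<close> and \<open>\<theta>\<close>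
    vanish.\<close>
  define u where "u = (1 / (a * norm y)) *\<^sub>R y"
  define \<theta> where "\<theta> e = (e \<bullet> y) / norm y" for e
  have u: "(a *\<^sub>R e) \<bullet> u = \<theta> e" for e using a by (simp add: u_def \<theta>_def)
  have u': "a * (e \<bullet> u) = \<theta> e" for e using u [of e] by simp
  have sq: "(\<Sum>e\<in>E. (\<theta> e)\<^sup>2) \<le> 1"
  proof (cases "y = 0")
    case False
    have "(\<Sum>e\<in>E. (\<theta> e)\<^sup>2) = (\<Sum>e\<in>E. (e \<bullet> y)\<^sup>2) / (norm y)\<^sup>2"
      by (simp add: \<theta>_def power_divide sum_divide_distrib)
    also have "\<dots> \<le> 1" using bessel [OF E(1), of y] False by (simp add: E_def)
    finally show ?thesis .
  qed (simp add: \<theta>_def)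
  have \<theta>1: "(\<theta> e)\<^sup>2 \<le> 1" if "e \<in> E" for e
    using member_le_sum [OF that, of "\<lambda>e. (\<theta> e)\<^sup>2"] finE sq by simp
  have small: "\<forall>e\<in>set (map (scaleR a) es). \<bar>e \<bullet> u\<bar> \<le> 1"
  proof
    fix e assume "e \<in> set (map (scaleR a) es)"
    then obtain e' where e': "e = a *\<^sub>R e'" "e' \<in> E" by (auto simp: E_def)
    show "\<bar>e \<bullet> u\<bar> \<le> 1"
      using \<theta>1 [OF e'(2)] by (simp only: e'(1) u abs_square_le_1)
  qed
  define p where "p = a *\<^sub>R (\<Sum>e\<in>E. \<theta> e *\<^sub>R e)"
  have drift: "(\<Sum>e\<leftarrow>map (scaleR a) es. (e \<bullet> u) *\<^sub>R e) = p"
    unfolding p_def E_def scaleR_sum_right using E(2)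
    by (simp add: comp_def u' sum_list_distinct_conv_sum_set mult.commute)
  \<comment> \<open>The term with \<open>- u\<close> is the exponential weight of
    \<open>rad_tilt\<close>, placed in the exponent before Jensen's inequality is applied.\<close>
  define Q where "Q h = h \<bullet> (y - u) + (- 1 / 2) * q h" for h
  have q2: "q (a *\<^sub>R e) = a\<^sup>2 * q e" for e
    using q [of 0 a e] q [of 0 1 0] B0 by simp
  have "rad u (map (scaleR a) es) Q 0 = p \<bullet> (y - u) - (q p + (\<Sum>e\<in>E. (1 - (\<theta> e)\<^sup>2) * (a\<^sup>2 * q e))) / 2"
    unfolding Q_def rad_add rad_cmult rad_inner rad_quadratic [OF q] drift
    using E(2) by (simp add: comp_def u' q2 E_def sum_list_distinct_conv_sum_set)
  also have "\<dots> \<ge> a * (\<Sum>e\<in>E. (e \<bullet> y)\<^sup>2) / norm y - a\<^sup>2 * V - 1"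
  proof -
    have f1: "p \<bullet> y = a * (\<Sum>e\<in>E. (e \<bullet> y)\<^sup>2) / norm y"
      by (simp add: p_def inner_sum_left \<theta>_def power2_eq_square sum_divide_distrib sum_distrib_left)
    have f2: "p \<bullet> u = (\<Sum>e\<in>E. (\<theta> e)\<^sup>2)"
    proof -
      have "p \<bullet> u = (\<Sum>e\<in>E. \<theta> e * ((a *\<^sub>R e) \<bullet> u))"
        by (simp add: p_def inner_sum_left sum_distrib_left mult_ac)
      then show ?thesis by (simp only: u power2_eq_square)
    qed
    have f3: "q p \<le> a\<^sup>2 * V"
    proof -
      have V0: "0 \<le> V" using tr sum_nonneg [of "set es" q] q0 by fastforce
      have "(norm p)\<^sup>2 = a\<^sup>2 * (\<Sum>e\<in>E. (\<theta> e)\<^sup>2)"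
        unfolding p_def norm_scaleR power_mult_distrib E_def orthonormal_set_norm_sum [OF E(1)] by simp
      also have "\<dots> \<le> a\<^sup>2 * 1" using sq by (intro mult_left_mono) auto
      finally have le: "(norm p)\<^sup>2 \<le> a\<^sup>2" by simp
      have "q p \<le> (norm p)\<^sup>2 * V" by (rule qV)
      also have "\<dots> \<le> a\<^sup>2 * V" using le V0 by (rule mult_right_mono)
      finally show ?thesis .
    qed
    have f4: "(\<Sum>e\<in>E. (1 - (\<theta> e)\<^sup>2) * (a\<^sup>2 * q e)) \<le> a\<^sup>2 * V"
    proof -
      have "(\<Sum>e\<in>E. (1 - (\<theta> e)\<^sup>2) * (a\<^sup>2 * q e)) \<le> (\<Sum>e\<in>E. 1 * (a\<^sup>2 * q e))"
        using q0 by (intro sum_mono mult_right_mono) auto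
      also have "\<dots> = a\<^sup>2 * (\<Sum>e\<in>E. q e)" by (simp add: sum_distrib_left)
      also have "\<dots> \<le> a\<^sup>2 * V" using tr by (intro mult_left_mono) (auto simp: E_def)
      finally show ?thesis .
    qed
    \<comment> \<open>The constant 1 bounds \<open>p \<bullet> u\<close>, the cost of the bias; of
      \<open>a\<^sup>2 * V\<close> one half pays for the mean position and one half for the
      variances.\<close>
    have arith: "x - v - 1 \<le> py - pu - (qp + r) / 2"
      if "py = x" "pu = t" "qp \<le> v" "r \<le> v" "t \<le> 1" for x v py pu qp r t :: real
      using that by argo
    show ?thesis unfolding inner_diff_right by (rule arith [OF f1 f2 f3 f4 sq])
  qed
  finally have "exp (a * (\<Sum>e\<in>E. (e \<bullet> y)\<^sup>2) / norm y - a\<^sup>2 * V - 1) \<le> exp (rad u (map (scaleR a) es) Q 0)"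
    by simp
  also have "\<dots> \<le> rad u (map (scaleR a) es) (\<lambda>h. exp (Q h)) 0"
    by (rule rad_jensen [OF small])
  also have "(\<lambda>h. exp (Q h)) = (\<lambda>h. exp (h \<bullet> y - q h / 2) * exp (- ((h - 0) \<bullet> u)))"
    by (auto simp: Q_def exp_add [symmetric] inner_diff_right)
  also have "rad u (map (scaleR a) es) \<dots> 0 \<le> rad 0 (map (scaleR a) es) (\<lambda>h. exp (h \<bullet> y - q h / 2)) 0"
    by (rule rad_tilt [OF small]) simp
  finally show ?thesis by (simp add: E_def)
qed

text \<open>The mean over signs is a finite convex combination, so the bound by one survives; this
  is the exchange of averaging and integration.\<close>

lemma rad_nn_integral_le:
  assumes "\<And>h. (\<lambda>\<omega>. f h \<omega>) \<in> borel_measurable M" "\<And>h \<omega>. 0 \<le> f h \<omega>" "\<And>h. (\<integral>\<^sup>+\<omega>. ennreal (f h \<omega>) \<partial>M) \<le> 1"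
  shows "(\<lambda>\<omega>. rad 0 es (\<lambda>h. f h \<omega>) h) \<in> borel_measurable M \<and> (\<integral>\<^sup>+\<omega>. ennreal (rad 0 es (\<lambda>h. f h \<omega>) h) \<partial>M) \<le> 1"
proof (induction es arbitrary: h)
  case (Cons e es)
  let ?r = "\<lambda>h \<omega>. rad 0 es (\<lambda>h. f h \<omega>) h"
  have [measurable]: "?r h \<in> borel_measurable M" for h using Cons by blast
  have nn: "0 \<le> ?r h \<omega>" for h \<omega> by (intro rad_nonneg) (auto simp: assms)
  have "(\<integral>\<^sup>+\<omega>. ennreal (rad 0 (e # es) (\<lambda>h. f h \<omega>) h) \<partial>M)
     = (\<integral>\<^sup>+\<omega>. ennreal (1 / 2) * ennreal (?r (h + e) \<omega>) + ennreal (1 / 2) * ennreal (?r (h - e) \<omega>) \<partial>M)"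
  proof (intro nn_integral_cong)
    fix \<omega>
    have *: "ennreal (1 / 2 * x + 1 / 2 * y) = ennreal (1 / 2) * ennreal x + ennreal (1 / 2) * ennreal y"
      if "0 \<le> x" "0 \<le> y" for x y
      using that by (subst ennreal_plus, simp, simp, subst ennreal_mult', simp, subst ennreal_mult', simp, simp)
    have "rad 0 (e # es) (\<lambda>h. f h \<omega>) h = 1 / 2 * ?r (h + e) \<omega> + 1 / 2 * ?r (h - e) \<omega>" by simp
    then show "ennreal (rad 0 (e # es) (\<lambda>h. f h \<omega>) h)
       = ennreal (1 / 2) * ennreal (?r (h + e) \<omega>) + ennreal (1 / 2) * ennreal (?r (h - e) \<omega>)"
      using * [OF nn nn] by metis
  qed
  also have "\<dots> = ennreal (1 / 2) * (\<integral>\<^sup>+\<omega>. ennreal (?r (h + e) \<omega>) \<partial>M) + ennreal (1 / 2) * (\<integral>\<^sup>+\<omega>. ennreal (?r (h - e) \<omega>) \<partial>M)"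
    by (simp add: nn_integral_add nn_integral_cmult)
  also have "\<dots> \<le> ennreal (1 / 2) * 1 + ennreal (1 / 2) * 1"
    using Cons by (intro add_mono mult_left_mono) auto
  also have "\<dots> = ennreal (1 / 2 + 1 / 2)" by (subst ennreal_plus) simp_all
  also have "\<dots> = 1" by simp
  finally show ?case by simp
qed (use assms in auto)

section \<open>Vector-valued elementary integrals, paired with vectors and with a control\<close>

lemma set_integral_finite_sum:
  fixes f :: "'i \<Rightarrow> 'a \<Rightarrow> 'b::{banach, second_countable_topology}"
  assumes "\<And>i. i \<in> A \<Longrightarrow> set_integrable M S (f i)"
  shows "set_integrable M S (\<lambda>u. \<Sum>i\<in>A. f i u)" "(LINT u:S|M. (\<Sum>i\<in>A. f i u)) = (\<Sum>i\<in>A. LINT u:S|M. f i u)"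
  using assms unfolding set_integrable_def set_lebesgue_integral_def scaleR_sum_right
  by (auto intro: Bochner_Integration.integral_sum)

lemma set_integral_inner_right:
  fixes f :: "'a \<Rightarrow> 'b::{real_inner, banach, second_countable_topology}"
  assumes "set_integrable M S f"
  shows "set_integrable M S (\<lambda>u. h \<bullet> f u)" "(LINT u:S|M. h \<bullet> f u) = h \<bullet> (LINT u:S|M. f u)"
proof -
  note int = assms [unfolded set_integrable_def]
  show "set_integrable M S (\<lambda>u. h \<bullet> f u)"
    using integrable_inner_right [OF int, of h] by (simp add: set_integrable_def)
  show "(LINT u:S|M. h \<bullet> f u) = h \<bullet> (LINT u:S|M. f u)"
    using integral_inner_right [OF int, of h] by (simp add: set_lebesgue_integral_def)
qed

text \<open>The bracket of the vector integral of \<open>e\<close> with the real integral of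
  \<open>d\<close>, which is the drift that tilting by \<open>d\<close> adds to the integral of
  \<open>e\<close>.\<close>

definition cross_energy :: "('w, 'h::{real_normed_vector, second_countable_topology, banach}) elementary \<Rightarrow> ('w, real) elementary \<Rightarrow>
    nat set \<Rightarrow> real \<Rightarrow> 'w \<Rightarrow> 'h" where
  "cross_energy e d J t \<omega> = (LINT u:{0..t}|lborel. (\<Sum>k\<in>J. coef d k u \<omega> *\<^sub>R coef e k u \<omega>))"

definition inner_elementary :: "'h::real_inner \<Rightarrow> ('w, 'h) elementary \<Rightarrow> ('w, real) elementary" where
  "inner_elementary h e = map (\<lambda>(k, a, b, \<xi>). (k, a, b, \<lambda>\<omega>. \<xi> \<omega> \<bullet> h)) e"

lemma coef_inner: "coef (inner_elementary h e) k u \<omega> = coef e k u \<omega> \<bullet> h"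
  by (induction e) (auto simp: inner_elementary_def coef_Cons inner_add_left)

lemma elementary_integral_inner:
  "elementary_integral \<beta> (inner_elementary h e) t \<omega> = elementary_integral \<beta> e t \<omega> \<bullet> h"
  by (induction e) (auto simp: inner_elementary_def elementary_integral_Cons inner_add_left)

lemma idx_inner: "fst ` set (inner_elementary h e) = fst ` set e"
  by (force simp: inner_elementary_def)

lemma elementary_process_inner:
  fixes h :: "'h::{real_inner, second_countable_topology}"
  assumes "elementary_process M \<F> I e"
  shows "elementary_process M \<F> I (inner_elementary h e)"
  using assms
proof (induction rule: elementary_induct)
  case (Cons k a b \<xi> e)
  obtain C where "norm (\<xi> \<omega>) \<le> C" if "\<omega> \<in> space M" for \<omega> using Cons(5) by (auto simp: bounded_iff)
  then have "bounded ((\<lambda>\<omega>. \<xi> \<omega> \<bullet> h) ` space M)"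
    unfolding bounded_iff by (intro exI [of _ "C * norm h"]) (auto intro: order_trans [OF Cauchy_Schwarz_ineq2 mult_right_mono])
  moreover have "(\<lambda>\<omega>. \<xi> \<omega> \<bullet> h) \<in> borel_measurable (\<F> a)" using Cons(4) by measurable
  ultimately show ?case using Cons by (simp add: inner_elementary_def elementary_process_Cons)
qed (simp add: inner_elementary_def)

lemma set_integrable_coef:
  fixes e :: "('w, 'h::{real_inner, second_countable_topology, banach}) elementary" and d :: "('w, real) elementary"
  assumes "finite J"
  shows "set_integrable lborel {s..t} (\<lambda>u. \<Sum>k\<in>J. (norm (coef e k u \<omega>))\<^sup>2)"
    and "set_integrable lborel {s..t} (\<lambda>u. \<Sum>k\<in>J. coef d k u \<omega> *\<^sub>R coef e k u \<omega>)"
    and "set_integrable lborel {s..t} (\<lambda>u. \<Sum>k\<in>J. (coef e k u \<omega> \<bullet> x) * (coef e k u \<omega> \<bullet> y))"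
proof -
  obtain C where C: "\<And>k u. norm (coef e k u \<omega>) \<le> C k"
    using coef_bounded [of e _ \<omega>] by metis
  obtain D where D: "\<And>k u. norm (coef d k u \<omega>) \<le> D k"
    using coef_bounded [of d _ \<omega>] by metis
  have C0: "0 \<le> C k" for k using C norm_ge_zero order_trans by blast
  have D0: "0 \<le> D k" for k using D norm_ge_zero order_trans by blast
  show "set_integrable lborel {s..t} (\<lambda>u. \<Sum>k\<in>J. (norm (coef e k u \<omega>))\<^sup>2)"
    by (rule set_integrable_bounded_Icc [where C = "\<Sum>k\<in>J. (C k)\<^sup>2"], measurable)
       (simp add: sum_nonneg, intro sum_mono power_mono C norm_ge_zero)
  show "set_integrable lborel {s..t} (\<lambda>u. \<Sum>k\<in>J. coef d k u \<omega> *\<^sub>R coef e k u \<omega>)"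
    by (rule set_integrable_bounded_Icc [where C = "\<Sum>k\<in>J. D k * C k"], measurable,
        rule order_trans [OF norm_sum sum_mono])
       (unfold norm_scaleR real_norm_def [symmetric], intro mult_mono D C D0 norm_ge_zero)
  show "set_integrable lborel {s..t} (\<lambda>u. \<Sum>k\<in>J. (coef e k u \<omega> \<bullet> x) * (coef e k u \<omega> \<bullet> y))"
  proof (rule set_integrable_bounded_Icc [where C = "\<Sum>k\<in>J. (C k * norm x) * (C k * norm y)"], measurable)
    fix u
    have "\<bar>coef e k u \<omega> \<bullet> z\<bar> \<le> C k * norm z" for k z
      by (rule order_trans [OF Cauchy_Schwarz_ineq2 mult_right_mono [OF C norm_ge_zero]])
    then show "norm (\<Sum>k\<in>J. (coef e k u \<omega> \<bullet> x) * (coef e k u \<omega> \<bullet> y)) \<le> (\<Sum>k\<in>J. (C k * norm x) * (C k * norm y))"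
      using C0 by (intro order_trans [OF norm_sum sum_mono]) (auto simp: abs_mult intro!: mult_mono)
  qed
qed

context wiener_setting
begin

lemma coef_measurable_pair [measurable]:
  fixes e :: "('w, 'h::{real_normed_vector, second_countable_topology}) elementary"
  assumes "elementary_process M \<F> I e"
  shows "(\<lambda>(\<omega>, u). coef e k u \<omega>) \<in> borel_measurable (M \<Otimes>\<^sub>M lborel)"
  using assms
proof (induction rule: elementary_induct)
  case (Cons k' a b \<xi> e)
  note [measurable] = Cons.IH
  have [measurable]: "\<xi> \<in> borel_measurable M" using Cons measurable_\<F>_M by blast
  show ?case by (cases "k' = k") (simp_all add: coef_Cons)
qed simp

lemma energy_measurable [measurable]:
  assumes [measurable]: "elementary_process M \<F> I e"
  shows "energy e J t \<in> borel_measurable M"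
  unfolding energy_def [abs_def] set_lebesgue_integral_def by measurable

lemma cross_energy_measurable [measurable]:
  assumes [measurable]: "elementary_process M \<F> I e" "elementary_process M \<F> I d"
  shows "cross_energy e d J t \<in> borel_measurable M"
  unfolding cross_energy_def [abs_def] set_lebesgue_integral_def by measurable

lemma elementary_integral_measurable [measurable]:
  fixes e :: "('w, 'h::{real_normed_vector, second_countable_topology}) elementary"
  assumes "elementary_process M \<F> I e" "0 \<le> t"
  shows "elementary_integral \<beta> e t \<in> borel_measurable M"
  using assms
proof (induction rule: elementary_induct)
  case (Cons k a b \<xi> e)
  have [measurable]: "\<xi> \<in> borel_measurable M" "elementary_integral \<beta> e t \<in> borel_measurable M"
    "\<beta> k (min b t) \<in> borel_measurable M" "\<beta> k (min a t) \<in> borel_measurable M"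
    using Cons measurable_\<F>_M by (auto intro!: \<beta>_measurable)
  show ?case unfolding elementary_integral_Cons [abs_def] by measurable
qed (simp add: elementary_integral_def [abs_def])

text \<open>For a fixed vector \<open>h\<close> the exponential of
  \<open>h \<bullet> y - q h / 2\<close> has tilted mean at most one. Averaging over a random
  \<open>h\<close>, built from signs and an orthonormal set, replaces the linear exponent by a
  multiple of the norm through \<open>rad_lower_bound\<close>. Fatou's lemma then lets the
  orthonormal set grow; the loss \<open>exp (- 1)\<close> does not depend on it.\<close>

lemma exponential_supermartingale_vector:
  fixes e :: "('w, 'h::{real_inner, banach, second_countable_topology}) elementary"
  assumes e: "elementary_process M \<F> I e" and d: "elementary_process M \<F> I d"
    and J: "finite J" "fst ` set e \<subseteq> J" "fst ` set d \<subseteq> J" "J \<subseteq> I" and t: "0 \<le> t" and a: "0 < a"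
  shows "(\<integral>\<^sup>+\<omega>. ennreal (exp (elementary_integral \<beta> d t \<omega> - energy d J t \<omega> / 2) *
      exp (a * norm (elementary_integral \<beta> e t \<omega> - cross_energy e d J t \<omega>) - a\<^sup>2 * energy e J t \<omega> - 1)) \<partial>M) \<le> 1"
proof -
  note [measurable] = e d elementary_process_inner [OF e]
  define D where "D \<omega> = exp (elementary_integral \<beta> d t \<omega> - energy d J t \<omega> / 2)" for \<omega>
  define y where "y \<omega> = elementary_integral \<beta> e t \<omega> - cross_energy e d J t \<omega>" for \<omega>
  define V where "V \<omega> = energy e J t \<omega>" for \<omega>
  define B where "B \<omega> x y = (LINT u:{0..t}|lborel. (\<Sum>k\<in>J. (coef e k u \<omega> \<bullet> x) * (coef e k u \<omega> \<bullet> y)))" for \<omega> x y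
  define q where "q \<omega> x = B \<omega> x x" for \<omega> x
  note si = set_integrable_coef [OF J(1), of 0 t _ \<omega> for \<omega>]
  have q_energy: "q \<omega> h = energy (inner_elementary h e) J t \<omega>" for \<omega> h
    by (simp add: q_def B_def energy_def coef_inner power2_eq_square)
  have Badd: "B \<omega> (x + c *\<^sub>R x') y = B \<omega> x y + c * B \<omega> x' y" "B \<omega> y (x + c *\<^sub>R x') = B \<omega> y x + c * B \<omega> y x'" for \<omega> x c x' y
  proof -
    have "B \<omega> (x + c *\<^sub>R x') y = (LINT u:{0..t}|lborel. (\<Sum>k\<in>J. (coef e k u \<omega> \<bullet> x) * (coef e k u \<omega> \<bullet> y)) + c * (\<Sum>k\<in>J. (coef e k u \<omega> \<bullet> x') * (coef e k u \<omega> \<bullet> y)))"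
      unfolding B_def by (intro set_lebesgue_integral_cong) (auto simp: inner_simps algebra_simps sum.distrib sum_distrib_left)
    also have "\<dots> = B \<omega> x y + c * B \<omega> x' y"
      unfolding B_def by (subst set_integral_add) (auto intro!: si set_integrable_mult_right)
    finally show 1: "B \<omega> (x + c *\<^sub>R x') y = B \<omega> x y + c * B \<omega> x' y" .
    have comm: "B \<omega> x y = B \<omega> y x" for x y by (simp add: B_def mult.commute)
    show "B \<omega> y (x + c *\<^sub>R x') = B \<omega> y x + c * B \<omega> y x'"
      using 1 by (simp add: comm [of y])
  qed
  have Bcomm: "B \<omega> x y = B \<omega> y x" for \<omega> x y by (simp add: B_def mult.commute)
  have q1: "q \<omega> (x + c *\<^sub>R x') = q \<omega> x + 2 * c * B \<omega> x x' + c\<^sup>2 * q \<omega> x'" for \<omega> x c x'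
    unfolding q_def Badd by (simp add: Bcomm [of _ x' x] algebra_simps power2_eq_square)
  have q0: "0 \<le> q \<omega> x" for \<omega> x unfolding q_energy by (rule energy_nonneg)
  have qV: "q \<omega> x \<le> (norm x)\<^sup>2 * V \<omega>" for \<omega> x
  proof -
    have "q \<omega> x \<le> (LINT u:{0..t}|lborel. (norm x)\<^sup>2 * (\<Sum>k\<in>J. (norm (coef e k u \<omega>))\<^sup>2))"
      unfolding q_def B_def
    proof (rule set_integral_mono)
      fix u
      have "(coef e k u \<omega> \<bullet> x) * (coef e k u \<omega> \<bullet> x) \<le> (norm x)\<^sup>2 * (norm (coef e k u \<omega>))\<^sup>2" for k
        using Cauchy_Schwarz_ineq [of "coef e k u \<omega>" x] unfolding power2_norm_eq_inner by (simp add: power2_eq_square mult_ac)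
      then show "(\<Sum>k\<in>J. (coef e k u \<omega> \<bullet> x) * (coef e k u \<omega> \<bullet> x)) \<le> (norm x)\<^sup>2 * (\<Sum>k\<in>J. (norm (coef e k u \<omega>))\<^sup>2)"
        unfolding sum_distrib_left by (rule sum_mono)
    qed (auto intro!: si set_integrable_mult_right)
    then show ?thesis by (simp add: V_def energy_def)
  qed
  \<comment> \<open>Bessel's inequality bounds the trace of the covariance form by the energy for
    every orthonormal set. This is the source of dimension-free estimates.\<close>
  have tr: "(\<Sum>x\<in>E. q \<omega> x) \<le> V \<omega>" if E: "orthonormal_set E" for E \<omega>
  proof -
    have fin: "finite E" using E by (simp add: orthonormal_set_def)
    have "(\<Sum>x\<in>E. q \<omega> x) = (LINT u:{0..t}|lborel. (\<Sum>x\<in>E. (\<Sum>k\<in>J. (coef e k u \<omega> \<bullet> x) * (coef e k u \<omega> \<bullet> x))))"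
      unfolding q_def B_def by (intro set_integral_finite_sum(2) [symmetric] si)
    also have "\<dots> \<le> (LINT u:{0..t}|lborel. (\<Sum>k\<in>J. (norm (coef e k u \<omega>))\<^sup>2))"
    proof (rule set_integral_mono)
      show "set_integrable lborel {0..t} (\<lambda>u. \<Sum>x\<in>E. \<Sum>k\<in>J. (coef e k u \<omega> \<bullet> x) * (coef e k u \<omega> \<bullet> x))"
        by (intro set_integral_finite_sum(1) si)
      fix u
      have "(\<Sum>x\<in>E. (coef e k u \<omega> \<bullet> x) * (coef e k u \<omega> \<bullet> x)) \<le> (norm (coef e k u \<omega>))\<^sup>2" for k
        using bessel [OF E, of "coef e k u \<omega>"] by (simp add: power2_eq_square inner_commute)
      then show "(\<Sum>x\<in>E. \<Sum>k\<in>J. (coef e k u \<omega> \<bullet> x) * (coef e k u \<omega> \<bullet> x)) \<le> (\<Sum>k\<in>J. (norm (coef e k u \<omega>))\<^sup>2)"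
        by (subst sum.swap) (rule sum_mono)
    qed (rule si)
    finally show ?thesis by (simp add: V_def energy_def)
  qed
  have [measurable]: "D \<in> borel_measurable M" "y \<in> borel_measurable M" "V \<in> borel_measurable M" "(\<lambda>\<omega>. q \<omega> h) \<in> borel_measurable M" for h
    unfolding D_def [abs_def] y_def [abs_def] V_def [abs_def] q_energy using t by measurable
  \<comment> \<open>The list paired with \<open>h\<close> and the list of the control are
    concatenated. The mixed term in the energy of the concatenation is twice
    \<open>h \<bullet> cross_energy\<close>, exactly the recentring contained in
    \<open>y\<close>.\<close>
  have one: "(\<integral>\<^sup>+\<omega>. ennreal (D \<omega> * exp (h \<bullet> y \<omega> - q \<omega> h / 2)) \<partial>M) \<le> 1" for h
  proof -
    have "energy (inner_elementary h e @ d) J t \<omega> = q \<omega> h + 2 * (h \<bullet> cross_energy e d J t \<omega>) + energy d J t \<omega>" for \<omega>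
    proof -
      have "energy (inner_elementary h e @ d) J t \<omega> = (LINT u:{0..t}|lborel. ((\<Sum>k\<in>J. (coef e k u \<omega> \<bullet> h) * (coef e k u \<omega> \<bullet> h)) +
           2 * (h \<bullet> (\<Sum>k\<in>J. coef d k u \<omega> *\<^sub>R coef e k u \<omega>))) + (\<Sum>k\<in>J. (norm (coef d k u \<omega>))\<^sup>2))"
        unfolding energy_def
      proof (intro set_lebesgue_integral_cong allI impI)
        fix u
        have "(norm (coef (inner_elementary h e @ d) k u \<omega>))\<^sup>2 = (coef e k u \<omega> \<bullet> h) * (coef e k u \<omega> \<bullet> h) +
            2 * (h \<bullet> coef d k u \<omega> *\<^sub>R coef e k u \<omega>) + (norm (coef d k u \<omega>))\<^sup>2" for k
          unfolding coef_append coef_inner real_norm_def power2_abs inner_scaleR_right inner_commute [of h]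
          by (simp add: power2_eq_square algebra_simps)
        then show "(\<Sum>k\<in>J. (norm (coef (inner_elementary h e @ d) k u \<omega>))\<^sup>2) = ((\<Sum>k\<in>J. (coef e k u \<omega> \<bullet> h) * (coef e k u \<omega> \<bullet> h)) +
           2 * (h \<bullet> (\<Sum>k\<in>J. coef d k u \<omega> *\<^sub>R coef e k u \<omega>))) + (\<Sum>k\<in>J. (norm (coef d k u \<omega>))\<^sup>2)"
          by (simp only: sum.distrib inner_sum_right sum_distrib_left)
      qed simp
      also have "\<dots> = (LINT u:{0..t}|lborel. (\<Sum>k\<in>J. (coef e k u \<omega> \<bullet> h) * (coef e k u \<omega> \<bullet> h)) +
           2 * (h \<bullet> (\<Sum>k\<in>J. coef d k u \<omega> *\<^sub>R coef e k u \<omega>))) + energy d J t \<omega>"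
        unfolding energy_def
        by (intro set_integral_add set_integrable_mult_right set_integral_inner_right(1) si set_integrable_coef J)
      also have "(LINT u:{0..t}|lborel. (\<Sum>k\<in>J. (coef e k u \<omega> \<bullet> h) * (coef e k u \<omega> \<bullet> h)) +
           2 * (h \<bullet> (\<Sum>k\<in>J. coef d k u \<omega> *\<^sub>R coef e k u \<omega>)))
         = q \<omega> h + (LINT u:{0..t}|lborel. 2 * (h \<bullet> (\<Sum>k\<in>J. coef d k u \<omega> *\<^sub>R coef e k u \<omega>)))"
        unfolding q_def B_def
        by (intro set_integral_add set_integrable_mult_right set_integral_inner_right(1) si set_integrable_coef J)
      also have "(LINT u:{0..t}|lborel. 2 * (h \<bullet> (\<Sum>k\<in>J. coef d k u \<omega> *\<^sub>R coef e k u \<omega>))) = 2 * (h \<bullet> cross_energy e d J t \<omega>)"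
        unfolding cross_energy_def
        by (simp add: set_integral_inner_right(2) [OF si(2)])
      finally show ?thesis .
    qed
    then have eq: "D \<omega> * exp (h \<bullet> y \<omega> - q \<omega> h / 2)
       = exp (elementary_integral \<beta> (inner_elementary h e @ d) t \<omega> - energy (inner_elementary h e @ d) J t \<omega> / 2)" for \<omega>
      unfolding D_def y_def exp_add [symmetric] elementary_integral_append elementary_integral_inner inner_diff_right
      by (simp add: inner_commute [of h] field_simps)
    have "fst ` set (inner_elementary h e @ d) \<subseteq> J"
      unfolding set_append image_Un idx_inner using J by simp
    then show ?thesis
      unfolding eq
      by (intro exponential_supermartingale(2) t J) (simp_all add: elementary_process_append e d elementary_process_inner)
  qed
  obtain E :: "nat \<Rightarrow> 'h set" where E: "\<And>n. orthonormal_set (E n)" "\<And>y. (\<lambda>n. \<Sum>e\<in>E n. (e \<bullet> y)\<^sup>2) \<longlonglongrightarrow> (norm y)\<^sup>2"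
    using orthonormal_exhaustion by blast
  have "\<exists>es. set es = E n \<and> distinct es" for n
    using E(1) [of n] by (intro finite_distinct_list) (simp add: orthonormal_set_def)
  then have "\<exists>es. \<forall>n. set (es n) = E n \<and> distinct (es n)" by (intro choice allI)
  then obtain es where es: "\<And>n. set (es n) = E n" "\<And>n. distinct (es n)" by blast
  define G where "G n \<omega> = ennreal (D \<omega> * exp (a * (\<Sum>x\<in>E n. (x \<bullet> y \<omega>)\<^sup>2) / norm (y \<omega>) - a\<^sup>2 * V \<omega> - 1))" for n \<omega>
  have [measurable]: "G n \<in> borel_measurable M" for n
    unfolding G_def [abs_def] by measurable
  have Gle: "(\<integral>\<^sup>+\<omega>. G n \<omega> \<partial>M) \<le> 1" for n
  proof -
    have "(\<integral>\<^sup>+\<omega>. G n \<omega> \<partial>M) \<le> (\<integral>\<^sup>+\<omega>. ennreal (rad 0 (map (scaleR a) (es n)) (\<lambda>h. D \<omega> * exp (h \<bullet> y \<omega> - q \<omega> h / 2)) 0) \<partial>M)"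
    proof (intro nn_integral_mono, unfold G_def rad_cmult, intro ennreal_leI mult_left_mono)
      fix \<omega>
      show "exp (a * (\<Sum>x\<in>E n. (x \<bullet> y \<omega>)\<^sup>2) / norm (y \<omega>) - a\<^sup>2 * V \<omega> - 1)
          \<le> rad 0 (map (scaleR a) (es n)) (\<lambda>h. exp (h \<bullet> y \<omega> - q \<omega> h / 2)) 0"
        by (rule rad_lower_bound [of "es n" a "q \<omega>" "B \<omega>" "V \<omega>" "y \<omega>", unfolded es(1), OF E(1) es(2) a q1 _ q0 qV tr [OF E(1)]])
           (simp add: B_def)
    qed (simp add: D_def)
    also have "\<dots> \<le> 1"
    proof (rule rad_nn_integral_le [THEN conjunct2])
      show "(\<lambda>\<omega>. D \<omega> * exp (h \<bullet> y \<omega> - q \<omega> h / 2)) \<in> borel_measurable M" for h by measurable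
      show "0 \<le> D \<omega> * exp (h \<bullet> y \<omega> - q \<omega> h / 2)" for h \<omega> by (simp add: D_def)
    qed (rule one)
    finally show ?thesis .
  qed
  have lim: "(\<lambda>n. G n \<omega>) \<longlonglongrightarrow> ennreal (D \<omega> * exp (a * norm (y \<omega>) - a\<^sup>2 * V \<omega> - 1))" for \<omega>
  proof -
    have "(\<lambda>n. a * (\<Sum>x\<in>E n. (x \<bullet> y \<omega>)\<^sup>2) / norm (y \<omega>)) \<longlonglongrightarrow> a * norm (y \<omega>)"
    proof (cases "y \<omega> = 0")
      case False
      have "(\<lambda>n. a * (\<Sum>x\<in>E n. (x \<bullet> y \<omega>)\<^sup>2) / norm (y \<omega>)) \<longlonglongrightarrow> a * (norm (y \<omega>))\<^sup>2 / norm (y \<omega>)"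
        by (intro tendsto_divide tendsto_mult tendsto_const E(2)) (use False in simp)
      moreover have "a * (norm (y \<omega>))\<^sup>2 / norm (y \<omega>) = a * norm (y \<omega>)" by (simp add: power2_eq_square)
      ultimately show ?thesis by (simp only:)
    qed simp
    from tendsto_ennrealI [OF tendsto_mult [OF tendsto_const tendsto_exp [OF tendsto_diff [OF tendsto_diff [OF this tendsto_const] tendsto_const]]]]
    show ?thesis unfolding G_def .
  qed
  have "(\<integral>\<^sup>+\<omega>. ennreal (D \<omega> * exp (a * norm (y \<omega>) - a\<^sup>2 * V \<omega> - 1)) \<partial>M) = (\<integral>\<^sup>+\<omega>. liminf (\<lambda>n. G n \<omega>) \<partial>M)"
    by (intro nn_integral_cong lim_imp_Liminf [symmetric] lim) simp
  also have "\<dots> \<le> liminf (\<lambda>n. \<integral>\<^sup>+\<omega>. G n \<omega> \<partial>M)"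
    by (intro nn_integral_liminf) measurable
  also have "\<dots> \<le> liminf (\<lambda>n. 1)"
    by (intro Liminf_mono always_eventually allI Gle)
  also have "\<dots> = (1 :: ennreal)" by (intro Liminf_const) simp
  finally show ?thesis unfolding D_def y_def V_def .
qed

end

section \<open>Hilbert--Schmidt operators and predictability\<close>

lemma hs_norm_power2: "(hs_norm I g T)\<^sup>2 = (\<Sum>\<^sub>\<infinity>k\<in>I. (norm (T (g k)))\<^sup>2)"
  unfolding hs_norm_def by (intro real_sqrt_pow2 infsum_nonneg) simp

lemma hs_norm_nonneg [simp]: "0 \<le> hs_norm I g T"
  unfolding hs_norm_def by (intro real_sqrt_ge_zero infsum_nonneg) simp

lemma hs_norm_finite_sum:
  assumes "hilbert_schmidt I g T" "finite J" "J \<subseteq> I"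
  shows "(\<Sum>k\<in>J. (norm (T (g k)))\<^sup>2) \<le> (hs_norm I g T)\<^sup>2"
  unfolding hs_norm_power2 using assms
  by (intro finite_sum_le_infsum) (auto simp: hilbert_schmidt_def)

lemma power2_norm_add_le:
  fixes x y :: "'a::real_normed_vector"
  shows "(norm (x + y))\<^sup>2 \<le> 2 * (norm x)\<^sup>2 + 2 * (norm y)\<^sup>2"
proof -
  have "(norm (x + y))\<^sup>2 \<le> (norm x + norm y)\<^sup>2"
    by (intro power_mono norm_triangle_ineq norm_ge_zero)
  also have "\<dots> \<le> 2 * (norm x)\<^sup>2 + 2 * (norm y)\<^sup>2"
    using sum_squares_bound [of "norm x" "norm y"] by (simp add: power2_sum)
  finally show ?thesis .
qed

lemma hilbert_schmidt_add:
  assumes "hilbert_schmidt I g T" "hilbert_schmidt I g T'"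
  shows "hilbert_schmidt I g (T + T')" "(hs_norm I g (T + T'))\<^sup>2 \<le> 2 * (hs_norm I g T)\<^sup>2 + 2 * (hs_norm I g T')\<^sup>2"
proof -
  have s: "(\<lambda>k. 2 * (norm (T (g k)))\<^sup>2) summable_on I" "(\<lambda>k. 2 * (norm (T' (g k)))\<^sup>2) summable_on I"
    using assms by (auto simp: hilbert_schmidt_def intro: summable_on_cmult_right)
  have le: "(norm ((T + T') (g k)))\<^sup>2 \<le> 2 * (norm (T (g k)))\<^sup>2 + 2 * (norm (T' (g k)))\<^sup>2" for k
    unfolding blinfun.add_left by (rule power2_norm_add_le)
  show 1: "hilbert_schmidt I g (T + T')"
    unfolding hilbert_schmidt_def by (rule summable_on_comparison_test [OF summable_on_add [OF s]]) (use le in auto)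
  have "(hs_norm I g (T + T'))\<^sup>2 \<le> (\<Sum>\<^sub>\<infinity>k\<in>I. 2 * (norm (T (g k)))\<^sup>2 + 2 * (norm (T' (g k)))\<^sup>2)"
    unfolding hs_norm_power2 by (intro infsum_mono summable_on_add s le 1 [unfolded hilbert_schmidt_def])
  also have "\<dots> = 2 * (hs_norm I g T)\<^sup>2 + 2 * (hs_norm I g T')\<^sup>2"
    unfolding hs_norm_power2 infsum_add [OF s] infsum_cmult_right' ..
  finally show "(hs_norm I g (T + T'))\<^sup>2 \<le> 2 * (hs_norm I g T)\<^sup>2 + 2 * (hs_norm I g T')\<^sup>2" .
qed

lemma hilbert_schmidt_minus:
  "hilbert_schmidt I g (- T) \<longleftrightarrow> hilbert_schmidt I g T" "hs_norm I g (- T) = hs_norm I g T"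
  by (simp_all add: hilbert_schmidt_def hs_norm_def blinfun.minus_left)

lemma hilbert_schmidt_diff:
  assumes "hilbert_schmidt I g T" "hilbert_schmidt I g T'"
  shows "hilbert_schmidt I g (T - T')" "(hs_norm I g (T - T'))\<^sup>2 \<le> 2 * (hs_norm I g T)\<^sup>2 + 2 * (hs_norm I g T')\<^sup>2"
  using hilbert_schmidt_add [of I g T "- T'"] assms by (simp_all add: hilbert_schmidt_minus)

lemma hilbert_schmidt_compose:
  assumes "hilbert_schmidt I g T"
  shows "hilbert_schmidt I g (L o\<^sub>L T)" "hs_norm I g (L o\<^sub>L T) \<le> norm L * hs_norm I g T"
proof -
  have s: "(\<lambda>k. (norm L)\<^sup>2 * (norm (T (g k)))\<^sup>2) summable_on I"
    using assms by (auto simp: hilbert_schmidt_def intro: summable_on_cmult_right)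
  have le: "(norm ((L o\<^sub>L T) (g k)))\<^sup>2 \<le> (norm L)\<^sup>2 * (norm (T (g k)))\<^sup>2" for k
    unfolding power_mult_distrib [symmetric] by (intro power_mono) (auto intro: norm_blinfun)
  show 1: "hilbert_schmidt I g (L o\<^sub>L T)"
    unfolding hilbert_schmidt_def by (rule summable_on_comparison_test [OF s]) (use le in auto)
  have "(hs_norm I g (L o\<^sub>L T))\<^sup>2 \<le> (\<Sum>\<^sub>\<infinity>k\<in>I. (norm L)\<^sup>2 * (norm (T (g k)))\<^sup>2)"
    unfolding hs_norm_power2 by (intro infsum_mono s le 1 [unfolded hilbert_schmidt_def])
  also have "\<dots> = (norm L * hs_norm I g T)\<^sup>2"
    unfolding power_mult_distrib hs_norm_power2 infsum_cmult_right' ..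
  finally show "hs_norm I g (L o\<^sub>L T) \<le> norm L * hs_norm I g T"
    by (rule power2_le_imp_le) simp
qed

lemma hs_norm_apply_sum:
  assumes "hilbert_schmidt I g T" "finite J" "J \<subseteq> I"
  shows "norm (T (\<Sum>k\<in>J. c k *\<^sub>R g k)) \<le> hs_norm I g T * sqrt (\<Sum>k\<in>J. (c k)\<^sup>2)"
proof -
  have "norm (T (\<Sum>k\<in>J. c k *\<^sub>R g k)) \<le> (\<Sum>k\<in>J. \<bar>norm (T (g k))\<bar> * \<bar>c k\<bar>)"
    unfolding blinfun.sum_right blinfun.scaleR_right by (rule order_trans [OF norm_sum]) (simp add: mult.commute)
  also have "\<dots> \<le> L2_set (\<lambda>k. norm (T (g k))) J * L2_set c J"
    by (rule L2_set_mult_ineq)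
  also have "\<dots> \<le> hs_norm I g T * sqrt (\<Sum>k\<in>J. (c k)\<^sup>2)"
    unfolding L2_set_def
  proof (rule mult_right_mono)
    show "sqrt (\<Sum>k\<in>J. (norm (T (g k)))\<^sup>2) \<le> hs_norm I g T"
      using hs_norm_finite_sum [OF assms] by (simp add: real_le_lsqrt sum_nonneg)
  qed (simp add: sum_nonneg)
  finally show ?thesis .
qed

lemma orthonormal_basis_norm_sum:
  assumes "orthonormal_basis I g" "finite J" "J \<subseteq> I"
  shows "(norm (\<Sum>k\<in>J. c k *\<^sub>R g k))\<^sup>2 = (\<Sum>k\<in>J. (c k)\<^sup>2)"
proof -
  have "(\<Sum>j\<in>J. \<Sum>k\<in>J. c j * (c k * (g k \<bullet> g j))) = (\<Sum>j\<in>J. \<Sum>k\<in>J. if k = j then (c j)\<^sup>2 else 0)"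
    using assms by (intro sum.cong refl) (auto simp: orthonormal_basis_def power2_eq_square subset_iff)
  then show ?thesis
    using assms(2) by (simp add: power2_norm_eq_inner inner_sum_right inner_sum_left sum_distrib_left)
qed

text \<open>Cauchy-Schwarz in coordinates gives the bound on the span of the basis; both sides are
  continuous in \<open>u\<close>, so it extends to the closure.\<close>

lemma norm_le_hs_norm:
  assumes b: "orthonormal_basis I g" and T: "hilbert_schmidt I g T"
  shows "norm (T u) \<le> hs_norm I g T * norm u"
proof -
  let ?S = "{u. norm (T u) \<le> hs_norm I g T * norm u}"
  have "closed ?S" by (intro closed_Collect_le continuous_intros)
  moreover have "span (g ` I) \<subseteq> ?S"
  proof
    fix u assume "u \<in> span (g ` I)"
    then obtain t r where t: "finite t" "t \<subseteq> g ` I" "u = (\<Sum>a\<in>t. r a *\<^sub>R a)"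
      unfolding span_explicit by blast
    from t(1,2) obtain J where J: "J \<subseteq> I" "finite J" "t = g ` J" by (meson finite_subset_image)
    have "inj_on g J"
    proof (rule inj_onI)
      fix i j assume ij: "i \<in> J" "j \<in> J" "g i = g j"
      have "g i \<bullet> g i = 1" "g i \<bullet> g j = (if i = j then 1 else 0)"
        using b J ij(1,2) unfolding orthonormal_basis_def by (auto simp: subset_iff)
      with ij(3) show "i = j" by (cases "i = j") simp_all
    qed
    then have u: "u = (\<Sum>k\<in>J. r (g k) *\<^sub>R g k)" using t(3) J by (simp add: sum.reindex)
    have "norm u = sqrt (\<Sum>k\<in>J. (r (g k))\<^sup>2)"
      unfolding u orthonormal_basis_norm_sum [OF b J(2,1), symmetric] by simp
    then show "u \<in> ?S" using hs_norm_apply_sum [OF T J(2,1), of "\<lambda>k. r (g k)"] u by simp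
  qed
  ultimately have "closure (span (g ` I)) \<subseteq> ?S" by (rule closure_minimal [rotated])
  then show ?thesis using b by (auto simp: orthonormal_basis_def)
qed

text \<open>The squared norm is the limit of partial sums taken in the order of the naturals with
  zeros outside \<open>I\<close>, so measurability of the columns is enough.\<close>

lemma hs_norm_measurable:
  assumes I: "\<And>x. x \<in> space N \<Longrightarrow> hilbert_schmidt I g (T x)"
    and m: "\<And>k. k \<in> I \<Longrightarrow> (\<lambda>x. T x (g k)) \<in> borel_measurable N"
  shows "(\<lambda>x. hs_norm I g (T x)) \<in> borel_measurable N"
proof -
  define a where "a x k = (if k \<in> I then (norm (T x (g k)))\<^sup>2 else 0)" for x k
  have am: "(\<lambda>x. a x k) \<in> borel_measurable N" for k
    using m by (cases "k \<in> I") (simp_all add: a_def)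
  have lim: "(\<lambda>n. \<Sum>k<n. a x k) \<longlonglongrightarrow> (hs_norm I g (T x))\<^sup>2" if "x \<in> space N" for x
  proof -
    have "((\<lambda>k. (norm (T x (g k)))\<^sup>2) has_sum (hs_norm I g (T x))\<^sup>2) I"
      using I [OF that] by (simp add: hs_norm_power2 hilbert_schmidt_def)
    then have "(a x has_sum (hs_norm I g (T x))\<^sup>2) UNIV"
      by (rule has_sum_cong_neutral [THEN iffD1, rotated -1]) (auto simp: a_def)
    then show ?thesis using has_sum_imp_sums sums_def by blast
  qed
  have "(\<lambda>x. (hs_norm I g (T x))\<^sup>2) \<in> borel_measurable N"
    by (rule borel_measurable_LIMSEQ_real, erule lim) (intro borel_measurable_sum am)
  then have "(\<lambda>x. sqrt ((hs_norm I g (T x))\<^sup>2)) \<in> borel_measurable N" by measurable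
  then show ?thesis by simp
qed

lemma elementary_value_basis:
  assumes "orthonormal_basis I g" "elementary_process M \<F> I e" "k \<in> I"
  shows "elementary_value g e u \<omega> (g k) = coef e k u \<omega>"
  using assms(2)
proof (induction rule: elementary_induct)
  case (Cons k' a b \<xi> e)
  have "g k \<bullet> g k' = (if k' = k then 1 else 0)"
    using assms Cons(1) by (auto simp: orthonormal_basis_def)
  then show ?case
    using Cons.IH by (auto simp: elementary_value_def coef_def blinfun.add_left blinfun.scaleR_left)
qed (simp_all add: elementary_value_def)

lemma elementary_value_hilbert_schmidt:
  assumes b: "orthonormal_basis I g" and e: "elementary_process M \<F> I e"
  shows "hilbert_schmidt I g (elementary_value g e u \<omega>)"
proof -
  have "((\<lambda>k. (norm (elementary_value g e u \<omega> (g k)))\<^sup>2) summable_on (I \<inter> fst ` set e))"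
    by (rule summable_on_finite) simp
  then show ?thesis
    unfolding hilbert_schmidt_def
    by (rule summable_on_cong_neutral [THEN iffD1, rotated -1])
       (auto simp: elementary_value_basis [OF b e] coef_outside)
qed

text \<open>Cutting the integrand at \<open>t\<close> turns an integral over \<open>[0,t]\<close>
  into one over any longer interval, so that integrals with different end times become comparable at
  one horizon. Terms starting after \<open>t\<close> are dropped, since otherwise
  \<open>min b t\<close> would fall below \<open>a\<close>.\<close>

definition truncate :: "real \<Rightarrow> ('w, 'h) elementary \<Rightarrow> ('w, 'h) elementary" where
  "truncate t e = map (\<lambda>(k, a, b, \<xi>). (k, a, min b t, \<xi>)) (filter (\<lambda>(k, a, b, \<xi>). a \<le> t) e)"

definition map_elementary :: "('h::real_normed_vector \<Rightarrow>\<^sub>L 'h) \<Rightarrow> ('w, 'h) elementary \<Rightarrow> ('w, 'h) elementary" where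
  "map_elementary L e = map (\<lambda>(k, a, b, \<xi>). (k, a, b, \<lambda>\<omega>. L (\<xi> \<omega>))) e"

lemma elementary_process_truncate:
  "elementary_process M \<F> I e \<Longrightarrow> elementary_process M \<F> I (truncate t e)"
  by (induction rule: elementary_induct) (auto simp: truncate_def elementary_process_Cons)

lemma coef_truncate:
  "coef (truncate t e) k u \<omega> = indicator {..t} u *\<^sub>R coef e k u \<omega>"
  by (induction e) (auto simp: truncate_def coef_Cons indicator_def)

lemma elementary_integral_truncate:
  assumes "elementary_process M \<F> I e" "t \<le> T"
  shows "elementary_integral \<beta> (truncate t e) T \<omega> = elementary_integral \<beta> e t \<omega>"
  using assms(1)
proof (induction rule: elementary_induct)
  case (Cons k a b \<xi> e)
  show ?case
  proof (cases "a \<le> t")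
    case True
    then have "min (min b t) T = min b t" "min a T = min a t" using assms(2) by auto
    then show ?thesis using Cons.IH True by (simp add: truncate_def elementary_integral_Cons)
  next
    case False
    then have "min b t = t" "min a t = t" using Cons(3) by auto
    then show ?thesis using Cons.IH False by (simp add: truncate_def elementary_integral_Cons)
  qed
qed (simp add: truncate_def)

lemma elementary_process_map:
  fixes e :: "('w, 'h::{real_normed_vector, second_countable_topology}) elementary"
  assumes "elementary_process M \<F> I e"
  shows "elementary_process M \<F> I (map_elementary L e)"
  using assms
proof (induction rule: elementary_induct)
  case (Cons k a b \<xi> e)
  have "(\<lambda>\<omega>. L (\<xi> \<omega>)) ` space M = L ` \<xi> ` space M" by auto
  then have "bounded ((\<lambda>\<omega>. L (\<xi> \<omega>)) ` space M)"
    using Cons(5) bounded_linear_image [of "\<xi> ` space M" "blinfun_apply L"] blinfun.bounded_linear_right by metis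
  moreover have "(\<lambda>\<omega>. L (\<xi> \<omega>)) \<in> borel_measurable (\<F> a)"
    by (rule measurable_compose [OF Cons(4)], rule borel_measurable_continuous_onI) (intro continuous_intros)
  ultimately show ?case using Cons by (simp add: map_elementary_def elementary_process_Cons)
qed (simp add: map_elementary_def)

lemma coef_map: "coef (map_elementary L e) k u \<omega> = L (coef e k u \<omega>)"
  by (induction e) (auto simp: map_elementary_def coef_Cons blinfun.add_right blinfun.scaleR_right blinfun.zero_right)

lemma elementary_integral_map:
  "elementary_integral \<beta> (map_elementary L e) t \<omega> = L (elementary_integral \<beta> e t \<omega>)"
  by (induction e) (auto simp: map_elementary_def elementary_integral_Cons blinfun.add_right blinfun.scaleR_right blinfun.zero_right)

text \<open>Borel-Cantelli along indices at which the level \<open>(1/2)^n\<close> is exceeded with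
  probability below \<open>(1/2)^n\<close>. The values are in ennreal because energies may be
  infinite.\<close>

lemma (in prob_space) AE_subsequence:
  fixes R :: "nat \<Rightarrow> 'a \<Rightarrow> ennreal"
  assumes [measurable]: "\<And>n. R n \<in> borel_measurable M"
    and lim: "\<And>\<eta>. 0 < \<eta> \<Longrightarrow> (\<lambda>n. prob {\<omega>\<in>space M. ennreal \<eta> < R n \<omega>}) \<longlonglongrightarrow> 0"
  shows "\<exists>r. strict_mono r \<and> (AE \<omega> in M. (\<lambda>n. R (r n) \<omega>) \<longlonglongrightarrow> 0)"
proof -
  have *: "\<exists>n>m. prob {\<omega>\<in>space M. ennreal ((1/2)^j) < R n \<omega>} < (1/2)^j" for m j :: nat
  proof -
    have "\<forall>\<^sub>F n in sequentially. prob {\<omega>\<in>space M. ennreal ((1/2)^j) < R n \<omega>} < (1/2)^j"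
      using lim [of "(1/2)^j"] by (rule order_tendstoD) auto
    then obtain N where "\<And>n. n \<ge> N \<Longrightarrow> prob {\<omega>\<in>space M. ennreal ((1/2)^j) < R n \<omega>} < (1/2)^j"
      unfolding eventually_sequentially by blast
    then show ?thesis by (intro exI [of _ "max N (Suc m)"]) auto
  qed
  have "\<exists>r. \<forall>n. prob {\<omega>\<in>space M. ennreal ((1/2)^n) < R (r n) \<omega>} < (1/2)^n \<and> r n < r (Suc n)"
  proof (intro dependent_nat_choice)
    show "\<exists>x. prob {\<omega>\<in>space M. ennreal ((1/2)^0) < R x \<omega>} < (1/2)^0" using * by blast
    show "\<exists>y. prob {\<omega>\<in>space M. ennreal ((1/2)^Suc n) < R y \<omega>} < (1/2)^Suc n \<and> x < y" for x n using * by blast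
  qed
  then obtain r where r: "\<And>n. prob {\<omega>\<in>space M. ennreal ((1/2)^n) < R (r n) \<omega>} < (1/2)^n" "\<And>n. r n < r (Suc n)"
    by blast
  have sm: "strict_mono r" using r(2) by (simp add: strict_mono_Suc_iff)
  define A where "A n = {\<omega>\<in>space M. ennreal ((1/2)^n) < R (r n) \<omega>}" for n
  have "AE \<omega> in M. eventually (\<lambda>n. \<omega> \<in> space M - A n) sequentially"
  proof (rule borel_cantelli_AE1)
    show "A n \<in> sets M" for n unfolding A_def by measurable
    show "emeasure M (A n) < \<infinity>" for n by (simp add: emeasure_eq_measure)
    show "summable (\<lambda>n. measure M (A n))"
      by (rule summable_comparison_test [OF _ summable_geometric [of "1/2 :: real"]])
         (use r(1) in \<open>auto simp: A_def intro!: exI [of _ 0] less_imp_le\<close>)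
  qed
  then have "AE \<omega> in M. (\<lambda>n. R (r n) \<omega>) \<longlonglongrightarrow> 0"
  proof (rule AE_mp, intro AE_I2 impI)
    fix \<omega> assume "eventually (\<lambda>n. \<omega> \<in> space M - A n) sequentially"
    then have ev: "eventually (\<lambda>n. R (r n) \<omega> \<le> ennreal ((1/2)^n)) sequentially"
      by eventually_elim (auto simp: A_def not_less)
    have "(\<lambda>n. ennreal ((1/2)^n)) \<longlonglongrightarrow> ennreal 0"
      by (intro tendsto_ennrealI LIMSEQ_realpow_zero) auto
    then show "(\<lambda>n. R (r n) \<omega>) \<longlonglongrightarrow> 0"
      by (intro tendsto_sandwich [OF _ ev tendsto_const]) auto
  qed
  with sm show ?thesis by blast
qed

section \<open>Joint measurability of predictable integrands\<close>

context wiener_setting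
begin

lemma predictable_measurable:
  fixes f :: "real \<times> 'w \<Rightarrow> 'b::{real_normed_vector, second_countable_topology}"
  assumes f: "f \<in> borel_measurable (predictable_sigma M \<F> t)" and t: "0 \<le> t"
  shows "f \<in> borel_measurable (restrict_space (lborel \<Otimes>\<^sub>M M) ({0..t} \<times> space M))"
proof -
  let ?G = "{{0} \<times> B | B. B \<in> sets (\<F> 0)} \<union> {{s<..t'} \<times> B | s t' B. 0 \<le> s \<and> s < t' \<and> t' \<le> t \<and> B \<in> sets (\<F> s)}"
  let ?N = "restrict_space (lborel \<Otimes>\<^sub>M M) ({0..t} \<times> space M)"
  have sub: "B \<in> sets (\<F> s) \<Longrightarrow> 0 \<le> s \<Longrightarrow> B \<subseteq> space M" for B s
    using sets.sets_into_space space_\<F> by blast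
  have pow: "?G \<subseteq> Pow ({0..t} \<times> space M)"
    using sub t by auto
  have spN: "space ?N = {0..t} \<times> space M"
    by (auto simp: space_restrict_space space_pair_measure)
  have "x \<in> sets ?N" if "x \<in> ?G" for x
  proof -
    have "x \<in> sets (lborel \<Otimes>\<^sub>M M)" using that sets_\<F> by (auto intro!: pair_measureI)
    moreover have "x = x \<inter> ({0..t} \<times> space M)" using pow that by blast
    ultimately show ?thesis by (auto simp: sets_restrict_space)
  qed
  then have "?G \<subseteq> sets ?N" by (rule subsetI)
  then have "sigma_sets (space ?N) ?G \<subseteq> sets ?N"
    by (rule sets.sigma_sets_subset)
  then have "sigma_sets ({0..t} \<times> space M) ?G \<subseteq> sets ?N" unfolding spN .
  then have "sets (predictable_sigma M \<F> t) \<subseteq> sets ?N"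
    using pow by (simp add: predictable_sigma_def)
  moreover have "space (predictable_sigma M \<F> t) = space ?N"
    using pow by (simp add: predictable_sigma_def spN space_measure_of)
  ultimately have "subalgebra ?N (predictable_sigma M \<F> t)" by (simp add: subalgebra_def)
  then show ?thesis using f measurable_from_subalg by blast
qed

lemma predictable_section:
  fixes f :: "real \<times> 'w \<Rightarrow> 'b::{real_normed_vector, second_countable_topology}"
  assumes f: "f \<in> borel_measurable (predictable_sigma M \<F> t)" and t: "0 \<le> t"
  shows "\<omega> \<in> space M \<Longrightarrow> (\<lambda>u. f (u, \<omega>)) \<in> borel_measurable (restrict_space lborel {0..t})"
    and "u \<in> {0..t} \<Longrightarrow> (\<lambda>\<omega>. f (u, \<omega>)) \<in> borel_measurable M"
proof -
  note fm = predictable_measurable [OF f t]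
  show "(\<lambda>u. f (u, \<omega>)) \<in> borel_measurable (restrict_space lborel {0..t})" if "\<omega> \<in> space M"
  proof (rule measurable_compose [OF _ fm])
    show "(\<lambda>u. (u, \<omega>)) \<in> restrict_space lborel {0..t} \<rightarrow>\<^sub>M restrict_space (lborel \<Otimes>\<^sub>M M) ({0..t} \<times> space M)"
      using that by (intro measurable_restrict_space2 measurable_Pair measurable_restrict_space1)
        (auto simp: space_restrict_space)
  qed
  show "(\<lambda>\<omega>. f (u, \<omega>)) \<in> borel_measurable M" if "u \<in> {0..t}"
  proof (rule measurable_compose [OF _ fm])
    show "(\<lambda>\<omega>. (u, \<omega>)) \<in> M \<rightarrow>\<^sub>M restrict_space (lborel \<Otimes>\<^sub>M M) ({0..t} \<times> space M)"
      using that by (intro measurable_restrict_space2 measurable_Pair) auto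
  qed
qed

text \<open>This gives content to the convergence in \<open>has_stochastic_integral\<close>:
  \<open>measure\<close> of a non-measurable event is 0 by convention, so the approximation errors
  must be known to be measurable before a subsequence is extracted.\<close>

lemma stochastically_integrable_measurable:
  fixes \<Phi> :: "real \<Rightarrow> 'w \<Rightarrow> 'u \<Rightarrow>\<^sub>L 'h::{real_inner, banach, second_countable_topology}"
  assumes \<Phi>: "stochastically_integrable M \<F> I g t \<Phi>" and e: "elementary_process M \<F> I e" and t: "0 \<le> t"
  shows "(\<lambda>\<omega>. \<integral>\<^sup>+u\<in>{0..t}. ennreal ((hs_norm I g (\<Phi> u \<omega> - elementary_value g e u \<omega>))\<^sup>2) \<partial>lborel) \<in> borel_measurable M"
proof -
  let ?N = "restrict_space (lborel \<Otimes>\<^sub>M M) ({0..t} \<times> space M)"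
  have hs: "hilbert_schmidt I g (\<Phi> u \<omega> - elementary_value g e u \<omega>)" if "u \<in> {0..t}" "\<omega> \<in> space M" for u \<omega>
    using \<Phi> that elementary_value_hilbert_schmidt [OF basis e]
    by (intro hilbert_schmidt_diff) (auto simp: stochastically_integrable_def)
  have "(\<lambda>x. hs_norm I g (\<Phi> (fst x) (snd x) - elementary_value g e (fst x) (snd x))) \<in> borel_measurable ?N"
  proof (rule hs_norm_measurable)
    fix x assume "x \<in> space ?N"
    then show "hilbert_schmidt I g (\<Phi> (fst x) (snd x) - elementary_value g e (fst x) (snd x))"
      by (intro hs) (auto simp: space_restrict_space)
  next
    fix k assume k: "k \<in> I"
    have [measurable]: "(\<lambda>x. \<Phi> (fst x) (snd x) (g k)) \<in> borel_measurable ?N"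
      using \<Phi> t by (intro predictable_measurable) (auto simp: stochastically_integrable_def split_beta')
    have "(\<lambda>x. coef e k (fst x) (snd x)) \<in> borel_measurable (lborel \<Otimes>\<^sub>M M)"
      using coef_measurable_pair [OF e, of k] by (subst measurable_pair_swap_iff) (simp add: split_beta')
    then have [measurable]: "(\<lambda>x. coef e k (fst x) (snd x)) \<in> borel_measurable ?N"
      by (rule measurable_restrict_space1)
    show "(\<lambda>x. (\<Phi> (fst x) (snd x) - elementary_value g e (fst x) (snd x)) (g k)) \<in> borel_measurable ?N"
      by (simp add: blinfun.diff_left elementary_value_basis [OF basis e k])
  qed
  then have "(\<lambda>x. indicator ({0..t} \<times> space M) x *\<^sub>R hs_norm I g (\<Phi> (fst x) (snd x) - elementary_value g e (fst x) (snd x)))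
     \<in> borel_measurable (lborel \<Otimes>\<^sub>M M)"
    by (subst (asm) borel_measurable_restrict_space_iff) (auto simp: space_pair_measure)
  then have [measurable]: "(\<lambda>(\<omega>, u). indicator ({0..t} \<times> space M) (u, \<omega>) *\<^sub>R hs_norm I g (\<Phi> u \<omega> - elementary_value g e u \<omega>))
     \<in> borel_measurable (M \<Otimes>\<^sub>M lborel)"
    by (subst measurable_pair_swap_iff) (simp add: split_beta')
  have "(\<lambda>\<omega>. \<integral>\<^sup>+u. ennreal ((indicator ({0..t} \<times> space M) (u, \<omega>) *\<^sub>R hs_norm I g (\<Phi> u \<omega> - elementary_value g e u \<omega>))\<^sup>2) \<partial>lborel) \<in> borel_measurable M"
    by measurable
  then show ?thesis
    by (rule measurable_cong [THEN iffD1, rotated]) (auto intro!: nn_integral_cong simp: indicator_def)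
qed

end

section \<open>Stochastic convolutions under a tilted measure\<close>

definition deterministic :: "('w, real) elementary \<Rightarrow> bool" where
  "deterministic d \<longleftrightarrow> (\<forall>(k, a, b, \<xi>)\<in>set d. \<exists>c. \<xi> = (\<lambda>_. c))"

lemma deterministic_coef: "deterministic d \<Longrightarrow> coef d k u \<omega> = coef d k u undefined"
  by (induction d) (auto simp: coef_Cons deterministic_def)

text \<open>The control as a function of time alone. For \<open>deterministic\<close> lists the
  coefficients do not depend on the sample point, and \<open>undefined\<close> serves as an
  arbitrary one.\<close>

definition control :: "(nat \<Rightarrow> 'u::real_vector) \<Rightarrow> ('w, real) elementary \<Rightarrow> real \<Rightarrow> 'u" where
  "control g d u = (\<Sum>k\<in>fst ` set d. coef d k u undefined *\<^sub>R g k)"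

text \<open>What a single path of an admissible integrand retains; it allows the energy and drift
  estimates to be made for a fixed sample point.\<close>

definition hs_path :: "nat set \<Rightarrow> (nat \<Rightarrow> 'u::real_inner) \<Rightarrow> real \<Rightarrow>
    (real \<Rightarrow> 'u \<Rightarrow>\<^sub>L 'h::{real_inner, banach, second_countable_topology}) \<Rightarrow> bool" where
  "hs_path I g t \<Phi> \<longleftrightarrow> (\<forall>u\<in>{0..t}. hilbert_schmidt I g (\<Phi> u)) \<and>
     (\<forall>k\<in>I. (\<lambda>u. \<Phi> u (g k)) \<in> borel_measurable (restrict_space lborel {0..t}))"

definition hs_energy :: "nat set \<Rightarrow> (nat \<Rightarrow> 'u::real_inner) \<Rightarrow> real set \<Rightarrow> (real \<Rightarrow> 'u \<Rightarrow>\<^sub>L 'h::real_inner) \<Rightarrow> ennreal" where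
  "hs_energy I g S \<Phi> = (\<integral>\<^sup>+u\<in>S. ennreal ((hs_norm I g (\<Phi> u))\<^sup>2) \<partial>lborel)"

lemma hs_path_diff: "hs_path I g t \<Phi> \<Longrightarrow> hs_path I g t \<Psi> \<Longrightarrow> hs_path I g t (\<lambda>u. \<Phi> u - \<Psi> u)"
  by (auto simp: hs_path_def blinfun.diff_left intro: hilbert_schmidt_diff intro!: borel_measurable_diff)

lemma hs_path_elementary:
  fixes e :: "('w, 'h::{real_inner, banach, second_countable_topology}) elementary"
  assumes "orthonormal_basis I g" "elementary_process M \<F> I e"
  shows "hs_path I g t (\<lambda>u. elementary_value g e u \<omega>)"
  using assms by (auto simp: hs_path_def elementary_value_basis elementary_value_hilbert_schmidt
      intro!: measurable_restrict_space1)

lemma hs_path_measurable: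
  assumes "hs_path I g t \<Phi>"
  shows "(\<lambda>u. indicator {0..t} u * hs_norm I g (\<Phi> u)) \<in> borel_measurable borel"
    and "S \<in> sets borel \<Longrightarrow> S \<subseteq> {0..t} \<Longrightarrow> (\<lambda>u. ennreal ((hs_norm I g (\<Phi> u))\<^sup>2) * indicator S u) \<in> borel_measurable borel"
proof -
  have "(\<lambda>u. hs_norm I g (\<Phi> u)) \<in> borel_measurable (restrict_space lborel {0..t})"
    using assms by (intro hs_norm_measurable) (auto simp: hs_path_def space_restrict_space)
  then show 1: "(\<lambda>u. indicator {0..t} u * hs_norm I g (\<Phi> u)) \<in> borel_measurable borel"
    by (subst (asm) borel_measurable_restrict_space_iff) auto
  show "(\<lambda>u. ennreal ((hs_norm I g (\<Phi> u))\<^sup>2) * indicator S u) \<in> borel_measurable borel"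
    if [measurable]: "S \<in> sets borel" and sub: "S \<subseteq> {0..t}"
  proof -
    note [measurable] = 1
    have "(\<lambda>u. ennreal ((indicator {0..t} u * hs_norm I g (\<Phi> u))\<^sup>2) * indicator S u) \<in> borel_measurable borel"
      by measurable
    moreover have "ennreal ((indicator {0..t} u * hs_norm I g (\<Phi> u))\<^sup>2) * indicator S u = ennreal ((hs_norm I g (\<Phi> u))\<^sup>2) * indicator S u" for u
      using sub by (auto simp: indicator_def)
    ultimately show ?thesis by simp
  qed
qed

lemma control_bounded:
  "\<exists>C. \<forall>u. sqrt (\<Sum>k\<in>fst ` set d. (coef d k u undefined)\<^sup>2) \<le> C" for d :: "('w, real) elementary"
proof -
  obtain C where C: "\<And>u. norm (\<Sum>k\<in>fst ` set d. (norm (coef d k u undefined))\<^sup>2) \<le> C"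
    using energy_integrand(2) [of "fst ` set d" d undefined] by blast
  have "sqrt (\<Sum>k\<in>fst ` set d. (coef d k u undefined)\<^sup>2) \<le> sqrt C" for u
    using C [of u] by (simp add: sum_nonneg)
  then show ?thesis by blast
qed

text \<open>Young's inequality with weight \<open>\<kappa>\<close> in place of Cauchy-Schwarz makes
  the bound affine in the energy. In \<open>control_integral_tendsto\<close> the weight is matched
  to the accuracy wanted there.\<close>

lemma control_integral:
  fixes d :: "('w, real) elementary"
  assumes \<Phi>: "hs_path I g t \<Phi>" and d: "fst ` set d \<subseteq> I" and fin: "hs_energy I g {0..t} \<Phi> < \<infinity>" and t: "0 \<le> t"
    and C: "\<And>u. sqrt (\<Sum>k\<in>fst ` set d. (coef d k u undefined)\<^sup>2) \<le> C"
  shows "set_integrable lborel {0..t} (\<lambda>u. \<Phi> u (control g d u))"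
    and "0 < \<kappa> \<Longrightarrow> norm (LINT u:{0..t}|lborel. \<Phi> u (control g d u)) \<le> C * (\<kappa> * t + enn2real (hs_energy I g {0..t} \<Phi>) / \<kappa>) / 2"
proof -
  have C0: "0 \<le> C" by (rule order_trans [OF real_sqrt_ge_zero C [of 0]]) (simp add: sum_nonneg)
  define h where "h u = indicator {0..t} u * hs_norm I g (\<Phi> u)" for u
  have [measurable]: "h \<in> borel_measurable borel" unfolding h_def [abs_def] by (rule hs_path_measurable [OF \<Phi>])
  have eqE: "hs_energy I g {0..t} \<Phi> = (\<integral>\<^sup>+u. ennreal ((h u)\<^sup>2) \<partial>lborel)"
    unfolding hs_energy_def by (intro nn_integral_cong) (auto simp: h_def indicator_def)
  have h2: "integrable lborel (\<lambda>u. (h u)\<^sup>2)"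
    using fin unfolding eqE by (intro integrableI_nonneg) auto
  have h2': "(LINT u|lborel. (h u)\<^sup>2) = enn2real (hs_energy I g {0..t} \<Phi>)"
    unfolding eqE by (intro integral_eq_nn_integral) auto
  have meas: "(\<lambda>u. indicator {0..t} u *\<^sub>R \<Phi> u (control g d u)) \<in> borel_measurable lborel"
  proof -
    have [measurable]: "(\<lambda>u. indicator {0..t} u *\<^sub>R \<Phi> u (g k)) \<in> borel_measurable borel" if "k \<in> fst ` set d" for k
      using \<Phi> d that borel_measurable_restrict_space_iff [of "{0..t}" lborel "\<lambda>u. \<Phi> u (g k)"]
      by (auto simp: hs_path_def)
    have "(\<lambda>u. \<Sum>k\<in>fst ` set d. coef d k u undefined *\<^sub>R (indicator {0..t} u *\<^sub>R \<Phi> u (g k))) \<in> borel_measurable borel"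
      by measurable
    then show ?thesis
      by (simp add: control_def blinfun.sum_right blinfun.scaleR_right scaleR_sum_right mult.commute)
  qed
  have bound: "norm (indicator {0..t} u *\<^sub>R \<Phi> u (control g d u)) \<le> C * (\<kappa> * indicator {0..t} u + (h u)\<^sup>2 / \<kappa>) / 2" if \<kappa>: "0 < \<kappa>" for u \<kappa>
  proof (cases "u \<in> {0..t}")
    case True
    have "norm (\<Phi> u (control g d u)) \<le> hs_norm I g (\<Phi> u) * sqrt (\<Sum>k\<in>fst ` set d. (coef d k u undefined)\<^sup>2)"
      unfolding control_def using \<Phi> d True by (intro hs_norm_apply_sum) (auto simp: hs_path_def)
    also have "\<dots> \<le> h u * C"
      using True by (auto simp: h_def intro!: mult_left_mono C)
    also have "\<dots> \<le> C * ((\<kappa> + (h u)\<^sup>2 / \<kappa>) / 2)"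
    proof -
      have "h u \<le> (\<kappa> + (h u)\<^sup>2 / \<kappa>) / 2"
        using \<kappa> sum_squares_bound [of \<kappa> "h u"] by (simp add: field_simps power2_eq_square)
      then show ?thesis using C0 by (subst mult.commute, intro mult_left_mono) auto
    qed
    finally show ?thesis using True by simp
  qed (use C0 that in \<open>simp add: h_def\<close>)
  have ind: "integrable lborel (\<lambda>u. \<kappa> * indicator {0..t} u :: real)" for \<kappa>
    using t by (intro integrable_mult_right) (simp add: emeasure_lborel_Icc_eq)
  have intb: "integrable lborel (\<lambda>u. C * (\<kappa> * indicator {0..t} u + (h u)\<^sup>2 / \<kappa>) / 2)" for \<kappa>
    using ind h2 by (intro integrable_divide integrable_mult_right Bochner_Integration.integrable_add) auto
  show 1: "set_integrable lborel {0..t} (\<lambda>u. \<Phi> u (control g d u))"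
    unfolding set_integrable_def
    by (rule Bochner_Integration.integrable_bound [OF intb [of 1] meas], intro AE_I2 order_trans [OF bound [OF zero_less_one]]) simp
  show "norm (LINT u:{0..t}|lborel. \<Phi> u (control g d u)) \<le> C * (\<kappa> * t + enn2real (hs_energy I g {0..t} \<Phi>) / \<kappa>) / 2" if \<kappa>: "0 < \<kappa>"
  proof -
    have "norm (LINT u:{0..t}|lborel. \<Phi> u (control g d u)) \<le> (LINT u|lborel. norm (indicator {0..t} u *\<^sub>R \<Phi> u (control g d u)))"
      unfolding set_lebesgue_integral_def by (rule integral_norm_bound)
    also have "\<dots> \<le> (LINT u|lborel. C * (\<kappa> * indicator {0..t} u + (h u)\<^sup>2 / \<kappa>) / 2)"
      using 1 unfolding set_integrable_def by (intro integral_mono integrable_norm intb bound \<kappa>)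
    also have "\<dots> = C * (\<kappa> * (LINT u|lborel. indicator {0..t} u) + (LINT u|lborel. (h u)\<^sup>2) / \<kappa>) / 2"
    proof -
      have "(LINT u|lborel. \<kappa> * indicator {0..t} u + (h u)\<^sup>2 / \<kappa>) = (LINT u|lborel. \<kappa> * indicator {0..t} u) + (LINT u|lborel. (h u)\<^sup>2 / \<kappa>)"
        using ind h2 by (intro Bochner_Integration.integral_add) auto
      then show ?thesis by simp
    qed
    also have "(LINT u|lborel. indicator {0..t} u) = t" using t by simp
    finally show ?thesis unfolding h2' .
  qed
qed

lemma set_integral_indicator_atMost:
  assumes "t \<le> T"
  shows "(LINT u:{0..T}|M. indicator {..t} u *\<^sub>R f u) = (LINT u:{0..t::real}|M. f u)"
    "set_integrable M {0..T} (\<lambda>u. indicator {..t} u *\<^sub>R f u) \<longleftrightarrow> set_integrable M {0..t} f"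
proof -
  have *: "(\<lambda>u. indicator {0..T} u *\<^sub>R (indicator {..t} u *\<^sub>R f u)) = (\<lambda>u. indicator {0..t} u *\<^sub>R f u)"
    using assms by (intro ext) (auto simp: indicator_def)
  show "(LINT u:{0..T}|M. indicator {..t} u *\<^sub>R f u) = (LINT u:{0..t}|M. f u)"
    "set_integrable M {0..T} (\<lambda>u. indicator {..t} u *\<^sub>R f u) \<longleftrightarrow> set_integrable M {0..t} f"
    unfolding set_lebesgue_integral_def set_integrable_def * by auto
qed

section \<open>Increments of stochastic convolutions and their tilted tails\<close>

context wiener_setting
begin

definition girsanov :: "('w, real) elementary \<Rightarrow> real \<Rightarrow> 'w \<Rightarrow> real" where
  "girsanov d t \<omega> = exp (elementary_integral \<beta> d t \<omega> - energy d (fst ` set d) t \<omega> / 2)"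

lemma girsanov_measurable [measurable]:
  "elementary_process M \<F> I d \<Longrightarrow> 0 \<le> t \<Longrightarrow> girsanov d t \<in> borel_measurable M"
  unfolding girsanov_def [abs_def] by measurable

lemma energy_superset:
  assumes "fst ` set e \<subseteq> J" "finite J"
  shows "energy e J t \<omega> = energy e (fst ` set e) t \<omega>"
proof -
  have "(\<Sum>k\<in>J. (norm (coef e k u \<omega>))\<^sup>2) = (\<Sum>k\<in>fst ` set e. (norm (coef e k u \<omega>))\<^sup>2)" for u
    using assms by (intro sum.mono_neutral_right) (auto simp: coef_outside)
  then show ?thesis by (simp add: energy_def)
qed

lemma set_integrable_elementary_control:
  fixes e :: "('w, 'h::{real_inner, banach, second_countable_topology}) elementary"
  assumes e: "elementary_process M \<F> I e" and d: "elementary_process M \<F> I d" "deterministic d"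
  shows "set_integrable lborel {0..t} (\<lambda>u. elementary_value g e u \<omega> (control g d u))"
    and "elementary_value g e u \<omega> (control g d u) = (\<Sum>k\<in>fst ` set d. coef d k u \<omega> *\<^sub>R coef e k u \<omega>)"
proof -
  show eq: "elementary_value g e u \<omega> (control g d u) = (\<Sum>k\<in>fst ` set d. coef d k u \<omega> *\<^sub>R coef e k u \<omega>)" for u
    unfolding control_def blinfun.sum_right blinfun.scaleR_right
    using elementary_process_idx [OF d(1)] deterministic_coef [OF d(2), of _ u \<omega>]
    by (intro sum.cong refl) (auto simp: elementary_value_basis [OF basis e])
  show "set_integrable lborel {0..t} (\<lambda>u. elementary_value g e u \<omega> (control g d u))"
    unfolding eq by (rule set_integrable_coef) simp
qed

text \<open>This identifies the drift of the combined elementary integrand with the two controlled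
  integrals by which the increment is recentred. Truncation has put both lists on the common horizon
  \<open>T\<close>.\<close>

lemma cross_energy_truncate:
  fixes e e' :: "('w, 'h::{real_inner, banach, second_countable_topology}) elementary"
  assumes e: "elementary_process M \<F> I e" and e': "elementary_process M \<F> I e'"
    and d: "elementary_process M \<F> I d" "deterministic d" and st: "s \<le> T" "t \<le> T"
    and J: "finite J" "fst ` set d \<subseteq> J"
  shows "cross_energy (truncate t e @ map_elementary (- L) (truncate s e')) d J T \<omega>
     = (LINT u:{0..t}|lborel. elementary_value g e u \<omega> (control g d u))
       - L (LINT u:{0..s}|lborel. elementary_value g e' u \<omega> (control g d u))"
proof -
  let ?f = "\<lambda>u. elementary_value g e u \<omega> (control g d u)" and ?f' = "\<lambda>u. elementary_value g e' u \<omega> (control g d u)"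
  have "(\<Sum>k\<in>J. coef d k u \<omega> *\<^sub>R coef (truncate t e @ map_elementary (- L) (truncate s e')) k u \<omega>)
     = indicator {..t} u *\<^sub>R ?f u - indicator {..s} u *\<^sub>R L (?f' u)" for u
  proof -
    have "(\<Sum>k\<in>J. coef d k u \<omega> *\<^sub>R coef (truncate t e @ map_elementary (- L) (truncate s e')) k u \<omega>)
      = (\<Sum>k\<in>fst ` set d. coef d k u \<omega> *\<^sub>R coef (truncate t e @ map_elementary (- L) (truncate s e')) k u \<omega>)"
      using J by (intro sum.mono_neutral_right) (auto simp: coef_outside)
    also have "\<dots> = (\<Sum>k\<in>fst ` set d. indicator {..t} u *\<^sub>R (coef d k u \<omega> *\<^sub>R coef e k u \<omega>) - indicator {..s} u *\<^sub>R L (coef d k u \<omega> *\<^sub>R coef e' k u \<omega>))"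
      by (intro sum.cong refl) (simp add: coef_append coef_map coef_truncate blinfun.minus_left blinfun.scaleR_right scaleR_diff_right algebra_simps)
    finally show ?thesis
      by (simp add: set_integrable_elementary_control(2) [OF e d, of u \<omega>] set_integrable_elementary_control(2) [OF e' d, of u \<omega>]
          sum_subtractf scaleR_sum_right blinfun.sum_right)
  qed
  then have "cross_energy (truncate t e @ map_elementary (- L) (truncate s e')) d J T \<omega>
     = (LINT u:{0..T}|lborel. indicator {..t} u *\<^sub>R ?f u - indicator {..s} u *\<^sub>R L (?f' u))"
    by (simp add: cross_energy_def)
  also have "\<dots> = (LINT u:{0..T}|lborel. indicator {..t} u *\<^sub>R ?f u) - (LINT u:{0..T}|lborel. indicator {..s} u *\<^sub>R L (?f' u))"
  proof (rule set_integral_diff(2))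
    show "set_integrable lborel {0..T} (\<lambda>u. indicator {..t} u *\<^sub>R ?f u)"
      unfolding set_integral_indicator_atMost(2) [OF st(2)] by (rule set_integrable_elementary_control(1) [OF e d])
    have "set_integrable lborel {0..s} (\<lambda>u. L (?f' u))"
      using integrable_bounded_linear [OF blinfun.bounded_linear_right, of lborel "\<lambda>u. indicator {0..s} u *\<^sub>R ?f' u" L]
        set_integrable_elementary_control(1) [OF e' d, of s \<omega>]
      by (simp add: set_integrable_def blinfun.scaleR_right)
    then show "set_integrable lborel {0..T} (\<lambda>u. indicator {..s} u *\<^sub>R L (?f' u))"
      unfolding set_integral_indicator_atMost(2) [OF st(1)] .
  qed
  also have "(LINT u:{0..T}|lborel. indicator {..t} u *\<^sub>R ?f u) = (LINT u:{0..t}|lborel. ?f u)"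
    by (rule set_integral_indicator_atMost(1) [OF st(2)])
  also have "(LINT u:{0..T}|lborel. indicator {..s} u *\<^sub>R L (?f' u)) = (LINT u:{0..s}|lborel. L (?f' u))"
    by (rule set_integral_indicator_atMost(1) [OF st(1)])
  also have "(LINT u:{0..s}|lborel. L (?f' u)) = L (LINT u:{0..s}|lborel. ?f' u)"
    using integral_bounded_linear [OF blinfun.bounded_linear_right, of lborel "\<lambda>u. indicator {0..s} u *\<^sub>R ?f' u" L]
      set_integrable_elementary_control(1) [OF e' d, of s \<omega>]
    by (simp add: set_integrable_def set_lebesgue_integral_def blinfun.scaleR_right)
  finally show ?thesis .
qed

text \<open>On \<open>[0,s]\<close> the limits \<open>\<Phi>\<close> and
  \<open>L o\<^sub>L \<Psi>\<close> cancel and only approximation errors remain; on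
  \<open>{s<..t}\<close> the integrand is \<open>\<Phi>\<close> up to its error. Hence the energy
  over the short interval alone governs the increment.\<close>

lemma energy_truncate_le:
  fixes e e' :: "('w, 'h::{real_inner, banach, second_countable_topology}) elementary"
  assumes e: "elementary_process M \<F> I e" and e': "elementary_process M \<F> I e'"
    and st: "0 \<le> s" "s \<le> t" "t \<le> T" and J: "finite J" "J \<subseteq> I"
    and \<Phi>: "hs_path I g t \<Phi>" and \<Psi>: "hs_path I g s \<Psi>" and rel: "\<And>u. u \<in> {0..s} \<Longrightarrow> \<Phi> u = L o\<^sub>L \<Psi> u"
  shows "ennreal (energy (truncate t e @ map_elementary (- L) (truncate s e')) J T \<omega>)
     \<le> 2 * hs_energy I g {s<..t} \<Phi> + 2 * hs_energy I g {0..t} (\<lambda>u. \<Phi> u - elementary_value g e u \<omega>)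
       + ennreal (2 * (norm L)\<^sup>2) * hs_energy I g {0..s} (\<lambda>u. \<Psi> u - elementary_value g e' u \<omega>)"
proof -
  let ?w = "truncate t e @ map_elementary (- L) (truncate s e')"
  let ?A = "\<lambda>u. \<Phi> u - elementary_value g e u \<omega>" and ?B = "\<lambda>u. \<Psi> u - elementary_value g e' u \<omega>"
  have A: "hs_path I g t ?A" by (intro hs_path_diff \<Phi> hs_path_elementary [OF basis e])
  have B: "hs_path I g s ?B" by (intro hs_path_diff \<Psi> hs_path_elementary [OF basis e'])
  have pointwise: "(\<Sum>k\<in>J. (norm (coef ?w k u \<omega>))\<^sup>2) \<le> indicator {s<..t} u * (2 * (hs_norm I g (\<Phi> u))\<^sup>2)
      + (indicator {0..t} u * (2 * (hs_norm I g (?A u))\<^sup>2) + indicator {0..s} u * (2 * (norm L)\<^sup>2 * (hs_norm I g (?B u))\<^sup>2))" (is "?lhs \<le> ?rhs")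
    if u: "u \<in> {0..T}" for u
  proof -
    have co: "coef ?w k u \<omega> = indicator {..t} u *\<^sub>R elementary_value g e u \<omega> (g k) - indicator {..s} u *\<^sub>R L (elementary_value g e' u \<omega> (g k))"
      if "k \<in> J" for k
      using that J by (simp add: coef_append coef_map coef_truncate blinfun.minus_left blinfun.scaleR_right
          elementary_value_basis [OF basis e] elementary_value_basis [OF basis e'] subset_iff)
    consider "u \<le> s" | "s < u" "u \<le> t" | "t < u" by linarith
    then show ?thesis
    proof cases
      case 1
      let ?C = "(L o\<^sub>L ?B u) - ?A u"
      have hs: "hilbert_schmidt I g (?A u)" "hilbert_schmidt I g (?B u)"
        using A B u 1 st by (auto simp: hs_path_def)
      have "?lhs = (\<Sum>k\<in>J. (norm (?C (g k)))\<^sup>2)"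
        using 1 st u by (intro sum.cong refl) (simp add: co rel blinfun.diff_left blinfun.diff_right)
      also have "\<dots> \<le> (hs_norm I g ?C)\<^sup>2"
        by (intro hs_norm_finite_sum J hilbert_schmidt_diff hilbert_schmidt_compose hs)
      also have "\<dots> \<le> 2 * (hs_norm I g (L o\<^sub>L ?B u))\<^sup>2 + 2 * (hs_norm I g (?A u))\<^sup>2"
        by (intro hilbert_schmidt_diff hilbert_schmidt_compose hs)
      also have "\<dots> \<le> 2 * (norm L * hs_norm I g (?B u))\<^sup>2 + 2 * (hs_norm I g (?A u))\<^sup>2"
        by (intro add_right_mono mult_left_mono power_mono hilbert_schmidt_compose hs) auto
      also have "\<dots> = ?rhs"
        using 1 st u by (simp add: power_mult_distrib)
      finally show ?thesis .
    next
      case 2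
      have hs: "hilbert_schmidt I g (?A u)" "hilbert_schmidt I g (\<Phi> u)"
        using A \<Phi> u 2 st by (auto simp: hs_path_def)
      have "?lhs = (\<Sum>k\<in>J. (norm ((\<Phi> u - ?A u) (g k)))\<^sup>2)"
        using 2 st u by (intro sum.cong refl) (simp add: co)
      also have "\<dots> \<le> (hs_norm I g (\<Phi> u - ?A u))\<^sup>2"
        by (intro hs_norm_finite_sum J hilbert_schmidt_diff(1) [OF hs(2,1)])
      also have "\<dots> \<le> 2 * (hs_norm I g (\<Phi> u))\<^sup>2 + 2 * (hs_norm I g (?A u))\<^sup>2"
        by (intro hilbert_schmidt_diff(2) hs)
      also have "\<dots> = ?rhs"
        using 2 st u by simp
      finally show ?thesis .
    next
      case 3
      then show ?thesis using st by (simp add: co)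
    qed
  qed
  have "ennreal (energy ?w J T \<omega>) = (\<integral>\<^sup>+u. ennreal (indicator {0..T} u * (\<Sum>k\<in>J. (norm (coef ?w k u \<omega>))\<^sup>2)) \<partial>lborel)"
    using set_integrable_coef(1) [OF J(1), of 0 T ?w \<omega>]
    unfolding energy_def set_lebesgue_integral_def set_integrable_def
    by (subst nn_integral_eq_integral) (auto simp: sum_nonneg)
  also have "\<dots> \<le> (\<integral>\<^sup>+u. 2 * (ennreal ((hs_norm I g (\<Phi> u))\<^sup>2) * indicator {s<..t} u)
      + (2 * (ennreal ((hs_norm I g (?A u))\<^sup>2) * indicator {0..t} u) + ennreal (2 * (norm L)\<^sup>2) * (ennreal ((hs_norm I g (?B u))\<^sup>2) * indicator {0..s} u)) \<partial>lborel)"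
  proof (intro nn_integral_mono)
    fix u
    have e2: "2 * ennreal x = ennreal (2 * x)" if "0 \<le> x" for x
      using that by (simp add: ennreal_mult)
    have "indicator {0..T} u * (\<Sum>k\<in>J. (norm (coef ?w k u \<omega>))\<^sup>2) \<le> indicator {s<..t} u * (2 * (hs_norm I g (\<Phi> u))\<^sup>2)
      + (indicator {0..t} u * (2 * (hs_norm I g (?A u))\<^sup>2) + indicator {0..s} u * (2 * (norm L)\<^sup>2 * (hs_norm I g (?B u))\<^sup>2))"
      using pointwise [of u] by (cases "u \<in> {0..T}") simp_all
    then have "ennreal (indicator {0..T} u * (\<Sum>k\<in>J. (norm (coef ?w k u \<omega>))\<^sup>2)) \<le> ennreal (indicator {s<..t} u * (2 * (hs_norm I g (\<Phi> u))\<^sup>2)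
      + (indicator {0..t} u * (2 * (hs_norm I g (?A u))\<^sup>2) + indicator {0..s} u * (2 * (norm L)\<^sup>2 * (hs_norm I g (?B u))\<^sup>2)))"
      by (rule ennreal_leI)
    also have "\<dots> = ennreal (indicator {s<..t} u * (2 * (hs_norm I g (\<Phi> u))\<^sup>2))
      + (ennreal (indicator {0..t} u * (2 * (hs_norm I g (?A u))\<^sup>2)) + ennreal (indicator {0..s} u * (2 * (norm L)\<^sup>2 * (hs_norm I g (?B u))\<^sup>2)))"
      by (subst ennreal_plus, simp, simp, subst ennreal_plus, simp_all)
    also have "\<dots> = 2 * (ennreal ((hs_norm I g (\<Phi> u))\<^sup>2) * indicator {s<..t} u)
      + (2 * (ennreal ((hs_norm I g (?A u))\<^sup>2) * indicator {0..t} u) + ennreal (2 * (norm L)\<^sup>2) * (ennreal ((hs_norm I g (?B u))\<^sup>2) * indicator {0..s} u))"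
      by (auto simp: indicator_def ennreal_mult)
    finally show "ennreal (indicator {0..T} u * (\<Sum>k\<in>J. (norm (coef ?w k u \<omega>))\<^sup>2)) \<le> 2 * (ennreal ((hs_norm I g (\<Phi> u))\<^sup>2) * indicator {s<..t} u)
      + (2 * (ennreal ((hs_norm I g (?A u))\<^sup>2) * indicator {0..t} u) + ennreal (2 * (norm L)\<^sup>2) * (ennreal ((hs_norm I g (?B u))\<^sup>2) * indicator {0..s} u))" .
  qed
  also have "\<dots> = 2 * hs_energy I g {s<..t} \<Phi> + (2 * hs_energy I g {0..t} ?A + ennreal (2 * (norm L)\<^sup>2) * hs_energy I g {0..s} ?B)"
  proof -
    have [measurable]: "(\<lambda>u. ennreal ((hs_norm I g (\<Phi> u))\<^sup>2) * indicator {s<..t} u) \<in> borel_measurable lborel"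
      "(\<lambda>u. ennreal ((hs_norm I g (?A u))\<^sup>2) * indicator {0..t} u) \<in> borel_measurable lborel"
      "(\<lambda>u. ennreal ((hs_norm I g (?B u))\<^sup>2) * indicator {0..s} u) \<in> borel_measurable lborel"
      using st hs_path_measurable(2) [OF \<Phi>, of "{s<..t}"] hs_path_measurable(2) [OF A, of "{0..t}"] hs_path_measurable(2) [OF B, of "{0..s}"]
      by (auto intro!: greaterThanAtMost_subseteq_atLeastAtMost_iff [THEN iffD2])
    show ?thesis
      unfolding hs_energy_def by (simp add: nn_integral_add nn_integral_cmult)
  qed
  finally show ?thesis by (simp add: add.assoc)
qed

lemma stochastically_integrable_hs_path:
  fixes \<Phi> :: "real \<Rightarrow> 'w \<Rightarrow> 'u \<Rightarrow>\<^sub>L 'h::{real_inner, banach, second_countable_topology}"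
  assumes "stochastically_integrable M \<F> I g t \<Phi>" "0 \<le> t" "\<omega> \<in> space M"
  shows "hs_path I g t (\<lambda>u. \<Phi> u \<omega>)"
  unfolding hs_path_def
proof (intro conjI ballI)
  fix k assume "k \<in> I"
  show "(\<lambda>u. \<Phi> u \<omega> (g k)) \<in> borel_measurable (restrict_space lborel {0..t})"
    using predictable_section(1) [of "\<lambda>(u, \<omega>). \<Phi> u \<omega> (g k)" t \<omega>] assms
    by (simp add: stochastically_integrable_def)
qed (use assms in \<open>simp add: stochastically_integrable_def\<close>)

text \<open>Two successive extractions, one for the energies and one for the integrals. Almost sure
  convergence is what permits a passage to the limit inside the exponentials.\<close>

lemma approximating_subsequence:
  fixes \<Phi> :: "real \<Rightarrow> 'w \<Rightarrow> 'u \<Rightarrow>\<^sub>L 'h::{real_inner, banach, second_countable_topology}"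
  assumes \<Phi>: "has_stochastic_integral M \<F> I g \<beta> t \<Phi> Y" and t: "0 \<le> t"
  shows "\<exists>e. (\<forall>n. elementary_process M \<F> I (e n)) \<and>
    (AE \<omega> in M. (\<lambda>n. hs_energy I g {0..t} (\<lambda>u. \<Phi> u \<omega> - elementary_value g (e n) u \<omega>)) \<longlonglongrightarrow> 0 \<and>
       (\<lambda>n. elementary_integral \<beta> (e n) t \<omega>) \<longlonglongrightarrow> Y \<omega>)"
proof -
  from \<Phi> obtain e where e: "\<And>n. elementary_process M \<F> I (e n)"
    and R: "\<And>\<eta>. 0 < \<eta> \<Longrightarrow> (\<lambda>n. prob {\<omega>\<in>space M. ennreal \<eta> < hs_energy I g {0..t} (\<lambda>u. \<Phi> u \<omega> - elementary_value g (e n) u \<omega>)}) \<longlonglongrightarrow> 0"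
    and C: "converges_in_probability M (\<lambda>n. elementary_integral \<beta> (e n) t) Y"
    and si: "stochastically_integrable M \<F> I g t \<Phi>" and [measurable]: "Y \<in> borel_measurable M"
    unfolding has_stochastic_integral_def hs_energy_def by blast
  have [measurable]: "(\<lambda>\<omega>. hs_energy I g {0..t} (\<lambda>u. \<Phi> u \<omega> - elementary_value g (e n) u \<omega>)) \<in> borel_measurable M" for n
    using stochastically_integrable_measurable [OF si e t] by (simp add: hs_energy_def)
  have [measurable]: "elementary_integral \<beta> (e n) t \<in> borel_measurable M" for n
    using e t by measurable
  obtain r where r: "strict_mono r" "AE \<omega> in M. (\<lambda>n. hs_energy I g {0..t} (\<lambda>u. \<Phi> u \<omega> - elementary_value g (e (r n)) u \<omega>)) \<longlonglongrightarrow> 0"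
    using AE_subsequence [OF _ R] by auto
  have "\<exists>r'. strict_mono r' \<and> (AE \<omega> in M. (\<lambda>n. ennreal (dist (elementary_integral \<beta> (e (r (r' n))) t \<omega>) (Y \<omega>))) \<longlonglongrightarrow> 0)"
  proof (rule AE_subsequence)
    fix \<eta> :: real assume \<eta>: "0 < \<eta>"
    then have "(\<lambda>n. prob {\<omega>\<in>space M. \<eta> < dist (elementary_integral \<beta> (e n) t \<omega>) (Y \<omega>)}) \<longlonglongrightarrow> 0"
      using C by (simp add: converges_in_probability_def)
    then have "(\<lambda>n. prob {\<omega>\<in>space M. \<eta> < dist (elementary_integral \<beta> (e (r n)) t \<omega>) (Y \<omega>)}) \<longlonglongrightarrow> 0"
      using LIMSEQ_subseq_LIMSEQ [OF _ r(1)] by (fastforce simp: comp_def)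
    then show "(\<lambda>n. prob {\<omega>\<in>space M. ennreal \<eta> < ennreal (dist (elementary_integral \<beta> (e (r n)) t \<omega>) (Y \<omega>))}) \<longlonglongrightarrow> 0"
      using \<eta> by (simp add: ennreal_less_iff)
  qed measurable
  then obtain r' where r': "strict_mono r'" "AE \<omega> in M. (\<lambda>n. ennreal (dist (elementary_integral \<beta> (e (r (r' n))) t \<omega>) (Y \<omega>))) \<longlonglongrightarrow> 0"
    by blast
  have "AE \<omega> in M. (\<lambda>n. hs_energy I g {0..t} (\<lambda>u. \<Phi> u \<omega> - elementary_value g (e (r (r' n))) u \<omega>)) \<longlonglongrightarrow> 0 \<and>
       (\<lambda>n. elementary_integral \<beta> (e (r (r' n))) t \<omega>) \<longlonglongrightarrow> Y \<omega>"
    using r(2) r'(2)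
  proof eventually_elim
    case (elim \<omega>)
    have "(\<lambda>n. dist (elementary_integral \<beta> (e (r (r' n))) t \<omega>) (Y \<omega>)) \<longlonglongrightarrow> 0"
      using elim(2) tendsto_ennreal_iff [of "\<lambda>n. dist (elementary_integral \<beta> (e (r (r' n))) t \<omega>) (Y \<omega>)" sequentially 0] by simp
    then have "(\<lambda>n. elementary_integral \<beta> (e (r (r' n))) t \<omega>) \<longlonglongrightarrow> Y \<omega>" by (rule tendsto_dist_iff [THEN iffD2])
    moreover have "(\<lambda>n. hs_energy I g {0..t} (\<lambda>u. \<Phi> u \<omega> - elementary_value g (e (r (r' n))) u \<omega>)) \<longlonglongrightarrow> 0"
      using LIMSEQ_subseq_LIMSEQ [OF elim(1) r'(1)] by (simp add: comp_def)
    ultimately show ?case by blast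
  qed
  then show ?thesis using e by (intro exI [of _ "\<lambda>n. e (r (r' n))"] conjI allI)
qed

lemma control_integral_tendsto:
  fixes \<Phi> :: "real \<Rightarrow> 'u \<Rightarrow>\<^sub>L 'h::{real_inner, banach, second_countable_topology}"
  assumes \<Phi>: "hs_path I g t \<Phi>" and d: "elementary_process M \<F> I d" "deterministic d" and e: "\<And>n. elementary_process M \<F> I (e n)"
    and t: "0 \<le> t" and lim: "(\<lambda>n. hs_energy I g {0..t} (\<lambda>u. \<Phi> u - elementary_value g (e n) u \<omega>)) \<longlonglongrightarrow> 0"
  shows "(\<lambda>n. LINT u:{0..t}|lborel. elementary_value g (e n) u \<omega> (control g d u)) \<longlonglongrightarrow> (LINT u:{0..t}|lborel. \<Phi> u (control g d u))"
proof -
  let ?A = "\<lambda>n u. \<Phi> u - elementary_value g (e n) u \<omega>"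
  obtain C where C: "\<And>u. sqrt (\<Sum>k\<in>fst ` set d. (coef d k u undefined)\<^sup>2) \<le> C"
    using control_bounded by blast
  have A: "hs_path I g t (?A n)" for n by (intro hs_path_diff \<Phi> hs_path_elementary [OF basis e])
  note dI = elementary_process_idx [OF d(1)]
  have C0: "0 \<le> C" by (rule order_trans [OF real_sqrt_ge_zero C [of 0]]) (simp add: sum_nonneg)
  show ?thesis
  proof (rule LIMSEQ_I)
    fix r :: real assume r: "0 < r"
    \<comment> \<open>Chosen so that the estimate below ends at \<open>r / 4\<close>; the added ones
      keep the denominator away from zero.\<close>
    define \<kappa> where "\<kappa> = r / (2 * (C + 1) * (t + 1))"
    have \<kappa>: "0 < \<kappa>" using r C0 t by (simp add: \<kappa>_def)
    have "\<forall>\<^sub>F n in sequentially. hs_energy I g {0..t} (?A n) < ennreal (\<kappa>\<^sup>2)"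
      using lim \<kappa> by (intro order_tendstoD) auto
    then obtain N where N: "\<And>n. n \<ge> N \<Longrightarrow> hs_energy I g {0..t} (?A n) < ennreal (\<kappa>\<^sup>2)"
      unfolding eventually_sequentially by blast
    have "norm ((LINT u:{0..t}|lborel. elementary_value g (e n) u \<omega> (control g d u)) - (LINT u:{0..t}|lborel. \<Phi> u (control g d u))) < r"
      if "N \<le> n" for n
    proof -
      have lt: "hs_energy I g {0..t} (?A n) < ennreal (\<kappa>\<^sup>2)" using N that by blast
      then have fin: "hs_energy I g {0..t} (?A n) < \<infinity>" using less_trans ennreal_less_top by fastforce
      have le: "enn2real (hs_energy I g {0..t} (?A n)) \<le> \<kappa>\<^sup>2" using lt by (intro enn2real_leI) auto
      have iA: "set_integrable lborel {0..t} (\<lambda>u. ?A n u (control g d u))"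
        by (rule control_integral(1) [OF A dI fin t C])
      have ie: "set_integrable lborel {0..t} (\<lambda>u. elementary_value g (e n) u \<omega> (control g d u))"
        by (rule set_integrable_elementary_control(1) [OF e d])
      have "(LINT u:{0..t}|lborel. \<Phi> u (control g d u)) = (LINT u:{0..t}|lborel. ?A n u (control g d u) + elementary_value g (e n) u \<omega> (control g d u))"
        by (simp add: blinfun.diff_left)
      also have "\<dots> = (LINT u:{0..t}|lborel. ?A n u (control g d u)) + (LINT u:{0..t}|lborel. elementary_value g (e n) u \<omega> (control g d u))"
        by (rule set_integral_add(2) [OF iA ie])
      finally have "norm ((LINT u:{0..t}|lborel. elementary_value g (e n) u \<omega> (control g d u)) - (LINT u:{0..t}|lborel. \<Phi> u (control g d u)))
         = norm (LINT u:{0..t}|lborel. ?A n u (control g d u))" by simp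
      also have "\<dots> \<le> C * (\<kappa> * t + enn2real (hs_energy I g {0..t} (?A n)) / \<kappa>) / 2"
        by (rule control_integral(2) [OF A dI fin t C \<kappa>])
      also have "\<dots> \<le> C * (\<kappa> * t + \<kappa>\<^sup>2 / \<kappa>) / 2"
        using C0 \<kappa> le by (intro divide_right_mono mult_left_mono add_left_mono) auto
      also have "\<dots> = C * (\<kappa> * (t + 1)) / 2" using \<kappa> by (simp add: power2_eq_square algebra_simps)
      also have "\<dots> \<le> (C + 1) * (\<kappa> * (t + 1)) / 2" using \<kappa> t by (intro divide_right_mono mult_right_mono) auto
      also have "\<dots> = r / 4" 
      proof -
        have "2 * (C + 1) * (t + 1) \<noteq> 0" using C0 t by simp
        then have "r = \<kappa> * (2 * (C + 1) * (t + 1))" by (simp add: \<kappa>_def)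
        then show ?thesis by (simp add: algebra_simps)
      qed
      also have "\<dots> < r" using r by simp
      finally show ?thesis .
    qed
    then show "\<exists>N. \<forall>n\<ge>N. norm ((LINT u:{0..t}|lborel. elementary_value g (e n) u \<omega> (control g d u)) - (LINT u:{0..t}|lborel. \<Phi> u (control g d u))) < r"
      by blast
  qed
qed

text \<open>The bound \<open>exp 1\<close> is the price of the random signs. By
  \<open>energy_superset\<close> the index set of the control may be enlarged to the common
  \<open>J\<close> without changing \<open>girsanov\<close>.\<close>

lemma girsanov_exponential_le:
  fixes e :: "('w, 'h::{real_inner, banach, second_countable_topology}) elementary"
  assumes e: "elementary_process M \<F> I e" and d: "elementary_process M \<F> I d" and T: "0 \<le> T" and a: "0 < a"
    and J: "J = fst ` set e \<union> fst ` set d"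
  shows "(\<integral>\<^sup>+\<omega>. ennreal (girsanov d T \<omega>) * ennreal (exp (a * norm (elementary_integral \<beta> e T \<omega> - cross_energy e d J T \<omega>)
      - a\<^sup>2 * energy e J T \<omega>)) \<partial>M) \<le> ennreal (exp 1)"
proof -
  have J': "finite J" "fst ` set e \<subseteq> J" "fst ` set d \<subseteq> J" "J \<subseteq> I"
    using elementary_process_idx [OF e] elementary_process_idx [OF d] by (auto simp: J)
  note [measurable] = e d
  have "(\<integral>\<^sup>+\<omega>. ennreal (girsanov d T \<omega>) * ennreal (exp (a * norm (elementary_integral \<beta> e T \<omega> - cross_energy e d J T \<omega>)
      - a\<^sup>2 * energy e J T \<omega>)) \<partial>M)
    = (\<integral>\<^sup>+\<omega>. ennreal (exp 1) * ennreal (exp (elementary_integral \<beta> d T \<omega> - energy d J T \<omega> / 2) *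
      exp (a * norm (elementary_integral \<beta> e T \<omega> - cross_energy e d J T \<omega>) - a\<^sup>2 * energy e J T \<omega> - 1)) \<partial>M)"
    unfolding girsanov_def energy_superset [OF J'(3,1)]
    by (intro nn_integral_cong) (simp add: ennreal_mult [symmetric] exp_add [symmetric])
  also have "\<dots> = ennreal (exp 1) * (\<integral>\<^sup>+\<omega>. ennreal (exp (elementary_integral \<beta> d T \<omega> - energy d J T \<omega> / 2) *
      exp (a * norm (elementary_integral \<beta> e T \<omega> - cross_energy e d J T \<omega>) - a\<^sup>2 * energy e J T \<omega> - 1)) \<partial>M)"
    using T by (intro nn_integral_cmult) measurable
  also have "\<dots> \<le> ennreal (exp 1) * 1"
    by (intro mult_left_mono exponential_supermartingale_vector e d J' T a) simp
  finally show ?thesis by simp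
qed

text \<open>The tilt by \<open>girsanov d T\<close> is what compensates the drift. The exceptional set absorbs
  all measurability questions about the localising event.\<close>

lemma stochastic_increment_tail:
  fixes \<Phi> \<Psi> :: "real \<Rightarrow> 'w \<Rightarrow> 'u \<Rightarrow>\<^sub>L 'h::{real_inner, banach, second_countable_topology}"
  assumes \<Phi>: "has_stochastic_integral M \<F> I g \<beta> t \<Phi> Y" and \<Psi>: "has_stochastic_integral M \<F> I g \<beta> s \<Psi> Y'"
    and st: "0 \<le> s" "s \<le> t" "t \<le> T"
    and rel: "\<And>u \<omega>. u \<in> {0..s} \<Longrightarrow> \<omega> \<in> space M \<Longrightarrow> \<Phi> u \<omega> = L o\<^sub>L \<Psi> u \<omega>"
    and d: "elementary_process M \<F> I d" "deterministic d" and a: "0 < a" and R: "0 \<le> R"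
  shows "\<exists>N\<in>sets M. (\<integral>\<^sup>+\<omega>. ennreal (girsanov d T \<omega>) * indicator N \<omega> \<partial>M) \<le> ennreal (exp (1 - a * \<eta> + 2 * a\<^sup>2 * R)) \<and>
    (\<forall>\<omega>\<in>space M - N. hs_energy I g {s<..t} (\<lambda>u. \<Phi> u \<omega>) \<le> ennreal R \<longrightarrow>
       norm ((Y \<omega> - L (Y' \<omega>)) - ((LINT u:{0..t}|lborel. \<Phi> u \<omega> (control g d u)) - L (LINT u:{0..s}|lborel. \<Psi> u \<omega> (control g d u)))) \<le> \<eta>)"
proof -
  have t: "0 \<le> t" and T: "0 \<le> T" using st by auto
  have si: "stochastically_integrable M \<F> I g t \<Phi>" "stochastically_integrable M \<F> I g s \<Psi>"
    using \<Phi> \<Psi> by (auto simp: has_stochastic_integral_def)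
  from approximating_subsequence [OF \<Phi> t] obtain e where e: "\<And>n. elementary_process M \<F> I (e n)"
    and elim: "AE \<omega> in M. (\<lambda>n. hs_energy I g {0..t} (\<lambda>u. \<Phi> u \<omega> - elementary_value g (e n) u \<omega>)) \<longlonglongrightarrow> 0 \<and>
       (\<lambda>n. elementary_integral \<beta> (e n) t \<omega>) \<longlonglongrightarrow> Y \<omega>" by blast
  from approximating_subsequence [OF \<Psi> st(1)] obtain e' where e': "\<And>n. elementary_process M \<F> I (e' n)"
    and elim': "AE \<omega> in M. (\<lambda>n. hs_energy I g {0..s} (\<lambda>u. \<Psi> u \<omega> - elementary_value g (e' n) u \<omega>)) \<longlonglongrightarrow> 0 \<and>
       (\<lambda>n. elementary_integral \<beta> (e' n) s \<omega>) \<longlonglongrightarrow> Y' \<omega>" by blast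
  \<comment> \<open>Elementary approximation of the increment \<open>Y - L Y'\<close>, to be
    evaluated at the horizon \<open>T\<close> of the density.\<close>
  define w where "w n = truncate t (e n) @ map_elementary (- L) (truncate s (e' n))" for n
  have w: "elementary_process M \<F> I (w n)" for n
    unfolding w_def by (simp add: elementary_process_append elementary_process_truncate elementary_process_map e e')
  define J where "J n = fst ` set (w n) \<union> fst ` set d" for n
  have J: "finite (J n)" "fst ` set d \<subseteq> J n" "J n \<subseteq> I" for n
    using elementary_process_idx [OF w [of n]] elementary_process_idx [OF d(1)] by (auto simp: J_def)
  define y where "y n \<omega> = elementary_integral \<beta> (w n) T \<omega> - cross_energy (w n) d (J n) T \<omega>" for n \<omega>
  define V where "V n \<omega> = energy (w n) (J n) T \<omega>" for n \<omega>
  note [measurable] = w d(1)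
  define f where "f n \<omega> = ennreal (exp (a * norm (y n \<omega>) - a\<^sup>2 * V n \<omega>))" for n \<omega>
  have [measurable]: "f n \<in> borel_measurable M" for n
    unfolding f_def [abs_def] y_def V_def using T by measurable
  have [measurable]: "girsanov d T \<in> borel_measurable M" using T by measurable
  define Z where "Z \<omega> = (Y \<omega> - L (Y' \<omega>)) - ((LINT u:{0..t}|lborel. \<Phi> u \<omega> (control g d u)) - L (LINT u:{0..s}|lborel. \<Psi> u \<omega> (control g d u)))" for \<omega>
  \<comment> \<open>In the limit the energy of the increment is at most twice \<open>R\<close>,
    whence the compensator \<open>2 * a\<^sup>2 * R\<close>.\<close>
  define l where "l = ennreal (exp (a * \<eta> - 2 * a\<^sup>2 * R))"
  \<comment> \<open>Where the limit inferior of the exponentials reaches \<open>l\<close>. Fatou's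
    lemma bounds its tilted mean by \<open>exp 1\<close>, and Markov's inequality turns this into
    the tail bound.\<close>
  define Bad where "Bad = {\<omega> \<in> space M. l \<le> liminf (\<lambda>n. f n \<omega>)}"
  have Bad [measurable]: "Bad \<in> sets M" unfolding Bad_def by measurable
  have "(\<integral>\<^sup>+\<omega>. ennreal (girsanov d T \<omega>) * liminf (\<lambda>n. f n \<omega>) \<partial>M) \<le> (\<integral>\<^sup>+\<omega>. liminf (\<lambda>n. ennreal (girsanov d T \<omega>) * f n \<omega>) \<partial>M)"
  proof (rule nn_integral_mono)
    fix \<omega>
    show "ennreal (girsanov d T \<omega>) * liminf (\<lambda>n. f n \<omega>) \<le> liminf (\<lambda>n. ennreal (girsanov d T \<omega>) * f n \<omega>)"
      unfolding liminf_SUP_INF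
      by (subst SUP_mult_left_ennreal) (auto intro!: SUP_mono INF_greatest mult_left_mono INF_lower)
  qed
  also have "\<dots> \<le> liminf (\<lambda>n. \<integral>\<^sup>+\<omega>. ennreal (girsanov d T \<omega>) * f n \<omega> \<partial>M)"
    by (rule nn_integral_liminf) measurable
  also have "\<dots> \<le> liminf (\<lambda>n. ennreal (exp 1))"
  proof (intro Liminf_mono always_eventually allI)
    fix n
    show "(\<integral>\<^sup>+\<omega>. ennreal (girsanov d T \<omega>) * f n \<omega> \<partial>M) \<le> ennreal (exp 1)"
      unfolding f_def y_def V_def by (rule girsanov_exponential_le [OF w d(1) T a]) (simp add: J_def)
  qed
  also have "\<dots> = ennreal (exp 1)" by (intro Liminf_const) simp
  finally have fatou: "(\<integral>\<^sup>+\<omega>. ennreal (girsanov d T \<omega>) * liminf (\<lambda>n. f n \<omega>) \<partial>M) \<le> ennreal (exp 1)" .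
  have "l * (\<integral>\<^sup>+\<omega>. ennreal (girsanov d T \<omega>) * indicator Bad \<omega> \<partial>M) = (\<integral>\<^sup>+\<omega>. l * (ennreal (girsanov d T \<omega>) * indicator Bad \<omega>) \<partial>M)"
    using T by (intro nn_integral_cmult [symmetric]) measurable
  also have "\<dots> \<le> (\<integral>\<^sup>+\<omega>. ennreal (girsanov d T \<omega>) * liminf (\<lambda>n. f n \<omega>) \<partial>M)"
  proof (rule nn_integral_mono)
    fix \<omega>
    show "l * (ennreal (girsanov d T \<omega>) * indicator Bad \<omega>) \<le> ennreal (girsanov d T \<omega>) * liminf (\<lambda>n. f n \<omega>)"
    proof (cases "\<omega> \<in> Bad")
      case True
      then have "ennreal (girsanov d T \<omega>) * l \<le> ennreal (girsanov d T \<omega>) * liminf (\<lambda>n. f n \<omega>)"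
        by (intro mult_left_mono) (auto simp: Bad_def)
      then show ?thesis using True by (simp add: mult.commute)
    qed simp
  qed
  finally have "l * (\<integral>\<^sup>+\<omega>. ennreal (girsanov d T \<omega>) * indicator Bad \<omega> \<partial>M) \<le> ennreal (exp 1)"
    using fatou by (rule order_trans)
  then have 1: "ennreal (exp (- (a * \<eta> - 2 * a\<^sup>2 * R))) * (l * (\<integral>\<^sup>+\<omega>. ennreal (girsanov d T \<omega>) * indicator Bad \<omega> \<partial>M))
     \<le> ennreal (exp (- (a * \<eta> - 2 * a\<^sup>2 * R))) * ennreal (exp 1)"
    by (rule mult_left_mono) simp
  have 2: "ennreal (exp (- (a * \<eta> - 2 * a\<^sup>2 * R))) * l = 1"
    unfolding l_def by (subst ennreal_mult [symmetric]) (simp_all add: exp_add [symmetric])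
  have 3: "ennreal (exp (- (a * \<eta> - 2 * a\<^sup>2 * R))) * ennreal (exp 1) = ennreal (exp (1 - a * \<eta> + 2 * a\<^sup>2 * R))"
    by (subst ennreal_mult [symmetric]) (simp_all add: exp_add [symmetric])
  have bad_le: "(\<integral>\<^sup>+\<omega>. ennreal (girsanov d T \<omega>) * indicator Bad \<omega> \<partial>M) \<le> ennreal (exp (1 - a * \<eta> + 2 * a\<^sup>2 * R))"
    using 1 unfolding mult.assoc [symmetric] 2 3 mult_1 .
  have fin: "AE \<omega> in M. hs_energy I g {0..t} (\<lambda>u. \<Phi> u \<omega>) < \<infinity>"
    using si(1) by (simp add: stochastically_integrable_def hs_energy_def)
  have "AE \<omega> in M. hs_energy I g {s<..t} (\<lambda>u. \<Phi> u \<omega>) \<le> ennreal R \<longrightarrow> \<eta> < norm (Z \<omega>) \<longrightarrow> \<omega> \<in> Bad"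
    using elim elim' AE_space
  proof eventually_elim
    case (elim \<omega>)
    have ps: "hs_path I g t (\<lambda>u. \<Phi> u \<omega>)" "hs_path I g s (\<lambda>u. \<Psi> u \<omega>)"
      using si t st(1) elim(3) by (auto intro: stochastically_integrable_hs_path)
    let ?A = "\<lambda>n. hs_energy I g {0..t} (\<lambda>u. \<Phi> u \<omega> - elementary_value g (e n) u \<omega>)"
    let ?B = "\<lambda>n. hs_energy I g {0..s} (\<lambda>u. \<Psi> u \<omega> - elementary_value g (e' n) u \<omega>)"
    have yeq: "y n \<omega> = (elementary_integral \<beta> (e n) t \<omega> - L (elementary_integral \<beta> (e' n) s \<omega>))
        - ((LINT u:{0..t}|lborel. elementary_value g (e n) u \<omega> (control g d u)) - L (LINT u:{0..s}|lborel. elementary_value g (e' n) u \<omega> (control g d u)))" for n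
      unfolding y_def w_def
      using cross_energy_truncate [OF e [of n] e' [of n] d, of s T t "J n" L \<omega>] st J
      by (simp add: elementary_integral_append elementary_integral_map elementary_integral_truncate [OF e st(3)]
          elementary_integral_truncate [OF elementary_process_truncate [OF e']] elementary_integral_truncate [OF e', of s T] blinfun.minus_left)
    have ylim: "(\<lambda>n. y n \<omega>) \<longlonglongrightarrow> Z \<omega>"
      unfolding yeq Z_def using elim ps t st
      by (intro tendsto_diff blinfun.tendsto tendsto_const control_integral_tendsto d e e') auto
    show ?case
    proof (intro impI)
      assume H: "hs_energy I g {s<..t} (\<lambda>u. \<Phi> u \<omega>) \<le> ennreal R" and Zgt: "\<eta> < norm (Z \<omega>)"
      \<comment> \<open>Half of the excess of the norm over \<open>\<eta>\<close>. Approximation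
        energy below \<open>c / a\<close> costs at most \<open>a * c\<close> in the exponent, and
        this is exactly what \<open>norm (y n \<omega>) > \<eta> + c\<close> gains.\<close>
      define c where "c = (norm (Z \<omega>) - \<eta>) / 2"
      have c: "0 < c" using Zgt by (simp add: c_def)
      have lim0: "(\<lambda>n. 2 * ?A n + ennreal (2 * (norm L)\<^sup>2) * ?B n) \<longlonglongrightarrow> 2 * 0 + ennreal (2 * (norm L)\<^sup>2) * 0"
        using elim by (intro tendsto_add ennreal_tendsto_cmult) auto
      have ev1: "\<forall>\<^sub>F n in sequentially. 2 * ?A n + ennreal (2 * (norm L)\<^sup>2) * ?B n < ennreal (c / a)"
        using lim0 a c by (intro order_tendstoD(2)) auto
      have ev2: "\<forall>\<^sub>F n in sequentially. \<eta> + c < norm (y n \<omega>)"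
        using tendsto_norm [OF ylim] by (rule order_tendstoD(1)) (use Zgt in \<open>simp add: c_def field_simps\<close>)
      have "\<forall>\<^sub>F n in sequentially. l \<le> f n \<omega>"
        using ev1 ev2
      proof eventually_elim
        case (elim n)
        have "ennreal (V n \<omega>) \<le> 2 * hs_energy I g {s<..t} (\<lambda>u. \<Phi> u \<omega>) + 2 * ?A n + ennreal (2 * (norm L)\<^sup>2) * ?B n"
          unfolding V_def w_def
          by (rule energy_truncate_le [OF e e' st J(1,3) ps]) (use rel \<open>\<omega> \<in> space M\<close> in auto)
        also have "\<dots> \<le> 2 * ennreal R + ennreal (c / a)"
          unfolding add.assoc using H elim(1) by (intro add_mono mult_left_mono) auto
        also have "\<dots> = ennreal (2 * R + c / a)"
          using R a c by (simp add: ennreal_plus ennreal_mult)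
        finally have "V n \<omega> \<le> 2 * R + c / a"
          using R a c by (subst (asm) ennreal_le_iff) auto
        then have "a\<^sup>2 * V n \<omega> \<le> a\<^sup>2 * (2 * R + c / a)" by (intro mult_left_mono) auto
        also have "\<dots> = 2 * a\<^sup>2 * R + a * c" using a by (simp add: field_simps power2_eq_square)
        finally have 1: "a\<^sup>2 * V n \<omega> \<le> 2 * a\<^sup>2 * R + a * c" .
        have "a * (\<eta> + c) \<le> a * norm (y n \<omega>)" using elim(2) a by (intro mult_left_mono) auto
        with 1 have "a * \<eta> - 2 * a\<^sup>2 * R \<le> a * norm (y n \<omega>) - a\<^sup>2 * V n \<omega>" by (simp add: algebra_simps)
        then show ?case unfolding l_def f_def by (intro ennreal_leI) simp
      qed
      then have "l \<le> liminf (\<lambda>n. f n \<omega>)" by (rule Liminf_bounded)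
      then show "\<omega> \<in> Bad" using elim(3) by (simp add: Bad_def)
    qed
  qed
  then obtain N where N: "{\<omega> \<in> space M. \<not> (hs_energy I g {s<..t} (\<lambda>u. \<Phi> u \<omega>) \<le> ennreal R \<longrightarrow> \<eta> < norm (Z \<omega>) \<longrightarrow> \<omega> \<in> Bad)} \<subseteq> N"
    "N \<in> null_sets M" unfolding eventually_ae_filter by blast
  show ?thesis
  proof (intro bexI [of _ "Bad \<union> N"] conjI ballI impI)
    have "(\<integral>\<^sup>+\<omega>. ennreal (girsanov d T \<omega>) * indicator (Bad \<union> N) \<omega> \<partial>M) = (\<integral>\<^sup>+\<omega>. ennreal (girsanov d T \<omega>) * indicator Bad \<omega> \<partial>M)"
      using AE_not_in [OF N(2)] by (intro nn_integral_cong_AE) (auto elim!: eventually_mono simp: indicator_def)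
    then show "(\<integral>\<^sup>+\<omega>. ennreal (girsanov d T \<omega>) * indicator (Bad \<union> N) \<omega> \<partial>M) \<le> ennreal (exp (1 - a * \<eta> + 2 * a\<^sup>2 * R))"
      using bad_le by simp
    show "Bad \<union> N \<in> sets M" using Bad N(2) by auto
    fix \<omega> assume "\<omega> \<in> space M - (Bad \<union> N)" "hs_energy I g {s<..t} (\<lambda>u. \<Phi> u \<omega>) \<le> ennreal R"
    then have "\<not> \<eta> < norm (Z \<omega>)" using N(1) by blast
    then show "norm ((Y \<omega> - L (Y' \<omega>)) - ((LINT u:{0..t}|lborel. \<Phi> u \<omega> (control g d u)) - L (LINT u:{0..s}|lborel. \<Psi> u \<omega> (control g d u)))) \<le> \<eta>"
      by (simp add: Z_def)
  qed
qed

end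

section \<open>Semigroups, chaining and Gronwall\<close>

lemma uniform_boundedness:
  fixes T :: "nat \<Rightarrow> 'a::banach \<Rightarrow>\<^sub>L 'b::real_normed_vector"
  assumes "\<And>x. \<exists>B. \<forall>n. norm (T n x) \<le> B"
  shows "\<exists>B. \<forall>n. norm (T n) \<le> B"
proof -
  define A where "A m = {x. \<forall>n. norm (T n x) \<le> real m}" for m
  have cl: "closed (A m)" for m
    unfolding A_def by (intro closed_Collect_all closed_Collect_le continuous_intros)
  have un: "(\<Union>m. A m) = UNIV"
  proof (intro equalityI subset_UNIV subsetI)
    fix x
    obtain B where "\<And>n. norm (T n x) \<le> B" using assms by blast
    then have "x \<in> A (nat \<lceil>B\<rceil>)"
      unfolding A_def using of_nat_ceiling order_trans by blast
    then show "x \<in> (\<Union>m. A m)" by blast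
  qed
  have "\<exists>m. interior (A m) \<noteq> {}"
  proof (rule ccontr)
    assume *: "\<not> (\<exists>m. interior (A m) \<noteq> {})"
    have "euclidean interior_of \<Union>(range A) = {}"
      using cl * completely_metrizable_space_euclidean
      by (intro Baire_category_alt) auto
    then show False using un by simp
  qed
  then obtain m x where "x \<in> interior (A m)" by blast
  then obtain r where r: "0 < r" "cball x r \<subseteq> A m"
    using open_contains_cball [of "interior (A m)"] interior_subset by blast
  have bd: "norm (T n y) \<le> 2 * real m" if "norm y \<le> r" for n y
  proof -
    have "x + y \<in> A m" "x \<in> A m" using r that by (auto simp: dist_norm)
    then have "norm (T n (x + y)) \<le> real m" "norm (T n x) \<le> real m" by (auto simp: A_def)
    moreover have "T n y = T n (x + y) - T n x" by (simp add: blinfun.add_right)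
    ultimately show ?thesis using norm_triangle_ineq4 [of "T n (x + y)" "T n x"] by simp
  qed
  have "norm (T n) \<le> 2 * real m / r" for n
  proof (rule norm_blinfun_bound)
    fix y
    show "norm (T n y) \<le> 2 * real m / r * norm y"
    proof (cases "y = 0")
      case False
      have "norm (T n ((r / norm y) *\<^sub>R y)) \<le> 2 * real m" using False r by (intro bd) simp
      then show ?thesis using False r by (simp add: blinfun.scaleR_right field_simps)
    qed (simp add: blinfun.zero_right)
  qed (use r in auto)
  then show ?thesis by blast
qed

lemma c0_semigroup_near_zero:
  assumes S: "c0_semigroup S" and e: "0 < e"
  shows "\<exists>\<delta>>0. \<forall>r\<in>{0..\<delta>}. norm (S r x - x) < e"
proof -
  have "((\<lambda>t. S t x) \<longlongrightarrow> x) (at_right 0)" using S by (simp add: c0_semigroup_def)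
  then have "\<forall>\<^sub>F t in at_right 0. dist (S t x) x < e" using e by (rule tendstoD)
  then obtain b where b: "0 < b" "\<And>t. 0 < t \<Longrightarrow> t < b \<Longrightarrow> dist (S t x) x < e"
    unfolding eventually_at_right_field by auto
  have "norm (S r x - x) < e" if "r \<in> {0..b/2}" for r
    using b(2) [of r] b(1) that S e by (cases "r = 0") (auto simp: dist_norm c0_semigroup_def)
  then show ?thesis using b(1) by (intro exI [of _ "b / 2"]) auto
qed

text \<open>If \<open>S\<close> were unbounded near 0, there would be times \<open>r n\<close>
  tending to 0 with \<open>norm (S (r n)) > n\<close>. But \<open>S (r n) x\<close> tends to
  \<open>x\<close> for each \<open>x\<close>, so uniform boundedness is contradicted. A bound on a
  short interval reaches \<open>[0,1]\<close> through finitely many applications of the semigroup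
  law.\<close>

lemma c0_semigroup_bounded:
  fixes S :: "real \<Rightarrow> 'h::banach \<Rightarrow>\<^sub>L 'h"
  assumes S: "c0_semigroup S"
  shows "\<exists>C\<ge>1. \<forall>r\<in>{0..1}. norm (S r) \<le> C"
proof -
  have "\<exists>\<delta>>0. \<exists>C. \<forall>r\<in>{0..\<delta>}. norm (S r) \<le> C"
  proof (rule ccontr)
    assume "\<not> ?thesis"
    then have "\<exists>r. r \<in> {0..1 / real (Suc n)} \<and> real n < norm (S r)" for n
      by (meson not_le of_nat_0_less_iff zero_less_Suc divide_pos_pos zero_less_one)
    then obtain r where r: "\<And>n. r n \<in> {0..1 / real (Suc n)}" "\<And>n. real n < norm (S (r n))" by metis
    have "\<exists>B. \<forall>n. norm (S (r n) x) \<le> B" for x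
    proof -
      obtain \<delta> where \<delta>: "0 < \<delta>" "\<And>r. r \<in> {0..\<delta>} \<Longrightarrow> norm (S r x - x) < 1"
        using c0_semigroup_near_zero [OF S, of 1 x] by auto
      obtain N where N: "1 / real (Suc N) < \<delta>" using nat_approx_posE [OF \<delta>(1)] by blast
      have "norm (S (r n) x) \<le> norm x + 1 + (\<Sum>m<N. norm (S (r m) x))" for n
      proof (cases "N \<le> n")
        case True
        then have "1 / real (Suc n) \<le> 1 / real (Suc N)" by (intro divide_left_mono) auto
        then have "r n \<in> {0..\<delta>}" using r(1) [of n] N by simp
        then have "norm (S (r n) x - x) < 1" by (rule \<delta>(2))
        then have "norm (S (r n) x) \<le> norm x + 1" using norm_triangle_sub [of "S (r n) x" x] by linarith
        then show ?thesis by (simp add: add_increasing2 sum_nonneg)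
      next
        case False
        then have "norm (S (r n) x) \<le> (\<Sum>m<N. norm (S (r m) x))"
          using member_le_sum [of n "{..<N}" "\<lambda>m. norm (S (r m) x)"] by simp
        then show ?thesis using norm_ge_zero [of x] by linarith
      qed
      then show ?thesis by blast
    qed
    from uniform_boundedness [of "\<lambda>n. S (r n)", OF this] obtain B where B: "\<And>n. norm (S (r n)) \<le> B" by blast
    obtain n where "B < real n" using reals_Archimedean2 by blast
    then show False using B [of n] r(2) [of n] by simp
  qed
  then obtain \<delta> C where \<delta>: "0 < \<delta>" and C: "\<And>r. r \<in> {0..\<delta>} \<Longrightarrow> norm (S r) \<le> C" by blast
  define D where "D = max C 1"
  have D: "1 \<le> D" "\<And>r. r \<in> {0..\<delta>} \<Longrightarrow> norm (S r) \<le> D" using C by (auto simp: D_def max.coboundedI1)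
  have pow: "norm (S r) \<le> D ^ Suc n" if "0 \<le> r" "r \<le> real (Suc n) * \<delta>" for r n
    using that
  proof (induction n arbitrary: r)
    case 0
    then show ?case using D(2) by simp
  next
    case (Suc n)
    show ?case
    proof (cases "r \<le> \<delta>")
      case True
      then have "norm (S r) \<le> D" using Suc.prems D(2) by simp
      also have "D \<le> D ^ Suc (Suc n)" using D(1) by (rule self_le_power) simp
      finally show ?thesis .
    next
      case False
      then have "S (\<delta> + (r - \<delta>)) = S \<delta> o\<^sub>L S (r - \<delta>)" using S \<delta> unfolding c0_semigroup_def by (metis diff_ge_0_iff_ge less_imp_le not_le)
      then have "norm (S r) \<le> norm (S \<delta>) * norm (S (r - \<delta>))" using norm_blinfun_compose [of "S \<delta>" "S (r - \<delta>)"] by simp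
      also have "\<dots> \<le> D * D ^ Suc n"
      proof (intro mult_mono)
        show "norm (S \<delta>) \<le> D" using D(2) \<delta> by simp
        show "norm (S (r - \<delta>)) \<le> D ^ Suc n" using False Suc.prems by (intro Suc.IH) (auto simp: algebra_simps)
      qed (use D in auto)
      finally show ?thesis by simp
    qed
  qed
  obtain n where n: "1 / \<delta> < real n" using reals_Archimedean2 by blast
  have "norm (S r) \<le> D ^ Suc n" if "r \<in> {0..1}" for r
  proof (rule pow)
    have "1 \<le> real n * \<delta>" using n \<delta> by (simp add: field_simps)
    also have "\<dots> \<le> real (Suc n) * \<delta>" using \<delta> by (intro mult_right_mono) auto
    finally show "r \<le> real (Suc n) * \<delta>" using that by simp
  qed (use that in simp)
  moreover have "1 \<le> D ^ Suc n" using D(1) by (rule one_le_power)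
  ultimately show ?thesis by blast
qed

text \<open>A finite net reduces the claim to strong continuity at finitely many points; the
  distance to the net is magnified at most by \<open>C\<close>, hence the mesh
  \<open>e / (3 * C)\<close>.\<close>

lemma c0_semigroup_uniform_compact:
  fixes S :: "real \<Rightarrow> 'h::banach \<Rightarrow>\<^sub>L 'h"
  assumes S: "c0_semigroup S" and K: "compact K" and e: "0 < e"
  shows "\<exists>\<delta>\<in>{0<..1}. \<forall>r\<in>{0..\<delta>}. \<forall>v\<in>K. norm (S r v - v) < e"
proof -
  obtain C where C: "1 \<le> C" "\<And>r. r \<in> {0..1} \<Longrightarrow> norm (S r) \<le> C" using c0_semigroup_bounded [OF S] by blast
  define \<eta> where "\<eta> = e / (3 * C)"
  have \<eta>: "0 < \<eta>" "C * \<eta> = e / 3" using e C by (auto simp: \<eta>_def)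
  have \<eta>e: "\<eta> \<le> e / 3" 
  proof -
    have "1 * \<eta> \<le> C * \<eta>" using \<eta>(1) C(1) by (intro mult_right_mono) auto
    then show ?thesis using \<eta>(2) by simp
  qed
  have "\<exists>k. finite k \<and> k \<subseteq> K \<and> K \<subseteq> (\<Union>x\<in>k. ball x \<eta>)"
    using seq_compact_imp_totally_bounded [OF compact_imp_seq_compact [OF K], rule_format, OF \<eta>(1)] .
  then obtain k where k: "finite k" "k \<subseteq> K" "K \<subseteq> (\<Union>x\<in>k. ball x \<eta>)" by (elim exE conjE)
  have "\<forall>x. \<exists>\<delta>>0. \<forall>r\<in>{0..\<delta>}. norm (S r x - x) < e / 3"
    using e by (intro allI c0_semigroup_near_zero [OF S]) simp
  then have "\<exists>\<delta>. \<forall>x. 0 < \<delta> x \<and> (\<forall>r\<in>{0..\<delta> x}. norm (S r x - x) < e / 3)" by (rule choice)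
  then obtain \<delta> where \<delta>: "\<And>x. 0 < \<delta> x" "\<And>x r. r \<in> {0..\<delta> x} \<Longrightarrow> norm (S r x - x) < e / 3" by blast
  define \<delta>' where "\<delta>' = Min (insert 1 (\<delta> ` k))"
  have fin: "finite (insert 1 (\<delta> ` k))" using k by simp
  have \<delta>': "0 < \<delta>'" "\<delta>' \<le> 1" "\<And>x. x \<in> k \<Longrightarrow> \<delta>' \<le> \<delta> x"
    unfolding \<delta>'_def using fin \<delta>(1) by (auto simp: Min_gr_iff)
  have "norm (S r v - v) < e" if r: "r \<in> {0..\<delta>'}" and v: "v \<in> K" for r v
  proof -
    obtain x where x: "x \<in> k" "dist x v < \<eta>" using k(3) v by auto
    have "norm (S r (v - x)) \<le> C * \<eta>"
      using C(2) [of r] r \<delta>'(2) x C(1)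
      by (intro order_trans [OF norm_blinfun] mult_mono) (auto simp: dist_norm norm_minus_commute)
    moreover have "norm (S r x - x) < e / 3" using \<delta>'(3) [OF x(1)] r by (intro \<delta>(2)) auto
    moreover have "norm (x - v) < e / 3" using x(2) \<eta>e by (simp add: dist_norm)
    moreover have "norm (S r v - v) \<le> norm (S r (v - x)) + (norm (S r x - x) + norm (x - v))"
    proof -
      have eq: "S r v - v = S r (v - x) + ((S r x - x) + (x - v))" by (simp add: blinfun.diff_right)
      show ?thesis
        unfolding eq using norm_triangle_ineq [of "S r (v - x)" "(S r x - x) + (x - v)"] norm_triangle_ineq [of "S r x - x" "x - v"]
        by linarith
    qed
    ultimately show ?thesis using \<eta>(2) by linarith
  qed
  then show ?thesis using \<delta>' by (intro bexI [of _ \<delta>']) auto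
qed

text \<open>The operators are only strongly continuous, so the two variations are separated: the
  vector moves under an operator bounded by \<open>C\<close>, and the operator moves on a fixed
  vector, where the semigroup law reduces two times to their distance.\<close>

lemma c0_semigroup_convolution_continuous:
  fixes S :: "real \<Rightarrow> 'h::banach \<Rightarrow>\<^sub>L 'h"
  assumes S: "c0_semigroup S" and \<epsilon>: "\<epsilon> \<in> {0..1}" and t: "t \<in> {0..1}" and v: "continuous_on {0..t} v"
  shows "continuous_on {0..t} (\<lambda>u. S (\<epsilon> * (t - u)) (v u))"
proof -
  obtain C where C: "1 \<le> C" "\<And>r. r \<in> {0..1} \<Longrightarrow> norm (S r) \<le> C" using c0_semigroup_bounded [OF S] by blast
  have in01: "\<epsilon> * (t - u) \<in> {0..1}" if "u \<in> {0..t}" for u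
  proof -
    have "\<epsilon> * (t - u) \<le> 1 * 1" using \<epsilon> t that by (intro mult_mono) auto
    then show ?thesis using \<epsilon> that by simp
  qed
  have diff: "norm (S r x - S r' x) \<le> C * norm (S \<bar>r - r'\<bar> x - x)" if "r \<in> {0..1}" "r' \<in> {0..1}" for r r' x
  proof -
    have *: "norm (S b x - S a x) \<le> C * norm (S (b - a) x - x)" if "0 \<le> a" "a \<le> b" "a \<le> 1" for a b
    proof -
      have "S (a + (b - a)) = S a o\<^sub>L S (b - a)" 
        using S [unfolded c0_semigroup_def, THEN conjunct2, THEN conjunct1, rule_format, of a "b - a"] that by simp
      then have "S b x - S a x = S a (S (b - a) x - x)" by (simp add: blinfun.diff_right)
      then show ?thesis using C(2) [of a] that
        by (simp, intro order_trans [OF norm_blinfun] mult_right_mono) auto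
    qed
    show ?thesis using that * [of r' r] * [of r r'] by (cases "r' \<le> r") (auto simp: norm_minus_commute abs_if)
  qed
  show ?thesis
    unfolding continuous_on_iff
  proof (intro ballI allI impI)
    fix u e :: real assume u: "u \<in> {0..t}" and e: "0 < e"
    define \<eta> where "\<eta> = e / (2 * C)"
    have \<eta>: "0 < \<eta>" using e C by (simp add: \<eta>_def)
    have C\<eta>: "C * \<eta> = e / 2" using C(1) by (simp add: \<eta>_def)
    obtain \<delta>1 where \<delta>1: "0 < \<delta>1" "\<And>r. r \<in> {0..\<delta>1} \<Longrightarrow> norm (S r (v u) - v u) < \<eta>"
      using c0_semigroup_near_zero [OF S \<eta>, of "v u"] by blast
    obtain \<delta>2 where \<delta>2: "0 < \<delta>2" "\<And>u'. u' \<in> {0..t} \<Longrightarrow> dist u' u < \<delta>2 \<Longrightarrow> dist (v u') (v u) < \<eta>"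
      using v u \<eta> unfolding continuous_on_iff by meson
    have "dist (S (\<epsilon> * (t - u')) (v u')) (S (\<epsilon> * (t - u)) (v u)) < e" if u': "u' \<in> {0..t}" and d: "dist u' u < min \<delta>1 \<delta>2" for u'
    proof -
      have "\<bar>\<epsilon> * (t - u') - \<epsilon> * (t - u)\<bar> = \<epsilon> * \<bar>u' - u\<bar>"
        using \<epsilon> by (simp add: abs_mult [symmetric] right_diff_distrib [symmetric] abs_minus_commute) (simp add: abs_mult abs_minus_commute)
      also have "\<dots> \<le> 1 * \<bar>u' - u\<bar>" using \<epsilon> by (intro mult_right_mono) auto
      finally have "\<bar>\<epsilon> * (t - u') - \<epsilon> * (t - u)\<bar> \<in> {0..\<delta>1}" using d by (auto simp: dist_real_def)
      then have "norm (S (\<bar>\<epsilon> * (t - u') - \<epsilon> * (t - u)\<bar>) (v u) - v u) < \<eta>" by (rule \<delta>1(2))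
      then have 1: "norm (S (\<epsilon> * (t - u')) (v u) - S (\<epsilon> * (t - u)) (v u)) < C * \<eta>"
        using C(1) by (intro le_less_trans [OF diff [OF in01 [OF u'] in01 [OF u]]] mult_strict_left_mono) auto
      have 2: "norm (S (\<epsilon> * (t - u')) (v u' - v u)) \<le> C * \<eta>"
        using \<delta>2(2) [OF u'] d C(2) [OF in01 [OF u']] C(1)
        by (intro order_trans [OF norm_blinfun] mult_mono) (auto simp: dist_norm)
      have "S (\<epsilon> * (t - u')) (v u') - S (\<epsilon> * (t - u)) (v u) = S (\<epsilon> * (t - u')) (v u' - v u) + (S (\<epsilon> * (t - u')) (v u) - S (\<epsilon> * (t - u)) (v u))"
        by (simp add: blinfun.diff_right)
      then have "norm (S (\<epsilon> * (t - u')) (v u') - S (\<epsilon> * (t - u)) (v u)) \<le> norm (S (\<epsilon> * (t - u')) (v u' - v u)) + norm (S (\<epsilon> * (t - u')) (v u) - S (\<epsilon> * (t - u)) (v u))"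
        by (metis norm_triangle_ineq)
      then show ?thesis using 1 2 C\<eta> unfolding dist_norm by linarith
    qed
    then show "\<exists>d>0. \<forall>x'\<in>{0..t}. dist x' u < d \<longrightarrow> dist (S (\<epsilon> * (t - x')) (v x')) (S (\<epsilon> * (t - u)) (v u)) < e"
      using \<delta>1(1) \<delta>2(1) by (intro exI [of _ "min \<delta>1 \<delta>2"]) auto
  qed
qed

text \<open>The inequality is available on a dense set only, since the stochastic estimate holds at
  dyadic times. Because the weight decays at rate \<open>2 * c\<close>, twice the constant in the
  inequality, the integral contributes at most half of the maximum \<open>m\<close> of the weighted
  function. Continuity carries \<open>h \<le> a + m / 2\<close> to the maximiser, so
  \<open>m \<le> 2 * a\<close>.\<close>

lemma gronwall_dense:
  fixes f :: "real \<Rightarrow> real"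
  assumes f: "continuous_on {0..\<tau>} f" "\<And>t. t \<in> {0..\<tau>} \<Longrightarrow> 0 \<le> f t" and c: "0 < c" and \<tau>: "0 \<le> \<tau>"
    and D: "D \<subseteq> {0..\<tau>}" "{0..\<tau>} \<subseteq> closure D"
    and le: "\<And>t. t \<in> D \<Longrightarrow> f t \<le> a + c * integral {0..t} f"
  shows "t \<in> {0..\<tau>} \<Longrightarrow> f t \<le> 2 * a * exp (2 * c * t)"
proof -
  define h where "h t = f t * exp (- (2 * c * t))" for t
  have h: "continuous_on {0..\<tau>} h" unfolding h_def by (intro continuous_intros f)
  obtain s where s: "s \<in> {0..\<tau>}" "\<And>t. t \<in> {0..\<tau>} \<Longrightarrow> h t \<le> h s"
    using continuous_attains_sup [OF compact_Icc _ h] \<tau> by force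
  define m where "m = h s"
  have m0: "0 \<le> m" unfolding m_def h_def using f(2) [OF s(1)] by simp
  have fm: "f u \<le> m * exp (2 * c * u)" if "u \<in> {0..\<tau>}" for u
  proof -
    have "h u * exp (2 * c * u) \<le> m * exp (2 * c * u)" using s(2) [OF that] by (intro mult_right_mono) (auto simp: m_def)
    then show ?thesis by (simp add: h_def mult.assoc exp_add [symmetric])
  qed
  have a0: "0 \<le> a" if "D \<noteq> {}"
  proof (rule ccontr)
    assume na: "\<not> 0 \<le> a"
    have "0 \<in> closure D" using D(2) \<tau> by auto
    have "\<forall>t\<in>D. f t \<le> a + c * integral {0..t} f" using le by blast
    have cont: "continuous_on {0..\<tau>} (\<lambda>t. a + c * integral {0..t} f - f t)"
      using f(1) by (intro continuous_intros indefinite_integral_continuous_1 integrable_continuous_real)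
    have "0 \<le> a + c * integral {0..0} f - f 0"
      by (rule continuous_ge_on_closure [of D "\<lambda>t. a + c * integral {0..t} f - f t" 0 0])
         (use le \<open>0 \<in> closure D\<close> D cont in \<open>auto intro: continuous_on_subset simp: closure_minimal dest: closure_minimal [THEN subsetD]\<close>)
    then show False using na f(2) [of 0] \<tau> by simp
  qed
  have hD: "h t \<le> a + m / 2" if t: "t \<in> D" for t
  proof -
    have t': "0 \<le> t" "t \<le> \<tau>" using t D by auto
    have FTC: "((\<lambda>u. m * exp (2 * c * u)) has_integral (m / (2 * c) * exp (2 * c * t) - m / (2 * c) * exp (2 * c * 0))) {0..t}"
      using c t' by (intro fundamental_theorem_of_calculus)
        (auto intro!: derivative_eq_intros simp: has_real_derivative_iff_has_vector_derivative [symmetric])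
    have "integral {0..t} f \<le> integral {0..t} (\<lambda>u. m * exp (2 * c * u))"
    proof (rule integral_le)
      show "f integrable_on {0..t}"
        using f(1) t' by (intro integrable_continuous_real) (auto intro: continuous_on_subset)
      show "(\<lambda>u. m * exp (2 * c * u)) integrable_on {0..t}" using FTC by (rule has_integral_integrable)
      show "f u \<le> m * exp (2 * c * u)" if "u \<in> {0..t}" for u using that t' by (intro fm) auto
    qed
    also have "\<dots> = m / (2 * c) * exp (2 * c * t) - m / (2 * c)" using integral_unique [OF FTC] by (simp only: mult_zero_right exp_zero mult_1_right)
    also have "\<dots> \<le> m / (2 * c) * exp (2 * c * t)" using m0 c by simp
    finally have "c * integral {0..t} f \<le> c * (m / (2 * c) * exp (2 * c * t))" using c by (intro mult_left_mono) auto
    also have "\<dots> = m / 2 * exp (2 * c * t)" using c by simp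
    finally have "f t \<le> a + m / 2 * exp (2 * c * t)" using le [OF t] by linarith
    then have "f t * exp (- (2 * c * t)) \<le> (a + m / 2 * exp (2 * c * t)) * exp (- (2 * c * t))" by (intro mult_right_mono) auto
    also have "\<dots> = a * exp (- (2 * c * t)) + m / 2" by (simp add: algebra_simps exp_add [symmetric])
    also have "\<dots> \<le> a * 1 + m / 2" using a0 t t' c by (intro add_right_mono mult_left_mono) auto
    finally show ?thesis by (simp add: h_def)
  qed
  have clD: "closure D = {0..\<tau>}" using D closure_minimal [OF D(1) closed_real_atLeastAtMost] by blast
  have "m \<le> a + m / 2"
    unfolding m_def by (rule continuous_le_on_closure [of D h s]) (use h s(1) hD clD in \<open>auto simp: m_def\<close>)
  then have "m \<le> 2 * a" by simp
  then show "t \<in> {0..\<tau>} \<Longrightarrow> f t \<le> 2 * a * exp (2 * c * t)"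
    using fm [of t] by (meson exp_ge_zero mult_right_mono order_trans)
qed

text \<open>Binary digits are removed from the last one on: an odd numerator steps to its left
  neighbour at the cost of one increment, and the coarser point is propagated by the semigroup.
  Increments are controlled only up to the time considered, which keeps the bound compatible with
  localisation.\<close>

lemma dyadic_chaining:
  fixes S :: "real \<Rightarrow> 'h::real_normed_vector \<Rightarrow>\<^sub>L 'h" and Z :: "real \<Rightarrow> 'h"
  assumes S: "c0_semigroup S" and C: "0 \<le> C" "\<And>r. r \<in> {0..1} \<Longrightarrow> norm (S r) \<le> C" and \<epsilon>: "\<epsilon> \<in> {0..1}"
    and Z0: "Z 0 = 0"
    and inc: "\<And>j i'. 1 \<le> i' \<Longrightarrow> real i' / 2 ^ j \<le> real i / 2 ^ k \<Longrightarrow>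
      norm (Z (real i' / 2 ^ j) - S (\<epsilon> / 2 ^ j) (Z (real (i' - 1) / 2 ^ j))) \<le> b j"
    and i: "i \<le> 2 ^ k" and b: "\<And>j. 0 \<le> b j"
  shows "norm (Z (real i / 2 ^ k)) \<le> C * (\<Sum>j\<le>k. b j)"
proof -
  have sg: "S (r + s) x = S r (S s x)" if "0 \<le> r" "0 \<le> s" for r s x
    using S that by (simp add: c0_semigroup_def)
  \<comment> \<open>The free time \<open>r\<close> collects the propagation by the semigroup law.
    The norm of \<open>S\<close> is then used once per increment; bounding it at every level would
    produce powers of \<open>C\<close>.\<close>
  have main: "norm (S (\<epsilon> * r) (Z (real i' / 2 ^ l))) \<le> C * (\<Sum>j\<le>l. b j)"
    if "real i' / 2 ^ l \<le> real i / 2 ^ k" "i' \<le> 2 ^ l" "0 \<le> r" "real i' / 2 ^ l + r \<le> 1" for i' l r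
    using that
  proof (induction l arbitrary: i' r)
    case 0
    have r: "\<epsilon> * r \<in> {0..1}"
    proof -
      have "\<epsilon> * r \<le> 1 * 1" using \<epsilon> 0 by (intro mult_mono) auto
      then show ?thesis using \<epsilon> 0 by simp
    qed
    consider "i' = 0" | "i' = 1" using 0 by fastforce
    then show ?case
    proof cases
      case 1
      then show ?thesis using Z0 C b by (simp add: blinfun.zero_right)
    next
      case 2
      have "norm (Z 1) \<le> b 0" using inc [of 1 0] 0 2 Z0 by (simp add: blinfun.zero_right)
      then have "norm (S (\<epsilon> * r)) * norm (Z 1) \<le> C * b 0" using C r by (intro mult_mono) auto
      then show ?thesis using 2 by (simp, intro order_trans [OF norm_blinfun])
    qed
  next
    case (Suc l)
    have r: "\<epsilon> * r \<in> {0..1}"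
    proof -
      have "r \<le> 1" using Suc.prems(4) by (smt (verit) divide_nonneg_nonneg of_nat_0_le_iff zero_le_power)
      then have "\<epsilon> * r \<le> 1 * 1" using \<epsilon> Suc.prems by (intro mult_mono) auto
      then show ?thesis using \<epsilon> Suc.prems by simp
    qed
    have mono: "C * (\<Sum>j\<le>l. b j) \<le> C * (\<Sum>j\<le>Suc l. b j)"
      using b C by (intro mult_left_mono) auto
    show ?case
    proof (cases "even i'")
      case True
      then obtain n where n: "i' = 2 * n" by (elim evenE)
      then have eq: "real i' / 2 ^ Suc l = real n / 2 ^ l" by simp
      have "norm (S (\<epsilon> * r) (Z (real n / 2 ^ l))) \<le> C * (\<Sum>j\<le>l. b j)"
        using Suc.prems n unfolding eq by (intro Suc.IH) auto
      then show ?thesis unfolding eq using mono by linarith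
    next
      case False
      then obtain n where n: "i' = 2 * n + 1" by (elim oddE)
      let ?t = "real i' / 2 ^ Suc l" and ?s = "real n / 2 ^ l"
      have s: "real (i' - 1) / 2 ^ Suc l = ?s" using n by simp
      have ts: "?t = ?s + 1 / 2 ^ Suc l" using n by (simp add: field_simps)
      have d: "norm (Z ?t - S (\<epsilon> / 2 ^ Suc l) (Z ?s)) \<le> b (Suc l)"
        using inc [of i' "Suc l"] Suc.prems(1) n unfolding s by simp
      have "S (\<epsilon> * r) (Z ?t) = S (\<epsilon> * r) (S (\<epsilon> / 2 ^ Suc l) (Z ?s)) + S (\<epsilon> * r) (Z ?t - S (\<epsilon> / 2 ^ Suc l) (Z ?s))"
        by (simp add: blinfun.diff_right)
      also have "S (\<epsilon> * r) (S (\<epsilon> / 2 ^ Suc l) (Z ?s)) = S (\<epsilon> * (r + 1 / 2 ^ Suc l)) (Z ?s)"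
        using \<epsilon> Suc.prems by (subst sg [symmetric]) (auto simp: distrib_left)
      finally have "norm (S (\<epsilon> * r) (Z ?t)) \<le> norm (S (\<epsilon> * (r + 1 / 2 ^ Suc l)) (Z ?s)) + norm (S (\<epsilon> * r) (Z ?t - S (\<epsilon> / 2 ^ Suc l) (Z ?s)))"
        by (metis norm_triangle_ineq)
      moreover have "norm (S (\<epsilon> * (r + 1 / 2 ^ Suc l)) (Z ?s)) \<le> C * (\<Sum>j\<le>l. b j)"
      proof (rule Suc.IH)
        have "?s \<le> ?t" unfolding ts by simp
        then show "?s \<le> real i / 2 ^ k" using Suc.prems(1) by simp
        show "n \<le> 2 ^ l" using Suc.prems(2) n by simp
        show "?s + (r + 1 / 2 ^ Suc l) \<le> 1" using Suc.prems(4) ts by simp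
      qed (use Suc.prems in auto)
      moreover have "norm (S (\<epsilon> * r) (Z ?t - S (\<epsilon> / 2 ^ Suc l) (Z ?s))) \<le> C * b (Suc l)"
        using C(2) [OF r] C(1) d by (intro order_trans [OF norm_blinfun] mult_mono) auto
      ultimately show ?thesis by (simp add: distrib_left)
    qed
  qed
  have "S 0 = id_blinfun" using S by (simp add: c0_semigroup_def)
  then show ?thesis using main [of i k 0] i by simp
qed

lemma integral_Cauchy_Schwarz:
  fixes f h :: "'a \<Rightarrow> real"
  assumes [measurable]: "f \<in> borel_measurable M" "h \<in> borel_measurable M"
    and int: "integrable M (\<lambda>x. (f x)\<^sup>2)" "integrable M (\<lambda>x. (h x)\<^sup>2)"
  shows "integrable M (\<lambda>x. f x * h x)"
    and "(\<integral>x. \<bar>f x * h x\<bar> \<partial>M)\<^sup>2 \<le> (\<integral>x. (f x)\<^sup>2 \<partial>M) * (\<integral>x. (h x)\<^sup>2 \<partial>M)"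
proof -
  have bd: "\<bar>f x * h x\<bar> \<le> \<bar>(f x)\<^sup>2 + (h x)\<^sup>2\<bar>" for x
  proof -
    have "0 \<le> (\<bar>f x\<bar> - \<bar>h x\<bar>)\<^sup>2" by simp
    then have "2 * (\<bar>f x\<bar> * \<bar>h x\<bar>) \<le> (f x)\<^sup>2 + (h x)\<^sup>2" by (simp add: power2_diff)
    moreover have "0 \<le> \<bar>f x\<bar> * \<bar>h x\<bar>" by simp
    ultimately have "\<bar>f x\<bar> * \<bar>h x\<bar> \<le> (f x)\<^sup>2 + (h x)\<^sup>2" by linarith
    then show ?thesis by (simp add: abs_mult)
  qed
  show 1: "integrable M (\<lambda>x. f x * h x)"
    by (rule Bochner_Integration.integrable_bound [OF Bochner_Integration.integrable_add [OF int]]) (use bd in auto)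
  have e1: "(\<integral>\<^sup>+x. ennreal \<bar>f x\<bar> * ennreal \<bar>h x\<bar> \<partial>M) = ennreal (\<integral>x. \<bar>f x * h x\<bar> \<partial>M)"
    using integrable_abs [OF 1] by (subst nn_integral_eq_integral [symmetric]) (auto simp: abs_mult ennreal_mult)
  have e2: "(\<integral>\<^sup>+x. (ennreal \<bar>k x\<bar>)\<^sup>2 \<partial>M) = ennreal (\<integral>x. (k x)\<^sup>2 \<partial>M)" if "integrable M (\<lambda>x. (k x)\<^sup>2)" for k
    using that by (subst nn_integral_eq_integral [symmetric]) (auto simp: ennreal_power)
  have "(\<integral>\<^sup>+x. ennreal \<bar>f x\<bar> * ennreal \<bar>h x\<bar> \<partial>M)\<^sup>2 \<le> (\<integral>\<^sup>+x. (ennreal \<bar>f x\<bar>)\<^sup>2 \<partial>M) * (\<integral>\<^sup>+x. (ennreal \<bar>h x\<bar>)\<^sup>2 \<partial>M)"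
    by (rule Cauchy_Schwarz_nn_integral) auto
  then show "(\<integral>x. \<bar>f x * h x\<bar> \<partial>M)\<^sup>2 \<le> (\<integral>x. (f x)\<^sup>2 \<partial>M) * (\<integral>x. (h x)\<^sup>2 \<partial>M)"
    unfolding e1 e2 [OF int(1)] e2 [OF int(2)]
    by (simp add: ennreal_power ennreal_mult [symmetric] ennreal_le_iff)
qed

section \<open>Deviation of a mild solution from its controlled drift\<close>

definition scale_elementary :: "real \<Rightarrow> ('w, real) elementary \<Rightarrow> ('w, real) elementary" where
  "scale_elementary c d = map (\<lambda>(k, a, b, \<xi>). (k, a, b, \<lambda>\<omega>. c * \<xi> \<omega>)) d"

lemma coef_scale: "coef (scale_elementary c d) k u \<omega> = c * coef d k u \<omega>"
  by (induction d) (auto simp: scale_elementary_def coef_Cons algebra_simps)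

lemma elementary_integral_scale: "elementary_integral \<beta> (scale_elementary c d) t \<omega> = c * elementary_integral \<beta> d t \<omega>"
  by (induction d) (auto simp: scale_elementary_def elementary_integral_Cons algebra_simps)

lemma idx_scale: "fst ` set (scale_elementary c d) = fst ` set d"
  by (force simp: scale_elementary_def)

lemma deterministic_scale: "deterministic d \<Longrightarrow> deterministic (scale_elementary c d)"
  by (fastforce simp: deterministic_def scale_elementary_def)

lemma elementary_process_scale:
  assumes "elementary_process M \<F> I d"
  shows "elementary_process M \<F> I (scale_elementary c d)"
  using assms
proof (induction rule: elementary_induct)
  case (Cons k a b \<xi> e)
  have "(\<lambda>\<omega>. c * \<xi> \<omega>) ` space M = (*) c ` \<xi> ` space M" by auto
  then have "bounded ((\<lambda>\<omega>. c * \<xi> \<omega>) ` space M)"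
    using Cons(5) bounded_linear_image [of "\<xi> ` space M" "(*) c"] bounded_linear_mult_right by metis
  then show ?case using Cons by (simp add: scale_elementary_def elementary_process_Cons)
qed (simp add: scale_elementary_def)

lemma control_scale: "control g (scale_elementary c d) u = c *\<^sub>R control g d u"
  by (simp add: control_def idx_scale coef_scale scaleR_sum_right)

lemma energy_scale: "energy (scale_elementary c d) J t \<omega> = c\<^sup>2 * energy d J t \<omega>"
  by (simp add: energy_def coef_scale power_mult_distrib sum_distrib_left [symmetric])

lemma set_integrable_coef_continuous:
  fixes h :: "real \<Rightarrow> 'h::{banach, second_countable_topology}" and d :: "('w, real) elementary"
  assumes h: "continuous_on {0..t} h"
  shows "set_integrable lborel {0..t} (\<lambda>u. coef d k u \<omega> *\<^sub>R h u)"
proof -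
  obtain C where C: "\<And>u. norm (coef d k u \<omega>) \<le> C" using coef_bounded [of d k \<omega>] by blast
  have int: "integrable lborel (\<lambda>u. indicator {0..t} u *\<^sub>R h u)"
    by (rule borel_integrable_compact [OF compact_Icc h])
  then have [measurable]: "(\<lambda>u. indicator {0..t} u *\<^sub>R h u) \<in> borel_measurable borel" by auto
  have "integrable lborel (\<lambda>u. coef d k u \<omega> *\<^sub>R (indicator {0..t} u *\<^sub>R h u))"
  proof (rule Bochner_Integration.integrable_bound)
    show "integrable lborel (\<lambda>u. C *\<^sub>R (indicator {0..t} u *\<^sub>R h u))" using int by (rule integrable_scaleR_right)
    show "AE u in lborel. norm (coef d k u \<omega> *\<^sub>R (indicator {0..t} u *\<^sub>R h u)) \<le> norm (C *\<^sub>R (indicator {0..t} u *\<^sub>R h u))"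
    proof (intro AE_I2)
      fix u
      have "norm (coef d k u \<omega>) \<le> norm C" using C [of u] by simp
      then show "norm (coef d k u \<omega> *\<^sub>R (indicator {0..t} u *\<^sub>R h u)) \<le> norm (C *\<^sub>R (indicator {0..t} u *\<^sub>R h u))"
        unfolding norm_scaleR [of "coef d k u \<omega>"] norm_scaleR [of C] by (intro mult_right_mono) auto
    qed
  qed measurable
  then show ?thesis by (simp add: set_integrable_def mult.commute)
qed

text \<open>A control involves finitely many basis vectors, so the integrand is a finite sum of
  bounded step functions times continuous paths.\<close>

lemma set_integrable_control:
  fixes S :: "real \<Rightarrow> 'h::{real_inner, banach, second_countable_topology} \<Rightarrow>\<^sub>L 'h"
    and G :: "'h \<Rightarrow> 'u::real_inner \<Rightarrow>\<^sub>L 'h" and d :: "('w, real) elementary"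
  assumes S: "c0_semigroup S" and G: "\<And>y. continuous_on UNIV (\<lambda>x. G x y)"
    and \<epsilon>: "\<epsilon> \<in> {0..1}" and t: "t \<in> {0..1}" and v: "continuous_on {0..t} v"
  shows "set_integrable lborel {0..t} (\<lambda>u. S (\<epsilon> * (t - u)) (G (v u) (control g d u)))"
    and "set_integrable lborel {0..t} (\<lambda>u. G (v u) (control g d u))"
proof -
  have Gv: "continuous_on {0..t} (\<lambda>u. G (v u) y)" for y
    using continuous_on_compose2 [OF G [of y] v] by simp
  have "set_integrable lborel {0..t} (\<lambda>u. \<Sum>k\<in>fst ` set d. coef d k u undefined *\<^sub>R S (\<epsilon> * (t - u)) (G (v u) (g k)))"
    by (intro set_integral_finite_sum(1) set_integrable_coef_continuous c0_semigroup_convolution_continuous S \<epsilon> t Gv)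
  then show "set_integrable lborel {0..t} (\<lambda>u. S (\<epsilon> * (t - u)) (G (v u) (control g d u)))"
    by (simp add: control_def blinfun.sum_right blinfun.scaleR_right)
  have "set_integrable lborel {0..t} (\<lambda>u. \<Sum>k\<in>fst ` set d. coef d k u undefined *\<^sub>R G (v u) (g k))"
    by (intro set_integral_finite_sum(1) set_integrable_coef_continuous Gv)
  then show "set_integrable lborel {0..t} (\<lambda>u. G (v u) (control g d u))"
    by (simp add: control_def blinfun.sum_right blinfun.scaleR_right)
qed

lemma exp_minus_le_power4: "exp (- y) \<le> 256 / y ^ 4" if "0 < y" for y :: real
proof -
  have "(y / 4) ^ 4 \<le> exp (y / 4) ^ 4"
    using that by (intro power_mono order_trans [OF _ exp_ge_add_one_self [of "y / 4"]]) auto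
  also have "\<dots> = exp y" by (simp add: exp_of_nat_mult [symmetric])
  finally have "y ^ 4 / 256 \<le> exp y" by (simp add: power_divide)
  then show ?thesis using that by (simp add: exp_minus field_simps)
qed

text \<open>Level \<open>j\<close> has \<open>2 ^ j\<close> increments, each with energy at most
  \<open>R / 2 ^ j\<close>. The parameter \<open>(7/5) ^ j\<close> of the exponential grows slower
  than the square root of \<open>2 ^ j\<close>, so its compensator stays below \<open>2 * R\<close>;
  its product with the threshold grows like \<open>(63/50) ^ j\<close>. Since
  \<open>(63/50) ^ 4\<close> exceeds \<open>5 / 2\<close>, a fourth-power bound for the exponential
  beats the number of increments with ratio \<open>4/5\<close> and leaves the factor
  \<open>\<epsilon>\<^sup>2\<close>.\<close>

lemma chaining_level_bound:
  fixes \<epsilon> \<eta> R :: real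
  assumes "0 < \<epsilon>" "0 < \<eta>" "0 \<le> R"
  shows "2 ^ j * exp (1 - (7/5) ^ j * (\<eta> * (9/10) ^ j / sqrt \<epsilon>) + 2 * ((7/5) ^ j)\<^sup>2 * (R / 2 ^ j))
    \<le> 256 * exp (1 + 2 * R) * \<epsilon>\<^sup>2 / \<eta> ^ 4 * (4/5) ^ j"
proof -
  define b :: real where "b = 63 / 50"
  define y where "y = \<eta> * b ^ j / sqrt \<epsilon>"
  have y: "0 < y" using assms by (simp add: y_def b_def)
  have e1: "(7/5) ^ j * (\<eta> * (9/10) ^ j / sqrt \<epsilon>) = y"
  proof -
    have "(7/5 :: real) ^ j * (9/10) ^ j = (63/50) ^ j" by (simp add: power_mult_distrib [symmetric])
    then show ?thesis by (simp add: y_def b_def)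
  qed
  have e2: "2 * ((7/5) ^ j)\<^sup>2 * (R / 2 ^ j) \<le> 2 * R"
  proof -
    have "((7/5 :: real) ^ j)\<^sup>2 = ((7/5)\<^sup>2) ^ j" by (simp only: power_mult [symmetric] mult.commute)
    then have "((7/5 :: real) ^ j)\<^sup>2 / 2 ^ j = ((7/5)\<^sup>2 / 2) ^ j" by (simp only: power_divide)
    also have "\<dots> \<le> 1" by (intro power_le_one) (auto simp: power2_eq_square)
    finally have "((7/5 :: real) ^ j)\<^sup>2 / 2 ^ j * (2 * R) \<le> 1 * (2 * R)" using assms by (intro mult_right_mono) auto
    then show ?thesis by (simp add: mult_ac)
  qed
  have y4: "y ^ 4 = \<eta> ^ 4 * (b ^ 4) ^ j / \<epsilon>\<^sup>2"
  proof -
    have "sqrt \<epsilon> ^ 4 = (sqrt \<epsilon> ^ 2) ^ 2" by (simp only: power_mult [symmetric]) simp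
    also have "\<dots> = \<epsilon>\<^sup>2" using assms by simp
    finally have *: "sqrt \<epsilon> ^ 4 = \<epsilon>\<^sup>2" .
    have "(b ^ j) ^ 4 = (b ^ 4) ^ j" by (simp only: power_mult [symmetric] mult.commute)
    then show ?thesis by (simp only: y_def power_mult_distrib power_divide *)
  qed
  have "2 ^ j * exp (1 - (7/5) ^ j * (\<eta> * (9/10) ^ j / sqrt \<epsilon>) + 2 * ((7/5) ^ j)\<^sup>2 * (R / 2 ^ j)) \<le> 2 ^ j * exp ((1 + 2 * R) + (- y))"
    using e1 e2 by simp
  also have "\<dots> = 2 ^ j * (exp (1 + 2 * R) * exp (- y))" by (simp only: exp_add)
  also have "\<dots> \<le> 2 ^ j * (exp (1 + 2 * R) * (256 / y ^ 4))"
    using exp_minus_le_power4 [OF y] by (intro mult_left_mono) auto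
  also have "\<dots> = 256 * exp (1 + 2 * R) * \<epsilon>\<^sup>2 / \<eta> ^ 4 * (2 ^ j / (b ^ 4) ^ j)"
    using assms unfolding y4 by (simp add: field_simps)
  also have "\<dots> \<le> 256 * exp (1 + 2 * R) * \<epsilon>\<^sup>2 / \<eta> ^ 4 * (4/5) ^ j"
  proof (rule mult_left_mono)
    have "(2 :: real) ^ j / (b ^ 4) ^ j = (2 / b ^ 4) ^ j" by (simp only: power_divide)
    also have "\<dots> \<le> (4/5) ^ j" by (intro power_mono) (auto simp: b_def power4_eq_xxxx)
    finally show "(2 :: real) ^ j / (b ^ 4) ^ j \<le> (4/5) ^ j" .
  qed (use assms in auto)
  finally show ?thesis .
qed

section \<open>Chaining for the mild solution\<close>

context wiener_setting
begin

text \<open>Elementary integrals vanish at time 0 and limits in probability are unique. This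
  provides the starting value for the chaining.\<close>

lemma stochastic_integral_at_zero:
  assumes "has_stochastic_integral M \<F> I g \<beta> 0 \<Phi> Y"
  shows "AE \<omega> in M. Y \<omega> = (0 :: 'h::{real_inner, second_countable_topology, banach})"
proof -
  from assms obtain e where e: "\<And>n. elementary_process M \<F> I (e n)"
    and C: "converges_in_probability M (\<lambda>n. elementary_integral \<beta> (e n) 0) Y" and [measurable]: "Y \<in> borel_measurable M"
    unfolding has_stochastic_integral_def by blast
  have "AE \<omega> in M. \<not> (1 / real (Suc n) < dist 0 (Y \<omega>))" for n
  proof -
    have "(\<lambda>n'. prob {\<omega>\<in>space M. 1 / real (Suc n) < dist 0 (Y \<omega>)}) \<longlonglongrightarrow> 0"
      using C elementary_integral_zero [OF e] unfolding converges_in_probability_def by simp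
    then have "prob {\<omega>\<in>space M. 1 / real (Suc n) < dist 0 (Y \<omega>)} = 0"
      using LIMSEQ_const_iff by blast
    moreover have "{\<omega>\<in>space M. 1 / real (Suc n) < dist 0 (Y \<omega>)} \<in> sets M" by measurable
    ultimately show ?thesis
      by (intro AE_I [where N = "{\<omega>\<in>space M. 1 / real (Suc n) < dist 0 (Y \<omega>)}"]) (auto simp: emeasure_eq_measure)
  qed
  then have "\<forall>n. AE \<omega> in M. \<not> (1 / real (Suc n) < dist 0 (Y \<omega>))" by (rule allI)
  then have "AE \<omega> in M. \<forall>n. \<not> (1 / real (Suc n) < dist 0 (Y \<omega>))" by (rule AE_all_countable [THEN iffD2])
  then show ?thesis
  proof eventually_elim
    case (elim \<omega>)
    show ?case
    proof (rule ccontr)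
      assume "Y \<omega> \<noteq> 0"
      then obtain n where "1 / real (Suc n) < norm (Y \<omega>)" using nat_approx_posE by (metis zero_less_norm_iff)
      then show False using elim by (simp add: dist_norm)
    qed
  qed
qed

definition tilted :: "('w, real) elementary \<Rightarrow> 'w measure" where
  "tilted d = density M (\<lambda>\<omega>. ennreal (girsanov d 1 \<omega>))"

lemma emeasure_tilted:
  "elementary_process M \<F> I d \<Longrightarrow> N \<in> sets M \<Longrightarrow> emeasure (tilted d) N = (\<integral>\<^sup>+\<omega>. ennreal (girsanov d 1 \<omega>) * indicator N \<omega> \<partial>M)"
  unfolding tilted_def by (intro emeasure_density) auto

lemma sets_tilted [simp]: "sets (tilted d) = sets M" and space_tilted [simp]: "space (tilted d) = space M"
  by (simp_all add: tilted_def)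

text \<open>Each dyadic increment has an exceptional set from
  \<open>stochastic_increment_tail\<close>. Their union is small by
  \<open>chaining_level_bound\<close>, and off it \<open>dyadic_chaining\<close> adds up the
  thresholds. The ball condition refers only to times up to the one considered, so the conclusion
  can be used before an exit. The constants \<open>1280 = 256 * 5\<close> and \<open>10\<close> come
  from the geometric series with ratios \<open>4/5\<close> and \<open>9/10\<close>.\<close>

lemma mild_solution_deviation:
  fixes S :: "real \<Rightarrow> 'h::{real_inner, banach, second_countable_topology} \<Rightarrow>\<^sub>L 'h"
    and G :: "'h \<Rightarrow> 'u \<Rightarrow>\<^sub>L 'h" and X :: "real \<Rightarrow> 'w \<Rightarrow> 'h"
  assumes S: "c0_semigroup S" and C: "1 \<le> C" "\<And>r. r \<in> {0..1} \<Longrightarrow> norm (S r) \<le> C"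
    and Gc: "\<And>y. continuous_on UNIV (\<lambda>x. G x y)"
    and G_hs: "\<And>x. hilbert_schmidt I g (G x)" and G_growth: "\<And>x. hs_norm I g (G x) \<le> \<Lambda> * (1 + norm x)" and \<Lambda>: "0 < \<Lambda>"
    and \<epsilon>: "\<epsilon> \<in> {0<..1}" and X: "mild_solution M \<F> I g \<beta> S F G \<epsilon> x X"
    and d: "elementary_process M \<F> I d" "deterministic d" and \<eta>: "0 < \<eta>" and \<rho>: "0 \<le> \<rho>"
    and R: "R = (C * (\<Lambda> * (1 + \<rho>)))\<^sup>2"
  shows "\<exists>N\<in>sets M. emeasure (tilted (scale_elementary (1 / sqrt \<epsilon>) d)) N \<le> ennreal (1280 * exp (1 + 2 * R) * \<epsilon>\<^sup>2 / \<eta> ^ 4) \<and>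
    (\<forall>\<omega>\<in>space M - N. \<forall>i k. i \<le> 2 ^ k \<longrightarrow> (\<forall>u\<in>{0<..real i / 2 ^ k}. norm (X u \<omega>) \<le> \<rho>) \<longrightarrow>
       norm (X (real i / 2 ^ k) \<omega> - (S (\<epsilon> * (real i / 2 ^ k)) x
         + \<epsilon> *\<^sub>R (LINT u:{0..real i / 2 ^ k}|lebesgue. S (\<epsilon> * (real i / 2 ^ k - u)) (F (\<epsilon> * u) (X u \<omega>)))
         + (LINT u:{0..real i / 2 ^ k}|lborel. S (\<epsilon> * (real i / 2 ^ k - u)) (G (X u \<omega>) (control g d u))))) \<le> 10 * C * \<eta>)"
proof -
  \<comment> \<open>The factor \<open>sqrt \<epsilon>\<close> in front of the noise will cancel
    \<open>1 / sqrt \<epsilon>\<close>, so that the drift of the equation is produced by the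
    unscaled control \<open>d\<close>.\<close>
  define d' where "d' = scale_elementary (1 / sqrt \<epsilon>) d"
  have d': "elementary_process M \<F> I d'" "deterministic d'"
    unfolding d'_def using d by (auto intro: elementary_process_scale deterministic_scale)
  have \<epsilon>0: "0 < \<epsilon>" "\<epsilon> \<le> 1" using \<epsilon> by auto
  have R0: "0 \<le> R" by (simp add: R)
  define \<Phi> where "\<Phi> t u \<omega> = S (\<epsilon> * (t - u)) o\<^sub>L G (X u \<omega>)" for t u \<omega>
  define drift where "drift t \<omega> = S (\<epsilon> * t) x + \<epsilon> *\<^sub>R (LINT u:{0..t}|lebesgue. S (\<epsilon> * (t - u)) (F (\<epsilon> * u) (X u \<omega>)))" for t \<omega>
  from X have Xc: "\<And>\<omega>. \<omega> \<in> space M \<Longrightarrow> continuous_on {0..1} (\<lambda>t. X t \<omega>)"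
    and "\<forall>t\<in>{0..1}. \<exists>Y. has_stochastic_integral M \<F> I g \<beta> t (\<Phi> t) Y \<and> (AE \<omega> in M. X t \<omega> = drift t \<omega> + sqrt \<epsilon> *\<^sub>R Y \<omega>)"
    unfolding mild_solution_def \<Phi>_def drift_def by auto
  then have "\<exists>Y. \<forall>t\<in>{0..1}. has_stochastic_integral M \<F> I g \<beta> t (\<Phi> t) (Y t) \<and> (AE \<omega> in M. X t \<omega> = drift t \<omega> + sqrt \<epsilon> *\<^sub>R Y t \<omega>)"
    by (intro bchoice)
  then obtain Y where Y: "\<And>t. t \<in> {0..1} \<Longrightarrow> has_stochastic_integral M \<F> I g \<beta> t (\<Phi> t) (Y t)"
    and XY: "\<And>t. t \<in> {0..1} \<Longrightarrow> AE \<omega> in M. X t \<omega> = drift t \<omega> + sqrt \<epsilon> *\<^sub>R Y t \<omega>" by blast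
  define J where "J t \<omega> = (LINT u:{0..t}|lborel. \<Phi> t u \<omega> (control g d' u))" for t \<omega>
  define p where "p j i = real i / 2 ^ j" for j i :: nat
  have p01: "p j i \<in> {0..1}" if "i \<le> 2 ^ j" for i j
  proof -
    have "real i \<le> 2 ^ j" using that by (metis of_nat_le_iff of_nat_numeral of_nat_power)
    then show ?thesis by (simp add: p_def)
  qed
  have "\<exists>N. \<forall>i\<in>{1..2^j}. N i \<in> sets M \<and> emeasure (tilted d') (N i) \<le> ennreal (exp (1 - (7/5) ^ j * (\<eta> * (9/10) ^ j / sqrt \<epsilon>) + 2 * ((7/5) ^ j)\<^sup>2 * (R / 2 ^ j))) \<and>
    (\<forall>\<omega>\<in>space M - N i. hs_energy I g {p j (i - 1)<..p j i} (\<lambda>u. \<Phi> (p j i) u \<omega>) \<le> ennreal (R / 2 ^ j) \<longrightarrow>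
       norm ((Y (p j i) \<omega> - S (\<epsilon> / 2 ^ j) (Y (p j (i - 1)) \<omega>)) - (J (p j i) \<omega> - S (\<epsilon> / 2 ^ j) (J (p j (i - 1)) \<omega>))) \<le> \<eta> * (9/10) ^ j / sqrt \<epsilon>)" for j
  proof (rule bchoice, rule ballI)
    fix i assume i: "i \<in> {1..2 ^ j :: nat}"
    let ?t = "p j i" and ?s = "p j (i - 1)"
    have t: "?t \<in> {0..1}" using i by (intro p01) simp
    have s: "?s \<in> {0..1}" using i by (intro p01 order_trans [OF diff_le_self]) simp
    have st: "?t - ?s = 1 / 2 ^ j" using i by (simp add: p_def diff_divide_distrib of_nat_diff)
    have le: "?s \<le> ?t" by (simp add: p_def divide_right_mono)
    \<comment> \<open>Up to the earlier time the two integrands differ by a fixed operator only.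
      This is why \<open>Y\<close> at \<open>?t\<close> is compared with the propagated value at
      \<open>?s\<close> and not with the value itself.\<close>
    have rel: "\<Phi> ?t u \<omega> = S (\<epsilon> / 2 ^ j) o\<^sub>L \<Phi> ?s u \<omega>" if "u \<in> {0..?s}" for u \<omega>
    proof -
      have "\<epsilon> * (?t - u) = \<epsilon> / 2 ^ j + \<epsilon> * (?s - u)"
        using st by (simp add: algebra_simps)
      moreover have "S (\<epsilon> / 2 ^ j + \<epsilon> * (?s - u)) = S (\<epsilon> / 2 ^ j) o\<^sub>L S (\<epsilon> * (?s - u))"
        using S \<epsilon>0 that by (simp add: c0_semigroup_def)
      ultimately show ?thesis by (intro blinfun_eqI) (simp add: \<Phi>_def)
    qed
    have "\<exists>N\<in>sets M. (\<integral>\<^sup>+\<omega>. ennreal (girsanov d' 1 \<omega>) * indicator N \<omega> \<partial>M) \<le> ennreal (exp (1 - (7/5) ^ j * (\<eta> * (9/10) ^ j / sqrt \<epsilon>) + 2 * ((7/5) ^ j)\<^sup>2 * (R / 2 ^ j))) \<and>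
      (\<forall>\<omega>\<in>space M - N. hs_energy I g {?s<..?t} (\<lambda>u. \<Phi> ?t u \<omega>) \<le> ennreal (R / 2 ^ j) \<longrightarrow>
       norm ((Y ?t \<omega> - S (\<epsilon> / 2 ^ j) (Y ?s \<omega>)) - ((LINT u:{0..?t}|lborel. \<Phi> ?t u \<omega> (control g d' u)) - S (\<epsilon> / 2 ^ j) (LINT u:{0..?s}|lborel. \<Phi> ?s u \<omega> (control g d' u)))) \<le> \<eta> * (9/10) ^ j / sqrt \<epsilon>)"
      using t s le R0 by (intro stochastic_increment_tail Y d' rel) auto
    then obtain N where "N \<in> sets M" "(\<integral>\<^sup>+\<omega>. ennreal (girsanov d' 1 \<omega>) * indicator N \<omega> \<partial>M) \<le> ennreal (exp (1 - (7/5) ^ j * (\<eta> * (9/10) ^ j / sqrt \<epsilon>) + 2 * ((7/5) ^ j)\<^sup>2 * (R / 2 ^ j)))"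
      "\<And>\<omega>. \<omega> \<in> space M - N \<Longrightarrow> hs_energy I g {?s<..?t} (\<lambda>u. \<Phi> ?t u \<omega>) \<le> ennreal (R / 2 ^ j) \<Longrightarrow>
       norm ((Y ?t \<omega> - S (\<epsilon> / 2 ^ j) (Y ?s \<omega>)) - (J ?t \<omega> - S (\<epsilon> / 2 ^ j) (J ?s \<omega>))) \<le> \<eta> * (9/10) ^ j / sqrt \<epsilon>"
      unfolding J_def by blast
    then show "\<exists>N. N \<in> sets M \<and> emeasure (tilted d') N \<le> ennreal (exp (1 - (7/5) ^ j * (\<eta> * (9/10) ^ j / sqrt \<epsilon>) + 2 * ((7/5) ^ j)\<^sup>2 * (R / 2 ^ j))) \<and>
      (\<forall>\<omega>\<in>space M - N. hs_energy I g {?s<..?t} (\<lambda>u. \<Phi> ?t u \<omega>) \<le> ennreal (R / 2 ^ j) \<longrightarrow>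
       norm ((Y ?t \<omega> - S (\<epsilon> / 2 ^ j) (Y ?s \<omega>)) - (J ?t \<omega> - S (\<epsilon> / 2 ^ j) (J ?s \<omega>))) \<le> \<eta> * (9/10) ^ j / sqrt \<epsilon>)"
      by (intro exI [of _ N]) (auto simp: emeasure_tilted [OF d'(1)])
  qed
  then have "\<exists>N. \<forall>j. \<forall>i\<in>{1..2^j}. N j i \<in> sets M \<and> emeasure (tilted d') (N j i) \<le> ennreal (exp (1 - (7/5) ^ j * (\<eta> * (9/10) ^ j / sqrt \<epsilon>) + 2 * ((7/5) ^ j)\<^sup>2 * (R / 2 ^ j))) \<and>
    (\<forall>\<omega>\<in>space M - N j i. hs_energy I g {p j (i - 1)<..p j i} (\<lambda>u. \<Phi> (p j i) u \<omega>) \<le> ennreal (R / 2 ^ j) \<longrightarrow>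
       norm ((Y (p j i) \<omega> - S (\<epsilon> / 2 ^ j) (Y (p j (i - 1)) \<omega>)) - (J (p j i) \<omega> - S (\<epsilon> / 2 ^ j) (J (p j (i - 1)) \<omega>))) \<le> \<eta> * (9/10) ^ j / sqrt \<epsilon>)"
    by (intro choice allI)
  then obtain N where N: "\<And>j i. i \<in> {1..2^j} \<Longrightarrow> N j i \<in> sets M"
    "\<And>j i. i \<in> {1..2^j} \<Longrightarrow> emeasure (tilted d') (N j i) \<le> ennreal (exp (1 - (7/5) ^ j * (\<eta> * (9/10) ^ j / sqrt \<epsilon>) + 2 * ((7/5) ^ j)\<^sup>2 * (R / 2 ^ j)))"
    "\<And>j i \<omega>. i \<in> {1..2^j} \<Longrightarrow> \<omega> \<in> space M - N j i \<Longrightarrow> hs_energy I g {p j (i - 1)<..p j i} (\<lambda>u. \<Phi> (p j i) u \<omega>) \<le> ennreal (R / 2 ^ j) \<Longrightarrow>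
       norm ((Y (p j i) \<omega> - S (\<epsilon> / 2 ^ j) (Y (p j (i - 1)) \<omega>)) - (J (p j i) \<omega> - S (\<epsilon> / 2 ^ j) (J (p j (i - 1)) \<omega>))) \<le> \<eta> * (9/10) ^ j / sqrt \<epsilon>"
    by blast
  \<comment> \<open>The versions \<open>Y t\<close> are chosen separately for each time; only
    countably many dyadic times can share one null set.\<close>
  have "AE \<omega> in M. (\<forall>j i. i \<le> 2 ^ j \<longrightarrow> X (p j i) \<omega> = drift (p j i) \<omega> + sqrt \<epsilon> *\<^sub>R Y (p j i) \<omega>) \<and> Y 0 \<omega> = 0"
  proof (intro AE_conjI)
    show "AE \<omega> in M. \<forall>j i. i \<le> 2 ^ j \<longrightarrow> X (p j i) \<omega> = drift (p j i) \<omega> + sqrt \<epsilon> *\<^sub>R Y (p j i) \<omega>"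
      unfolding AE_all_countable
    proof (intro allI)
      fix j i :: nat
      show "AE \<omega> in M. i \<le> 2 ^ j \<longrightarrow> X (p j i) \<omega> = drift (p j i) \<omega> + sqrt \<epsilon> *\<^sub>R Y (p j i) \<omega>"
      proof (cases "i \<le> 2 ^ j")
        case True
        then show ?thesis using XY [OF p01 [OF True]] by simp
      qed simp
    qed
    show "AE \<omega> in M. Y 0 \<omega> = 0" by (rule stochastic_integral_at_zero [OF Y]) simp
  qed
  then obtain N0 where N0: "N0 \<in> null_sets M"
    "\<And>\<omega>. \<omega> \<in> space M - N0 \<Longrightarrow> (\<forall>j i. i \<le> 2 ^ j \<longrightarrow> X (p j i) \<omega> = drift (p j i) \<omega> + sqrt \<epsilon> *\<^sub>R Y (p j i) \<omega>) \<and> Y 0 \<omega> = 0"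
    unfolding eventually_ae_filter by blast
  define B where "B j = (\<Union>i\<in>{1..2^j}. N j i)" for j
  have B: "B j \<in> sets M" for j unfolding B_def using N(1) by (intro sets.finite_UN) auto
  define NN where "NN = N0 \<union> (\<Union>j. B j)"
  have NN: "NN \<in> sets M" unfolding NN_def using N0(1) B by auto
  have "emeasure (tilted d') NN \<le> emeasure (tilted d') N0 + emeasure (tilted d') (\<Union>j. B j)"
    unfolding NN_def using N0(1) B by (intro emeasure_subadditive) auto
  also have "emeasure (tilted d') N0 = 0"
  proof -
    have "(\<integral>\<^sup>+\<omega>. ennreal (girsanov d' 1 \<omega>) * indicator N0 \<omega> \<partial>M) = (\<integral>\<^sup>+\<omega>. 0 \<partial>M)"
      using AE_not_in [OF N0(1)] by (intro nn_integral_cong_AE) (auto elim!: eventually_mono)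
    then show ?thesis by (simp add: emeasure_tilted [OF d'(1) null_setsD2 [OF N0(1)]])
  qed
  also have "emeasure (tilted d') (\<Union>j. B j) \<le> (\<Sum>j. emeasure (tilted d') (B j))"
    using B by (intro emeasure_subadditive_countably) auto
  also have "\<dots> \<le> (\<Sum>j. ennreal (256 * exp (1 + 2 * R) * \<epsilon>\<^sup>2 / \<eta> ^ 4 * (4/5) ^ j))"
  proof (intro suminf_le allI)
    fix j
    have "emeasure (tilted d') (B j) \<le> (\<Sum>i\<in>{1..2^j}. emeasure (tilted d') (N j i))"
      unfolding B_def using N(1) by (intro emeasure_subadditive_finite) auto
    also have "\<dots> \<le> (\<Sum>i\<in>{1..2^j :: nat}. ennreal (exp (1 - (7/5) ^ j * (\<eta> * (9/10) ^ j / sqrt \<epsilon>) + 2 * ((7/5) ^ j)\<^sup>2 * (R / 2 ^ j))))"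
      by (intro sum_mono N(2))
    also have "\<dots> = ennreal (2 ^ j * exp (1 - (7/5) ^ j * (\<eta> * (9/10) ^ j / sqrt \<epsilon>) + 2 * ((7/5) ^ j)\<^sup>2 * (R / 2 ^ j)))"
      by (simp add: ennreal_mult ennreal_of_nat_eq_real_of_nat)
    also have "\<dots> \<le> ennreal (256 * exp (1 + 2 * R) * \<epsilon>\<^sup>2 / \<eta> ^ 4 * (4/5) ^ j)"
      by (intro ennreal_leI chaining_level_bound \<epsilon>0 \<eta> R0)
    finally show "emeasure (tilted d') (B j) \<le> ennreal (256 * exp (1 + 2 * R) * \<epsilon>\<^sup>2 / \<eta> ^ 4 * (4/5) ^ j)" .
  qed auto
  also have "\<dots> = ennreal (256 * exp (1 + 2 * R) * \<epsilon>\<^sup>2 / \<eta> ^ 4 * 5)"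
  proof (rule suminf_ennreal_eq)
    have "(\<lambda>j. (4/5 :: real) ^ j) sums (1 / (1 - 4/5))" by (rule geometric_sums) simp
    then have "(\<lambda>j. 256 * exp (1 + 2 * R) * \<epsilon>\<^sup>2 / \<eta> ^ 4 * (4/5) ^ j) sums (256 * exp (1 + 2 * R) * \<epsilon>\<^sup>2 / \<eta> ^ 4 * (1 / (1 - 4/5)))"
      by (rule sums_mult)
    then show "(\<lambda>j. 256 * exp (1 + 2 * R) * \<epsilon>\<^sup>2 / \<eta> ^ 4 * (4/5) ^ j) sums (256 * exp (1 + 2 * R) * \<epsilon>\<^sup>2 / \<eta> ^ 4 * 5)" by simp
  qed (use \<eta> in simp)
  finally have small: "emeasure (tilted d') NN \<le> ennreal (1280 * exp (1 + 2 * R) * \<epsilon>\<^sup>2 / \<eta> ^ 4)" by (simp add: mult_ac)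
  have dev: "norm (X (p k i) \<omega> - (drift (p k i) \<omega> + (LINT u:{0..p k i}|lborel. S (\<epsilon> * (p k i - u)) (G (X u \<omega>) (control g d u))))) \<le> 10 * C * \<eta>"
    if \<omega>: "\<omega> \<in> space M - NN" and i: "i \<le> 2 ^ k" and bd: "\<And>u. u \<in> {0<..p k i} \<Longrightarrow> norm (X u \<omega>) \<le> \<rho>" for \<omega> i k
  proof -
    \<comment> \<open>The recentred stochastic convolution, which starts at zero and satisfies the
      increment bounds of the chaining.\<close>
    define Z where "Z t = sqrt \<epsilon> *\<^sub>R (Y t \<omega> - J t \<omega>)" for t
    have good: "\<And>j i. i \<le> 2 ^ j \<Longrightarrow> X (p j i) \<omega> = drift (p j i) \<omega> + sqrt \<epsilon> *\<^sub>R Y (p j i) \<omega>" "Y 0 \<omega> = 0"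
      using N0(2) [of \<omega>] \<omega> by (auto simp: NN_def)
    have J0: "J 0 \<omega> = 0"
      unfolding J_def set_lebesgue_integral_def
      by (intro integral_eq_zero_AE AE_mp [OF AE_lborel_singleton [of "0::real"] AE_I2]) (auto simp: indicator_def)
    have Zsmall: "norm (Z (p k i)) \<le> C * (\<Sum>j\<le>k. \<eta> * (9/10) ^ j)"
      unfolding p_def
    proof (rule dyadic_chaining [OF S])
      show "\<epsilon> \<in> {0..1}" using \<epsilon>0 by simp
      show "Z 0 = 0" by (simp add: Z_def good J0)
      fix j i' :: nat assume i': "1 \<le> i'" and le: "real i' / 2 ^ j \<le> real i / 2 ^ k"
      have "real i / 2 ^ k \<le> 1" using p01 [OF i] unfolding p_def atLeastAtMost_iff by (rule conjunct2)
      with le have "real i' / 2 ^ j \<le> 1" by (rule order_trans)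
      then have "real i' \<le> 2 ^ j" by (simp only: pos_divide_le_eq zero_less_power zero_less_numeral mult_1)
      then have i'': "i' \<in> {1..2^j}" using i' by (metis atLeastAtMost_iff of_nat_le_iff of_nat_numeral of_nat_power)
      let ?t = "p j i'" and ?s = "p j (i' - 1)"
      have t01: "?t \<in> {0..1}" using i'' by (intro p01) simp
      have s0: "0 \<le> ?s" by (simp add: p_def)
      have st: "?t - ?s = 1 / 2 ^ j" using i' by (simp add: p_def diff_divide_distrib of_nat_diff)
      \<comment> \<open>The only use of the ball condition: inside it the Hilbert-Schmidt norm of
        the integrand is at most \<open>C * (\<Lambda> * (1 + \<rho>))\<close>, so the energy is at
        most \<open>R\<close> times the length.\<close>
      have "hs_energy I g {?s<..?t} (\<lambda>u. \<Phi> ?t u \<omega>) \<le> (\<integral>\<^sup>+u. ennreal R * indicator {?s<..?t} u \<partial>lborel)"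
        unfolding hs_energy_def
      proof (intro nn_integral_mono)
        fix u
        show "ennreal ((hs_norm I g (\<Phi> ?t u \<omega>))\<^sup>2) * indicator {?s<..?t} u \<le> ennreal R * indicator {?s<..?t} u"
        proof (cases "u \<in> {?s<..?t}")
          case True
          then have u: "0 < u" "u \<le> ?t" "?t \<le> 1" using s0 t01 by auto
          have "u \<in> {0<..p k i}" using u le by (simp add: p_def)
          then have Xu: "norm (X u \<omega>) \<le> \<rho>" by (rule bd)
          have "\<epsilon> * (?t - u) \<le> 1 * 1" using \<epsilon>0 u by (intro mult_mono) auto
          then have "norm (S (\<epsilon> * (?t - u))) \<le> C" using \<epsilon>0 u by (intro C) auto
          moreover have "hs_norm I g (G (X u \<omega>)) \<le> \<Lambda> * (1 + \<rho>)"
            using Xu \<Lambda> by (intro order_trans [OF G_growth] mult_left_mono) auto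
          ultimately have "norm (S (\<epsilon> * (?t - u))) * hs_norm I g (G (X u \<omega>)) \<le> C * (\<Lambda> * (1 + \<rho>))"
            using C(1) by (intro mult_mono) auto
          then have "hs_norm I g (\<Phi> ?t u \<omega>) \<le> C * (\<Lambda> * (1 + \<rho>))"
            unfolding \<Phi>_def by (rule order_trans [OF hilbert_schmidt_compose(2) [OF G_hs]])
          then have "(hs_norm I g (\<Phi> ?t u \<omega>))\<^sup>2 \<le> R" unfolding R by (intro power_mono) auto
          then show ?thesis using True by (simp add: ennreal_leI)
        qed simp
      qed
      also have "\<dots> = ennreal (R / 2 ^ j)"
      proof -
        have "?s \<le> ?t" by (simp add: p_def divide_right_mono)
        then have "emeasure lborel {?s<..?t} = ennreal (1 / 2 ^ j)" using st by simp
        then show ?thesis using R0 by (subst nn_integral_cmult) (auto simp: ennreal_mult [symmetric])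
      qed
      finally have E: "hs_energy I g {?s<..?t} (\<lambda>u. \<Phi> ?t u \<omega>) \<le> ennreal (R / 2 ^ j)" .
      have "\<omega> \<in> space M - N j i'" using \<omega> i'' by (auto simp: NN_def B_def)
      from N(3) [OF i'' this E]
      have "norm ((Y ?t \<omega> - S (\<epsilon> / 2 ^ j) (Y ?s \<omega>)) - (J ?t \<omega> - S (\<epsilon> / 2 ^ j) (J ?s \<omega>))) \<le> \<eta> * (9/10) ^ j / sqrt \<epsilon>" .
      then have "sqrt \<epsilon> * norm ((Y ?t \<omega> - S (\<epsilon> / 2 ^ j) (Y ?s \<omega>)) - (J ?t \<omega> - S (\<epsilon> / 2 ^ j) (J ?s \<omega>))) \<le> sqrt \<epsilon> * (\<eta> * (9/10) ^ j / sqrt \<epsilon>)"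
        using \<epsilon>0 by (intro mult_left_mono) auto
      also have "\<dots> = \<eta> * (9/10) ^ j" using \<epsilon>0 by simp
      also have "sqrt \<epsilon> * norm ((Y ?t \<omega> - S (\<epsilon> / 2 ^ j) (Y ?s \<omega>)) - (J ?t \<omega> - S (\<epsilon> / 2 ^ j) (J ?s \<omega>))) = norm (Z ?t - S (\<epsilon> / 2 ^ j) (Z ?s))"
      proof -
        have "Z ?t - S (\<epsilon> / 2 ^ j) (Z ?s) = sqrt \<epsilon> *\<^sub>R ((Y ?t \<omega> - S (\<epsilon> / 2 ^ j) (Y ?s \<omega>)) - (J ?t \<omega> - S (\<epsilon> / 2 ^ j) (J ?s \<omega>)))"
          by (simp add: Z_def blinfun.diff_right blinfun.scaleR_right algebra_simps)
        then show ?thesis using \<epsilon>0 by simp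
      qed
      finally show "norm (Z (real i' / 2 ^ j) - S (\<epsilon> / 2 ^ j) (Z (real (i' - 1) / 2 ^ j))) \<le> \<eta> * (9/10) ^ j"
        by (simp add: p_def)
    qed (use C \<eta> i in auto)
    have "(\<Sum>j\<le>k. \<eta> * (9/10) ^ j) \<le> 10 * \<eta>"
    proof -
      have "(\<lambda>j. \<eta> * (9/10 :: real) ^ j) sums (\<eta> * (1 / (1 - 9/10)))" by (intro sums_mult geometric_sums) simp
      then have s: "summable (\<lambda>j. \<eta> * (9/10 :: real) ^ j)" "(\<Sum>j. \<eta> * (9/10 :: real) ^ j) = 10 * \<eta>" by (auto simp: sums_iff)
      show ?thesis using sum_le_suminf [OF s(1), of "{..k}"] s(2) \<eta> by simp
    qed
    then have "C * (\<Sum>j\<le>k. \<eta> * (9/10) ^ j) \<le> C * (10 * \<eta>)" using C(1) by (intro mult_left_mono) auto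
    with Zsmall have Z10: "norm (Z (p k i)) \<le> 10 * C * \<eta>" by simp
    have "sqrt \<epsilon> *\<^sub>R J (p k i) \<omega> = (LINT u:{0..p k i}|lborel. S (\<epsilon> * (p k i - u)) (G (X u \<omega>) (control g d u)))"
    proof -
      have "continuous_on {0..p k i} (\<lambda>t. X t \<omega>)"
        using Xc [of \<omega>] \<omega> p01 [OF i] by (auto intro: continuous_on_subset)
      then have int: "set_integrable lborel {0..p k i} (\<lambda>u. S (\<epsilon> * (p k i - u)) (G (X u \<omega>) (control g d u)))"
        using \<epsilon>0 p01 [OF i] by (intro set_integrable_control(1) S Gc) auto
      have "J (p k i) \<omega> = (LINT u:{0..p k i}|lborel. (1 / sqrt \<epsilon>) *\<^sub>R S (\<epsilon> * (p k i - u)) (G (X u \<omega>) (control g d u)))"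
        unfolding J_def \<Phi>_def d'_def control_scale by (simp add: blinfun.scaleR_right)
      also have "\<dots> = (1 / sqrt \<epsilon>) *\<^sub>R (LINT u:{0..p k i}|lborel. S (\<epsilon> * (p k i - u)) (G (X u \<omega>) (control g d u)))"
        by (rule set_integral_scaleR_right) 
      finally show ?thesis using \<epsilon>0 by simp
    qed
    then have "X (p k i) \<omega> - (drift (p k i) \<omega> + (LINT u:{0..p k i}|lborel. S (\<epsilon> * (p k i - u)) (G (X u \<omega>) (control g d u)))) = Z (p k i)"
      using good(1) [OF i] by (simp add: Z_def scaleR_diff_right)
    then show ?thesis using Z10 by simp
  qed
  show ?thesis
    using NN small dev unfolding d'_def [symmetric] p_def drift_def by (intro bexI [of _ NN] conjI ballI allI impI) auto
qed

end

section \<open>Elementary approximation of controls\<close>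

lemma borel_measurable_lebesgue_on:
  "f \<in> borel_measurable borel \<Longrightarrow> f \<in> borel_measurable (lebesgue_on A)"
  by (intro measurable_restrict_space1 measurable_completion) simp

lemma control_superset:
  assumes "fst ` set d \<subseteq> J" "finite J"
  shows "control g d u = (\<Sum>k\<in>J. coef d k u undefined *\<^sub>R g k)"
  unfolding control_def using assms by (intro sum.mono_neutral_left) (auto simp: coef_outside)

lemma control_append: "control g (d @ d') u = control g d u + control g d' u"
proof -
  let ?J = "fst ` set d \<union> fst ` set d'"
  have "control g (d @ d') u = (\<Sum>k\<in>?J. coef (d @ d') k u undefined *\<^sub>R g k)"
    by (intro control_superset) auto
  also have "\<dots> = (\<Sum>k\<in>?J. coef d k u undefined *\<^sub>R g k) + (\<Sum>k\<in>?J. coef d' k u undefined *\<^sub>R g k)"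
    by (simp add: coef_append scaleR_add_left sum.distrib)
  finally show ?thesis by (simp add: control_superset [of d ?J] control_superset [of d' ?J])
qed

lemma control_measurable [measurable]:
  "control g d \<in> borel_measurable borel" for g :: "nat \<Rightarrow> 'u::{real_normed_vector, second_countable_topology}"
  unfolding control_def [abs_def] by measurable

lemma deterministic_append: "deterministic d \<Longrightarrow> deterministic d' \<Longrightarrow> deterministic (d @ d')"
  by (auto simp: deterministic_def)

text \<open>The square of the usual distance, whence the factors 2 in the triangle inequality. The
  completed measure is used because the given control is only Lebesgue measurable.\<close>

definition L2_dist :: "(real \<Rightarrow> 'a::real_normed_vector) \<Rightarrow> (real \<Rightarrow> 'a) \<Rightarrow> ennreal" where
  "L2_dist f h = (\<integral>\<^sup>+u. ennreal ((norm (f u - h u))\<^sup>2) \<partial>lebesgue_on {0..1})"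

lemma L2_dist_triangle:
  fixes f h k :: "real \<Rightarrow> 'a::{real_normed_vector, second_countable_topology}"
  assumes [measurable]: "f \<in> borel_measurable (lebesgue_on {0..1})" "h \<in> borel_measurable (lebesgue_on {0..1})" "k \<in> borel_measurable (lebesgue_on {0..1})"
  shows "L2_dist f k \<le> 2 * L2_dist f h + 2 * L2_dist h k"
proof -
  have "L2_dist f k \<le> (\<integral>\<^sup>+u. 2 * ennreal ((norm (f u - h u))\<^sup>2) + 2 * ennreal ((norm (h u - k u))\<^sup>2) \<partial>lebesgue_on {0..1})"
    unfolding L2_dist_def
  proof (intro nn_integral_mono)
    fix u
    have "(norm (f u - k u))\<^sup>2 \<le> 2 * (norm (f u - h u))\<^sup>2 + 2 * (norm (h u - k u))\<^sup>2"
      using power2_norm_add_le [of "f u - h u" "h u - k u"] by simp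
    then have "ennreal ((norm (f u - k u))\<^sup>2) \<le> ennreal (2 * (norm (f u - h u))\<^sup>2 + 2 * (norm (h u - k u))\<^sup>2)" by (rule ennreal_leI)
    also have "\<dots> = 2 * ennreal ((norm (f u - h u))\<^sup>2) + 2 * ennreal ((norm (h u - k u))\<^sup>2)"
      by (simp add: ennreal_plus ennreal_mult)
    finally show "ennreal ((norm (f u - k u))\<^sup>2) \<le> 2 * ennreal ((norm (f u - h u))\<^sup>2) + 2 * ennreal ((norm (h u - k u))\<^sup>2)" .
  qed
  also have "\<dots> = 2 * L2_dist f h + 2 * L2_dist h k"
    unfolding L2_dist_def by (simp add: nn_integral_add nn_integral_cmult)
  finally show ?thesis .
qed

lemma two_times_add_less:
  assumes "a < ennreal (e / 8)" "b < ennreal (e / 8)" "0 < e"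
  shows "2 * a + 2 * b < ennreal e"
proof -
  have "2 * a + 2 * b \<le> 2 * ennreal (e / 8) + 2 * ennreal (e / 8)"
    using assms by (intro add_mono mult_left_mono) auto
  also have "2 * ennreal (e / 8) = ennreal (2 * (e / 8))"
    using ennreal_mult [of 2 "e / 8"] assms(3) by simp
  also have "ennreal (2 * (e / 8)) + ennreal (2 * (e / 8)) = ennreal (2 * (e / 8) + 2 * (e / 8))"
    using assms(3) by (intro ennreal_plus [symmetric]) auto
  also have "\<dots> < ennreal e" using assms(3) by (intro ennreal_lessI) auto
  finally show ?thesis .
qed

lemma L2_dist_cong_AE: "AE u in lebesgue_on {0..1}. f u = f' u \<Longrightarrow> L2_dist f h = L2_dist f' h"
  unfolding L2_dist_def by (intro nn_integral_cong_AE) (auto elim!: eventually_mono)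

section \<open>Density of piecewise constant controls\<close>

context wiener_setting
begin

definition approximable :: "(real \<Rightarrow> 'u) \<Rightarrow> bool" where
  "approximable f \<longleftrightarrow> f \<in> borel_measurable (lebesgue_on {0..1}) \<and>
     (\<forall>e>0. \<exists>d :: ('w, real) elementary. elementary_process M \<F> I d \<and> deterministic d \<and> L2_dist f (control g d) < ennreal e)"

text \<open>The class is closed, so each extension below needs approximation only by functions
  already treated.\<close>

lemma approximable_limit:
  assumes f: "f \<in> borel_measurable (lebesgue_on {0..1})" and h: "\<And>e. 0 < e \<Longrightarrow> \<exists>h. approximable h \<and> L2_dist f h < ennreal e"
  shows "approximable f"
  unfolding approximable_def
proof (intro conjI f allI impI)
  fix e :: real assume e: "0 < e"
  obtain h where h: "approximable h" "L2_dist f h < ennreal (e / 8)" using h [of "e / 8"] e by auto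
  obtain d :: "('w, real) elementary" where d: "elementary_process M \<F> I d" "deterministic d" "L2_dist h (control g d) < ennreal (e / 8)"
    using h(1) e unfolding approximable_def by (meson divide_pos_pos zero_less_numeral)
  have "L2_dist f (control g d) \<le> 2 * L2_dist f h + 2 * L2_dist h (control g d)"
    using f h(1) by (intro L2_dist_triangle) (auto simp: approximable_def intro: borel_measurable_lebesgue_on)
  also have "\<dots> < ennreal e" by (rule two_times_add_less [OF h(2) d(3) e])
  finally show "\<exists>d :: ('w, real) elementary. elementary_process M \<F> I d \<and> deterministic d \<and> L2_dist f (control g d) < ennreal e"
    using d by blast
qed

lemma approximable_control:
  assumes "elementary_process M \<F> I d" "deterministic (d :: ('w, real) elementary)" "f \<in> borel_measurable (lebesgue_on {0..1})"
    and "AE u in lebesgue_on {0..1}. f u = control g d u"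
  shows "approximable f"
  unfolding approximable_def
proof (intro conjI assms allI impI)
  fix e :: real assume "0 < e"
  then have "L2_dist f (control g d) < ennreal e"
    unfolding L2_dist_cong_AE [OF assms(4)] by (simp add: L2_dist_def)
  then show "\<exists>d :: ('w, real) elementary. elementary_process M \<F> I d \<and> deterministic d \<and> L2_dist f (control g d) < ennreal e"
    using assms by blast
qed

lemma approximable_add:
  assumes f: "approximable f" and h: "approximable h"
  shows "approximable (\<lambda>u. f u + h u)"
  unfolding approximable_def
proof (intro conjI allI impI)
  have [measurable]: "f \<in> borel_measurable (lebesgue_on {0..1})" "h \<in> borel_measurable (lebesgue_on {0..1})"
    using f h by (auto simp: approximable_def)
  show "(\<lambda>u. f u + h u) \<in> borel_measurable (lebesgue_on {0..1})" by measurable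
  fix e :: real assume e: "0 < e"
  obtain d where d: "elementary_process M \<F> I d" "deterministic (d :: ('w, real) elementary)" "L2_dist f (control g d) < ennreal (e / 8)"
    using f e unfolding approximable_def by (meson divide_pos_pos zero_less_numeral)
  obtain d' where d': "elementary_process M \<F> I d'" "deterministic (d' :: ('w, real) elementary)" "L2_dist h (control g d') < ennreal (e / 8)"
    using h e unfolding approximable_def by (meson divide_pos_pos zero_less_numeral)
  have [measurable]: "control g d \<in> borel_measurable (lebesgue_on {0..1})" "control g d' \<in> borel_measurable (lebesgue_on {0..1})"
    by (auto intro: borel_measurable_lebesgue_on)
  have "L2_dist (\<lambda>u. f u + h u) (control g (d @ d')) \<le> 2 * L2_dist (\<lambda>u. f u + h u) (\<lambda>u. f u + control g d' u) + 2 * L2_dist (\<lambda>u. f u + control g d' u) (control g (d @ d'))"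
    by (rule L2_dist_triangle) (auto intro: borel_measurable_lebesgue_on)
  also have "\<dots> = 2 * L2_dist h (control g d') + 2 * L2_dist f (control g d)"
    by (simp add: L2_dist_def control_append)
  also have "\<dots> < ennreal e" by (rule two_times_add_less [OF d'(3) d(3) e])
  finally show "\<exists>d :: ('w, real) elementary. elementary_process M \<F> I d \<and> deterministic d \<and> L2_dist (\<lambda>u. f u + h u) (control g d) < ennreal e"
    using d d' by (intro exI [of _ "d @ d'"]) (auto simp: elementary_process_append deterministic_append)
qed

lemma approximable_scale:
  assumes f: "approximable f"
  shows "approximable (\<lambda>u. c *\<^sub>R f u)"
  unfolding approximable_def
proof (intro conjI allI impI)
  have [measurable]: "f \<in> borel_measurable (lebesgue_on {0..1})"
    using f by (auto simp: approximable_def)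
  show "(\<lambda>u. c *\<^sub>R f u) \<in> borel_measurable (lebesgue_on {0..1})" by measurable
  fix e :: real assume e: "0 < e"
  define e' where "e' = e / (c\<^sup>2 + 1)"
  have c1: "0 < c\<^sup>2 + 1" by (simp add: add_nonneg_pos)
  have e': "0 < e'" using e c1 by (simp add: e'_def)
  obtain d where d: "elementary_process M \<F> I d" "deterministic (d :: ('w, real) elementary)" "L2_dist f (control g d) < ennreal e'"
    using f e' unfolding approximable_def by blast
  have [measurable]: "control g d \<in> borel_measurable (lebesgue_on {0..1})"
    by (auto intro: borel_measurable_lebesgue_on)
  have "L2_dist (\<lambda>u. c *\<^sub>R f u) (control g (scale_elementary c d)) = ennreal (c\<^sup>2) * L2_dist f (control g d)"
    unfolding L2_dist_def control_scale scaleR_diff_right [symmetric] norm_scaleR power_mult_distrib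
    by (simp add: ennreal_mult nn_integral_cmult)
  also have "\<dots> \<le> ennreal (c\<^sup>2) * ennreal e'" using d(3) by (intro mult_left_mono) auto
  also have "\<dots> = ennreal (c\<^sup>2 * e')" using e' by (simp add: ennreal_mult)
  also have "\<dots> < ennreal e"
  proof (rule ennreal_lessI [OF e])
    have "c\<^sup>2 * e' < (c\<^sup>2 + 1) * e'" using e' by (intro mult_strict_right_mono) auto
    also have "\<dots> = e" using c1 by (simp add: e'_def)
    finally show "c\<^sup>2 * e' < e" .
  qed
  finally show "\<exists>d :: ('w, real) elementary. elementary_process M \<F> I d \<and> deterministic d \<and> L2_dist (\<lambda>u. c *\<^sub>R f u) (control g d) < ennreal e"
    using d by (intro exI [of _ "scale_elementary c d"]) (auto simp: elementary_process_scale deterministic_scale)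
qed

text \<open>The one-term list produces \<open>{0<..a}\<close>, which on \<open>[0,1]\<close> differs
  from \<open>{..a}\<close> only at the null point 0. For negative \<open>a\<close> the empty list
  serves.\<close>

lemma approximable_interval:
  assumes k: "k \<in> I"
  shows "approximable (\<lambda>u. indicator {..a} u *\<^sub>R g k)"
proof -
  define d :: "('w, real) elementary" where "d = (if 0 \<le> a then [(k, 0, a, \<lambda>_. 1)] else [])"
  show ?thesis
  proof (rule approximable_control [of d])
    show "elementary_process M \<F> I d"
      using k by (simp add: d_def elementary_process_Cons image_constant_conv)
    show "deterministic d" by (auto simp: d_def deterministic_def fun_eq_iff)
    have "AE u in lborel. u \<noteq> (0 :: real)" by (rule AE_lborel_singleton)
    then have "AE u in lebesgue. u \<noteq> (0 :: real)" by (rule AE_completion)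
    then have "AE u in lebesgue_on {0..1}. u \<noteq> (0 :: real)" by (subst AE_restrict_space_iff) (auto elim!: eventually_mono)
    moreover have "AE u in lebesgue_on {0..1}. u \<in> {0..1 :: real}" by (intro AE_I2) (simp add: space_restrict_space)
    ultimately show "AE u in lebesgue_on {0..1}. indicator {..a} u *\<^sub>R g k = control g d u"
    proof eventually_elim
      case (elim u)
      then show ?case by (auto simp: d_def control_def coef_def indicator_def)
    qed
    show "(\<lambda>u. indicator {..a} u *\<^sub>R g k) \<in> borel_measurable (lebesgue_on {0..1})"
      by (intro borel_measurable_lebesgue_on) measurable
  qed
qed

text \<open>Dynkin's argument with half-lines as generator. Complements are formed relative to
  \<open>{..1}\<close>, since only times in \<open>[0,1]\<close> count, and disjoint unions follow
  from finite ones by dominated convergence.\<close>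

lemma approximable_indicator_borel:
  assumes k: "k \<in> I" and A: "A \<in> sets borel"
  shows "approximable (\<lambda>u. indicator A u *\<^sub>R g k)"
proof -
  have gk: "norm (g k) = 1"
    using basis k by (auto simp: orthonormal_basis_def norm_eq_1)
  have meas: "A \<in> sets borel \<Longrightarrow> (\<lambda>u. indicator A u *\<^sub>R g k) \<in> borel_measurable (lebesgue_on {0..1})" for A :: "real set"
    by (intro borel_measurable_lebesgue_on borel_measurable_scaleR borel_measurable_indicator) auto
  have A': "A \<in> sigma_sets UNIV (range (\<lambda>a. {..a::real}))"
    using A unfolding borel_eq_atMost by simp
  have sb: "B \<in> sigma_sets UNIV (range (\<lambda>a. {..a::real})) \<longleftrightarrow> B \<in> sets borel" for B
    unfolding borel_eq_atMost by simp
  have stable: "Int_stable (range (\<lambda>a. {..a::real}))"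
  proof (rule Int_stableI)
    fix a b :: "real set" assume "a \<in> range (\<lambda>a. {..a})" "b \<in> range (\<lambda>a. {..a})"
    then obtain x y where "a = {..x}" "b = {..y}" by blast
    then have "a \<inter> b = {..min x y}" by auto
    then show "a \<inter> b \<in> range (\<lambda>a. {..a})" by blast
  qed
  have pow: "range (\<lambda>a. {..a::real}) \<subseteq> Pow UNIV" by simp
  show ?thesis
    using stable pow A'
  proof (induction rule: sigma_sets_induct_disjoint)
    case (basic B)
    then show ?case using approximable_interval [OF k] by auto
  next
    case empty
    show ?case using approximable_control [of "[]" "\<lambda>u. 0"] by (simp add: control_def deterministic_def)
  next
    case (compl B)
    have 1: "approximable (\<lambda>u. indicator {..1} u *\<^sub>R g k + (-1) *\<^sub>R (indicator B u *\<^sub>R g k))"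
      by (intro approximable_add approximable_interval approximable_scale compl.IH k)
    show ?case
    proof (rule approximable_limit)
      show "(\<lambda>u. indicator (UNIV - B) u *\<^sub>R g k) \<in> borel_measurable (lebesgue_on {0..1})"
        using compl.hyps by (intro meas) (auto simp: sb)
      fix e :: real assume "0 < e"
      moreover have "L2_dist (\<lambda>u. indicator (UNIV - B) u *\<^sub>R g k) (\<lambda>u. indicator {..1} u *\<^sub>R g k + (-1) *\<^sub>R (indicator B u *\<^sub>R g k)) = 0"
        unfolding L2_dist_def
        by (subst nn_integral_cong [where v = "\<lambda>_. 0"]) (auto simp: space_restrict_space indicator_def)
      ultimately show "\<exists>h. approximable h \<and> L2_dist (\<lambda>u. indicator (UNIV - B) u *\<^sub>R g k) h < ennreal e"
        using 1 by (intro exI conjI) auto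
    qed
  next
    case (union B)
    have Bm [measurable]: "B i \<in> sets borel" for i using union.hyps(2) sb by blast
    have fin: "approximable (\<lambda>u. indicator (\<Union>i<n. B i) u *\<^sub>R g k)" for n
    proof (induction n)
      case 0
      then show ?case using approximable_control [of "[]" "\<lambda>u. 0"] by (simp add: control_def deterministic_def)
    next
      case (Suc n)
      have "(\<lambda>u. indicator (\<Union>i<Suc n. B i) u *\<^sub>R g k) = (\<lambda>u. indicator (\<Union>i<n. B i) u *\<^sub>R g k + indicator (B n) u *\<^sub>R g k)"
      proof
        fix u
        have "B i \<inter> B n = {}" if "i < n" for i
          using disjoint_family_onD [OF union.hyps(1), of i n] that by simp
        then have "(\<Union>i<n. B i) \<inter> B n = {}" by blast
        then show "indicator (\<Union>i<Suc n. B i) u *\<^sub>R g k = indicator (\<Union>i<n. B i) u *\<^sub>R g k + indicator (B n) u *\<^sub>R g k"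
          by (auto simp: indicator_def lessThan_Suc)
      qed
      then show ?case using approximable_add [OF Suc union.IH [of n]] by simp
    qed
    show ?case
    proof (rule approximable_limit)
      show "(\<lambda>u. indicator (\<Union>i. B i) u *\<^sub>R g k) \<in> borel_measurable (lebesgue_on {0..1})"
        using Bm by (intro meas) auto
      fix e :: real assume e: "0 < e"
      have "(\<lambda>n. L2_dist (\<lambda>u. indicator (\<Union>i. B i) u *\<^sub>R g k) (\<lambda>u. indicator (\<Union>i<n. B i) u *\<^sub>R g k)) \<longlonglongrightarrow> (\<integral>\<^sup>+u. 0 \<partial>lebesgue_on {0..1 :: real})"
        unfolding L2_dist_def
      proof (rule nn_integral_dominated_convergence [where M = "lebesgue_on {0..1}" and w = "\<lambda>_. 1" and u' = "\<lambda>_. 0"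
        and u = "\<lambda>n u. ennreal ((norm (indicator (\<Union>i. B i) u *\<^sub>R g k - indicator (\<Union>i<n. B i) u *\<^sub>R g k))\<^sup>2)"])
        show "(\<lambda>u. ennreal ((norm (indicator (\<Union>i. B i) u *\<^sub>R g k - indicator (\<Union>i<n. B i) u *\<^sub>R g k))\<^sup>2)) \<in> borel_measurable (lebesgue_on {0..1})" for n
          by (intro borel_measurable_lebesgue_on) measurable
        show "AE u in lebesgue_on {0..1}. ennreal ((norm (indicator (\<Union>i. B i) u *\<^sub>R g k - indicator (\<Union>i<n. B i) u *\<^sub>R g k))\<^sup>2) \<le> 1" for n
          using gk by (intro AE_I2) (auto simp: indicator_def)
        show "(\<integral>\<^sup>+u. 1 \<partial>lebesgue_on {0..1 :: real}) < \<infinity>"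
          by (simp add: emeasure_restrict_space)
        show "AE u in lebesgue_on {0..1}. (\<lambda>n. ennreal ((norm (indicator (\<Union>i. B i) u *\<^sub>R g k - indicator (\<Union>i<n. B i) u *\<^sub>R g k))\<^sup>2)) \<longlonglongrightarrow> 0"
        proof (intro AE_I2)
          fix u
          have "\<forall>\<^sub>F n in sequentially. ennreal ((norm (indicator (\<Union>i. B i) u *\<^sub>R g k - indicator (\<Union>i<n. B i) u *\<^sub>R g k))\<^sup>2) = 0"
          proof (cases "u \<in> (\<Union>i. B i)")
            case True
            then obtain m where "u \<in> B m" by blast
            then show ?thesis unfolding eventually_sequentially
              by (intro exI [of _ "Suc m"]) (auto simp: indicator_def intro!: bexI [of _ m])
          next
            case False
            then show ?thesis by (simp add: indicator_def)
          qed
          then show "(\<lambda>n. ennreal ((norm (indicator (\<Union>i. B i) u *\<^sub>R g k - indicator (\<Union>i<n. B i) u *\<^sub>R g k))\<^sup>2)) \<longlonglongrightarrow> 0"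
            by (rule tendsto_eventually)
        qed
      qed auto
      then have "(\<lambda>n. L2_dist (\<lambda>u. indicator (\<Union>i. B i) u *\<^sub>R g k) (\<lambda>u. indicator (\<Union>i<n. B i) u *\<^sub>R g k)) \<longlonglongrightarrow> 0" by simp
      then have "\<forall>\<^sub>F n in sequentially. L2_dist (\<lambda>u. indicator (\<Union>i. B i) u *\<^sub>R g k) (\<lambda>u. indicator (\<Union>i<n. B i) u *\<^sub>R g k) < ennreal e"
        using e by (intro order_tendstoD(2)) auto
      then obtain n where "L2_dist (\<lambda>u. indicator (\<Union>i. B i) u *\<^sub>R g k) (\<lambda>u. indicator (\<Union>i<n. B i) u *\<^sub>R g k) < ennreal e"
        unfolding eventually_sequentially by blast
      then show "\<exists>h. approximable h \<and> L2_dist (\<lambda>u. indicator (\<Union>i. B i) u *\<^sub>R g k) h < ennreal e"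
        using fin by blast
    qed
  qed
qed

lemma approximable_sum:
  "finite J \<Longrightarrow> (\<And>j. j \<in> J \<Longrightarrow> approximable (f j)) \<Longrightarrow> approximable (\<lambda>u. \<Sum>j\<in>J. f j u)"
proof (induction J rule: finite_induct)
  case empty
  show ?case using approximable_control [of "[]" "\<lambda>u. 0"] by (simp add: control_def deterministic_def)
next
  case (insert j J)
  then show ?case using approximable_add [of "f j" "\<lambda>u. \<Sum>j\<in>J. f j u"] by simp
qed

text \<open>Two reductions at once: a Lebesgue set is a Borel set up to a null set, and the vector
  \<open>v\<close> is close to a finite combination of basis vectors.\<close>

lemma approximable_indicator:
  assumes A: "A \<in> sets lebesgue"
  shows "approximable (\<lambda>u. indicator A u *\<^sub>R v)"
proof (rule approximable_limit)
  have meas: "(\<lambda>u. indicator A u *\<^sub>R v) \<in> borel_measurable (lebesgue_on {0..1})" for v :: 'u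
    using A by (intro measurable_restrict_space1 borel_measurable_scaleR borel_measurable_indicator) auto
  then show "(\<lambda>u. indicator A u *\<^sub>R v) \<in> borel_measurable (lebesgue_on {0..1})" .
  from A obtain B N N' where B: "A = B \<union> N" "N \<subseteq> N'" "N' \<in> null_sets lborel" "B \<in> sets lborel"
    by (rule sets_completionE)
  have ae: "AE u in lebesgue_on {0..1}. indicator A u = (indicator B u :: real)"
  proof -
    have "AE u in lebesgue. u \<notin> N'" by (rule AE_completion [OF AE_not_in [OF B(3)]])
    then have "AE u in lebesgue. indicator A u = (indicator B u :: real)"
      by eventually_elim (use B(1,2) in \<open>auto simp: indicator_def\<close>)
    then show ?thesis by (subst AE_restrict_space_iff) (auto elim!: eventually_mono)
  qed
  fix e :: real assume e: "0 < e"
  have "v \<in> closure (span (g ` I))" using basis by (simp add: orthonormal_basis_def)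
  then obtain w where w: "w \<in> span (g ` I)" "dist w v < sqrt (e / 2)"
    using e by (metis closure_approachable half_gt_zero real_sqrt_gt_zero)
  then obtain t r where t: "finite t" "t \<subseteq> g ` I" "w = (\<Sum>a\<in>t. r a *\<^sub>R a)"
    unfolding span_explicit by blast
  have "approximable (\<lambda>u. \<Sum>a\<in>t. r a *\<^sub>R (indicator B u *\<^sub>R a))"
    using t(1,2) B(4) by (intro approximable_sum approximable_scale) (auto intro: approximable_indicator_borel)
  then have "approximable (\<lambda>u. indicator B u *\<^sub>R w)"
    by (simp add: t(3) scaleR_sum_right mult.commute)
  moreover have "L2_dist (\<lambda>u. indicator A u *\<^sub>R v) (\<lambda>u. indicator B u *\<^sub>R w) < ennreal e"
  proof -
    have "L2_dist (\<lambda>u. indicator A u *\<^sub>R v) (\<lambda>u. indicator B u *\<^sub>R w) \<le> (\<integral>\<^sup>+u. ennreal (e / 2) \<partial>lebesgue_on {0..1 :: real})"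
      unfolding L2_dist_def
    proof (rule nn_integral_mono_AE, use ae in eventually_elim)
      case (elim u)
      have "(norm (v - w))\<^sup>2 \<le> (sqrt (e / 2))\<^sup>2" using w(2) by (intro power_mono) (auto simp: dist_norm norm_minus_commute)
      then have "(norm (v - w))\<^sup>2 \<le> e / 2" using e by simp
      then show ?case using e elim by (intro ennreal_leI) (auto simp: indicator_def split: if_splits)
    qed
    also have "\<dots> = ennreal (e / 2)" by (simp add: emeasure_restrict_space)
    also have "\<dots> < ennreal e" using e by (simp add: ennreal_lessI)
    finally show ?thesis .
  qed
  ultimately show "\<exists>h. approximable h \<and> L2_dist (\<lambda>u. indicator A u *\<^sub>R v) h < ennreal e" by blast
qed

text \<open>Simple functions \<open>s i\<close> with norm at most \<open>2 * norm \<phi>\<close>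
  differ from \<open>\<phi>\<close> by at most \<open>3 * norm \<phi>\<close>; its square is the
  dominating function with the factor 9.\<close>

lemma approximable_square_integrable:
  assumes "square_integrable (lebesgue_on {0..1}) \<phi>"
  shows "approximable \<phi>"
proof (rule approximable_limit)
  have meas [measurable]: "\<phi> \<in> borel_measurable (lebesgue_on {0..1})" and int: "integrable (lebesgue_on {0..1}) (\<lambda>u. (norm (\<phi> u))\<^sup>2)"
    using assms by (auto simp: square_integrable_def)
  show "\<phi> \<in> borel_measurable (lebesgue_on {0..1})" by (rule meas)
  have sp: "space (lebesgue_on {0..1 :: real}) = {0..1}" by (simp add: space_restrict_space)
  obtain s where s0: "\<forall>i. simple_function (lebesgue_on {0..1}) (s i)" "\<forall>u\<in>space (lebesgue_on {0..1}). (\<lambda>i. s i u) \<longlonglongrightarrow> \<phi> u"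
    "\<forall>i. \<forall>u\<in>space (lebesgue_on {0..1}). dist (s i u) 0 \<le> 2 * dist (\<phi> u) 0"
    using borel_measurable_implies_sequence_metric [OF meas, of 0] by (elim exE conjE)
  have s: "simple_function (lebesgue_on {0..1}) (s i)" "u \<in> {0..1} \<Longrightarrow> (\<lambda>i. s i u) \<longlonglongrightarrow> \<phi> u"
    "u \<in> {0..1} \<Longrightarrow> norm (s i u) \<le> 2 * norm (\<phi> u)" for i u
    using s0 [unfolded sp] by simp_all
  have sm [measurable]: "s i \<in> borel_measurable (lebesgue_on {0..1})" for i using s(1) by (rule borel_measurable_simple_function)
  have app: "approximable (s i)" for i
  proof (rule approximable_limit)
    show "s i \<in> borel_measurable (lebesgue_on {0..1})" by (rule sm)
    have fin: "finite (s i ` {0..1})" using s(1) [of i] by (simp add: simple_function_def space_restrict_space)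
    have 1: "approximable (\<lambda>u. \<Sum>v\<in>s i ` {0..1}. indicator (s i -` {v} \<inter> {0..1}) u *\<^sub>R v)"
    proof (intro approximable_sum fin approximable_indicator)
      fix v
      have "s i -` {v} \<inter> {0..1} \<in> sets (lebesgue_on {0..1})"
        using s(1) [of i] simple_functionD(2) [OF s(1), of i "{v}"] by (simp add: space_restrict_space)
      then show "s i -` {v} \<inter> {0..1} \<in> sets lebesgue" by (subst (asm) sets_restrict_space_iff) auto
    qed
    have 2: "L2_dist (s i) (\<lambda>u. \<Sum>v\<in>s i ` {0..1}. indicator (s i -` {v} \<inter> {0..1}) u *\<^sub>R v) = 0"
    proof -
      have z: "s i u - (\<Sum>v\<in>s i ` {0..1}. indicator (s i -` {v} \<inter> {0..1}) u *\<^sub>R v) = 0" if u: "u \<in> {0..1}" for u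
      proof -
        have "(\<Sum>v\<in>s i ` {0..1}. indicator (s i -` {v} \<inter> {0..1}) u *\<^sub>R v) = (\<Sum>v\<in>s i ` {0..1}. if v = s i u then v else 0)"
          using u by (intro sum.cong) (auto simp: indicator_def)
        also have "\<dots> = s i u" using fin u by simp
        finally show ?thesis by simp
      qed
      have "L2_dist (s i) (\<lambda>u. \<Sum>v\<in>s i ` {0..1}. indicator (s i -` {v} \<inter> {0..1}) u *\<^sub>R v) = (\<integral>\<^sup>+u. 0 \<partial>lebesgue_on {0..1 :: real})"
        unfolding L2_dist_def
      proof (intro nn_integral_cong)
        fix u assume "u \<in> space (lebesgue_on {0..1 :: real})"
        then have "u \<in> {0..1}" by (simp only: sp)
        from z [OF this] show "ennreal ((norm (s i u - (\<Sum>v\<in>s i ` {0..1}. indicator (s i -` {v} \<inter> {0..1}) u *\<^sub>R v)))\<^sup>2) = 0"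
          by (simp only: norm_zero) simp
      qed
      then show ?thesis by simp
    qed
    show "\<exists>h. approximable h \<and> L2_dist (s i) h < ennreal e" if "0 < e" for e
      by (rule exI, rule conjI, rule 1, unfold 2) (use that in simp)
  qed
  fix e :: real assume e: "0 < e"
  have "(\<lambda>i. L2_dist \<phi> (s i)) \<longlonglongrightarrow> (\<integral>\<^sup>+u. 0 \<partial>lebesgue_on {0..1 :: real})"
    unfolding L2_dist_def
  proof (rule nn_integral_dominated_convergence [where M = "lebesgue_on {0..1}" and w = "\<lambda>u. ennreal (9 * (norm (\<phi> u))\<^sup>2)" and u' = "\<lambda>_. 0"
        and u = "\<lambda>i u. ennreal ((norm (\<phi> u - s i u))\<^sup>2)"])
    show "AE u in lebesgue_on {0..1}. ennreal ((norm (\<phi> u - s i u))\<^sup>2) \<le> ennreal (9 * (norm (\<phi> u))\<^sup>2)" for i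
    proof (intro AE_I2 ennreal_leI)
      fix u assume "u \<in> space (lebesgue_on {0..1 :: real})"
      then have u: "u \<in> {0..1}" by (simp add: space_restrict_space)
      have "norm (\<phi> u - s i u) \<le> 3 * norm (\<phi> u)"
        using norm_triangle_ineq4 [of "\<phi> u" "s i u"] s(3) [OF u, of i] by simp
      then have "(norm (\<phi> u - s i u))\<^sup>2 \<le> (3 * norm (\<phi> u))\<^sup>2" by (intro power_mono) auto
      then show "(norm (\<phi> u - s i u))\<^sup>2 \<le> 9 * (norm (\<phi> u))\<^sup>2" by (simp add: power_mult_distrib)
    qed
    show "(\<integral>\<^sup>+u. ennreal (9 * (norm (\<phi> u))\<^sup>2) \<partial>lebesgue_on {0..1}) < \<infinity>"
      using int by (subst nn_integral_eq_integral) auto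
    show "AE u in lebesgue_on {0..1}. (\<lambda>i. ennreal ((norm (\<phi> u - s i u))\<^sup>2)) \<longlonglongrightarrow> 0"
    proof (intro AE_I2)
      fix u assume "u \<in> space (lebesgue_on {0..1 :: real})"
      then have u: "u \<in> {0..1}" by (simp add: space_restrict_space)
      have "(\<lambda>i. (norm (\<phi> u - s i u))\<^sup>2) \<longlonglongrightarrow> (norm (\<phi> u - \<phi> u))\<^sup>2"
        by (intro tendsto_intros s(2) u)
      from tendsto_ennrealI [OF this] show "(\<lambda>i. ennreal ((norm (\<phi> u - s i u))\<^sup>2)) \<longlonglongrightarrow> 0" by simp
    qed
  qed measurable
  then have "(\<lambda>i. L2_dist \<phi> (s i)) \<longlonglongrightarrow> 0" by simp
  then have "\<forall>\<^sub>F i in sequentially. L2_dist \<phi> (s i) < ennreal e"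
    using e by (intro order_tendstoD(2)) auto
  then obtain i where "L2_dist \<phi> (s i) < ennreal e"
    unfolding eventually_sequentially by blast
  then show "\<exists>h. approximable h \<and> L2_dist \<phi> h < ennreal e" using app by blast
qed

end

section \<open>The controlled equation\<close>

text \<open>Measurability of \<open>T\<close> is known for each fixed vector only. For simple
  \<open>f\<close> the composition uses finitely many fixed vectors, and continuity of each operator
  \<open>T u\<close> gives the limit.\<close>

lemma measurable_operator_apply:
  fixes T :: "'a \<Rightarrow> 'u::{real_normed_vector, second_countable_topology} \<Rightarrow>\<^sub>L 'h::{real_normed_vector, second_countable_topology}"
  assumes T: "\<And>y. (\<lambda>u. T u y) \<in> borel_measurable N" and f: "f \<in> borel_measurable N"
  shows "(\<lambda>u. T u (f u)) \<in> borel_measurable N"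
proof -
  obtain s where s: "\<forall>i. simple_function N (s i)" "\<forall>u\<in>space N. (\<lambda>i. s i u) \<longlonglongrightarrow> f u"
    using borel_measurable_implies_sequence_metric [OF f, of 0] by (elim exE conjE)
  show ?thesis
  proof (rule borel_measurable_LIMSEQ_metric)
    fix i
    have fin: "finite (s i ` space N)" using s(1) by (simp add: simple_function_def)
    have "(\<lambda>u. \<Sum>v\<in>s i ` space N. indicator (s i -` {v} \<inter> space N) u *\<^sub>R T u v) \<in> borel_measurable N"
      using s(1) T by (intro borel_measurable_sum borel_measurable_scaleR borel_measurable_indicator simple_functionD(2)) auto
    moreover have "(\<Sum>v\<in>s i ` space N. indicator (s i -` {v} \<inter> space N) u *\<^sub>R T u v) = T u (s i u)" if u: "u \<in> space N" for u
    proof -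
      have "(\<Sum>v\<in>s i ` space N. indicator (s i -` {v} \<inter> space N) u *\<^sub>R T u v) = (\<Sum>v\<in>s i ` space N. if v = s i u then T u v else 0)"
        using u by (intro sum.cong) (auto simp: indicator_def)
      also have "\<dots> = T u (s i u)" using fin u by simp
      finally show ?thesis .
    qed
    ultimately show "(\<lambda>u. T u (s i u)) \<in> borel_measurable N"
      by (subst (asm) measurable_cong) auto
  next
    fix u assume "u \<in> space N"
    then show "(\<lambda>i. T u (s i u)) \<longlonglongrightarrow> T u (f u)"
      using s(2) by (intro blinfun.tendsto tendsto_const) auto
  qed
qed

lemma lborel_to_lebesgue:
  fixes h :: "real \<Rightarrow> 'h::{banach, second_countable_topology}"
  assumes "set_integrable lborel S h"
  shows "set_integrable lebesgue S h" "(LINT u:S|lborel. h u) = (LINT u:S|lebesgue. h u)"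
proof -
  have m: "(\<lambda>u. indicator S u *\<^sub>R h u) \<in> borel_measurable lborel"
    using assms by (auto simp: set_integrable_def)
  show "set_integrable lebesgue S h"
    using assms integrable_completion [OF m] by (simp add: set_integrable_def)
  show "(LINT u:S|lborel. h u) = (LINT u:S|lebesgue. h u)"
    using integral_completion [OF m] by (simp add: set_lebesgue_integral_def)
qed

lemma set_integral_lebesgue_on:
  fixes h :: "real \<Rightarrow> 'h::{banach, second_countable_topology}"
  shows "set_integrable lebesgue {0..t} h \<longleftrightarrow> integrable (lebesgue_on {0..t}) h"
    "(LINT u:{0..t}|lebesgue. h u) = integral\<^sup>L (lebesgue_on {0..t}) h"
  by (simp_all add: set_integrable_def set_lebesgue_integral_def integrable_restrict_space integral_restrict_space)

text \<open>Integrability of \<open>f\<close> is not presupposed: if it fails, the integral is 0 by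
  convention and the nonnegative right side still bounds it.\<close>

lemma norm_set_integral_le:
  fixes f :: "real \<Rightarrow> 'h::{banach, second_countable_topology}"
  assumes k: "set_integrable lebesgue S k" and le: "\<And>u. u \<in> S \<Longrightarrow> norm (f u) \<le> k u"
    and S: "S \<in> sets lebesgue"
  shows "norm (LINT u:S|lebesgue. f u) \<le> (LINT u:S|lebesgue. k u)"
proof (cases "set_integrable lebesgue S f")
  case True
  have "norm (LINT u:S|lebesgue. f u) \<le> (LINT u:S|lebesgue. norm (f u))"
    using True by (rule set_integral_norm_bound)
  also have "\<dots> \<le> (LINT u:S|lebesgue. k u)"
    using True k le by (intro set_integral_mono set_integrable_norm) auto
  finally show ?thesis .
next
  case False
  have "0 \<le> (LINT u:S|lebesgue. k u)"
    unfolding set_lebesgue_integral_def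
    by (intro integral_nonneg_AE AE_I2) (use le in \<open>auto simp: indicator_def intro: order_trans [OF norm_ge_zero]\<close>)
  then show ?thesis using False by (simp add: set_lebesgue_integral_def set_integrable_def not_integrable_integral_eq)
qed

text \<open>Squaring the inequality and applying Cauchy-Schwarz turns the square integrable weight
  into the constant \<open>P\<close>, so that \<open>gronwall_dense\<close> applies to the square of
  \<open>f\<close>. The added 1 in \<open>2 * P + 1\<close> keeps the rate positive when
  \<open>P = 0\<close>.\<close>

lemma gronwall_L2:
  fixes f \<kappa> :: "real \<Rightarrow> real"
  assumes f: "continuous_on {0..\<tau>} f" "\<And>t. t \<in> {0..\<tau>} \<Longrightarrow> 0 \<le> f t" and \<tau>: "0 \<le> \<tau>" "\<tau> \<le> 1" and a: "0 \<le> a"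
    and \<kappa>: "\<kappa> \<in> borel_measurable (lebesgue_on {0..1})" "\<And>u. 0 \<le> \<kappa> u"
    and \<kappa>2: "integrable (lebesgue_on {0..1}) (\<lambda>u. (\<kappa> u)\<^sup>2)" "integral\<^sup>L (lebesgue_on {0..1}) (\<lambda>u. (\<kappa> u)\<^sup>2) \<le> P"
    and D: "D \<subseteq> {0..\<tau>}" "{0..\<tau>} \<subseteq> closure D"
    and le: "\<And>t. t \<in> D \<Longrightarrow> f t \<le> a + (LINT u:{0..t}|lebesgue. \<kappa> u * f u)"
    and t: "t \<in> {0..\<tau>}"
  shows "f t \<le> 2 * a * exp (2 * P + 1)"
proof -
  have P0: "0 \<le> P" by (rule order_trans [OF integral_nonneg_AE \<kappa>2(2)]) simp
  have "(f t)\<^sup>2 \<le> 2 * (2 * a\<^sup>2) * exp (2 * (2 * P + 1) * t)"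
  proof (rule gronwall_dense [where f = "\<lambda>t. (f t)\<^sup>2" and D = D and \<tau> = \<tau>])
    show "continuous_on {0..\<tau>} (\<lambda>t. (f t)\<^sup>2)" by (intro continuous_intros f)
    fix s assume s: "s \<in> D"
    then have s01: "0 \<le> s" "s \<le> \<tau>" "s \<le> 1" using D \<tau> by auto
    have sub: "{0..s} \<subseteq> {0..1}" using s01 by auto
    have \<kappa>m: "\<kappa> \<in> borel_measurable (lebesgue_on {0..s})"
      using measurable_restrict_mono [OF \<kappa>(1) sub] .
    have fs: "continuous_on {0..s} f" using f(1) s01 by (auto intro: continuous_on_subset)
    have fm: "f \<in> borel_measurable (lebesgue_on {0..s})"
      by (rule continuous_imp_measurable_on_sets_lebesgue [OF fs]) simp
    have \<kappa>i: "set_integrable lebesgue {0..1} (\<lambda>u. (\<kappa> u)\<^sup>2)" using \<kappa>2(1) by (simp add: set_integral_lebesgue_on)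
    then have \<kappa>is: "set_integrable lebesgue {0..s} (\<lambda>u. (\<kappa> u)\<^sup>2)"
      by (rule set_integrable_subset) (use sub in auto)
    have fi: "set_integrable lebesgue {0..s} (\<lambda>u. (f u)\<^sup>2)"
      by (rule absolutely_integrable_continuous_real) (intro continuous_intros fs)
    note CS = integral_Cauchy_Schwarz [OF \<kappa>m fm, of, OF \<kappa>is [unfolded set_integral_lebesgue_on] fi [unfolded set_integral_lebesgue_on]]
    have "(LINT u:{0..s}|lebesgue. (\<kappa> u)\<^sup>2) \<le> (LINT u:{0..1}|lebesgue. (\<kappa> u)\<^sup>2)"
      unfolding set_lebesgue_integral_def using \<kappa>i \<kappa>is sub
      by (intro integral_mono) (auto simp: set_integrable_def indicator_def)
    also have "\<dots> \<le> P" using \<kappa>2(2) by (simp add: set_integral_lebesgue_on)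
    finally have \<kappa>P: "integral\<^sup>L (lebesgue_on {0..s}) (\<lambda>u. (\<kappa> u)\<^sup>2) \<le> P" by (simp add: set_integral_lebesgue_on)
    have f2: "integral\<^sup>L (lebesgue_on {0..s}) (\<lambda>u. (f u)\<^sup>2) = integral {0..s} (\<lambda>u. (f u)\<^sup>2)"
      using set_lebesgue_integral_eq_integral(2) [OF fi] by (simp add: set_integral_lebesgue_on)
    have f2nn: "0 \<le> integral {0..s} (\<lambda>u. (f u)\<^sup>2)" unfolding f2 [symmetric] by (intro integral_nonneg_AE) simp
    have "(LINT u:{0..s}|lebesgue. \<kappa> u * f u)\<^sup>2 \<le> (integral\<^sup>L (lebesgue_on {0..s}) (\<lambda>u. \<bar>\<kappa> u * f u\<bar>))\<^sup>2"
      unfolding set_integral_lebesgue_on using integral_abs_bound [of "lebesgue_on {0..s}" "\<lambda>u. \<kappa> u * f u"]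
      by (metis abs_ge_zero power2_abs power_mono)
    also have "\<dots> \<le> integral\<^sup>L (lebesgue_on {0..s}) (\<lambda>u. (\<kappa> u)\<^sup>2) * integral\<^sup>L (lebesgue_on {0..s}) (\<lambda>u. (f u)\<^sup>2)"
      by (rule CS(2))
    also have "\<dots> \<le> P * integral {0..s} (\<lambda>u. (f u)\<^sup>2)"
      unfolding f2 using \<kappa>P f2nn by (intro mult_right_mono) auto
    finally have sq: "(LINT u:{0..s}|lebesgue. \<kappa> u * f u)\<^sup>2 \<le> P * integral {0..s} (\<lambda>u. (f u)\<^sup>2)" .
    have "(f s)\<^sup>2 \<le> (a + (LINT u:{0..s}|lebesgue. \<kappa> u * f u))\<^sup>2"
      using le [OF s] f(2) [of s] s01 by (intro power_mono) auto
    also have "\<dots> \<le> 2 * a\<^sup>2 + 2 * (LINT u:{0..s}|lebesgue. \<kappa> u * f u)\<^sup>2"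
      using power2_norm_add_le [of a "LINT u:{0..s}|lebesgue. \<kappa> u * f u"] by simp
    also have "\<dots> \<le> 2 * a\<^sup>2 + (2 * P + 1) * integral {0..s} (\<lambda>u. (f u)\<^sup>2)"
      using sq f2nn by (simp add: algebra_simps)
    finally show "(f s)\<^sup>2 \<le> 2 * a\<^sup>2 + (2 * P + 1) * integral {0..s} (\<lambda>u. (f u)\<^sup>2)" .
  qed (use P0 \<tau> D t in auto)
  also have "\<dots> \<le> 2 * (2 * a\<^sup>2) * exp (2 * (2 * P + 1) * 1)"
    using P0 t \<tau> by (intro mult_left_mono) (auto intro!: mult_left_le)
  also have "\<dots> = (2 * a * exp (2 * P + 1))\<^sup>2"
    by (simp add: power_mult_distrib power2_eq_square exp_add [symmetric])
  finally show ?thesis by (rule power2_le_imp_le) (use a in simp)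
qed

lemma dyadic_dense:
  assumes \<tau>: "0 < \<tau>"
  shows "{0..\<tau>} \<subseteq> closure {real i / 2 ^ k | i k. real i / 2 ^ k < \<tau>}" (is "_ \<subseteq> closure ?D")
proof
  fix t assume t: "t \<in> {0..\<tau>}"
  show "t \<in> closure ?D"
    unfolding closure_approachable
  proof (intro allI impI)
    fix e :: real assume e: "0 < e"
    \<comment> \<open>The target is first moved strictly below \<open>\<tau>\<close>, so that
      rounding up to a dyadic number does not cross it.\<close>
    define t' where "t' = max 0 (min t (\<tau> - e / 2))"
    have t': "0 \<le> t'" "t' < \<tau>" "\<bar>t' - t\<bar> \<le> e / 2" using t e \<tau> by (auto simp: t'_def max_def min_def abs_if field_simps)
    obtain k where k: "(1 / 2 :: real) ^ k < min (e / 2) (\<tau> - t')"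
      using real_arch_pow_inv [of "min (e / 2) (\<tau> - t')" "1 / 2"] e t' by auto
    define i where "i = nat \<lceil>t' * 2 ^ k\<rceil>"
    have "real i = of_int \<lceil>t' * 2 ^ k\<rceil>" using t' by (simp add: i_def)
    then have i: "t' * 2 ^ k \<le> real i" "real i < t' * 2 ^ k + 1" by linarith+
    have "t' \<le> real i / 2 ^ k" using i(1) by (simp add: field_simps)
    moreover have "real i / 2 ^ k < t' + (1 / 2) ^ k" using i(2) by (simp add: field_simps power_one_over)
    moreover have "(1 / 2) ^ k < e / 2" "(1 / 2) ^ k < \<tau> - t'" using k by auto
    moreover have "x < \<tau> \<and> \<bar>x - t\<bar> < e" if "t' \<le> x" "x < t' + b" "b < e / 2" "b < \<tau> - t'" for x b
      using that t'(3) unfolding abs_le_iff abs_less_iff by argo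
    ultimately have "real i / 2 ^ k < \<tau>" "dist (real i / 2 ^ k) t < e"
      unfolding dist_real_def by blast+
    then show "\<exists>y\<in>?D. dist y t < e" by blast
  qed
qed

section \<open>The controlled path as a function of time and initial point\<close>

context
  fixes I :: "nat set" and g :: "nat \<Rightarrow> 'u::{real_inner, banach, second_countable_topology}"
    and G :: "'h::{real_inner, banach, second_countable_topology} \<Rightarrow> 'u \<Rightarrow>\<^sub>L 'h" and \<Lambda> :: real
  assumes basis: "orthonormal_basis I g"
    and G_hs: "\<And>x. hilbert_schmidt I g (G x)" and \<Lambda>: "0 < \<Lambda>"
    and G_lip: "\<And>x y. hs_norm I g (G x - G y) \<le> \<Lambda> * norm (x - y)"
    and G_growth: "\<And>x. hs_norm I g (G x) \<le> \<Lambda> * (1 + norm x)"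
begin

lemma G_lipschitz_apply: "norm (G x u - G y u) \<le> \<Lambda> * norm (x - y) * norm u"
proof -
  have "norm ((G x - G y) u) \<le> hs_norm I g (G x - G y) * norm u"
    by (intro norm_le_hs_norm basis hilbert_schmidt_diff G_hs)
  also have "\<dots> \<le> \<Lambda> * norm (x - y) * norm u"
    by (intro mult_right_mono G_lip) simp
  finally show ?thesis by (simp add: blinfun.diff_left)
qed

lemma G_growth_apply: "norm (G x u) \<le> \<Lambda> * (1 + norm x) * norm u"
  by (rule order_trans [OF norm_le_hs_norm [OF basis G_hs]]) (intro mult_right_mono G_growth norm_ge_zero)

lemma G_continuous: "continuous_on A (\<lambda>x. G x u)"
  unfolding continuous_on_iff
proof (intro ballI allI impI)
  fix x e :: real and y :: 'h
  assume e: "0 < e"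
  have p: "0 < \<Lambda> * norm u + 1" using \<Lambda> by (simp add: add_nonneg_pos)
  have "dist (G x' u) (G y u) < e" if "dist x' y < e / (\<Lambda> * norm u + 1)" for x'
  proof -
    have "dist (G x' u) (G y u) \<le> (\<Lambda> * norm u) * dist x' y"
      using G_lipschitz_apply [of x' u y] by (simp add: dist_norm mult_ac)
    also have "\<dots> \<le> (\<Lambda> * norm u + 1) * dist x' y" by (intro mult_right_mono) auto
    also have "\<dots> < e" using that p by (simp add: field_simps)
    finally show ?thesis .
  qed
  then show "\<exists>d>0. \<forall>x'\<in>A. dist x' y < d \<longrightarrow> dist (G x' u) (G y u) < e"
    using e p by (intro exI [of _ "e / (\<Lambda> * norm u + 1)"]) auto
qed

text \<open>The path is bounded on a compact interval, and
  \<open>1 + (norm (\<phi> u))\<^sup>2\<close> dominates \<open>norm (\<phi> u)\<close>. Since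
  \<open>\<phi>\<close> is only Lebesgue measurable, the composition goes through
  \<open>measurable_operator_apply\<close>.\<close>

lemma G_path_integrable:
  fixes v :: "real \<Rightarrow> 'h"
  assumes v: "continuous_on {0..t} v" and t: "t \<le> 1" and \<phi>: "square_integrable (lebesgue_on {0..1}) \<phi>"
  shows "set_integrable lebesgue {0..t} (\<lambda>u. G (v u) (\<phi> u))"
proof -
  have sub: "{0..t} \<subseteq> {0..1}" using t by (auto intro: order_trans)
  have \<phi>m: "\<phi> \<in> borel_measurable (lebesgue_on {0..t})"
    using \<phi> measurable_restrict_mono [OF _ sub] by (auto simp: square_integrable_def)
  have \<phi>2: "integrable (lebesgue_on {0..t}) (\<lambda>u. (norm (\<phi> u))\<^sup>2)"
    unfolding set_integral_lebesgue_on(1) [symmetric]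
    by (rule set_integrable_subset [of _ "{0..1}"])
       (use \<phi> sub in \<open>auto simp: square_integrable_def set_integral_lebesgue_on\<close>)
  have one: "integrable (lebesgue_on {0..t}) (\<lambda>u. 1 :: real)"
    unfolding set_integral_lebesgue_on(1) [symmetric] by (rule absolutely_integrable_continuous_real) simp
  have Gm: "(\<lambda>u. G (v u) (\<phi> u)) \<in> borel_measurable (lebesgue_on {0..t})"
  proof (rule measurable_operator_apply [OF _ \<phi>m])
    fix y
    have "continuous_on {0..t} (\<lambda>u. G (v u) y)"
      using continuous_on_compose2 [OF G_continuous [of UNIV y] v] by simp
    then have "continuous_on {0..t} (\<lambda>u. G (v u) y)" .
    then have "(\<lambda>u. indicator {0..t} u *\<^sub>R G (v u) y) \<in> borel_measurable borel"
      by (intro borel_measurable_continuous_on_indicator) auto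
    then have "(\<lambda>u. indicator {0..t} u *\<^sub>R G (v u) y) \<in> borel_measurable (lebesgue_on {0..t})"
      by (rule borel_measurable_lebesgue_on)
    then show "(\<lambda>u. G (v u) y) \<in> borel_measurable (lebesgue_on {0..t})"
      by (rule measurable_cong [THEN iffD1, rotated]) (simp add: space_restrict_space)
  qed
  obtain B where "\<forall>x\<in>v ` {0..t}. norm x \<le> B"
    using compact_imp_bounded [OF compact_continuous_image [OF v compact_Icc]] unfolding bounded_iff by (elim exE)
  then have B: "\<And>u. u \<in> {0..t} \<Longrightarrow> norm (v u) \<le> B" by simp
  show ?thesis
    unfolding set_integral_lebesgue_on
  proof (rule Bochner_Integration.integrable_bound [OF _ Gm])
    show "integrable (lebesgue_on {0..t}) (\<lambda>u. \<Lambda> * (1 + B) * (1 + (norm (\<phi> u))\<^sup>2))"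
      by (intro integrable_mult_right Bochner_Integration.integrable_add one \<phi>2)
    show "AE u in lebesgue_on {0..t}. norm (G (v u) (\<phi> u)) \<le> norm (\<Lambda> * (1 + B) * (1 + (norm (\<phi> u))\<^sup>2))"
    proof (intro AE_I2)
      fix u assume "u \<in> space (lebesgue_on {0..t})"
      then have u: "u \<in> {0..t}" by (simp add: space_restrict_space)
      have B0: "0 \<le> B" using B [OF u] norm_ge_zero order_trans by blast
      have "norm (\<phi> u) \<le> 1 + (norm (\<phi> u))\<^sup>2"
        using sum_squares_bound [of 1 "norm (\<phi> u)"] norm_ge_zero [of "\<phi> u"] unfolding power_one mult_1_right by linarith
      then have "norm (G (v u) (\<phi> u)) \<le> \<Lambda> * (1 + B) * (1 + (norm (\<phi> u))\<^sup>2)"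
        using \<Lambda> B [OF u] B0 by (intro order_trans [OF G_growth_apply] mult_mono) auto
      then show "norm (G (v u) (\<phi> u)) \<le> norm (\<Lambda> * (1 + B) * (1 + (norm (\<phi> u))\<^sup>2))" by simp
    qed
  qed
qed

text \<open>\<open>gronwall_L2\<close> with weight \<open>\<Lambda> * norm (\<phi> u)\<close> yields
  one Lipschitz constant for all times, as joint continuity demands.\<close>

lemma controlled_solution_lipschitz:
  assumes \<phi>: "square_integrable (lebesgue_on {0..1}) \<phi>"
    and z: "\<And>x. controlled_solution G \<phi> x (z x)"
  shows "\<exists>L\<ge>0. \<forall>x y. \<forall>t\<in>{0..1}. norm (z x t - z y t) \<le> L * norm (x - y)"
proof -
  define P where "P = \<Lambda>\<^sup>2 * integral\<^sup>L (lebesgue_on {0..1}) (\<lambda>u. (norm (\<phi> u))\<^sup>2)"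
  have zc: "continuous_on {0..1} (z x)" and ze: "t \<in> {0..1} \<Longrightarrow> z x t = x + (LINT s:{0..t}|lebesgue. G (z x s) (\<phi> s))" for x t
    using z by (auto simp: controlled_solution_def)
  have \<phi>m: "\<phi> \<in> borel_measurable (lebesgue_on {0..1})" and \<phi>2: "integrable (lebesgue_on {0..1}) (\<lambda>u. (norm (\<phi> u))\<^sup>2)"
    using \<phi> by (auto simp: square_integrable_def)
  have "norm (z x t - z y t) \<le> 2 * norm (x - y) * exp (2 * P + 1)" if t: "t \<in> {0..1}" for x y t
  proof (rule gronwall_L2 [where \<tau> = 1 and \<kappa> = "\<lambda>u. \<Lambda> * norm (\<phi> u)" and D = "{0..1}" and f = "\<lambda>t. norm (z x t - z y t)"])
    show "continuous_on {0..1} (\<lambda>t. norm (z x t - z y t))" by (intro continuous_intros zc)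
    show "(\<lambda>u. \<Lambda> * norm (\<phi> u)) \<in> borel_measurable (lebesgue_on {0..1})" using \<phi>m by measurable
    show "integrable (lebesgue_on {0..1}) (\<lambda>u. (\<Lambda> * norm (\<phi> u))\<^sup>2)"
      unfolding power_mult_distrib by (intro integrable_mult_right \<phi>2)
    show "integral\<^sup>L (lebesgue_on {0..1}) (\<lambda>u. (\<Lambda> * norm (\<phi> u))\<^sup>2) \<le> P"
      unfolding power_mult_distrib P_def by simp
    fix s :: real assume s: "s \<in> {0..1}"
    have zs: "continuous_on {0..s} (z w)" for w by (rule continuous_on_subset [OF zc]) (use s in auto)
    have i: "set_integrable lebesgue {0..s} (\<lambda>u. G (z w u) (\<phi> u))" for w
      using s by (intro G_path_integrable zs \<phi>) auto
    have "z x s - z y s = (x - y) + (LINT u:{0..s}|lebesgue. G (z x u) (\<phi> u) - G (z y u) (\<phi> u))"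
      unfolding ze [OF s] set_integral_diff(2) [OF i i] by simp
    then have "norm (z x s - z y s) \<le> norm (x - y) + norm (LINT u:{0..s}|lebesgue. G (z x u) (\<phi> u) - G (z y u) (\<phi> u))"
      by (simp only: norm_triangle_ineq)
    also have "norm (LINT u:{0..s}|lebesgue. G (z x u) (\<phi> u) - G (z y u) (\<phi> u)) \<le> (LINT u:{0..s}|lebesgue. \<Lambda> * norm (\<phi> u) * norm (z x u - z y u))"
    proof (rule norm_set_integral_le)
      show "norm (G (z x u) (\<phi> u) - G (z y u) (\<phi> u)) \<le> \<Lambda> * norm (\<phi> u) * norm (z x u - z y u)" for u
        using G_lipschitz_apply [of "z x u" "\<phi> u" "z y u"] by (simp add: mult_ac)
      have sub: "{0..s} \<subseteq> {0..1}" using s by auto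
      have m: "(\<lambda>u. \<Lambda> * norm (\<phi> u)) \<in> borel_measurable (lebesgue_on {0..s})"
        using measurable_restrict_mono [OF \<phi>m sub] by measurable
      have c: "continuous_on {0..s} (\<lambda>u. norm (z x u - z y u))" by (intro continuous_intros zs)
      have fm: "(\<lambda>u. norm (z x u - z y u)) \<in> borel_measurable (lebesgue_on {0..s})"
        by (rule continuous_imp_measurable_on_sets_lebesgue [OF c]) simp
      show "set_integrable lebesgue {0..s} (\<lambda>u. \<Lambda> * norm (\<phi> u) * norm (z x u - z y u))"
        unfolding set_integral_lebesgue_on
      proof (rule integral_Cauchy_Schwarz(1) [OF m fm])
        show "integrable (lebesgue_on {0..s}) (\<lambda>u. (\<Lambda> * norm (\<phi> u))\<^sup>2)"
        proof -
          have "set_integrable lebesgue {0..1} (\<lambda>u. (norm (\<phi> u))\<^sup>2)"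
            unfolding set_integral_lebesgue_on(1) by (rule \<phi>2)
          then have "set_integrable lebesgue {0..s} (\<lambda>u. (norm (\<phi> u))\<^sup>2)"
            by (rule set_integrable_subset) (use sub in simp_all)
          then have "integrable (lebesgue_on {0..s}) (\<lambda>u. (norm (\<phi> u))\<^sup>2)"
            unfolding set_integral_lebesgue_on(1) .
          then show ?thesis unfolding power_mult_distrib by (rule integrable_mult_right)
        qed
        show "integrable (lebesgue_on {0..s}) (\<lambda>u. (norm (z x u - z y u))\<^sup>2)"
          unfolding set_integral_lebesgue_on(1) [symmetric]
          by (rule absolutely_integrable_continuous_real) (intro continuous_intros zs)
      qed
    qed simp
    finally show "norm (z x s - z y s) \<le> norm (x - y) + (LINT u:{0..s}|lebesgue. \<Lambda> * norm (\<phi> u) * norm (z x u - z y u))" by simp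
  qed (use t \<Lambda> closure_subset in auto)
  then show ?thesis
    by (intro exI [of _ "2 * exp (2 * P + 1)"]) (auto simp: mult_ac)
qed

text \<open>Its purpose is compactness of the set of all \<open>z x t\<close> with \<open>x\<close>
  in a compact set, the source of uniformity in the initial point.\<close>

lemma controlled_solution_continuous:
  assumes \<phi>: "square_integrable (lebesgue_on {0..1}) \<phi>"
    and z: "\<And>x. controlled_solution G \<phi> x (z x)"
  shows "continuous_on (A \<times> {0..1}) (\<lambda>(x, t). z x t)"
proof -
  obtain L where L: "0 \<le> L" "\<And>x y t. t \<in> {0..1} \<Longrightarrow> norm (z x t - z y t) \<le> L * norm (x - y)"
    using controlled_solution_lipschitz [OF \<phi> z] by blast
  show ?thesis
    unfolding continuous_on_iff
  proof (safe)
    fix x :: 'h and t e :: real assume t: "t \<in> {0..1}" and e: "0 < e" and "x \<in> A"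
    have zc: "continuous_on {0..1} (z x)" using z by (auto simp: controlled_solution_def)
    obtain \<delta> where \<delta>: "0 < \<delta>" "\<And>s. s \<in> {0..1} \<Longrightarrow> dist s t < \<delta> \<Longrightarrow> dist (z x s) (z x t) < e / 2"
      using zc t e unfolding continuous_on_iff by (metis half_gt_zero)
    define \<eta> where "\<eta> = e / (2 * (L + 1))"
    have "0 < L + 1" using L(1) by simp
    then have \<eta>: "0 < \<eta>" "(L + 1) * \<eta> = e / 2" using e by (auto simp: \<eta>_def divide_simps)
    have *: "dist (z y s) (z x t) < e" if s: "s \<in> {0..1}" and d: "dist (y, s) (x, t) < min \<delta> \<eta>" for y s
    proof -
      have ys: "dist y x < \<eta>" "dist s t < \<delta>"
        using d dist_fst_le [of "(y, s)" "(x, t)"] dist_snd_le [of "(y, s)" "(x, t)"] by auto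
      have "norm (z y s - z x s) \<le> L * norm (y - x)" by (rule L(2) [OF s])
      also have "\<dots> \<le> (L + 1) * \<eta>" using ys L(1) by (intro mult_mono) (auto simp: dist_norm)
      finally have "dist (z y s) (z x s) \<le> e / 2" using \<eta>(2) by (simp add: dist_norm)
      then show ?thesis using \<delta>(2) [OF s ys(2)] dist_triangle [of "z y s" "z x t" "z x s"] by linarith
    qed
    show "\<exists>d>0. \<forall>x'\<in>A \<times> {0..1}. dist x' (x, t) < d \<longrightarrow> dist (case x' of (x, t) \<Rightarrow> z x t) (z x t) < e"
    proof (intro exI [of _ "min \<delta> \<eta>"] conjI ballI impI)
      fix x' assume "x' \<in> A \<times> {0..1 :: real}" and d: "dist x' (x, t) < min \<delta> \<eta>"
      then obtain y s where x': "x' = (y, s)" "s \<in> {0..1}" by blast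
      show "dist (case x' of (x, t) \<Rightarrow> z x t) (z x t) < e"
        using * [OF x'(2) d [unfolded x'(1)]] by (simp add: x'(1))
    qed (use \<delta>(1) \<eta>(1) in simp)
  qed
qed

end

section \<open>Change of measure and the lower bound\<close>

lemma control_norm2:
  assumes "orthonormal_basis I g" "fst ` set d \<subseteq> I"
  shows "(norm (control g d u))\<^sup>2 = (\<Sum>k\<in>fst ` set d. (norm (coef d k u undefined))\<^sup>2)"
  unfolding control_def using assms by (subst orthonormal_basis_norm_sum) auto

lemma control_square_integrable:
  fixes g :: "nat \<Rightarrow> 'u::{real_inner, banach, second_countable_topology}" and d :: "('w, real) elementary"
  assumes "orthonormal_basis I g" "fst ` set d \<subseteq> I"
  shows "square_integrable (lebesgue_on {0..1}) (control g d)"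
    and "integral\<^sup>L (lebesgue_on {0..1}) (\<lambda>u. (norm (control g d u))\<^sup>2) = energy d (fst ` set d) 1 undefined"
proof -
  have i: "set_integrable lborel {0..1} (\<lambda>u. (norm (control g d u))\<^sup>2)"
    unfolding control_norm2 [OF assms] by (rule set_integrable_coef(1)) simp
  from lborel_to_lebesgue [OF i]
  show "square_integrable (lebesgue_on {0..1}) (control g d)"
    "integral\<^sup>L (lebesgue_on {0..1}) (\<lambda>u. (norm (control g d u))\<^sup>2) = energy d (fst ` set d) 1 undefined"
    unfolding square_integrable_def set_integral_lebesgue_on
    by (auto intro: borel_measurable_lebesgue_on simp: energy_def control_norm2 [OF assms])
qed

section \<open>Pathwise confinement to the tube\<close>

context
  fixes I :: "nat set" and g :: "nat \<Rightarrow> 'u::{real_inner, banach, second_countable_topology}"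
    and G :: "'h::{real_inner, banach, second_countable_topology} \<Rightarrow> 'u \<Rightarrow>\<^sub>L 'h" and \<Lambda> :: real
  assumes basis: "orthonormal_basis I g"
    and G_hs: "\<And>x. hilbert_schmidt I g (G x)" and \<Lambda>: "0 < \<Lambda>"
    and G_lip: "\<And>x y. hs_norm I g (G x - G y) \<le> \<Lambda> * norm (x - y)"
    and G_growth: "\<And>x. hs_norm I g (G x) \<le> \<Lambda> * (1 + norm x)"
begin

text \<open>Five errors, each at most \<open>\<theta>\<close>, separate the path from the controlled
  one: the semigroup acting on \<open>x\<close>, the drift \<open>dr\<close>, the semigroup acting
  on the controlled velocity, the exchange of \<open>\<psi>\<close> for \<open>\<phi>\<close>, and
  the stochastic deviation. Before the first exit from the tube the path lies in the ball of radius
  \<open>\<rho>\<close>, where all of them are available, and \<open>gronwall_L2\<close> gives a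
  bound below \<open>\<delta>\<close> at the exit time, a contradiction.\<close>

lemma pathwise_bound:
  fixes S :: "real \<Rightarrow> 'h \<Rightarrow>\<^sub>L 'h" and d :: "('w, real) elementary" and v z dr :: "real \<Rightarrow> 'h"
  defines "\<psi> \<equiv> control g d"
  assumes S: "c0_semigroup S" and C: "1 \<le> C" "\<And>r. r \<in> {0..1} \<Longrightarrow> norm (S r) \<le> C" and \<epsilon>: "\<epsilon> \<in> {0<..1}"
    and v: "continuous_on {0..1} v" and z: "controlled_solution G \<phi> x z"
    and \<phi>: "square_integrable (lebesgue_on {0..1}) \<phi>" and dI: "fst ` set d \<subseteq> I"
    and \<delta>: "0 < \<delta>" and \<rho>: "\<And>u. u \<in> {0..1} \<Longrightarrow> norm (z u) + \<delta> \<le> \<rho>" and \<theta>: "0 \<le> \<theta>"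
    and P: "integral\<^sup>L (lebesgue_on {0..1}) (\<lambda>u. (C * \<Lambda> * norm (\<psi> u))\<^sup>2) \<le> P"
    and small: "2 * (5 * \<theta>) * exp (2 * P + 1) < \<delta>"
    and a1: "\<And>t. t \<in> {0..1} \<Longrightarrow> norm (S (\<epsilon> * t) x - x) \<le> \<theta>"
    and a2: "\<And>t. t \<in> {0..1} \<Longrightarrow> \<forall>u\<in>{0<..t}. norm (v u) \<le> \<rho> \<Longrightarrow> norm (dr t) \<le> \<theta>"
    and a3: "\<And>r u. r \<in> {0..\<epsilon>} \<Longrightarrow> u \<in> {0..1} \<Longrightarrow> norm (S r (G (z u) (\<psi> u)) - G (z u) (\<psi> u)) \<le> \<theta>"
    and a4: "\<Lambda> * (1 + \<rho>) * (LINT u:{0..1}|lebesgue. norm (\<psi> u - \<phi> u)) \<le> \<theta>"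
    and dy: "\<And>i k. i \<le> 2 ^ k \<Longrightarrow> \<forall>u\<in>{0<..real i / 2 ^ k}. norm (v u) \<le> \<rho> \<Longrightarrow>
      norm (v (real i / 2 ^ k) - (S (\<epsilon> * (real i / 2 ^ k)) x + dr (real i / 2 ^ k)
        + (LINT u:{0..real i / 2 ^ k}|lborel. S (\<epsilon> * (real i / 2 ^ k - u)) (G (v u) (\<psi> u))))) \<le> \<theta>"
    and t: "t \<in> {0..1}"
  shows "norm (v t - z t) < \<delta>"
proof -
  define f where "f t = norm (v t - z t)" for t
  have zc: "continuous_on {0..1} z" and ze: "\<And>t. t \<in> {0..1} \<Longrightarrow> z t = x + (LINT s:{0..t}|lebesgue. G (z s) (\<phi> s))"
    using z by (auto simp: controlled_solution_def)
  have fc: "continuous_on {0..1} f" unfolding f_def by (intro continuous_intros v zc)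
  have f0: "0 \<le> f t" for t by (simp add: f_def)
  note Gc = G_continuous [OF basis G_hs \<Lambda> G_lip G_growth]
  note Gl = G_lipschitz_apply [OF basis G_hs \<Lambda> G_lip G_growth]
  note Gg = G_growth_apply [OF basis G_hs \<Lambda> G_lip G_growth]
  note Gi = G_path_integrable [OF basis G_hs \<Lambda> G_lip G_growth]
  have \<psi>sq: "square_integrable (lebesgue_on {0..1}) \<psi>"
    unfolding \<psi>_def by (rule control_square_integrable(1) [OF basis dI])
  have \<psi>m: "\<psi> \<in> borel_measurable (lebesgue_on {0..1})" and \<psi>2: "integrable (lebesgue_on {0..1}) (\<lambda>u. (norm (\<psi> u))\<^sup>2)"
    using \<psi>sq by (auto simp: square_integrable_def)
  define \<kappa> where "\<kappa> u = C * \<Lambda> * norm (\<psi> u)" for u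
  have \<kappa>0: "0 \<le> \<kappa> u" for u using C \<Lambda> by (simp add: \<kappa>_def)
  have \<kappa>m: "\<kappa> \<in> borel_measurable (lebesgue_on {0..1})" unfolding \<kappa>_def using \<psi>m by measurable
  have \<kappa>2: "integrable (lebesgue_on {0..1}) (\<lambda>u. (\<kappa> u)\<^sup>2)"
    unfolding \<kappa>_def power_mult_distrib [of "C * \<Lambda>"] by (intro integrable_mult_right \<psi>2)
  have diffm: "(\<lambda>u. norm (\<psi> u - \<phi> u)) \<in> borel_measurable (lebesgue_on {0..1})"
    using \<psi>m \<phi> by (auto simp: square_integrable_def)
  have diff1: "set_integrable lebesgue {0..1} (\<lambda>u. norm (\<psi> u - \<phi> u))"
    unfolding set_integral_lebesgue_on
  proof (rule Bochner_Integration.integrable_bound [OF _ diffm])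
    have one: "integrable (lebesgue_on {0..1}) (\<lambda>u::real. 1 :: real)"
      unfolding set_integral_lebesgue_on(1) [symmetric] by (rule absolutely_integrable_continuous_real) simp
    show "integrable (lebesgue_on {0..1}) (\<lambda>u. 1 + (2 * (norm (\<psi> u))\<^sup>2 + 2 * (norm (\<phi> u))\<^sup>2))"
      using \<phi> by (intro Bochner_Integration.integrable_add one integrable_mult_right \<psi>2) (simp add: square_integrable_def)
    show "AE u in lebesgue_on {0..1}. norm (norm (\<psi> u - \<phi> u)) \<le> norm (1 + (2 * (norm (\<psi> u))\<^sup>2 + 2 * (norm (\<phi> u))\<^sup>2))"
    proof (intro AE_I2)
      fix u
      have "norm (\<psi> u - \<phi> u) \<le> 1 + (norm (\<psi> u - \<phi> u))\<^sup>2"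
        using sum_squares_bound [of 1 "norm (\<psi> u - \<phi> u)"] norm_ge_zero [of "\<psi> u - \<phi> u"] unfolding power_one mult_1_right by linarith
      also have "\<dots> \<le> 1 + (2 * (norm (\<psi> u))\<^sup>2 + 2 * (norm (\<phi> u))\<^sup>2)"
        using power2_norm_add_le [of "\<psi> u" "- \<phi> u"] by simp
      finally show "norm (norm (\<psi> u - \<phi> u)) \<le> norm (1 + (2 * (norm (\<psi> u))\<^sup>2 + 2 * (norm (\<phi> u))\<^sup>2))" by simp
    qed
  qed
  \<comment> \<open>At a dyadic time up to which the path stays in the closed tube; the integral is
    the Lipschitz term that is left to Gronwall's inequality.\<close>
  have est: "f t \<le> 5 * \<theta> + (LINT u:{0..t}|lebesgue. \<kappa> u * f u)"
    if t: "t = real i / 2 ^ k" "i \<le> 2 ^ k" and fle: "\<forall>u\<in>{0<..t}. f u \<le> \<delta>" for t i k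
  proof -
    have t01: "t \<in> {0..1}"
    proof -
      have "real i \<le> 2 ^ k" using t(2) by (metis of_nat_le_iff of_nat_numeral of_nat_power)
      then show ?thesis by (simp add: t(1))
    qed
    have sub: "{0..t} \<subseteq> {0..1}" using t01 by auto
    have vt: "continuous_on {0..t} v" and zt: "continuous_on {0..t} z"
      using v zc sub by (auto intro: continuous_on_subset)
    have vb: "\<forall>u\<in>{0<..t}. norm (v u) \<le> \<rho>"
    proof
      fix u assume u: "u \<in> {0<..t}"
      then have "norm (z u) + \<delta> \<le> \<rho>" using t01 by (intro \<rho>) auto
      moreover have "norm (v u - z u) \<le> \<delta>" using fle u by (simp add: f_def)
      ultimately show "norm (v u) \<le> \<rho>"
        using norm_triangle_sub [of "v u" "z u"] by linarith
    qed
    have in01: "\<epsilon> * (t - u) \<in> {0..1}" "\<epsilon> * (t - u) \<in> {0..\<epsilon>}" if "u \<in> {0..t}" for u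
    proof -
      have "\<epsilon> * (t - u) \<le> \<epsilon> * 1" using \<epsilon> t01 that by (intro mult_left_mono) auto
      moreover have "0 \<le> \<epsilon> * (t - u)" "\<epsilon> \<le> 1" using \<epsilon> that by auto
      ultimately show "\<epsilon> * (t - u) \<in> {0..1}" "\<epsilon> * (t - u) \<in> {0..\<epsilon>}" unfolding atLeastAtMost_iff by linarith+
    qed
    \<comment> \<open>From \<open>h1\<close> to \<open>h4\<close> one thing changes at a time: the
      path \<open>v\<close> becomes \<open>z\<close>, the semigroup is dropped, the control
      \<open>\<psi>\<close> becomes \<open>\<phi>\<close>.\<close>
    define h1 where "h1 u = S (\<epsilon> * (t - u)) (G (v u) (\<psi> u))" for u
    define h2 where "h2 u = S (\<epsilon> * (t - u)) (G (z u) (\<psi> u))" for u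
    define h3 where "h3 u = G (z u) (\<psi> u)" for u
    define h4 where "h4 u = G (z u) (\<phi> u)" for u
    have \<epsilon>': "\<epsilon> \<in> {0..1}" using \<epsilon> by auto
    have b1: "set_integrable lborel {0..t} h1" and b2: "set_integrable lborel {0..t} h2"
      unfolding h1_def h2_def \<psi>_def by (intro set_integrable_control(1) S Gc \<epsilon>' t01 vt zt)+
    have i1: "set_integrable lebesgue {0..t} h1" and i2: "set_integrable lebesgue {0..t} h2"
      using lborel_to_lebesgue(1) [OF b1] lborel_to_lebesgue(1) [OF b2] .
    have i3: "set_integrable lebesgue {0..t} h3" and i4: "set_integrable lebesgue {0..t} h4"
      unfolding h3_def h4_def using t01 by (auto intro!: Gi zt \<psi>sq \<phi>)
    have n1: "norm (LINT u:{0..t}|lebesgue. h1 u - h2 u) \<le> (LINT u:{0..t}|lebesgue. \<kappa> u * f u)"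
    proof (rule norm_set_integral_le)
      fix u assume u: "u \<in> {0..t}"
      have "norm (h1 u - h2 u) = norm (S (\<epsilon> * (t - u)) (G (v u) (\<psi> u) - G (z u) (\<psi> u)))"
        by (simp add: h1_def h2_def blinfun.diff_right)
      also have "\<dots> \<le> C * (\<Lambda> * norm (v u - z u) * norm (\<psi> u))"
        using C(2) [OF in01(1) [OF u]] C(1) by (intro order_trans [OF norm_blinfun] mult_mono Gl) auto
      also have "\<dots> = \<kappa> u * f u" by (simp add: \<kappa>_def f_def mult_ac)
      finally show "norm (h1 u - h2 u) \<le> \<kappa> u * f u" .
    next
      have m: "\<kappa> \<in> borel_measurable (lebesgue_on {0..t})"
        using measurable_restrict_mono [OF \<kappa>m sub] .
      have ft: "continuous_on {0..t} f" by (rule continuous_on_subset [OF fc sub])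
      have fm: "f \<in> borel_measurable (lebesgue_on {0..t})"
        by (rule continuous_imp_measurable_on_sets_lebesgue [OF ft]) simp
      have "set_integrable lebesgue {0..1} (\<lambda>u. (\<kappa> u)\<^sup>2)"
        unfolding set_integral_lebesgue_on(1) by (rule \<kappa>2)
      then have "set_integrable lebesgue {0..t} (\<lambda>u. (\<kappa> u)\<^sup>2)"
        by (rule set_integrable_subset) (use sub in simp_all)
      then have k2: "integrable (lebesgue_on {0..t}) (\<lambda>u. (\<kappa> u)\<^sup>2)"
        unfolding set_integral_lebesgue_on(1) .
      have "set_integrable lebesgue {0..t} (\<lambda>u. (f u)\<^sup>2)"
        by (rule absolutely_integrable_continuous_real) (intro continuous_intros ft)
      then have f2: "integrable (lebesgue_on {0..t}) (\<lambda>u. (f u)\<^sup>2)"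
        unfolding set_integral_lebesgue_on(1) .
      show "set_integrable lebesgue {0..t} (\<lambda>u. \<kappa> u * f u)"
        unfolding set_integral_lebesgue_on(1) by (rule integral_Cauchy_Schwarz(1) [OF m fm k2 f2])
    qed simp
    have n2: "norm (LINT u:{0..t}|lebesgue. h2 u - h3 u) \<le> (LINT u:{0..t}|lebesgue. \<theta>)"
    proof (rule norm_set_integral_le)
      fix u assume u: "u \<in> {0..t}"
      then have "u \<in> {0..1}" using t01 by auto
      from a3 [OF in01(2) [OF u] this] show "norm (h2 u - h3 u) \<le> \<theta>" by (simp add: h2_def h3_def)
    next
      show "set_integrable lebesgue {0..t} (\<lambda>u. \<theta>)"
        by (rule absolutely_integrable_continuous_real) simp
    qed simp
    also have "\<dots> \<le> \<theta>"
      using t01 \<theta> by (simp add: set_lebesgue_integral_def mult_left_le_one_le)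
    finally have n2': "norm (LINT u:{0..t}|lebesgue. h2 u - h3 u) \<le> \<theta>" .
    have \<rho>0: "0 \<le> \<rho>" proof -
      have "norm (z 0) + \<delta> \<le> \<rho>" by (rule \<rho>) simp
      then show ?thesis using \<delta> norm_ge_zero [of "z 0"] by linarith
    qed
    have n3: "norm (LINT u:{0..t}|lebesgue. h3 u - h4 u) \<le> (LINT u:{0..t}|lebesgue. \<Lambda> * (1 + \<rho>) * norm (\<psi> u - \<phi> u))"
    proof (rule norm_set_integral_le)
      fix u assume u: "u \<in> {0..t}"
      then have zu: "norm (z u) \<le> \<rho>" using t01 \<delta> \<rho> [of u] by auto
      have "norm (h3 u - h4 u) = norm (G (z u) (\<psi> u - \<phi> u))" by (simp add: h3_def h4_def blinfun.diff_right)
      also have "\<dots> \<le> \<Lambda> * (1 + norm (z u)) * norm (\<psi> u - \<phi> u)" by (rule Gg)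
      also have "\<dots> \<le> \<Lambda> * (1 + \<rho>) * norm (\<psi> u - \<phi> u)"
        using zu \<Lambda> by (intro mult_right_mono mult_left_mono) auto
      finally show "norm (h3 u - h4 u) \<le> \<Lambda> * (1 + \<rho>) * norm (\<psi> u - \<phi> u)" .
    next
      show "set_integrable lebesgue {0..t} (\<lambda>u. \<Lambda> * (1 + \<rho>) * norm (\<psi> u - \<phi> u))"
        using diff1 sub by (intro set_integrable_mult_right set_integrable_subset [OF diff1]) auto
    qed simp
    also have "\<dots> = \<Lambda> * (1 + \<rho>) * (LINT u:{0..t}|lebesgue. norm (\<psi> u - \<phi> u))"
      by (rule set_integral_mult_right)
    also have "\<dots> \<le> \<Lambda> * (1 + \<rho>) * (LINT u:{0..1}|lebesgue. norm (\<psi> u - \<phi> u))"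
    proof (intro mult_left_mono)
      have d0: "set_integrable lebesgue {0..t} (\<lambda>u. norm (\<psi> u - \<phi> u))"
        by (rule set_integrable_subset [OF diff1]) (use sub in simp_all)
      show "(LINT u:{0..t}|lebesgue. norm (\<psi> u - \<phi> u)) \<le> (LINT u:{0..1}|lebesgue. norm (\<psi> u - \<phi> u))"
        unfolding set_lebesgue_integral_def using d0 diff1 sub
        by (intro integral_mono) (auto simp: set_integrable_def indicator_def)
    qed (use \<Lambda> \<rho>0 in simp)
    also have "\<dots> \<le> \<theta>" by (rule a4)
    finally have n3': "norm (LINT u:{0..t}|lebesgue. h3 u - h4 u) \<le> \<theta>" .
    have "(LINT u:{0..t}|lebesgue. h1 u) - (LINT u:{0..t}|lebesgue. h4 u)
      = (LINT u:{0..t}|lebesgue. h1 u - h2 u) + ((LINT u:{0..t}|lebesgue. h2 u - h3 u) + (LINT u:{0..t}|lebesgue. h3 u - h4 u))"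
      by (simp add: set_integral_diff(2) [OF i1 i2] set_integral_diff(2) [OF i2 i3] set_integral_diff(2) [OF i3 i4])
    then have main: "norm ((LINT u:{0..t}|lebesgue. h1 u) - (LINT u:{0..t}|lebesgue. h4 u)) \<le> (LINT u:{0..t}|lebesgue. \<kappa> u * f u) + (\<theta> + \<theta>)"
      by (simp only:) (intro order_trans [OF norm_triangle_ineq] add_mono n1 order_trans [OF norm_triangle_ineq] n2' n3')
    have dyt: "norm (v t - (S (\<epsilon> * t) x + dr t + (LINT u:{0..t}|lebesgue. h1 u))) \<le> \<theta>"
      using dy [OF t(2), folded t(1), OF vb] unfolding lborel_to_lebesgue(2) [OF b1, symmetric] unfolding h1_def .
    have zt': "z t = x + (LINT u:{0..t}|lebesgue. h4 u)" unfolding h4_def by (rule ze [OF t01])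
    have "v t - z t = (v t - (S (\<epsilon> * t) x + dr t + (LINT u:{0..t}|lebesgue. h1 u))) + ((S (\<epsilon> * t) x - x)
        + (dr t + ((LINT u:{0..t}|lebesgue. h1 u) - (LINT u:{0..t}|lebesgue. h4 u))))"
      unfolding zt' by simp
    then have "f t \<le> \<theta> + (\<theta> + (\<theta> + ((LINT u:{0..t}|lebesgue. \<kappa> u * f u) + (\<theta> + \<theta>))))"
      unfolding f_def by (simp only:) (intro order_trans [OF norm_triangle_ineq] add_mono dyt a1 [OF t01] a2 [OF t01 vb] main [unfolded f_def])
    then show ?thesis by simp
  qed
  have e0: "exp (2 * P + 1) \<ge> 1"
  proof -
    have "0 \<le> P" by (rule order_trans [OF integral_nonneg_AE P]) simp
    then show ?thesis by simp
  qed
  \<comment> \<open>The dyadic estimate at time 0; it excludes an immediate exit and makes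
    \<open>\<tau>\<close> positive.\<close>
  have f00: "f 0 < \<delta>"
  proof -
    have "f 0 \<le> 5 * \<theta> + (LINT u:{0..0}|lebesgue. \<kappa> u * f u)" using est [of 0 0 0] by simp
    also have "(LINT u:{0..0}|lebesgue. \<kappa> u * f u) = 0"
      unfolding set_lebesgue_integral_def
      by (intro integral_eq_zero_AE AE_mp [OF AE_completion [OF AE_lborel_singleton [of "0::real"]] AE_I2]) (auto simp: indicator_def)
    also have "5 * \<theta> + 0 \<le> 2 * (5 * \<theta>) * exp (2 * P + 1)"
    proof -
      have "2 * (5 * \<theta>) * 1 \<le> 2 * (5 * \<theta>) * exp (2 * P + 1)" using e0 \<theta> by (intro mult_left_mono) auto
      then show ?thesis using \<theta> by linarith
    qed
    finally show ?thesis using small by linarith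
  qed
  have "f s < \<delta>" if s: "s \<in> {0..1}" for s
  proof (rule ccontr)
    assume ns: "\<not> f s < \<delta>"
    define B where "B = {t \<in> {0..1}. \<delta> \<le> f t}"
    have B: "s \<in> B" using s ns by (simp add: B_def)
    have cB: "closed B" unfolding B_def by (rule continuous_on_closed_Collect_le [OF continuous_on_const fc]) simp
    \<comment> \<open>The first exit time; it is attained because \<open>B\<close> is
      closed.\<close>
    define \<tau> where "\<tau> = Inf B"
    have bb: "bdd_below B" by (auto simp: B_def intro: bdd_belowI [of _ 0])
    have \<tau>B: "\<tau> \<in> B" unfolding \<tau>_def using cB B bb by (intro closed_contains_Inf) auto
    have \<tau>min: "f u < \<delta>" if "0 \<le> u" "u < \<tau>" for u
    proof (rule ccontr)
      assume "\<not> f u < \<delta>"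
      then have "u \<in> B" using that \<tau>B by (auto simp: B_def)
      then have "\<tau> \<le> u" unfolding \<tau>_def by (rule cInf_lower [OF _ bb])
      then show False using that by simp
    qed
    have \<tau>: "0 < \<tau>" "\<tau> \<le> 1" "\<delta> \<le> f \<tau>"
    proof -
      show "\<tau> \<le> 1" "\<delta> \<le> f \<tau>" using \<tau>B by (auto simp: B_def)
      have "\<tau> \<noteq> 0" using f00 \<open>\<delta> \<le> f \<tau>\<close> by auto
      then show "0 < \<tau>" using \<tau>B by (auto simp: B_def)
    qed
    have "f \<tau> \<le> 2 * (5 * \<theta>) * exp (2 * P + 1)"
    proof (rule gronwall_L2 [where f = f and D = "{real i / 2 ^ k | i k. real i / 2 ^ k < \<tau>}" and \<tau> = \<tau> and \<kappa> = \<kappa>])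
      show "continuous_on {0..\<tau>} f" by (rule continuous_on_subset [OF fc]) (use \<tau> in auto)
      show "{0..\<tau>} \<subseteq> closure {real i / 2 ^ k | i k. real i / 2 ^ k < \<tau>}" by (rule dyadic_dense [OF \<tau>(1)])
      show "{real i / 2 ^ k | i k. real i / 2 ^ k < \<tau>} \<subseteq> {0..\<tau>}" by auto
      show "integral\<^sup>L (lebesgue_on {0..1}) (\<lambda>u. (\<kappa> u)\<^sup>2) \<le> P" using P by (simp add: \<kappa>_def)
      fix t assume "t \<in> {real i / 2 ^ k | i k. real i / 2 ^ k < \<tau>}"
      then obtain i k where t: "t = real i / 2 ^ k" "t < \<tau>" by blast
      have "real i / 2 ^ k \<le> 1" using t \<tau>(2) by linarith
      then have "real i \<le> 2 ^ k" by (simp only: pos_divide_le_eq zero_less_power zero_less_numeral mult_1)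
      then have "i \<le> 2 ^ k" by (metis of_nat_le_iff of_nat_numeral of_nat_power)
      then show "f t \<le> 5 * \<theta> + (LINT u:{0..t}|lebesgue. \<kappa> u * f u)"
        using \<tau>min t by (intro est) (auto intro: less_imp_le)
    qed (use \<tau> \<theta> f0 \<kappa>m \<kappa>0 \<kappa>2 in auto)
    then show False using small \<tau>(3) by linarith
  qed
  then show ?thesis using t by (simp add: f_def)
qed

end

section \<open>Undoing the tilt\<close>

context wiener_setting
begin

text \<open>The tilted mass of \<open>A \<inter> Gd\<close> is at least
  \<open>1 - 1/4 - 1/4\<close>, and on \<open>Gd\<close> the density is at most
  \<open>exp ((E / 2 + \<gamma> / 4) / \<epsilon>)\<close>. Dividing by this bound returns to the
  original measure.\<close>

lemma tilted_lower_bound: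
  assumes d: "elementary_process M \<F> I d" "deterministic d" and E: "E = energy d (fst ` set d) 1 undefined"
    and \<epsilon>: "0 < \<epsilon>" and A: "A \<in> sets M" and N: "N \<in> sets M" "space M - N \<subseteq> A"
    and QN: "emeasure (tilted (scale_elementary (1 / sqrt \<epsilon>) d)) N \<le> ennreal (1 / 4)"
    and small: "exp (E / 2 - \<gamma> / (4 * sqrt \<epsilon>)) \<le> 1 / 4"
  shows "1 / 2 * exp (- (E / 2 + \<gamma> / 4) / \<epsilon>) \<le> prob A"
proof -
  define d' where "d' = scale_elementary (1 / sqrt \<epsilon>) d"
  have d': "elementary_process M \<F> I d'" "deterministic d'"
    unfolding d'_def using d by (auto intro: elementary_process_scale deterministic_scale)
  have dI: "fst ` set d \<subseteq> I" by (rule elementary_process_idx [OF d(1)])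
  have sq: "sqrt \<epsilon> * sqrt \<epsilon> = \<epsilon>" "0 < sqrt \<epsilon>" using \<epsilon> by auto
  have Econst: "energy d (fst ` set d) 1 \<omega> = E" for \<omega>
    unfolding E energy_def by (simp only: deterministic_coef [OF d(2), of _ _ \<omega>])
  define Y where "Y \<omega> = elementary_integral \<beta> d 1 \<omega>" for \<omega>
  note [measurable] = d(1) d'(1)
  have Ym [measurable]: "Y \<in> borel_measurable M" unfolding Y_def by measurable
  have gir: "girsanov (scale_elementary c d) 1 \<omega> = exp (c * Y \<omega> - c\<^sup>2 * E / 2)" for c \<omega>
    by (simp add: girsanov_def elementary_integral_scale idx_scale energy_scale Econst Y_def)
  have gir': "girsanov d' 1 \<omega> = exp (Y \<omega> / sqrt \<epsilon> - E / (2 * \<epsilon>))" for \<omega>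
    using \<epsilon> by (simp add: d'_def gir power_divide)
  have gm [measurable]: "girsanov d' 1 \<in> borel_measurable M" by measurable
  \<comment> \<open>Exact mass one is required here, not merely a mass of at most one; the
    coefficients are deterministic, so the equality case of
    \<open>exponential_supermartingale\<close> applies.\<close>
  have tot: "emeasure (tilted d') (space M) = 1"
  proof -
    have "emeasure (tilted d') (space M) = (\<integral>\<^sup>+\<omega>. ennreal (girsanov d' 1 \<omega>) \<partial>M)"
      unfolding emeasure_tilted [OF d'(1) sets.top] by (intro nn_integral_cong) simp
    also have "\<dots> = 1"
      unfolding girsanov_def using d' elementary_process_idx [OF d'(1)]
      by (intro exponential_supermartingale(3)) (auto simp: deterministic_def)
    finally show ?thesis .
  qed
  \<comment> \<open>Under the tilt \<open>Y / sqrt \<epsilon>\<close> is centred at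
    \<open>E / \<epsilon>\<close>, so \<open>b\<close> allows an excess of
    \<open>\<gamma> / (4 * \<epsilon>)\<close>. Subtracting the compensator
    \<open>E / (2 * \<epsilon>)\<close> leaves the exponent of the claim.\<close>
  define b where "b = (E + \<gamma> / 4) / \<epsilon>"
  define Gd where "Gd = {\<omega>\<in>space M. Y \<omega> / sqrt \<epsilon> \<le> b}"
  have Gd: "Gd \<in> sets M" unfolding Gd_def by measurable
  have QG: "emeasure (tilted d') (space M - Gd) \<le> ennreal (1 / 4)"
  proof -
    \<comment> \<open>Exponential Markov inequality inside the tilt: off \<open>Gd\<close> the
      factor \<open>exp (Y - sqrt \<epsilon> * b)\<close> is at least one, and multiplying by it
      raises the tilt from \<open>1 / sqrt \<epsilon>\<close> to
      \<open>c = 1 / sqrt \<epsilon> + 1\<close>. The constants that are left over form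
      \<open>r\<close>.\<close>
    define c where "c = (1 + sqrt \<epsilon>) / sqrt \<epsilon>"
    define r where "r = E / 2 - \<gamma> / (4 * sqrt \<epsilon>)"
    have "emeasure (tilted d') (space M - Gd) = (\<integral>\<^sup>+\<omega>. ennreal (girsanov d' 1 \<omega>) * indicator (space M - Gd) \<omega> \<partial>M)"
      by (rule emeasure_tilted [OF d'(1)]) (use Gd in auto)
    also have "\<dots> \<le> (\<integral>\<^sup>+\<omega>. ennreal (exp r) * ennreal (girsanov (scale_elementary c d) 1 \<omega>) \<partial>M)"
    proof (intro nn_integral_mono)
      fix \<omega> assume \<omega>: "\<omega> \<in> space M"
      show "ennreal (girsanov d' 1 \<omega>) * indicator (space M - Gd) \<omega> \<le> ennreal (exp r) * ennreal (girsanov (scale_elementary c d) 1 \<omega>)"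
      proof (cases "\<omega> \<in> Gd")
        case False
        then have Yb: "b \<le> Y \<omega> / sqrt \<epsilon>" using \<omega> by (simp add: Gd_def)
        have c2: "c\<^sup>2 = 1 / \<epsilon> + 2 / sqrt \<epsilon> + 1"
        proof -
          have "c = 1 / sqrt \<epsilon> + 1" using sq by (simp add: c_def add_divide_distrib)
          then show ?thesis using \<epsilon> by (simp add: power2_sum power_divide)
        qed
        have cY: "c * Y \<omega> = Y \<omega> / sqrt \<epsilon> + Y \<omega>" using sq by (simp add: c_def field_simps)
        have Yb': "sqrt \<epsilon> * b \<le> Y \<omega>" using Yb sq by (simp add: field_simps)
        have sb: "sqrt \<epsilon> * b = E / sqrt \<epsilon> + \<gamma> / (4 * sqrt \<epsilon>)"
        proof -
          have "sqrt \<epsilon> / \<epsilon> = 1 / sqrt \<epsilon>" using sq by (metis nonzero_divide_mult_cancel_left order_less_irrefl)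
          moreover have "sqrt \<epsilon> * b = (E + \<gamma> / 4) * (sqrt \<epsilon> / \<epsilon>)" by (simp add: b_def mult_ac)
          ultimately have "sqrt \<epsilon> * b = (E + \<gamma> / 4) * (1 / sqrt \<epsilon>)" by (simp only:)
          then show ?thesis by (simp add: add_divide_distrib)
        qed
        have "r + (c * Y \<omega> - c\<^sup>2 * E / 2) = (Y \<omega> / sqrt \<epsilon> - E / (2 * \<epsilon>)) + (Y \<omega> - sqrt \<epsilon> * b)"
          unfolding cY c2 sb r_def by (simp add: field_simps)
        then have "Y \<omega> / sqrt \<epsilon> - E / (2 * \<epsilon>) \<le> r + (c * Y \<omega> - c\<^sup>2 * E / 2)" using Yb' by linarith
        then have "ennreal (girsanov d' 1 \<omega>) \<le> ennreal (exp (r + (c * Y \<omega> - c\<^sup>2 * E / 2)))"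
          unfolding gir' by (intro ennreal_leI) simp
        also have "\<dots> = ennreal (exp r) * ennreal (girsanov (scale_elementary c d) 1 \<omega>)"
          unfolding gir exp_add by (intro ennreal_mult) auto
        finally show ?thesis using False \<omega> by simp
      qed simp
    qed
    also have "\<dots> = ennreal (exp r) * (\<integral>\<^sup>+\<omega>. ennreal (girsanov (scale_elementary c d) 1 \<omega>) \<partial>M)"
      using elementary_process_scale [OF d(1), of c] by (intro nn_integral_cmult) measurable
    also have "\<dots> \<le> ennreal (exp r) * 1"
    proof (intro mult_left_mono)
      show "(\<integral>\<^sup>+\<omega>. ennreal (girsanov (scale_elementary c d) 1 \<omega>) \<partial>M) \<le> 1"
        unfolding girsanov_def using elementary_process_scale [OF d(1), of c] dI
        by (intro exponential_supermartingale(2)) (auto simp: idx_scale)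
    qed simp
    also have "\<dots> \<le> ennreal (1 / 4)" using small by (simp add: r_def ennreal_leI)
    finally show ?thesis .
  qed
  have q: "ennreal (1 / 4) + ennreal (1 / 4) = ennreal (1 / 4 + 1 / 4)" by (rule ennreal_plus [symmetric]) auto
  have "1 \<le> emeasure (tilted d') (A \<inter> Gd) + (ennreal (1 / 4) + ennreal (1 / 4))"
  proof -
    have "emeasure (tilted d') (space M) \<le> emeasure (tilted d') ((A \<inter> Gd) \<union> (N \<union> (space M - Gd)))"
      using N Gd A by (intro emeasure_mono) auto
    also have "\<dots> \<le> emeasure (tilted d') (A \<inter> Gd) + emeasure (tilted d') (N \<union> (space M - Gd))"
      using N Gd A by (intro emeasure_subadditive) auto
    also have "\<dots> \<le> emeasure (tilted d') (A \<inter> Gd) + (emeasure (tilted d') N + emeasure (tilted d') (space M - Gd))"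
      using N Gd by (intro add_left_mono emeasure_subadditive) auto
    also have "\<dots> \<le> emeasure (tilted d') (A \<inter> Gd) + (ennreal (1 / 4) + ennreal (1 / 4))"
      using QN QG by (intro add_left_mono add_mono) (auto simp: d'_def)
    finally show ?thesis by (simp add: tot)
  qed
  also have "emeasure (tilted d') (A \<inter> Gd) \<le> ennreal (exp ((E / 2 + \<gamma> / 4) / \<epsilon>) * prob A)"
  proof -
    have "emeasure (tilted d') (A \<inter> Gd) = (\<integral>\<^sup>+\<omega>. ennreal (girsanov d' 1 \<omega>) * indicator (A \<inter> Gd) \<omega> \<partial>M)"
      by (rule emeasure_tilted [OF d'(1)]) (use A Gd in auto)
    also have "\<dots> \<le> (\<integral>\<^sup>+\<omega>. ennreal (exp ((E / 2 + \<gamma> / 4) / \<epsilon>)) * indicator A \<omega> \<partial>M)"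
    proof (intro nn_integral_mono)
      fix \<omega>
      show "ennreal (girsanov d' 1 \<omega>) * indicator (A \<inter> Gd) \<omega> \<le> ennreal (exp ((E / 2 + \<gamma> / 4) / \<epsilon>)) * indicator A \<omega>"
      proof (cases "\<omega> \<in> A \<inter> Gd")
        case True
        then have "Y \<omega> / sqrt \<epsilon> \<le> b" by (simp add: Gd_def)
        then have "Y \<omega> / sqrt \<epsilon> - E / (2 * \<epsilon>) \<le> b - E / (2 * \<epsilon>)" by simp
        also have "\<dots> = (E / 2 + \<gamma> / 4) / \<epsilon>" using \<epsilon> by (simp add: b_def field_simps)
        finally show ?thesis using True by (simp add: gir' ennreal_leI)
      qed simp
    qed
    also have "\<dots> = ennreal (exp ((E / 2 + \<gamma> / 4) / \<epsilon>) * prob A)"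
      using A by (simp add: nn_integral_cmult_indicator emeasure_eq_measure ennreal_mult)
    finally show ?thesis .
  qed
  finally have "ennreal 1 \<le> ennreal (exp ((E / 2 + \<gamma> / 4) / \<epsilon>) * prob A) + (ennreal (1 / 4) + ennreal (1 / 4))"
    by (simp add: add_right_mono)
  also have "\<dots> = ennreal (exp ((E / 2 + \<gamma> / 4) / \<epsilon>) * prob A + (1 / 4 + 1 / 4))"
    unfolding q by (rule ennreal_plus [symmetric]) auto
  finally have "1 \<le> exp ((E / 2 + \<gamma> / 4) / \<epsilon>) * prob A + (1 / 4 + 1 / 4)"
    by (subst (asm) ennreal_le_iff) (auto intro!: add_nonneg_nonneg)
  then have "1 / 2 \<le> exp ((E / 2 + \<gamma> / 4) / \<epsilon>) * prob A" by simp
  then have "exp (- ((E / 2 + \<gamma> / 4) / \<epsilon>)) * (1 / 2) \<le> exp (- ((E / 2 + \<gamma> / 4) / \<epsilon>)) * (exp ((E / 2 + \<gamma> / 4) / \<epsilon>) * prob A)"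
    by (intro mult_left_mono) auto
  also have "\<dots> = prob A" by (simp add: mult.assoc [symmetric] exp_add [symmetric])
  finally show ?thesis unfolding minus_divide_left [symmetric] by (simp only: mult.commute)
qed

end

text \<open>The substitution of \<open>\<epsilon> * u\<close> for the time variable absorbs the
  factor \<open>\<epsilon>\<close> and shrinks the interval to \<open>[0,\<epsilon>]\<close>, over
  which the integral of \<open>\<nu>\<close> is small. The bound is independent of the path inside
  the ball.\<close>

lemma scaled_drift_bound:
  fixes S :: "real \<Rightarrow> 'h::{real_inner, banach, second_countable_topology} \<Rightarrow>\<^sub>L 'h" and F :: "real \<Rightarrow> 'h \<Rightarrow> 'h"
    and \<nu> :: "real \<Rightarrow> real"
  assumes C: "0 \<le> C" "\<And>r. r \<in> {0..1} \<Longrightarrow> norm (S r) \<le> C"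
    and \<nu>: "\<nu> integrable_on {0..1}"
    and F: "\<And>t x. t \<in> {0..1} \<Longrightarrow> norm (F t x) \<le> \<nu> t * (1 + norm x)"
    and \<epsilon>: "\<epsilon> \<in> {0<..1}" and t: "t \<in> {0..1}" and \<rho>: "0 \<le> \<rho>" and v: "\<forall>u\<in>{0<..t}. norm (v u) \<le> \<rho>"
  shows "norm (\<epsilon> *\<^sub>R (LINT u:{0..t}|lebesgue. S (\<epsilon> * (t - u)) (F (\<epsilon> * u) (v u)))) \<le> C * (1 + \<rho>) * integral {0..\<epsilon>} \<nu>"
proof -
  have \<nu>0: "0 \<le> \<nu> s" if "s \<in> {0..1}" for s
    using F [OF that, of 0] norm_ge_zero [of "F s 0"] unfolding norm_zero add_0_right mult_1_right by linarith
  have \<epsilon>t: "0 \<le> \<epsilon> * t" "\<epsilon> * t \<le> \<epsilon>" using \<epsilon> t by (auto intro: mult_left_le)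
  have \<nu>i: "\<nu> integrable_on {0..r}" if "r \<le> 1" for r
    by (rule integrable_subinterval_real [OF \<nu>]) (use that in auto)
  \<comment> \<open>The path is bounded by \<open>\<rho>\<close> only at positive times, so the
    majorant gets a value of its own at 0, which does not affect the integral.\<close>
  define k where "k u = (if u = 0 then C * (\<nu> 0 * (1 + norm (v 0))) else C * (\<nu> (\<epsilon> * u) * (1 + \<rho>)))" for u
  have in01: "\<epsilon> * u \<in> {0..1}" "\<epsilon> * (t - u) \<in> {0..1}" if "u \<in> {0..t}" for u
    using \<epsilon> t that by (auto intro: mult_le_one)
  have "(\<nu> has_integral integral {0..\<epsilon> * t} \<nu>) {0..\<epsilon> * t}"
    using order_trans [OF \<epsilon>t(2), of 1] \<epsilon> by (intro integrable_integral \<nu>i) simp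
  from has_integral_stretch_real [OF this, of \<epsilon>] \<epsilon>
  have st: "((\<lambda>u. \<nu> (\<epsilon> * u)) has_integral integral {0..\<epsilon> * t} \<nu> / \<epsilon>) ((\<lambda>x. x / \<epsilon>) ` {0..\<epsilon> * t})"
    by simp
  have img: "(\<lambda>x. x / \<epsilon>) ` {0..\<epsilon> * t} = {0..t}"
    using \<epsilon> t by (subst image_divide_atLeastAtMost) auto
  have "((\<lambda>u. (C * (1 + \<rho>)) *\<^sub>R \<nu> (\<epsilon> * u)) has_integral (C * (1 + \<rho>)) *\<^sub>R (integral {0..\<epsilon> * t} \<nu> / \<epsilon>)) {0..t}"
    by (rule has_integral_cmul) (use st img in simp)
  then have kint: "(k has_integral (C * (1 + \<rho>)) *\<^sub>R (integral {0..\<epsilon> * t} \<nu> / \<epsilon>)) {0..t}"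
    by (rule has_integral_spike_finite [of "{0}", rotated 2]) (auto simp: k_def)
  have k0: "0 \<le> k u" if "u \<in> {0..t}" for u
    using C(1) \<rho> \<nu>0 [OF in01(1) [OF that]] \<nu>0 [of 0] by (auto simp: k_def)
  have kai: "set_integrable lebesgue {0..t} k"
    by (rule nonnegative_absolutely_integrable_1) (use kint k0 in \<open>auto simp: integrable_on_def\<close>)
  have "norm (LINT u:{0..t}|lebesgue. S (\<epsilon> * (t - u)) (F (\<epsilon> * u) (v u))) \<le> (LINT u:{0..t}|lebesgue. k u)"
  proof (rule norm_set_integral_le [OF kai])
    fix u assume u: "u \<in> {0..t}"
    have "norm (S (\<epsilon> * (t - u)) (F (\<epsilon> * u) (v u))) \<le> C * (\<nu> (\<epsilon> * u) * (1 + norm (v u)))"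
      using C(1) by (intro order_trans [OF norm_blinfun] mult_mono C(2) in01 F u) auto
    also have "\<dots> \<le> k u"
    proof (cases "u = 0")
      case False
      then have "norm (v u) \<le> \<rho>" using v u by auto
      then show ?thesis using False C(1) \<nu>0 [OF in01(1) [OF u]] by (auto simp: k_def intro!: mult_left_mono)
    qed (simp add: k_def)
    finally show "norm (S (\<epsilon> * (t - u)) (F (\<epsilon> * u) (v u))) \<le> k u" .
  qed simp
  also have "(LINT u:{0..t}|lebesgue. k u) = C * (1 + \<rho>) * (integral {0..\<epsilon> * t} \<nu> / \<epsilon>)"
    using set_lebesgue_integral_eq_integral(2) [OF kai] integral_unique [OF kint] by simp
  finally have "\<epsilon> * norm (LINT u:{0..t}|lebesgue. S (\<epsilon> * (t - u)) (F (\<epsilon> * u) (v u)))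
      \<le> \<epsilon> * (C * (1 + \<rho>) * (integral {0..\<epsilon> * t} \<nu> / \<epsilon>))"
    using \<epsilon> by (intro mult_left_mono) auto
  also have "\<dots> = C * (1 + \<rho>) * integral {0..\<epsilon> * t} \<nu>" using \<epsilon> by simp
  also have "\<dots> \<le> C * (1 + \<rho>) * integral {0..\<epsilon>} \<nu>"
    using C(1) \<rho> \<epsilon> \<epsilon>t \<nu>0 order_trans [OF \<epsilon>t(2), of 1] by (intro mult_left_mono integral_subset_le \<nu>i) auto
  finally show ?thesis using \<epsilon> by simp
qed

text \<open>With finitely many values of the control, the velocities
  \<open>G (z x u) (control g d u)\<close> lie in a finite union of compact sets, on which the
  semigroup is uniformly close to the identity.\<close>

lemma finite_range_control: "finite (range (control g d))"
proof (induction d)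
  case Nil
  have "range (control g []) \<subseteq> {0}" by (auto simp: control_def)
  then show ?case by (rule finite_subset) simp
next
  case (Cons p d)
  obtain k a b \<xi> where p: "p = (k, a, b, \<xi>)" by (cases p)
  have "range (control g [p]) \<subseteq> {0, \<xi> undefined *\<^sub>R g k}"
    by (auto simp: p control_def coef_def indicator_def)
  then have f: "finite (range (control g [p]))" by (rule finite_subset) simp
  have "control g (p # d) u = control g [p] u + control g d u" for u
    using control_append [of g "[p]" d u] by simp
  then have "range (control g (p # d)) \<subseteq> (\<lambda>(x, y). x + y) ` (range (control g [p]) \<times> range (control g d))"
    by auto
  then show ?case by (rule finite_subset) (intro finite_imageI finite_cartesian_product f Cons)
qed

section \<open>The tube event and its measurability\<close>

lemma Sup_less_iff_continuous:
  fixes f :: "real \<Rightarrow> real"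
  assumes f: "continuous_on {0..1} f"
  shows "(SUP t\<in>{0..1}. f t) < \<delta> \<longleftrightarrow> (\<forall>t\<in>{0..1}. f t < \<delta>)"
proof -
  obtain s where s: "s \<in> {0..1}" "\<forall>t\<in>{0..1}. f t \<le> f s"
    using continuous_attains_sup [OF compact_Icc _ f] by auto
  have "(SUP t\<in>{0..1}. f t) = f s"
    by (rule cSup_eq_maximum) (use s in auto)
  then show ?thesis using s by (auto intro: le_less_trans)
qed

text \<open>Continuity reduces the supremum to countably many dyadic times. The strict bound is
  written as a bound by \<open>\<delta> - 1 / real (Suc m)\<close> for some \<open>m\<close>,
  because only closed conditions pass from a dense set to its closure.\<close>

lemma sup_event_measurable:
  fixes X :: "real \<Rightarrow> 'w \<Rightarrow> 'h::{real_normed_vector, second_countable_topology}"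
  assumes X: "\<And>\<omega>. \<omega> \<in> space M \<Longrightarrow> continuous_on {0..1} (\<lambda>t. X t \<omega>)"
    and Xm: "\<And>t. t \<in> {0..1} \<Longrightarrow> X t \<in> borel_measurable M" and z: "continuous_on {0..1} z"
  shows "{\<omega>\<in>space M. (SUP t\<in>{0..1}. norm (X t \<omega> - z t)) < \<delta>} \<in> sets M"
proof -
  define D where "D = {real i / 2 ^ k | i k. real i / 2 ^ k < 1}"
  have D: "countable D" "D \<subseteq> {0..1}" "{0..1} \<subseteq> closure D"
  proof -
    have "D \<subseteq> range (\<lambda>(i, k). real i / 2 ^ k)" by (auto simp: D_def)
    then show "countable D" by (rule countable_subset) simp
    show "D \<subseteq> {0..1}" by (auto simp: D_def)
    show "{0..1} \<subseteq> closure D" unfolding D_def by (rule dyadic_dense) simp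
  qed
  have iff: "(SUP t\<in>{0..1}. norm (X t \<omega> - z t)) < \<delta> \<longleftrightarrow> (\<exists>m. \<forall>q\<in>D. norm (X q \<omega> - z q) \<le> \<delta> - 1 / real (Suc m))"
    if \<omega>: "\<omega> \<in> space M" for \<omega>
  proof -
    have c: "continuous_on {0..1} (\<lambda>t. norm (X t \<omega> - z t))" by (intro continuous_intros X z \<omega>)
    show ?thesis
    proof
      assume s: "(SUP t\<in>{0..1}. norm (X t \<omega> - z t)) < \<delta>"
      define s where "s = (SUP t\<in>{0..1}. norm (X t \<omega> - z t))"
      obtain m where m: "1 / real (Suc m) < \<delta> - s" using s reals_Archimedean [of "\<delta> - s"] by (auto simp: s_def inverse_eq_divide)
      have "norm (X q \<omega> - z q) \<le> s" if "q \<in> D" for q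
        unfolding s_def using that D(2) compact_imp_bounded [OF compact_continuous_image [OF c compact_Icc]]
        by (intro cSUP_upper bounded_imp_bdd_above) auto
      then show "\<exists>m. \<forall>q\<in>D. norm (X q \<omega> - z q) \<le> \<delta> - 1 / real (Suc m)"
        using m by (intro exI [of _ m]) (force intro: order_trans)
    next
      assume "\<exists>m. \<forall>q\<in>D. norm (X q \<omega> - z q) \<le> \<delta> - 1 / real (Suc m)"
      then obtain m where m: "\<forall>q\<in>D. norm (X q \<omega> - z q) \<le> \<delta> - 1 / real (Suc m)" by (elim exE)
      have "closed {t \<in> {0..1}. norm (X t \<omega> - z t) \<le> \<delta> - 1 / real (Suc m)}"
        by (rule continuous_on_closed_Collect_le [OF c continuous_on_const]) simp
      moreover have "D \<subseteq> {t \<in> {0..1}. norm (X t \<omega> - z t) \<le> \<delta> - 1 / real (Suc m)}" using m D(2) by auto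
      ultimately have "closure D \<subseteq> {t \<in> {0..1}. norm (X t \<omega> - z t) \<le> \<delta> - 1 / real (Suc m)}"
        by (intro closure_minimal)
      then have le: "norm (X t \<omega> - z t) \<le> \<delta> - 1 / real (Suc m)" if "t \<in> {0..1}" for t using D(3) that by blast
      have "0 < 1 / real (Suc m)" by simp
      then show "(SUP t\<in>{0..1}. norm (X t \<omega> - z t)) < \<delta>"
        unfolding Sup_less_iff_continuous [OF c] 
        by (intro ballI le_less_trans [OF le]) (assumption, linarith)
    qed
  qed
  have "{\<omega>\<in>space M. \<exists>m. \<forall>q\<in>D. norm (X q \<omega> - z q) \<le> \<delta> - 1 / real (Suc m)} \<in> sets M"
  proof (intro sets.sets_Collect_countable_Ex)
    fix m
    have "{\<omega>\<in>space M. \<forall>q\<in>D. norm (X q \<omega> - z q) \<le> \<delta> - 1 / real (Suc m)}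
      = space M - (\<Union>q\<in>D. {\<omega>\<in>space M. \<not> norm (X q \<omega> - z q) \<le> \<delta> - 1 / real (Suc m)})" by auto
    also have "\<dots> \<in> sets M"
    proof (intro sets.Diff sets.top sets.countable_UN'' D(1))
      fix q assume "q \<in> D"
      then have [measurable]: "X q \<in> borel_measurable M" using D(2) by (intro Xm) auto
      show "{\<omega>\<in>space M. \<not> norm (X q \<omega> - z q) \<le> \<delta> - 1 / real (Suc m)} \<in> sets M" by measurable
    qed
    finally show "{\<omega>\<in>space M. \<forall>q\<in>D. norm (X q \<omega> - z q) \<le> \<delta> - 1 / real (Suc m)} \<in> sets M" .
  qed
  then show ?thesis using iff by (simp cong: conj_cong)
qed

context wiener_setting
begin

text \<open>The energy is bounded through
  \<open>(1 + a) * norm \<phi>^2 + (1 + 1 / a) * q^2\<close>, where \<open>q\<close> is the distance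
  of the controls: \<open>a\<close> is chosen to make the first excess at most
  \<open>\<kappa> / 2\<close>, then the accuracy \<open>e\<close> to make the second at most
  \<open>\<kappa> / 2\<close>. The mean distance follows by Young's inequality.\<close>

lemma approximating_control:
  assumes \<phi>: "square_integrable (lebesgue_on {0..1}) \<phi>" and \<kappa>: "0 < \<kappa>"
  shows "\<exists>d :: ('w, real) elementary. elementary_process M \<F> I d \<and> deterministic d \<and>
    energy d (fst ` set d) 1 undefined \<le> integral\<^sup>L (lebesgue_on {0..1}) (\<lambda>u. (norm (\<phi> u))\<^sup>2) + \<kappa> \<and>
    (LINT u:{0..1}|lebesgue. norm (control g d u - \<phi> u)) \<le> \<kappa>"
proof -
  let ?L = "lebesgue_on {0..1::real}"
  define p where "p = integral\<^sup>L ?L (\<lambda>u. (norm (\<phi> u))\<^sup>2)"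
  have \<phi>m [measurable]: "\<phi> \<in> borel_measurable ?L" and \<phi>2: "integrable ?L (\<lambda>u. (norm (\<phi> u))\<^sup>2)"
    using \<phi> by (auto simp: square_integrable_def)
  have p0: "0 \<le> p" unfolding p_def by (rule integral_nonneg_AE) simp
  define a where "a = \<kappa> / (2 * (p + 1))"
  have a: "0 < a" "a * p \<le> \<kappa> / 2"
  proof -
    show "0 < a" using \<kappa> p0 by (simp add: a_def)
    have "a * p \<le> a * (p + 1)" using \<open>0 < a\<close> by (intro mult_left_mono) auto
    also have "\<dots> = \<kappa> / 2" using p0 by (simp add: a_def field_simps)
    finally show "a * p \<le> \<kappa> / 2" .
  qed
  define c where "c = 1 + 1 / a"
  have c: "0 < c" using a by (simp add: c_def add_pos_pos)
  \<comment> \<open>The first entry serves the mean distance, the second the energy.\<close>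
  define e where "e = min (\<kappa>\<^sup>2) (\<kappa> / 2 / c)"
  have e: "0 < e" "e \<le> \<kappa>\<^sup>2" "c * e \<le> \<kappa> / 2"
  proof -
    show "0 < e" "e \<le> \<kappa>\<^sup>2" using \<kappa> c by (auto simp: e_def)
    have "c * e \<le> c * (\<kappa> / 2 / c)" using c by (intro mult_left_mono) (auto simp: e_def)
    then show "c * e \<le> \<kappa> / 2" using c by simp
  qed
  obtain d :: "('w, real) elementary" where d: "elementary_process M \<F> I d" "deterministic d" "L2_dist \<phi> (control g d) < ennreal e"
    using approximable_square_integrable [OF \<phi>] e(1) unfolding approximable_def by blast
  note dI = elementary_process_idx [OF d(1)]
  define \<psi> where "\<psi> = control g d"
  have \<psi>m [measurable]: "\<psi> \<in> borel_measurable ?L" and \<psi>2: "integrable ?L (\<lambda>u. (norm (\<psi> u))\<^sup>2)"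
    and \<psi>E: "integral\<^sup>L ?L (\<lambda>u. (norm (\<psi> u))\<^sup>2) = energy d (fst ` set d) 1 undefined"
    using control_square_integrable [OF basis dI] by (auto simp: square_integrable_def \<psi>_def)
  define q where "q u = norm (\<psi> u - \<phi> u)" for u
  have qm [measurable]: "q \<in> borel_measurable ?L" unfolding q_def by measurable
  have dist: "L2_dist \<phi> \<psi> = (\<integral>\<^sup>+u. ennreal ((q u)\<^sup>2) \<partial>?L)"
    by (simp add: L2_dist_def q_def norm_minus_commute)
  have q2: "integrable ?L (\<lambda>u. (q u)\<^sup>2)"
  proof (rule integrableI_nonneg)
    show "(\<integral>\<^sup>+u. ennreal ((q u)\<^sup>2) \<partial>?L) < \<infinity>"
      unfolding dist [symmetric] \<psi>_def by (rule less_trans [OF d(3)]) simp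
  qed simp_all
  have Q: "integral\<^sup>L ?L (\<lambda>u. (q u)\<^sup>2) \<le> e"
  proof -
    have "ennreal (integral\<^sup>L ?L (\<lambda>u. (q u)\<^sup>2)) = L2_dist \<phi> \<psi>"
      unfolding dist by (rule nn_integral_eq_integral [OF q2, symmetric]) simp
    also have "\<dots> \<le> ennreal e" using d(3) by (simp add: \<psi>_def less_imp_le)
    finally show ?thesis using e(1) by (simp add: ennreal_le_iff)
  qed
  have "integral\<^sup>L ?L (\<lambda>u. (norm (\<psi> u))\<^sup>2) \<le> integral\<^sup>L ?L (\<lambda>u. (1 + a) * (norm (\<phi> u))\<^sup>2 + c * (q u)\<^sup>2)"
  proof (intro integral_mono \<psi>2 Bochner_Integration.integrable_add integrable_mult_right \<phi>2 q2)
    fix u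
    have "norm (\<psi> u) \<le> norm (\<phi> u) + q u" unfolding q_def by (rule norm_triangle_sub)
    then have "(norm (\<psi> u))\<^sup>2 \<le> (norm (\<phi> u) + q u)\<^sup>2" by (intro power_mono) auto
    also have "\<dots> = (norm (\<phi> u))\<^sup>2 + 2 * (a * norm (\<phi> u)) * q u / a + (q u)\<^sup>2" using a by (simp add: power2_sum)
    also have "\<dots> \<le> (norm (\<phi> u))\<^sup>2 + ((a * norm (\<phi> u))\<^sup>2 + (q u)\<^sup>2) / a + (q u)\<^sup>2"
      using a by (intro add_mono order_refl divide_right_mono sum_squares_bound) auto
    also have "\<dots> = (1 + a) * (norm (\<phi> u))\<^sup>2 + c * (q u)\<^sup>2" using a by (simp add: c_def field_simps power2_eq_square)
    finally show "(norm (\<psi> u))\<^sup>2 \<le> (1 + a) * (norm (\<phi> u))\<^sup>2 + c * (q u)\<^sup>2" .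
  qed
  also have "\<dots> = (1 + a) * p + c * integral\<^sup>L ?L (\<lambda>u. (q u)\<^sup>2)"
    unfolding p_def by (subst Bochner_Integration.integral_add) (auto intro: integrable_mult_right \<phi>2 q2)
  also have "\<dots> \<le> (1 + a) * p + c * e" using Q c by (intro add_left_mono mult_left_mono) auto
  also have "\<dots> \<le> p + \<kappa>" using a(2) e(3) by (simp add: distrib_right)
  finally have en: "energy d (fst ` set d) 1 undefined \<le> p + \<kappa>" unfolding \<psi>E .
  have one: "integrable ?L (\<lambda>u. c) \<and> integral\<^sup>L ?L (\<lambda>u. c) = c" for c :: real
  proof -
    have "set_integrable lebesgue {0..1} (\<lambda>u::real. c)" by (rule absolutely_integrable_continuous_real) simp
    moreover from set_lebesgue_integral_eq_integral(2) [OF this] have "(LINT u:{0..1::real}|lebesgue. c) = c" by simp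
    ultimately show ?thesis unfolding set_integral_lebesgue_on by simp
  qed
  have "integral\<^sup>L ?L q \<le> integral\<^sup>L ?L (\<lambda>u. \<kappa> / 2 + 1 / (2 * \<kappa>) * (q u)\<^sup>2)"
  proof (intro integral_mono' Bochner_Integration.integrable_add integrable_mult_right q2 conjunct1 [OF one])
    fix u
    have "q u = (2 * \<kappa> * q u) / (2 * \<kappa>)" using \<kappa> by simp
    also have "\<dots> \<le> (\<kappa>\<^sup>2 + (q u)\<^sup>2) / (2 * \<kappa>)" using \<kappa> by (intro divide_right_mono sum_squares_bound) auto
    also have "\<dots> = \<kappa> / 2 + 1 / (2 * \<kappa>) * (q u)\<^sup>2" using \<kappa> by (simp add: field_simps power2_eq_square)
    finally show "q u \<le> \<kappa> / 2 + 1 / (2 * \<kappa>) * (q u)\<^sup>2" .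
    show "0 \<le> \<kappa> / 2 + 1 / (2 * \<kappa>) * (q u)\<^sup>2" using \<kappa> by simp
  qed
  also have "\<dots> = \<kappa> / 2 + 1 / (2 * \<kappa>) * integral\<^sup>L ?L (\<lambda>u. (q u)\<^sup>2)"
    using one [of "\<kappa> / 2"] by (subst Bochner_Integration.integral_add) (auto intro: integrable_mult_right q2)
  also have "\<dots> \<le> \<kappa> / 2 + 1 / (2 * \<kappa>) * \<kappa>\<^sup>2" using Q e(2) \<kappa> by (intro add_left_mono mult_left_mono) auto
  also have "\<dots> = \<kappa>" using \<kappa> by (simp add: power2_eq_square)
  finally have "(LINT u:{0..1}|lebesgue. norm (control g d u - \<phi> u)) \<le> \<kappa>"
    unfolding set_integral_lebesgue_on(2) q_def \<psi>_def .
  then show ?thesis using d(1,2) en unfolding p_def by blast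
qed

end

theorem theorem2:
  fixes S :: "real \<Rightarrow> 'h::{real_inner, banach, second_countable_topology} \<Rightarrow>\<^sub>L 'h"
    and F :: "real \<Rightarrow> 'h \<Rightarrow> 'h"
    and G :: "'h \<Rightarrow> 'u::{real_inner, banach, second_countable_topology} \<Rightarrow>\<^sub>L 'h"
    and \<nu> :: "real \<Rightarrow> real"
    and \<Lambda> :: real
    and M :: "'w measure"
    and \<F> :: "real \<Rightarrow> 'w measure"
    and I :: "nat set"
    and g :: "nat \<Rightarrow> 'u"
    and \<beta> :: "nat \<Rightarrow> real \<Rightarrow> 'w \<Rightarrow> real"
    and X :: "real \<Rightarrow> 'h \<Rightarrow> real \<Rightarrow> 'w \<Rightarrow> 'h"
    and \<phi> :: "real \<Rightarrow> 'u"
    and z :: "'h \<Rightarrow> real \<Rightarrow> 'h"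
    and K :: "'h set"
    and \<delta> \<gamma> :: real
  assumes basis: "orthonormal_basis I g"
    and semigroup: "c0_semigroup S"
    and F_measurable: "(\<lambda>(t, x). F t x) \<in> borel_measurable (restrict_space borel ({0..1} \<times> UNIV))"
    and G_hilbert_schmidt: "\<And>x. hilbert_schmidt I g (G x)"
    and \<nu>: "square_integrable (lebesgue_on {0..1}) \<nu>"
    and \<Lambda>: "0 < \<Lambda>"
    and F_lipschitz: "\<And>t x y. t \<in> {0..1} \<Longrightarrow> norm (F t x - F t y) \<le> \<nu> t * norm (x - y)"
    and F_growth: "\<And>t x. t \<in> {0..1} \<Longrightarrow> norm (F t x) \<le> \<nu> t * (1 + norm x)"
    and G_lipschitz: "\<And>x y. hs_norm I g (G x - G y) \<le> \<Lambda> * norm (x - y)"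
    and G_growth: "\<And>x. hs_norm I g (G x) \<le> \<Lambda> * (1 + norm x)"
    and prob: "prob_space M"
    and filtration: "usual_filtration M \<F>"
    and wiener: "independent_brownian_motions M \<F> I \<beta>"
    and X: "\<And>\<epsilon> x. \<epsilon> \<in> {0<..1} \<Longrightarrow> mild_solution M \<F> I g \<beta> S F G \<epsilon> x (X \<epsilon> x)"
    and \<phi>: "square_integrable (lebesgue_on {0..1}) \<phi>"
    and z: "\<And>x. controlled_solution G \<phi> x (z x)"
    and K: "compact K"
    and \<delta>: "0 < \<delta>"
    and \<gamma>: "0 < \<gamma>"
  shows "\<exists>\<epsilon>\<^sub>0\<in>{0<..1}. \<forall>x\<in>K. \<forall>\<epsilon>\<in>{0<..\<epsilon>\<^sub>0}.
    measure M {\<omega>\<in>space M. (SUP t\<in>{0..1}. norm (X \<epsilon> x t \<omega> - z x t)) < \<delta>}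
      \<ge> exp ((- (1/2) * (LINT s:{0..1}|lebesgue. (norm (\<phi> s))\<^sup>2) - \<gamma>) / \<epsilon>)"
proof -
  interpret wiener_setting M \<F> I g \<beta>
    by (rule wiener_setting.intro [OF prob wiener_setting_axioms.intro [OF basis filtration wiener]])
  note Gfacts = basis G_hilbert_schmidt \<Lambda> G_lipschitz G_growth
  obtain C where C: "1 \<le> C" "\<And>r. r \<in> {0..1} \<Longrightarrow> norm (S r) \<le> C"
    using c0_semigroup_bounded [OF semigroup] by blast
  have zc: "continuous_on {0..1} (z x)" for x using z by (simp add: controlled_solution_def)
  have zKc: "continuous_on (K \<times> {0..1}) (\<lambda>(x, t). z x t)"
    by (rule controlled_solution_continuous [OF Gfacts \<phi> z])
  have cK: "compact (K \<times> {0..1::real})" by (intro compact_Times K compact_Icc)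
  obtain B where B: "\<forall>y\<in>(\<lambda>(x, t). z x t) ` (K \<times> {0..1}). norm y \<le> B"
    using compact_imp_bounded [OF compact_continuous_image [OF zKc cK]] unfolding bounded_iff by (elim exE)
  \<comment> \<open>A ball that contains the \<open>\<delta>\<close>-tubes around all controlled
    paths starting in \<open>K\<close>.\<close>
  define \<rho> where "\<rho> = max B 0 + \<delta>"
  have \<rho>0: "0 \<le> \<rho>" using \<delta> by (simp add: \<rho>_def)
  have z\<rho>: "norm (z x u) + \<delta> \<le> \<rho>" if "x \<in> K" "u \<in> {0..1}" for x u
    using B that by (force simp: \<rho>_def)
  define \<Phi> where "\<Phi> = integral\<^sup>L (lebesgue_on {0..1}) (\<lambda>u. (norm (\<phi> u))\<^sup>2)"
  define P where "P = (C * \<Lambda>)\<^sup>2 * (\<Phi> + \<gamma> / 2)"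
  define \<theta> where "\<theta> = \<delta> / (20 * exp (2 * P + 1))"
  have \<theta>: "0 < \<theta>" "2 * (5 * \<theta>) * exp (2 * P + 1) < \<delta>" using \<delta> by (auto simp: \<theta>_def)
  \<comment> \<open>The first entry limits the loss of energy, the second the error made in the
    controlled equation.\<close>
  define \<kappa> where "\<kappa> = min (\<gamma> / 2) (\<theta> / (\<Lambda> * (1 + \<rho>)))"
  have \<Lambda>\<rho>: "0 < \<Lambda> * (1 + \<rho>)" using \<Lambda> \<rho>0 by simp
  have \<kappa>: "0 < \<kappa>" "\<kappa> \<le> \<gamma> / 2" "\<Lambda> * (1 + \<rho>) * \<kappa> \<le> \<theta>"
  proof -
    show "0 < \<kappa>" unfolding \<kappa>_def using \<gamma> \<theta>(1) \<Lambda>\<rho> by simp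
    show "\<kappa> \<le> \<gamma> / 2" unfolding \<kappa>_def by (rule min.cobounded1)
    have "\<Lambda> * (1 + \<rho>) * \<kappa> \<le> \<Lambda> * (1 + \<rho>) * (\<theta> / (\<Lambda> * (1 + \<rho>)))"
      unfolding \<kappa>_def using \<Lambda>\<rho> by (intro mult_left_mono min.cobounded2) simp
    also have "\<dots> = \<theta>" using \<Lambda>\<rho> by (simp only: times_divide_eq_right nonzero_mult_div_cancel_left less_imp_neq [symmetric] not_False_eq_True)
    finally show "\<Lambda> * (1 + \<rho>) * \<kappa> \<le> \<theta>" .
  qed
  obtain d :: "('w, real) elementary" where d: "elementary_process M \<F> I d" "deterministic d"
    and dE: "energy d (fst ` set d) 1 undefined \<le> \<Phi> + \<kappa>"
    and d\<phi>: "(LINT u:{0..1}|lebesgue. norm (control g d u - \<phi> u)) \<le> \<kappa>"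
    using approximating_control [OF \<phi> \<kappa>(1)] unfolding \<Phi>_def by blast
  have dI: "fst ` set d \<subseteq> I" by (rule elementary_process_idx [OF d(1)])
  define E where "E = energy d (fst ` set d) 1 undefined"
  have E\<Phi>: "E \<le> \<Phi> + \<gamma> / 2" using dE \<kappa>(2) by (simp add: E_def)
  have PE: "integral\<^sup>L (lebesgue_on {0..1}) (\<lambda>u. (C * \<Lambda> * norm (control g d u))\<^sup>2) \<le> P"
  proof -
    have "integral\<^sup>L (lebesgue_on {0..1}) (\<lambda>u. (C * \<Lambda> * norm (control g d u))\<^sup>2) = (C * \<Lambda>)\<^sup>2 * E"
      unfolding E_def control_square_integrable(2) [OF basis dI, symmetric] power_mult_distrib [of "C * \<Lambda>"] by simp
    also have "\<dots> \<le> P" unfolding P_def using E\<Phi> by (intro mult_left_mono) auto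
    finally show ?thesis .
  qed
  have \<phi>\<theta>: "\<Lambda> * (1 + \<rho>) * (LINT u:{0..1}|lebesgue. norm (control g d u - \<phi> u)) \<le> \<theta>"
    using \<Lambda>\<rho> by (intro order_trans [OF mult_left_mono [OF d\<phi>] \<kappa>(3)]) simp
  obtain \<epsilon>1 where \<epsilon>1: "\<epsilon>1 \<in> {0<..1}" "\<forall>r\<in>{0..\<epsilon>1}. \<forall>v\<in>K. norm (S r v - v) < \<theta>"
    using c0_semigroup_uniform_compact [OF semigroup K \<theta>(1)] by blast
  \<comment> \<open>All velocities that the approximate control can give to controlled paths from
    \<open>K\<close>.\<close>
  define V where "V = (\<Union>w\<in>range (control g d). (\<lambda>y. G y w) ` ((\<lambda>(x, t). z x t) ` (K \<times> {0..1})))"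
  have "compact V"
    unfolding V_def
    by (intro compact_UN finite_range_control compact_continuous_image G_continuous [OF Gfacts] zKc cK)
  then obtain \<epsilon>2 where \<epsilon>2: "\<epsilon>2 \<in> {0<..1}" "\<forall>r\<in>{0..\<epsilon>2}. \<forall>v\<in>V. norm (S r v - v) < \<theta>"
    using c0_semigroup_uniform_compact [OF semigroup _ \<theta>(1)] by blast
  have \<nu>i: "\<nu> integrable_on {0..1}"
  proof -
    have one: "integrable (lebesgue_on {0..1}) (\<lambda>u::real. 1\<^sup>2 :: real)"
      unfolding set_integral_lebesgue_on(1) [symmetric] by (rule absolutely_integrable_continuous_real) simp
    have "integrable (lebesgue_on {0..1}) (\<lambda>u. \<nu> u * 1)"
      using \<nu> one by (intro integral_Cauchy_Schwarz(1)) (auto simp: square_integrable_def)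
    then have "set_integrable lebesgue {0..1} \<nu>" unfolding set_integral_lebesgue_on(1) by simp
    then show ?thesis by (rule set_lebesgue_integral_eq_integral(1))
  qed
  \<comment> \<open>Chosen so that the deviation bound \<open>10 * C * \<eta>\<close> is exactly
    \<open>\<theta>\<close>.\<close>
  define \<eta> where "\<eta> = \<theta> / (10 * C)"
  have \<eta>: "0 < \<eta>" "10 * C * \<eta> = \<theta>" using \<theta> C by (auto simp: \<eta>_def)
  define R where "R = (C * (\<Lambda> * (1 + \<rho>)))\<^sup>2"
  have l1: "((\<lambda>\<epsilon>. C * (1 + \<rho>) * integral {0..\<epsilon>} \<nu>) \<longlongrightarrow> 0) (at_right 0)"
  proof -
    have "((\<lambda>\<epsilon>. integral {0..\<epsilon>} \<nu>) \<longlongrightarrow> integral {0..0} \<nu>) (at 0 within {0..1})"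
      using indefinite_integral_continuous_1 [OF \<nu>i] unfolding continuous_on_def by (rule bspec) simp
    then have "((\<lambda>\<epsilon>. integral {0..\<epsilon>} \<nu>) \<longlongrightarrow> 0) (at_right 0)" by (simp add: at_within_Icc_at_right)
    from tendsto_mult_left [OF this, of "C * (1 + \<rho>)"] show ?thesis by simp
  qed
  have l2: "((\<lambda>\<epsilon>. 1280 * exp (1 + 2 * R) * \<epsilon>\<^sup>2 / \<eta> ^ 4) \<longlongrightarrow> 0) (at_right 0)"
  proof -
    have "((\<lambda>\<epsilon>. 1280 * exp (1 + 2 * R) * \<epsilon>\<^sup>2 / \<eta> ^ 4) \<longlongrightarrow> 1280 * exp (1 + 2 * R) * 0\<^sup>2 / \<eta> ^ 4) (at_right 0)"
      using \<eta>(1) by (intro tendsto_intros) auto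
    then show ?thesis by simp
  qed
  have l3: "((\<lambda>\<epsilon>. exp (E / 2 - \<gamma> / (4 * sqrt \<epsilon>))) \<longlongrightarrow> 0) (at_right 0)" using \<gamma> by real_asymp
  have l4: "((\<lambda>\<epsilon>. exp (- (\<gamma> / (2 * \<epsilon>)))) \<longlongrightarrow> 0) (at_right 0)" using \<gamma> by real_asymp
  have "\<forall>\<^sub>F \<epsilon> in at_right 0. C * (1 + \<rho>) * integral {0..\<epsilon>} \<nu> < \<theta> \<and> 1280 * exp (1 + 2 * R) * \<epsilon>\<^sup>2 / \<eta> ^ 4 < 1 / 4 \<and>
      exp (E / 2 - \<gamma> / (4 * sqrt \<epsilon>)) < 1 / 4 \<and> exp (- (\<gamma> / (2 * \<epsilon>))) < 1 / 2"
    using \<theta>(1) by (intro eventually_conj order_tendstoD(2) [OF l1] order_tendstoD(2) [OF l2] order_tendstoD(2) [OF l3] order_tendstoD(2) [OF l4]) auto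
  then obtain b where b: "0 < b" and small: "\<And>\<epsilon>. 0 < \<epsilon> \<Longrightarrow> \<epsilon> < b \<Longrightarrow> C * (1 + \<rho>) * integral {0..\<epsilon>} \<nu> < \<theta> \<and>
      1280 * exp (1 + 2 * R) * \<epsilon>\<^sup>2 / \<eta> ^ 4 < 1 / 4 \<and> exp (E / 2 - \<gamma> / (4 * sqrt \<epsilon>)) < 1 / 4 \<and> exp (- (\<gamma> / (2 * \<epsilon>))) < 1 / 2"
    unfolding eventually_at_right_field by blast
  \<comment> \<open>None of the bounds that enter depends on the point of \<open>K\<close>. Halving
    \<open>b\<close> turns \<open>\<epsilon> \<le> \<epsilon>0\<close> into the strict
    \<open>\<epsilon> < b\<close>.\<close>
  define \<epsilon>0 where "\<epsilon>0 = min (min \<epsilon>1 \<epsilon>2) (b / 2)"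
  have \<epsilon>0: "\<epsilon>0 \<in> {0<..1}" using \<epsilon>1(1) \<epsilon>2(1) b by (auto simp: \<epsilon>0_def)
  have "exp ((- (1/2) * (LINT s:{0..1}|lebesgue. (norm (\<phi> s))\<^sup>2) - \<gamma>) / \<epsilon>)
      \<le> prob {\<omega>\<in>space M. (SUP t\<in>{0..1}. norm (X \<epsilon> x t \<omega> - z x t)) < \<delta>}"
    if x: "x \<in> K" and \<epsilon>: "\<epsilon> \<in> {0<..\<epsilon>0}" for x \<epsilon>
  proof -
    have \<epsilon>01: "\<epsilon> \<in> {0<..1}" and \<epsilon>le: "\<epsilon> \<le> \<epsilon>1" "\<epsilon> \<le> \<epsilon>2" "0 < \<epsilon>" "\<epsilon> < b" using \<epsilon> \<epsilon>0 b by (auto simp: \<epsilon>0_def)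
    note sm = small [OF \<epsilon>le(3,4)]
    define A where "A = {\<omega>\<in>space M. (SUP t\<in>{0..1}. norm (X \<epsilon> x t \<omega> - z x t)) < \<delta>}"
    have Xc: "continuous_on {0..1} (\<lambda>t. X \<epsilon> x t \<omega>)" if "\<omega> \<in> space M" for \<omega>
      using X [OF \<epsilon>01, of x] that by (simp add: mild_solution_def)
    have Xp: "(\<lambda>(t, \<omega>). X \<epsilon> x t \<omega>) \<in> borel_measurable (predictable_sigma M \<F> 1)"
      using X [OF \<epsilon>01, of x] by (simp add: mild_solution_def)
    have Xm: "X \<epsilon> x t \<in> borel_measurable M" if "t \<in> {0..1}" for t
      using predictable_section(2) [OF Xp _ that] by simp
    have A: "A \<in> sets M" unfolding A_def by (rule sup_event_measurable [OF Xc Xm zc])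
    define dr where "dr \<omega> t = \<epsilon> *\<^sub>R (LINT u:{0..t}|lebesgue. S (\<epsilon> * (t - u)) (F (\<epsilon> * u) (X \<epsilon> x u \<omega>)))" for \<omega> t
    obtain N where N: "N \<in> sets M"
      "emeasure (tilted (scale_elementary (1 / sqrt \<epsilon>) d)) N \<le> ennreal (1280 * exp (1 + 2 * R) * \<epsilon>\<^sup>2 / \<eta> ^ 4)"
      "\<forall>\<omega>\<in>space M - N. \<forall>i k. i \<le> 2 ^ k \<longrightarrow> (\<forall>u\<in>{0<..real i / 2 ^ k}. norm (X \<epsilon> x u \<omega>) \<le> \<rho>) \<longrightarrow>
       norm (X \<epsilon> x (real i / 2 ^ k) \<omega> - (S (\<epsilon> * (real i / 2 ^ k)) x + dr \<omega> (real i / 2 ^ k)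
         + (LINT u:{0..real i / 2 ^ k}|lborel. S (\<epsilon> * (real i / 2 ^ k - u)) (G (X \<epsilon> x u \<omega>) (control g d u))))) \<le> 10 * C * \<eta>"
      using mild_solution_deviation [OF semigroup C G_continuous [OF Gfacts] G_hilbert_schmidt G_growth \<Lambda> \<epsilon>01 X [OF \<epsilon>01] d \<eta>(1) \<rho>0 R_def, of x, simplified simp_thms, OF TrueI]
      unfolding dr_def by (elim bexE conjE)
    have NA: "space M - N \<subseteq> A"
    proof
      fix \<omega> assume \<omega>: "\<omega> \<in> space M - N"
      then have \<omega>M: "\<omega> \<in> space M" by simp
      have "norm (X \<epsilon> x t \<omega> - z x t) < \<delta>" if t: "t \<in> {0..1}" for t
      proof (rule pathwise_bound [OF Gfacts semigroup C \<epsilon>01 Xc [OF \<omega>M] z \<phi> dI \<delta> z\<rho> [OF x] less_imp_le [OF \<theta>(1)] PE \<theta>(2) _ _ _ \<phi>\<theta> _ t,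
            where dr = "dr \<omega>"])
        fix t :: real assume t: "t \<in> {0..1}"
        have "\<epsilon> * t \<in> {0..\<epsilon>1}" using \<epsilon>le t by (auto intro: order_trans [OF mult_left_le])
        then show "norm (S (\<epsilon> * t) x - x) \<le> \<theta>" using \<epsilon>1(2) x by (simp add: less_imp_le)
      next
        fix t :: real assume "t \<in> {0..1}" "\<forall>u\<in>{0<..t}. norm (X \<epsilon> x u \<omega>) \<le> \<rho>"
        then show "norm (dr \<omega> t) \<le> \<theta>"
          unfolding dr_def using sm C(1)
          by (intro order_trans [OF scaled_drift_bound [OF _ C(2) \<nu>i F_growth \<epsilon>01 _ \<rho>0]]) auto
      next
        fix r u :: real assume r: "r \<in> {0..\<epsilon>}" and u: "u \<in> {0..1}"
        have "G (z x u) (control g d u) \<in> V" unfolding V_def using x u by force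
        then show "norm (S r (G (z x u) (control g d u)) - G (z x u) (control g d u)) \<le> \<theta>"
          using \<epsilon>2(2) r \<epsilon>le(2) by (simp add: less_imp_le)
      next
        fix i k :: nat assume "i \<le> 2 ^ k" "\<forall>u\<in>{0<..real i / 2 ^ k}. norm (X \<epsilon> x u \<omega>) \<le> \<rho>"
        then show "norm (X \<epsilon> x (real i / 2 ^ k) \<omega> - (S (\<epsilon> * (real i / 2 ^ k)) x + dr \<omega> (real i / 2 ^ k)
          + (LINT u:{0..real i / 2 ^ k}|lborel. S (\<epsilon> * (real i / 2 ^ k - u)) (G (X \<epsilon> x u \<omega>) (control g d u))))) \<le> \<theta>"
          using N(3) \<omega> unfolding \<eta>(2) by blast
      qed
      moreover have "continuous_on {0..1} (\<lambda>t. norm (X \<epsilon> x t \<omega> - z x t))"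
        by (intro continuous_intros Xc zc \<omega>M)
      ultimately show "\<omega> \<in> A" using \<omega>M by (simp add: A_def Sup_less_iff_continuous)
    qed
    have lower: "1 / 2 * exp (- (E / 2 + \<gamma> / 4) / \<epsilon>) \<le> prob A"
    proof (rule tilted_lower_bound [OF d E_def \<epsilon>le(3) A N(1) NA])
      show "emeasure (tilted (scale_elementary (1 / sqrt \<epsilon>) d)) N \<le> ennreal (1 / 4)"
        using sm by (intro order_trans [OF N(2)] ennreal_leI) simp
      show "exp (E / 2 - \<gamma> / (4 * sqrt \<epsilon>)) \<le> 1 / 4" using sm by simp
    qed
    \<comment> \<open>How \<open>\<gamma>\<close> is spent: a quarter on the energy, since
      \<open>E / 2\<close> is at most \<open>\<Phi> / 2 + \<gamma> / 4\<close>, a quarter on undoing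
      the tilt, and the remaining half on the factor \<open>1 / 2\<close>, which exceeds
      \<open>exp (- (\<gamma> / (2 * \<epsilon>)))\<close>.\<close>
    have "(- (1/2) * (LINT s:{0..1}|lebesgue. (norm (\<phi> s))\<^sup>2) - \<gamma>) / \<epsilon> \<le> (- (E / 2 + \<gamma> / 4) - \<gamma> / 2) / \<epsilon>"
    proof (rule divide_right_mono)
      show "- (1/2) * (LINT s:{0..1}|lebesgue. (norm (\<phi> s))\<^sup>2) - \<gamma> \<le> - (E / 2 + \<gamma> / 4) - \<gamma> / 2"
        using E\<Phi> unfolding set_integral_lebesgue_on(2) \<Phi>_def [symmetric] by argo
    qed (use \<epsilon>le in simp)
    also have "\<dots> = - (\<gamma> / (2 * \<epsilon>)) + - (E / 2 + \<gamma> / 4) / \<epsilon>" by (simp add: diff_divide_distrib)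
    finally have "exp ((- (1/2) * (LINT s:{0..1}|lebesgue. (norm (\<phi> s))\<^sup>2) - \<gamma>) / \<epsilon>)
        \<le> exp (- (\<gamma> / (2 * \<epsilon>))) * exp (- (E / 2 + \<gamma> / 4) / \<epsilon>)"
      unfolding exp_add [symmetric] by (rule iffD2 [OF exp_le_cancel_iff])
    also have "\<dots> \<le> 1 / 2 * exp (- (E / 2 + \<gamma> / 4) / \<epsilon>)" using sm by (intro mult_right_mono) auto
    also have "\<dots> \<le> prob A" by (rule lower)
    finally show ?thesis unfolding A_def .
  qed
  then show ?thesis using \<epsilon>0 by blast
qed

end
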